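(* Let $R$ be a reduced Noetherian commutative ring of prime characteristic $p > 0$, with perfect closure $R^\infty$. Let $W \subseteq R$ be a multiplicative set such that $R_W$ is regular. Let $L$ be any $R$-module. Then \[ \mathrm{sK}_{R^\infty}\bigl(L \otimes_R (R^\infty)_W\bigr) = \bigcup_{\mathfrak{p} \in \mathrm{Ass}_R(L)} \mathrm{sK}_{R^\infty}\bigl((R^\infty/\mathfrak{p} R^\infty)_W\bigr). \] Hence, if $Q \in \mathrm{Spec}\, R^\infty$ with $Q \cap W = \emptyset$, then $Q \in \mathrm{sK}_{R^\infty}(L \otimes_R R^\infty)$ if and only if there is some $\mathfrak{p} \in \mathrm{Ass}_R(L)$ such that $Q \in \mathrm{sK}_{R^\infty}(R^\infty/\mathfrak{p} R^\infty)$.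
   Context: All rings are commutative with unity. For a ring $A$ and an $A$-module $N$, the set $\mathrm{sK}_A(N)$ of strong Krull primes of $N$ is the set of all $\mathfrak{p} \in \mathrm{Spec}\, A$ such that for every finitely generated ideal $I$ of $A$ with $I \subseteq \mathfrak{p}$ there is an element $z \in N$ with $I \subseteq \mathrm{ann}_A(z) \subseteq \mathfrak{p}$. $\mathrm{Ass}_R(L)$ denotes the set of associated primes of $L$, i.e. primes of the form $\mathrm{ann}_R(z)$ with $z \in L$. For a reduced ring $R$ of prime characteristic $p > 0$, the perfect closure $R^\infty \supseteq R$ is the ring obtained from $R$ by adjoining unique $p^n$th roots of all elements of $R$ for all $n \in \mathbb{N}$ (equivalently, the direct limit of $R \to R \to R \to \cdots$ where each map is the Frobenius endomorphism). A subscript $W$ denotes localization at $W$ (regarded inside $R^\infty$ where appropriate). A Noetherian ring is regular if its localization at every prime ideal is a regular local ring. *)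

theory Defs
  imports "HOL-Algebra.Algebra" "HOL-Computational_Algebra.Primes" "HOL-Library.Extended_Nat"
begin

section \<open>Modules over a commutative ring\<close>

text \<open>
  The records of type \<^typ>\<open>('a, 'b) module\<close> built below are modules only; the fields
  \<^const>\<open>monoid.mult\<close> and \<^const>\<open>monoid.one\<close>, which that record type inherits from rings,
  are ignored by the locale \<^locale>\<open>module\<close> and are left undefined where there is no ring
  structure.
\<close>

definition self_module :: "('a, 'm) ring_scheme \<Rightarrow> ('a, 'a) module" where
  "self_module R =
     \<lparr>carrier = carrier R, monoid.mult = monoid.mult R, monoid.one = monoid.one R,
      ring.zero = ring.zero R, ring.add = ring.add R, smult = monoid.mult R\<rparr>"

definition quotient_module :: "('a, 'm) ring_scheme \<Rightarrow> 'a set \<Rightarrow> ('a, 'a set) module" where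
  "quotient_module R I =
     ring.extend (R Quot I) (module.fields (\<lambda>r U. (I +>\<^bsub>R\<^esub> r) \<otimes>\<^bsub>R Quot I\<^esub> U))"

definition annihilator :: "('a, 'm) ring_scheme \<Rightarrow> ('a, 'b, 'n) module_scheme \<Rightarrow> 'b \<Rightarrow> 'a set" where
  "annihilator A N z = {a \<in> carrier A. a \<odot>\<^bsub>N\<^esub> z = \<zero>\<^bsub>N\<^esub>}"

definition Ass :: "('a, 'm) ring_scheme \<Rightarrow> ('a, 'b, 'n) module_scheme \<Rightarrow> 'a set set" where
  "Ass A N = {P. primeideal P A \<and> (\<exists>z \<in> carrier N. P = annihilator A N z)}"

definition fg_ideal :: "'a set \<Rightarrow> ('a, 'm) ring_scheme \<Rightarrow> bool" where
  "fg_ideal I A \<longleftrightarrow> (\<exists>B \<subseteq> carrier A. finite B \<and> I = Idl\<^bsub>A\<^esub> B)"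

definition strong_Krull_primes ::
    "('a, 'm) ring_scheme \<Rightarrow> ('a, 'b, 'n) module_scheme \<Rightarrow> 'a set set" where
  "strong_Krull_primes A N =
     {P. primeideal P A \<and>
         (\<forall>I. fg_ideal I A \<and> I \<subseteq> P \<longrightarrow>
            (\<exists>z \<in> carrier N. I \<subseteq> annihilator A N z \<and> annihilator A N z \<subseteq> P))}"


section \<open>Localization\<close>

definition fraction_rel ::
    "('a, 'm) ring_scheme \<Rightarrow> 'a set \<Rightarrow> ('a, 'b, 'n) module_scheme \<Rightarrow> (('b \<times> 'a) \<times> ('b \<times> 'a)) set" where
  "fraction_rel A W N =
     {((x, s), (y, t)). x \<in> carrier N \<and> s \<in> W \<and> y \<in> carrier N \<and> t \<in> W \<and>
        (\<exists>u \<in> W. u \<odot>\<^bsub>N\<^esub> (t \<odot>\<^bsub>N\<^esub> x) = u \<odot>\<^bsub>N\<^esub> (s \<odot>\<^bsub>N\<^esub> y))}"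

text \<open>The \<open>A\<close>-module \<open>N\<^sub>W\<close>; the class of \<open>(x, s)\<close> is the fraction \<open>x / s\<close>.\<close>

definition localized_module ::
    "('a, 'm) ring_scheme \<Rightarrow> 'a set \<Rightarrow> ('a, 'b, 'n) module_scheme \<Rightarrow> ('a, ('b \<times> 'a) set) module" where
  "localized_module A W N =
     (let E = fraction_rel A W N in
      \<lparr>carrier = (carrier N \<times> W) // E,
       monoid.mult = undefined,
       monoid.one = undefined,
       ring.zero = E `` {(\<zero>\<^bsub>N\<^esub>, \<one>\<^bsub>A\<^esub>)},
       ring.add = (\<lambda>U V. \<Union>(x, s) \<in> U. \<Union>(y, t) \<in> V.
                E `` {((t \<odot>\<^bsub>N\<^esub> x) \<oplus>\<^bsub>N\<^esub> (s \<odot>\<^bsub>N\<^esub> y), s \<otimes>\<^bsub>A\<^esub> t)}),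
       smult = (\<lambda>a U. \<Union>(x, s) \<in> U. E `` {(a \<odot>\<^bsub>N\<^esub> x, s)})\<rparr>)"

definition localized_ring :: "('a, 'm) ring_scheme \<Rightarrow> 'a set \<Rightarrow> ('a \<times> 'a) set ring" where
  "localized_ring A W =
     (let E = fraction_rel A W (self_module A); M = localized_module A W (self_module A) in
      \<lparr>carrier = carrier M,
       monoid.mult = (\<lambda>U V. \<Union>(x, s) \<in> U. \<Union>(y, t) \<in> V. E `` {(x \<otimes>\<^bsub>A\<^esub> y, s \<otimes>\<^bsub>A\<^esub> t)}),
       monoid.one = E `` {(\<one>\<^bsub>A\<^esub>, \<one>\<^bsub>A\<^esub>)},
       ring.zero = ring.zero M,
       ring.add = ring.add M\<rparr>)"


section \<open>Regular rings\<close>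

text \<open>
  For the zero ring the supremum below is that of the empty set, hence \<open>0\<close>; only the dimension of
  local rings is used.
\<close>

definition krull_dim :: "('a, 'm) ring_scheme \<Rightarrow> enat" where
  "krull_dim A =
     Sup {enat n | n. \<exists>P. (\<forall>i\<le>n. primeideal (P i) A) \<and> (\<forall>i<n. P i \<subset> P (Suc i))}"

definition regular_local_ring :: "('a, 'm) ring_scheme \<Rightarrow> bool" where
  "regular_local_ring A \<longleftrightarrow>
     cring A \<and> noetherian_ring A \<and>
     (\<exists>M. (\<forall>I. maximalideal I A \<longleftrightarrow> I = M) \<and>
          (\<exists>B \<subseteq> carrier A. finite B \<and> M = Idl\<^bsub>A\<^esub> B \<and> enat (card B) = krull_dim A))"

definition regular_ring :: "('a, 'm) ring_scheme \<Rightarrow> bool" where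
  "regular_ring A \<longleftrightarrow>
     cring A \<and> noetherian_ring A \<and>
     (\<forall>P. primeideal P A \<longrightarrow> regular_local_ring (localized_ring A (carrier A - P)))"


section \<open>Characteristic, reducedness and the perfect closure\<close>

text \<open>The order of \<open>1\<close> in the additive group (\<open>0\<close> if that order is infinite).\<close>

definition ring_char :: "('a, 'm) ring_scheme \<Rightarrow> nat" where
  "ring_char A = group.ord (add_monoid A) \<one>\<^bsub>A\<^esub>"

definition reduced_ring :: "('a, 'm) ring_scheme \<Rightarrow> bool" where
  "reduced_ring A \<longleftrightarrow>
     (\<forall>a \<in> carrier A. \<forall>n::nat. a [^]\<^bsub>A\<^esub> n = \<zero>\<^bsub>A\<^esub> \<longrightarrow> a = \<zero>\<^bsub>A\<^esub>)"

text \<open>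
  The perfect closure of a ring \<open>A\<close> of characteristic \<open>p\<close> is the direct limit of
  \<open>A \<rightarrow> A \<rightarrow> A \<rightarrow> \<dots>\<close> along the Frobenius endomorphism.  The pair \<open>(m, a)\<close> is the element \<open>a\<close> of
  the \<open>m\<close>-th copy of \<open>A\<close>, so its class is the \<open>p^m\<close>-th root of \<open>a\<close>.
\<close>

definition perfect_rel :: "nat \<Rightarrow> ('a, 'm) ring_scheme \<Rightarrow> ((nat \<times> 'a) \<times> (nat \<times> 'a)) set" where
  "perfect_rel p A =
     {((m, a), (n, b)). a \<in> carrier A \<and> b \<in> carrier A \<and>
        (\<exists>k. m \<le> k \<and> n \<le> k \<and> a [^]\<^bsub>A\<^esub> (p ^ (k - m)) = b [^]\<^bsub>A\<^esub> (p ^ (k - n)))}"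

definition perfect_closure :: "nat \<Rightarrow> ('a, 'm) ring_scheme \<Rightarrow> (nat \<times> 'a) set ring" where
  "perfect_closure p A =
     (let E = perfect_rel p A in
      \<lparr>carrier = (UNIV \<times> carrier A) // E,
       monoid.mult = (\<lambda>U V. \<Union>(m, a) \<in> U. \<Union>(n, b) \<in> V.
                 E `` {(m + n, a [^]\<^bsub>A\<^esub> (p ^ n) \<otimes>\<^bsub>A\<^esub> b [^]\<^bsub>A\<^esub> (p ^ m))}),
       monoid.one = E `` {(0, \<one>\<^bsub>A\<^esub>)},
       ring.zero = E `` {(0, \<zero>\<^bsub>A\<^esub>)},
       ring.add = (\<lambda>U V. \<Union>(m, a) \<in> U. \<Union>(n, b) \<in> V.
                 E `` {(m + n, a [^]\<^bsub>A\<^esub> (p ^ n) \<oplus>\<^bsub>A\<^esub> b [^]\<^bsub>A\<^esub> (p ^ m))})\<rparr>)"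

text \<open>The canonical map \<open>A \<rightarrow> A\<^sup>\<infinity>\<close>, injective for reduced \<open>A\<close>.\<close>

definition perfect_emb :: "nat \<Rightarrow> ('a, 'm) ring_scheme \<Rightarrow> 'a \<Rightarrow> (nat \<times> 'a) set" where
  "perfect_emb p A a = perfect_rel p A `` {(0, a)}"


section \<open>Tensor products\<close>

text \<open>
  For a ring homomorphism \<open>f : A \<rightarrow> S\<close>, an \<open>A\<close>-module \<open>L\<close> and an \<open>S\<close>-module \<open>N\<close>, this is
  \<open>L \<otimes>\<^sub>A N\<close>, where \<open>A\<close> acts on \<open>N\<close> through \<open>f\<close>: the free abelian group on
  \<open>carrier L \<times> carrier N\<close> modulo the bilinearity and balancing relations.  It is regarded as an
  \<open>S\<close>-module via \<open>s (x \<otimes> y) = x \<otimes> s y\<close>.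
\<close>

definition tensor_relations ::
    "('a, 'm) ring_scheme \<Rightarrow> ('a \<Rightarrow> 's) \<Rightarrow> ('a, 'b, 'k) module_scheme \<Rightarrow> ('s, 'c, 'n) module_scheme
      \<Rightarrow> ('b \<times> 'c \<Rightarrow>\<^sub>0 int) set" where
  "tensor_relations A f L N =
     {frag_of (x \<oplus>\<^bsub>L\<^esub> x', y) - frag_of (x, y) - frag_of (x', y) | x x' y.
        x \<in> carrier L \<and> x' \<in> carrier L \<and> y \<in> carrier N} \<union>
     {frag_of (x, y \<oplus>\<^bsub>N\<^esub> y') - frag_of (x, y) - frag_of (x, y') | x y y'.
        x \<in> carrier L \<and> y \<in> carrier N \<and> y' \<in> carrier N} \<union>
     {frag_of (a \<odot>\<^bsub>L\<^esub> x, y) - frag_of (x, f a \<odot>\<^bsub>N\<^esub> y) | a x y.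
        a \<in> carrier A \<and> x \<in> carrier L \<and> y \<in> carrier N}"

definition tensor_module ::
    "('a, 'm) ring_scheme \<Rightarrow> ('a \<Rightarrow> 's) \<Rightarrow> ('a, 'b, 'k) module_scheme \<Rightarrow> ('s, 'c, 'n) module_scheme
      \<Rightarrow> ('s, ('b \<times> 'c \<Rightarrow>\<^sub>0 int) set) module" where
  "tensor_module A f L N =
     (let F = free_Abelian_group (carrier L \<times> carrier N);
          K = generate F (tensor_relations A f L N) in
      \<lparr>carrier = carrier (F Mod K),
       monoid.mult = undefined,
       monoid.one = undefined,
       ring.zero = monoid.one (F Mod K),
       ring.add = monoid.mult (F Mod K),
       smult = (\<lambda>s U. \<Union>c \<in> U. K #>\<^bsub>F\<^esub> frag_extend (\<lambda>(x, y). frag_of (x, s \<odot>\<^bsub>N\<^esub> y)) c)\<rparr>)"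

end

theory Submission
  imports Defs
begin

text \<open>
  By Kunz's theorem the powers of the Frobenius endomorphism of \<open>R\<close> are flat up to multipliers from
  \<open>W\<close>: Noetherian induction on an ideal reduces the equational criterion to primes \<open>P\<close> disjoint from
  \<open>W\<close>, where a regular system of parameters of \<open>R\<^sub>P\<close> and all systems of powers of it are regular
  sequences. Hence \<open>N = R\<^sup>\<infinity>\<close> and \<open>N = (R\<^sup>\<infinity>)\<^sub>W\<close> are flat over \<open>R\<close> up to \<open>W\<close>.

  Let \<open>Q\<close> be a strong Krull prime of \<open>L \<otimes> N\<close> that does not meet \<open>W\<close>, put \<open>q = Q \<inter> R\<close>, and let
  \<open>I \<subseteq> Q\<close> be finitely generated. Take \<open>c\<close> with \<open>I + q R\<^sup>\<infinity> \<subseteq> ann c \<subseteq> Q\<close>. By flatness a multiple of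
  \<open>c\<close> comes from \<open>(0 :\<^sub>L q) \<otimes> N\<close>; if it is written as \<open>\<Sum> x\<^sub>i \<otimes> t\<^sub>i\<close> with as few terms as possible, then all
  syzygies of the \<open>x\<^sub>i\<close> have coefficients in \<open>q\<close>. So \<open>q = ann x\<^sub>i\<close> is associated to \<open>L\<close>, and flatness shows
  that the annihilator of \<open>c\<close> is, up to factors outside \<open>Q\<close>, the intersection of the annihilators of the
  \<open>t\<^sub>i\<close> modulo \<open>qN\<close>; one of these lies in \<open>Q\<close>. Conversely, for \<open>q = ann x\<close> the injection \<open>R/q \<rightarrow> L\<close>
  stays injective, up to \<open>W\<close>, after tensoring with \<open>N\<close>.
\<close>

section \<open>Saturations and Krull's principal ideal theorem\<close>

text \<open>Local rings occur only where the regularity hypothesis is unpacked: statements over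
  \<open>R_P\<close> become statements in R about saturations, and flatness over \<open>R_W\<close>
  becomes the existence of multipliers in W. The obstacle is uniformity. Regularity at P gives, for
  each relation separately, a multiplier outside P, whereas flatness asks for one in W. Relations
  over the Frobenius module are vectors over R, closed under ordinary multiplication, so by
  Noetherianity one s outside P serves them all. In the exact sequence Tor_1(R/P) -> Tor_1(R/P) ->
  Tor_1(R/(P + sR)), whose first map is multiplication by s, the first map is then zero and each
  element of the last term is killed by an element of W, by induction; this settles the prime case.
  The equational criterion is convenient here because it speaks of one finite relation at a time: it
  survives both multiplication by W and the passage to the limit.\<close>

definition adjoin :: "('a, 'm) ring_scheme \<Rightarrow> 'a set \<Rightarrow> 'a \<Rightarrow> 'a set" where
  "adjoin R I x = {i \<oplus>\<^bsub>R\<^esub> c \<otimes>\<^bsub>R\<^esub> x | i c. i \<in> I \<and> c \<in> carrier R}"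

definition colon :: "('a, 'm) ring_scheme \<Rightarrow> 'a set \<Rightarrow> 'a \<Rightarrow> 'a set" where
  "colon R I x = {c \<in> carrier R. x \<otimes>\<^bsub>R\<^esub> c \<in> I}"

text \<open>For a prime P and an ideal I this is the preimage in R of the ideal generated by I in
  the local ring at P. Local arguments can thus be carried out inside R.\<close>

definition saturation :: "('a, 'm) ring_scheme \<Rightarrow> 'a set \<Rightarrow> 'a set \<Rightarrow> 'a set" where
  "saturation R P I = {a \<in> carrier R. \<exists>s \<in> carrier R - P. s \<otimes>\<^bsub>R\<^esub> a \<in> I}"

lemma (in ideal) ideal_simps [simp]:
  "\<zero> \<in> I" "a \<in> I \<Longrightarrow> b \<in> I \<Longrightarrow> a \<oplus> b \<in> I" "a \<in> I \<Longrightarrow> \<ominus> a \<in> I"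
  "a \<in> I \<Longrightarrow> b \<in> I \<Longrightarrow> a \<ominus> b \<in> I"
  using a_subgroup by (auto simp: minus_eq)

lemma (in ideal) mem_add_cancel:
  assumes "a \<in> I" "b \<in> carrier R" "a \<oplus> b \<in> I"
  shows "b \<in> I"
proof -
  have "b = (a \<oplus> b) \<ominus> a" using assms Icarr[OF assms(1)] by algebra
  thus ?thesis using assms by (metis ideal_simps(4))
qed

lemma (in cring) idealI':
  assumes "I \<subseteq> carrier R" "\<zero> \<in> I" "\<And>a b. a \<in> I \<Longrightarrow> b \<in> I \<Longrightarrow> a \<oplus> b \<in> I"
    "\<And>a c. a \<in> I \<Longrightarrow> c \<in> carrier R \<Longrightarrow> c \<otimes> a \<in> I"
  shows "ideal I R"
proof (rule idealI)
  have "\<ominus> a \<in> I" if "a \<in> I" for a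
    using assms(4)[OF that, of "\<ominus> \<one>"] that assms(1) by (auto simp: l_minus)
  then show "subgroup I (add_monoid R)"
    using assms by (intro add.subgroupI) (auto simp: a_inv_def)
next
  fix a x assume ax: "a \<in> I" "x \<in> carrier R"
  thus xa: "x \<otimes> a \<in> I" by (rule assms(4))
  have "x \<otimes> a = a \<otimes> x" using ax assms(1) by (intro m_comm) auto
  with xa show "a \<otimes> x \<in> I" by (rule back_subst)
qed (rule ring_axioms)

lemma saturationI: "a \<in> carrier R \<Longrightarrow> s \<in> carrier R - P \<Longrightarrow> s \<otimes>\<^bsub>R\<^esub> a \<in> I \<Longrightarrow> a \<in> saturation R P I"
  by (auto simp: saturation_def)

context cring
begin

lemma adjoinI: "i \<in> I \<Longrightarrow> c \<in> carrier R \<Longrightarrow> i \<oplus> c \<otimes> x \<in> adjoin R I x"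
  by (auto simp: adjoin_def)

lemma adjoin_ideal:
  assumes "ideal I R" "x \<in> carrier R"
  shows "ideal (adjoin R I x) R"
proof (rule idealI')
  interpret I: ideal I R by fact
  show "adjoin R I x \<subseteq> carrier R" using assms(2) I.Icarr by (auto simp: adjoin_def)
  have "\<zero> \<oplus> \<zero> \<otimes> x \<in> adjoin R I x" by (intro adjoinI) auto
  thus "\<zero> \<in> adjoin R I x" using assms(2) by simp
  fix a assume "a \<in> adjoin R I x"
  then obtain i c where a: "i \<in> I" "c \<in> carrier R" "a = i \<oplus> c \<otimes> x" by (auto simp: adjoin_def)
  { fix b assume "b \<in> adjoin R I x"
    then obtain j d where b: "j \<in> I" "d \<in> carrier R" "b = j \<oplus> d \<otimes> x" by (auto simp: adjoin_def)
    have "a \<oplus> b = (i \<oplus> j) \<oplus> (c \<oplus> d) \<otimes> x"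
      using a b I.Icarr[OF a(1)] I.Icarr[OF b(1)] assms(2) by algebra
    thus "a \<oplus> b \<in> adjoin R I x" using a b unfolding adjoin_def by blast }
  fix d assume d: "d \<in> carrier R"
  have "d \<otimes> a = (d \<otimes> i) \<oplus> (d \<otimes> c) \<otimes> x"
    using a d I.Icarr[OF a(1)] assms(2) by algebra
  thus "d \<otimes> a \<in> adjoin R I x" using a d I.I_l_closed unfolding adjoin_def by blast
qed

lemma adjoin_superset:
  assumes "ideal I R" "x \<in> carrier R"
  shows "I \<subseteq> adjoin R I x" "x \<in> adjoin R I x"
proof -
  interpret I: ideal I R by fact
  show "I \<subseteq> adjoin R I x"
  proof
    fix i assume i: "i \<in> I"
    hence "i = i \<oplus> \<zero> \<otimes> x" using assms I.Icarr by simp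
    thus "i \<in> adjoin R I x" using i unfolding adjoin_def by blast
  qed
  have "x = \<zero> \<oplus> \<one> \<otimes> x" using assms by simp
  thus "x \<in> adjoin R I x" unfolding adjoin_def by (metis (mono_tags, lifting) I.ideal_simps(1) mem_Collect_eq one_closed)
qed

lemma adjoin_least:
  assumes "ideal J R" "I \<subseteq> J" "x \<in> J"
  shows "adjoin R I x \<subseteq> J"
proof -
  interpret J: ideal J R by fact
  show ?thesis using assms J.I_l_closed by (auto simp: adjoin_def)
qed

lemma adjoin_mono: "I \<subseteq> J \<Longrightarrow> adjoin R I x \<subseteq> adjoin R J x"
  by (auto simp: adjoin_def)

lemma genideal_insert:
  assumes "B \<subseteq> carrier R" "b \<in> carrier R"
  shows "Idl (insert b B) = adjoin R (Idl B) b"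
proof
  have i: "ideal (Idl B) R" by (rule genideal_ideal) fact
  show "Idl (insert b B) \<subseteq> adjoin R (Idl B) b"
    using adjoin_superset[OF i assms(2)] genideal_self[OF assms(1)]
    by (intro genideal_minimal adjoin_ideal i assms) auto
  show "adjoin R (Idl B) b \<subseteq> Idl (insert b B)"
    using assms genideal_self[of "insert b B"]
    by (intro adjoin_least genideal_ideal subset_Idl_subset) auto
qed

lemma colon_ideal:
  assumes "ideal I R" "x \<in> carrier R"
  shows "ideal (colon R I x) R"
  using ideal.helper_max_prime[OF assms(1) is_cring assms(2)] by (simp add: colon_def)

lemma colon_superset:
  assumes "ideal I R" "x \<in> carrier R"
  shows "I \<subseteq> colon R I x"
  using assms ideal.I_l_closed[OF assms(1)] ideal.Icarr[OF assms(1)] by (auto simp: colon_def)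

lemma primeideal_mult_notin:
  assumes "primeideal P R" "a \<in> carrier R - P" "b \<in> carrier R - P"
  shows "a \<otimes> b \<in> carrier R - P"
  using assms primeideal.I_prime[OF assms(1)] by auto

lemma primeideal_one_notin:
  assumes "primeideal P R" shows "\<one> \<in> carrier R - P"
  using assms ideal.one_imp_carrier primeideal.I_notcarr primeideal.axioms(1) by blast

lemma primeideal_pow_notin:
  assumes "primeideal P R" "a \<in> carrier R - P"
  shows "a [^] (n::nat) \<in> carrier R - P"
proof (induction n)
  case 0 then show ?case using primeideal_one_notin[OF assms(1)] by simp
next
  case (Suc n) then show ?case using primeideal_mult_notin[OF assms(1) Suc assms(2)] by simp
qed

lemma saturation_mono: "I \<subseteq> J \<Longrightarrow> saturation R P I \<subseteq> saturation R P J"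
  by (auto simp: saturation_def)

lemma saturation_antimono: "P' \<subseteq> P \<Longrightarrow> saturation R P I \<subseteq> saturation R P' I"
  by (auto simp: saturation_def)

lemma saturation_superset:
  assumes "primeideal P R" "ideal I R" shows "I \<subseteq> saturation R P I"
proof
  fix a assume a: "a \<in> I"
  hence "\<one> \<otimes> a \<in> I" using ideal.Icarr[OF assms(2)] by simp
  thus "a \<in> saturation R P I"
    using a primeideal_one_notin[OF assms(1)] ideal.Icarr[OF assms(2)] unfolding saturation_def by blast
qed

lemma saturation_ideal:
  assumes P: "primeideal P R" and I: "ideal I R"
  shows "ideal (saturation R P I) R"
proof (rule idealI')
  interpret I: ideal I R by fact
  show "saturation R P I \<subseteq> carrier R" by (auto simp: saturation_def)
  show "\<zero> \<in> saturation R P I" using saturation_superset[OF P I] by auto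
  fix a assume "a \<in> saturation R P I"
  then obtain s where s: "a \<in> carrier R" "s \<in> carrier R - P" "s \<otimes> a \<in> I" by (auto simp: saturation_def)
  { fix b assume "b \<in> saturation R P I"
    then obtain t where t: "b \<in> carrier R" "t \<in> carrier R - P" "t \<otimes> b \<in> I" by (auto simp: saturation_def)
    have "s \<in> carrier R" "t \<in> carrier R" using s t by auto
    hence "(s \<otimes> t) \<otimes> (a \<oplus> b) = t \<otimes> (s \<otimes> a) \<oplus> s \<otimes> (t \<otimes> b)" using s(1) t(1) by algebra
    hence "(s \<otimes> t) \<otimes> (a \<oplus> b) \<in> I" using s t I.I_l_closed by auto
    thus "a \<oplus> b \<in> saturation R P I"
      using s t primeideal_mult_notin[OF P s(2) t(2)] unfolding saturation_def by blast }
  fix c assume c: "c \<in> carrier R"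
  have "s \<otimes> (c \<otimes> a) = c \<otimes> (s \<otimes> a)" using s c by (simp add: m_lcomm)
  hence "s \<otimes> (c \<otimes> a) \<in> I" using s c I.I_l_closed by simp
  thus "c \<otimes> a \<in> saturation R P I" using s c unfolding saturation_def by blast
qed

lemma saturation_cancel:
  assumes P: "primeideal P R" and x: "x \<in> carrier R - P" "a \<in> carrier R" "x \<otimes> a \<in> saturation R P I"
  shows "a \<in> saturation R P I"
proof -
  obtain s where s: "s \<in> carrier R - P" "s \<otimes> (x \<otimes> a) \<in> I" using x(3) by (auto simp: saturation_def)
  have "(s \<otimes> x) \<otimes> a \<in> I" using s x by (simp add: m_assoc)
  thus ?thesis using primeideal_mult_notin[OF P s(1) x(1)] x(2) unfolding saturation_def by blast
qed

lemma saturation_subset: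
  assumes P: "primeideal P R" and IJ: "I \<subseteq> saturation R P J"
  shows "saturation R P I \<subseteq> saturation R P J"
proof
  fix a assume "a \<in> saturation R P I"
  then obtain s where s: "a \<in> carrier R" "s \<in> carrier R - P" "s \<otimes> a \<in> I" by (auto simp: saturation_def)
  thus "a \<in> saturation R P J" using saturation_cancel[OF P s(2,1)] IJ by blast
qed

lemma saturation_primeideal:
  assumes P: "primeideal P R" and P': "primeideal P' R" "P' \<subseteq> P"
  shows "saturation R P P' = P'"
proof
  show "saturation R P P' \<subseteq> P'" using primeideal.I_prime[OF P'(1)] P'(2) by (auto simp: saturation_def)
  show "P' \<subseteq> saturation R P P'" by (intro saturation_superset P primeideal.axioms(1)[OF P'(1)])
qed

lemma saturation_eq_carrier:
  assumes I: "ideal I R" and nI: "\<not> I \<subseteq> P"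
  shows "saturation R P I = carrier R"
proof -
  obtain s where s: "s \<in> I" "s \<notin> P" using nI by auto
  have "a \<in> saturation R P I" if "a \<in> carrier R" for a
    using that s ideal.I_r_closed[OF I s(1) that] ideal.Icarr[OF I s(1)] unfolding saturation_def by blast
  thus ?thesis by (auto simp: saturation_def)
qed

text \<open>Nakayama's lemma locally at P, by elimination instead of determinants. The relation for
  b reads s b = n + x (c + e b). Since x lies in P and s does not, u = s - x e is outside P, and u b
  = n + x c expresses b by the other generators.\<close>

lemma nakayama_generators:
  assumes P: "primeideal P R" and x: "x \<in> P" and N: "ideal N R"
    and B: "finite B" "B \<subseteq> carrier R"
    and gen: "\<And>b. b \<in> B \<Longrightarrow> \<exists>s \<in> carrier R - P. \<exists>n \<in> N. \<exists>c \<in> Idl B. s \<otimes> b = n \<oplus> x \<otimes> c"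
  shows "B \<subseteq> saturation R P N"
  using B gen
proof (induction B rule: finite_induct)
  case (insert b B)
  interpret P: primeideal P R by fact
  interpret N: ideal N R by fact
  have b: "b \<in> carrier R" and BR: "B \<subseteq> carrier R" using insert.prems by auto
  have xR: "x \<in> carrier R" using x P.Icarr by simp
  interpret B: ideal "Idl B" R by (rule genideal_ideal[OF BR])
  note Idl = genideal_insert[OF BR b]
  obtain s n e c where s: "s \<in> carrier R - P" "n \<in> N" "e \<in> carrier R" "c \<in> Idl B"
      "s \<otimes> b = n \<oplus> x \<otimes> (c \<oplus> e \<otimes> b)"
    using insert.prems(2)[of b] unfolding Idl adjoin_def by auto
  define u where "u = s \<ominus> x \<otimes> e"
  have carr: "s \<in> carrier R" "n \<in> carrier R" "c \<in> carrier R" using s N.Icarr B.Icarr by auto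
  have "s = u \<oplus> x \<otimes> e" using u_def carr s(3) xR by algebra
  hence "u \<notin> P" using s(1,3) P.I_r_closed[OF x s(3)] by (metis DiffD2 P.ideal_simps(2))
  hence u: "u \<in> carrier R - P" using u_def carr s(3) xR by simp
  have ub: "u \<otimes> b = n \<oplus> x \<otimes> c"
  proof -
    have "u \<otimes> b = s \<otimes> b \<ominus> x \<otimes> e \<otimes> b" using u_def carr s(3) xR b by algebra
    also have "\<dots> = n \<oplus> x \<otimes> c" unfolding s(5) using carr s(3) xR b by algebra
    finally show ?thesis .
  qed
  have "B \<subseteq> saturation R P N"
  proof (rule insert.IH[OF BR])
    fix b' assume b': "b' \<in> B"
    obtain s' n' e' c' where s': "s' \<in> carrier R - P" "n' \<in> N" "e' \<in> carrier R" "c' \<in> Idl B"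
      "s' \<otimes> b' = n' \<oplus> x \<otimes> (c' \<oplus> e' \<otimes> b)"
      using insert.prems(2)[of b'] b' unfolding Idl adjoin_def by auto
    have carr': "s' \<in> carrier R" "n' \<in> carrier R" "c' \<in> carrier R" "b' \<in> carrier R" "u \<in> carrier R"
      using s' N.Icarr B.Icarr b' BR u by auto
    \<comment> \<open>The relation for b' is multiplied by u and \<open>u \<otimes> b\<close> is
      replaced by \<open>n \<oplus> x \<otimes> c\<close>; what remains involves only generators in
      B.\<close>
    have "(u \<otimes> s') \<otimes> b' = u \<otimes> (s' \<otimes> b')" using carr' by algebra
    also have "\<dots> = u \<otimes> n' \<oplus> x \<otimes> (u \<otimes> c') \<oplus> x \<otimes> e' \<otimes> (u \<otimes> b)"
      unfolding s'(5) using carr' s'(3) xR b by algebra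
    also have "\<dots> = (u \<otimes> n' \<oplus> (x \<otimes> e') \<otimes> n) \<oplus> x \<otimes> (u \<otimes> c' \<oplus> (x \<otimes> e') \<otimes> c)"
      unfolding ub using carr' carr s'(3) xR by algebra
    finally have eq: "(u \<otimes> s') \<otimes> b' = (u \<otimes> n' \<oplus> (x \<otimes> e') \<otimes> n) \<oplus> x \<otimes> (u \<otimes> c' \<oplus> (x \<otimes> e') \<otimes> c)" .
    have "u \<otimes> n' \<oplus> (x \<otimes> e') \<otimes> n \<in> N" "u \<otimes> c' \<oplus> (x \<otimes> e') \<otimes> c \<in> Idl B"
      using s s' carr' xR N.I_l_closed B.I_l_closed by auto
    thus "\<exists>s \<in> carrier R - P. \<exists>n \<in> N. \<exists>c \<in> Idl B. s \<otimes> b' = n \<oplus> x \<otimes> c"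
      using eq primeideal_mult_notin[OF P u s'(1)] by blast
  qed
  moreover have sat: "ideal (saturation R P N) R" by (rule saturation_ideal[OF P N])
  ultimately have "Idl B \<subseteq> saturation R P N" by (intro genideal_minimal)
  hence "u \<otimes> b \<in> saturation R P N"
    unfolding ub using sat s(2,4) xR saturation_superset[OF P N]
    by (metis (no_types, lifting) ideal.I_l_closed ideal.ideal_simps(2) in_mono)
  hence "b \<in> saturation R P N" by (rule saturation_cancel[OF P u b])
  thus ?case using \<open>B \<subseteq> saturation R P N\<close> by simp
qed simp

end

section \<open>Noetherian induction, Nakayama's lemma and the principal ideal theorem\<close>

locale noetherian_cring = cring R + noetherian_ring R for R (structure)
begin

text \<open>Reverse inclusion of ideals is well-founded: a strictly increasing sequence would be a
  chain of ideals that contains its own union.\<close>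

lemma noetherian_induct [consumes 1]:
  assumes "ideal I R"
    and step: "\<And>I. ideal I R \<Longrightarrow> (\<And>J. ideal J R \<Longrightarrow> I \<subset> J \<Longrightarrow> Q J) \<Longrightarrow> Q I"
  shows "Q I"
proof -
  have "wf {(J, I). ideal J R \<and> ideal I R \<and> I \<subset> J}"
  proof (unfold wf_iff_no_infinite_down_chain, safe)
    fix f assume f: "\<forall>i. (f (Suc i), f i) \<in> {(J, I). ideal J R \<and> ideal I R \<and> I \<subset> J}"
    hence inc: "f i \<subseteq> f j" if "i \<le> j" for i j using lift_Suc_mono_le[of f] that by blast
    have "subset.chain {I. ideal I R} (range f)"
      unfolding subset_chain_def
    proof (intro conjI ballI)
      fix A B assume "A \<in> range f" "B \<in> range f"
      then obtain i j where "A = f i" "B = f j" by auto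
      thus "A \<subseteq> B \<or> B \<subseteq> A" using inc[of i j] inc[of j i] nle_le[of i j] by blast
    qed (use f in auto)
    hence "\<Union>(range f) \<in> range f" by (rule ideal_chain_is_trivial[rotated]) auto
    then obtain i where "\<Union>(range f) = f i" by auto
    moreover have "f (Suc i) \<subseteq> \<Union>(range f)" by (rule Union_upper) simp
    moreover have "f i \<subset> f (Suc i)" using f by simp
    ultimately show False by simp
  qed
  then show ?thesis using assms(1)
  proof (induction I rule: wf_induct_rule)
    case (less I)
    show ?case
    proof (rule step[OF less.prems])
      fix J assume J: "ideal J R" "I \<subset> J"
      show "Q J" by (rule less.IH[OF _ J(1)]) (use J less.prems in simp)
    qed
  qed
qed

lemma nakayama:
  assumes P: "primeideal P R" and x: "x \<in> P" and N: "ideal N R" and M: "ideal M R"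
    and gen: "\<And>b. b \<in> M \<Longrightarrow> \<exists>s \<in> carrier R - P. \<exists>n \<in> N. \<exists>c \<in> M. s \<otimes> b = n \<oplus> x \<otimes> c"
  shows "M \<subseteq> saturation R P N"
proof -
  obtain B where B: "B \<subseteq> carrier R" "finite B" "M = Idl B" using finetely_gen[OF M] by auto
  have "B \<subseteq> saturation R P N"
    using gen genideal_self[OF B(1)] B(3) by (intro nakayama_generators[OF P x N B(2,1)]) auto
  thus ?thesis unfolding B(3) by (intro genideal_minimal saturation_ideal P N)
qed

text \<open>
  This replaces the fact that the localization at \<open>P\<close> of \<open>R/J\<close> is Artinian if \<open>P\<close> is minimal over \<open>J\<close>.
\<close>

lemma descending_chain_stabilizes:
  assumes "ideal J R" and P: "primeideal P R"
    and I: "\<And>n::nat. ideal (I n) R" "\<And>n. I (Suc n) \<subseteq> I n" "\<And>n. J \<subseteq> I n"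
    and min: "\<And>P'. primeideal P' R \<Longrightarrow> J \<subseteq> P' \<Longrightarrow> P' \<subseteq> P \<Longrightarrow> P' = P"
  shows "\<exists>n. \<forall>m\<ge>n. I n \<subseteq> saturation R P (I m)"
  using assms(1) I min
proof (induction J arbitrary: I rule: noetherian_induct)
  case (1 J I)
  interpret J: ideal J R by fact
  have dec: "I m \<subseteq> I n" if "n \<le> m" for n m using lift_Suc_antimono_le[of I] 1(4) that by blast
  consider "\<not> J \<subseteq> P" | "J = P" | "J \<subset> P" by blast
  then show ?case
  proof cases
    case a: 1
    hence "saturation R P (I m) = carrier R" for m using 1(3,5) by (intro saturation_eq_carrier) blast+
    thus ?thesis using ideal.Icarr[OF 1(3)] by blast
  next
    case 2
    show ?thesis
    proof (cases "\<exists>n. I n \<subseteq> P")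
      case True
      then obtain n where "I n \<subseteq> P" by auto
      hence "I n \<subseteq> I m" if "m \<ge> n" for m using 1(5)[of m] 2 by blast
      thus ?thesis using saturation_superset[OF P 1(3)] by blast
    next
      case False
      hence "saturation R P (I m) = carrier R" for m using 1(3) by (intro saturation_eq_carrier) blast+
      thus ?thesis using ideal.Icarr[OF 1(3)] by blast
    qed
  next
    case 3
    \<comment> \<open>Minimality of P over J excludes a prime J strictly inside P, so some product x
      y lies in J without its factors. Both J + xR and J : x are strictly larger than J (the second
      contains y), and the minimality hypothesis passes to them.\<close>
    hence "\<not> primeideal J R" "J \<noteq> carrier R" using 1(6) primeideal.I_notcarr[OF P] ideal.Icarr[OF primeideal.axioms(1)[OF P]] by blast+
    then obtain x y where xy: "x \<in> carrier R" "y \<in> carrier R" "x \<otimes> y \<in> J" "x \<notin> J" "y \<notin> J"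
      using J.primeidealCD[OF is_cring] by auto
    have "\<exists>n. \<forall>m\<ge>n. adjoin R (I n) x \<subseteq> saturation R P (adjoin R (I m) x)"
    proof (rule 1(2)[of "adjoin R J x"])
      show "J \<subset> adjoin R J x" using adjoin_superset[OF 1(1) xy(1)] xy by auto
      show "ideal (adjoin R J x) R" "\<And>n. ideal (adjoin R (I n) x) R" using 1(1,3) adjoin_ideal xy by auto
      show "\<And>n. adjoin R (I (Suc n)) x \<subseteq> adjoin R (I n) x" "\<And>n. adjoin R J x \<subseteq> adjoin R (I n) x"
        using 1(4,5) adjoin_mono by auto
      show "\<And>P'. primeideal P' R \<Longrightarrow> adjoin R J x \<subseteq> P' \<Longrightarrow> P' \<subseteq> P \<Longrightarrow> P' = P"
        using 1(6) adjoin_superset[OF 1(1) xy(1)] by auto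
    qed
    then obtain n1 where n1: "\<And>m. m \<ge> n1 \<Longrightarrow> adjoin R (I n1) x \<subseteq> saturation R P (adjoin R (I m) x)" by auto
    have "\<exists>n. \<forall>m\<ge>n. colon R (I n) x \<subseteq> saturation R P (colon R (I m) x)"
    proof (rule 1(2)[of "colon R J x"])
      show "J \<subset> colon R J x" using colon_superset[OF 1(1) xy(1)] xy by (auto simp: colon_def)
      show "ideal (colon R J x) R" "\<And>n. ideal (colon R (I n) x) R" using 1(1,3) colon_ideal xy by auto
      show "\<And>n. colon R (I (Suc n)) x \<subseteq> colon R (I n) x" "\<And>n. colon R J x \<subseteq> colon R (I n) x"
        using 1(4,5) by (auto simp: colon_def)
      show "\<And>P'. primeideal P' R \<Longrightarrow> colon R J x \<subseteq> P' \<Longrightarrow> P' \<subseteq> P \<Longrightarrow> P' = P"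
        using 1(6) colon_superset[OF 1(1) xy(1)] by auto
    qed
    then obtain n2 where n2: "\<And>m. m \<ge> n2 \<Longrightarrow> colon R (I n2) x \<subseteq> saturation R P (colon R (I m) x)" by auto
    define n where "n = max n1 n2"
    \<comment> \<open>Locally at P an element of \<open>I n\<close> is b + c x with b in
      \<open>I m\<close>, by the first chain. Then c x lies in \<open>I n\<close>, so c belongs to
      the colon ideal at \<open>n2\<close>, and the second chain moves c x into
      \<open>I m\<close>.\<close>
    have "I n \<subseteq> saturation R P (I m)" if m: "m \<ge> n" for m
    proof
      interpret Im: ideal "I m" R by (rule 1(3))
      interpret In: ideal "I n" R by (rule 1(3))
      fix a assume a: "a \<in> I n"
      hence "a \<in> adjoin R (I n1) x" using adjoin_superset[OF 1(3) xy(1)] dec[of n1 n] n_def by (meson max.cobounded1 subsetD)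
      hence "a \<in> saturation R P (adjoin R (I m) x)" using n1[of m] m n_def by auto
      then obtain s b c where s: "s \<in> carrier R - P" "b \<in> I m" "c \<in> carrier R" "s \<otimes> a = b \<oplus> c \<otimes> x"
        by (auto simp: saturation_def adjoin_def)
      have "b \<oplus> c \<otimes> x \<in> I n" using In.I_l_closed[OF a, of s] s by simp
      hence "c \<otimes> x \<in> I n" using In.mem_add_cancel[of b "c \<otimes> x"] dec[OF m] s xy by auto
      hence "c \<in> colon R (I n2) x" using dec[of n2 n] n_def s xy by (auto simp: colon_def m_comm)
      hence "c \<in> saturation R P (colon R (I m) x)" using n2[of m] m n_def by auto
      then obtain t where t: "t \<in> carrier R - P" "x \<otimes> (t \<otimes> c) \<in> I m" by (auto simp: saturation_def colon_def)
      have st: "s \<in> carrier R" "t \<in> carrier R" using s t by auto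
      have "(t \<otimes> s) \<otimes> a = t \<otimes> (s \<otimes> a)" using In.Icarr[OF a] s t by (simp add: m_assoc)
      also have "\<dots> = t \<otimes> b \<oplus> x \<otimes> (t \<otimes> c)" unfolding s(4) using s(3) st xy(1) Im.Icarr[OF s(2)] by algebra
      also have "\<dots> \<in> I m" using t s Im.I_l_closed by auto
      finally show "a \<in> saturation R P (I m)"
        using primeideal_mult_notin[OF P t(1) s(1)] In.Icarr[OF a] unfolding saturation_def by blast
    qed
    thus ?thesis by blast
  qed
qed

text \<open>
  A form of Krull's principal ideal theorem. The ideals \<open>Q n\<close> in the proof take the part of the
  symbolic powers of \<open>P1/P0\<close>.
\<close>

lemma prime_between_containing:
  assumes P0: "primeideal P0 R" and P1: "primeideal P1 R" and P2: "primeideal P2 R"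
    and chain: "P0 \<subset> P1" "P1 \<subset> P2" and x: "x \<in> P2"
  shows "\<exists>P'. primeideal P' R \<and> P0 \<subset> P' \<and> P' \<subset> P2 \<and> x \<in> P'"
proof (rule ccontr)
  assume no: "\<not> ?thesis"
  interpret P0: primeideal P0 R by fact
  interpret P1: primeideal P1 R by fact
  interpret P2: primeideal P2 R by fact
  have xP1: "x \<notin> P1" using no chain P1 by blast
  have xR: "x \<in> carrier R" using x P2.Icarr by simp
  obtain y where y: "y \<in> P1" "y \<notin> P0" using chain by auto
  have yR: "y \<in> carrier R" using y P1.Icarr by simp
  define Y where "Y n = adjoin R P0 (y [^] n)" for n :: nat
  have Y: "ideal (Y n) R" for n unfolding Y_def using yR by (intro adjoin_ideal P0.is_ideal) auto
  have Ydec: "Y (Suc n) \<subseteq> Y n" for n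
  proof -
    have "y [^] Suc n \<in> Y n" using ideal.I_r_closed[OF Y, of "y [^] n" n y] adjoin_superset(2)[OF P0.is_ideal, of "y [^] n"] yR
      unfolding Y_def by simp
    thus ?thesis using adjoin_least[OF Y] adjoin_superset(1)[OF P0.is_ideal] yR unfolding Y_def by simp
  qed
  define Q where "Q n = saturation R P1 (Y n)" for n
  have Q: "ideal (Q n) R" for n unfolding Q_def by (intro saturation_ideal P1 Y)
  have Qdec: "Q (Suc n) \<subseteq> Q n" for n unfolding Q_def by (intro saturation_mono Ydec)
  have P0Y: "P0 \<subseteq> Y n" for n unfolding Y_def using adjoin_superset(1)[OF P0.is_ideal] yR by auto
  have P0Q: "P0 \<subseteq> Q n" for n unfolding Q_def using saturation_superset[OF P1 Y] P0Y by blast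
  \<comment> \<open>By the assumption \<open>no\<close>, P2 is minimal over P0 + xR: a prime over
    this ideal differs from P0 because x is not even in P1.\<close>
  have "\<exists>n. \<forall>m\<ge>n. adjoin R (Q n) x \<subseteq> saturation R P2 (adjoin R (Q m) x)"
  proof (rule descending_chain_stabilizes[of "adjoin R P0 x"])
    show "ideal (adjoin R P0 x) R" "\<And>n. ideal (adjoin R (Q n) x) R"
      by (intro adjoin_ideal Q P0.is_ideal xR)+
    show "\<And>n. adjoin R (Q (Suc n)) x \<subseteq> adjoin R (Q n) x" "\<And>n. adjoin R P0 x \<subseteq> adjoin R (Q n) x"
      by (intro adjoin_mono Qdec P0Q)+
    show "P' = P2" if "primeideal P' R" "adjoin R P0 x \<subseteq> P'" "P' \<subseteq> P2" for P'
    proof -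
      have "P0 \<subseteq> P'" "x \<in> P'" using adjoin_superset[OF P0.is_ideal xR] that by auto
      moreover have "P0 \<noteq> P'" using xP1 chain(1) \<open>x \<in> P'\<close> by auto
      ultimately show ?thesis using no that by blast
    qed
  qed (rule P2)
  then obtain n where n: "adjoin R (Q n) x \<subseteq> saturation R P2 (adjoin R (Q (Suc n)) x)" by (meson le_SucI order_refl)
  \<comment> \<open>If a in \<open>Q n\<close> is b + c x locally, with b in
    \<open>Q (Suc n)\<close>, then c x lies in \<open>Q n\<close>. This ideal is saturated at P1 and
    x is outside P1, so c is in \<open>Q n\<close>. Hence \<open>Q n\<close> lies locally in
    \<open>Q (Suc n) + x Q n\<close> at P2, and Nakayama's lemma applies.\<close>
  have "Q n \<subseteq> saturation R P2 (Q (Suc n))"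
  proof (rule nakayama[OF P2 x Q Q])
    interpret Qn: ideal "Q n" R by (rule Q)
    interpret Qs: ideal "Q (Suc n)" R by (rule Q)
    fix a assume a: "a \<in> Q n"
    hence "a \<in> saturation R P2 (adjoin R (Q (Suc n)) x)" using n adjoin_superset[OF Q xR] by blast
    then obtain s b c where s: "s \<in> carrier R - P2" "b \<in> Q (Suc n)" "c \<in> carrier R" "s \<otimes> a = b \<oplus> c \<otimes> x"
      by (auto simp: saturation_def adjoin_def)
    have "b \<oplus> c \<otimes> x \<in> Q n" using Qn.I_l_closed[OF a, of s] s by simp
    hence "c \<otimes> x \<in> Q n" using Qn.mem_add_cancel[of b "c \<otimes> x"] Qdec s xR by auto
    hence "c \<in> Q n" unfolding Q_def
      using saturation_cancel[OF P1, of x c] xP1 xR s(3) by (simp add: m_comm)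
    moreover have "s \<otimes> a = b \<oplus> x \<otimes> c" using s xR by (simp add: m_comm)
    ultimately show "\<exists>s \<in> carrier R - P2. \<exists>n' \<in> Q (Suc n). \<exists>c \<in> Q n. s \<otimes> a = n' \<oplus> x \<otimes> c"
      using s(1,2) by blast
  qed
  also have "\<dots> \<subseteq> saturation R P1 (Q (Suc n))" using chain by (intro saturation_antimono) auto
  also have "\<dots> \<subseteq> Q (Suc n)" unfolding Q_def by (intro saturation_subset P1 order_refl)
  finally have "y [^] n \<in> Q (Suc n)"
    using saturation_superset[OF P1 Y, of n] adjoin_superset(2)[OF P0.is_ideal, of "y [^] n"] yR
    unfolding Q_def Y_def by auto
  \<comment> \<open>Hence y^n (s - c y) lies in P0. As the prime P0 does not contain y, it contains
    s - c y, and so s lies in P1: a contradiction.\<close>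
  then obtain s i c where s: "s \<in> carrier R - P1" "i \<in> P0" "c \<in> carrier R" "s \<otimes> y [^] n = i \<oplus> c \<otimes> (y [^] n \<otimes> y)"
    by (auto simp: Q_def Y_def saturation_def adjoin_def)
  have sR: "s \<in> carrier R" using s by auto
  have "y [^] n \<otimes> (s \<ominus> c \<otimes> y) = s \<otimes> y [^] n \<ominus> c \<otimes> (y [^] n \<otimes> y)" using sR s(3) yR nat_pow_closed[OF yR, of n] by algebra
  also have "\<dots> = i" unfolding s(4) using sR s(3) yR nat_pow_closed[OF yR, of n] P0.Icarr[OF s(2)] by algebra
  finally have "y [^] n \<otimes> (s \<ominus> c \<otimes> y) \<in> P0" using s by simp
  moreover have "y [^] n \<notin> P0" using primeideal_pow_notin[OF P0, of y n] y yR by auto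
  ultimately have "s \<ominus> c \<otimes> y \<in> P0" using P0.I_prime[of "y [^] n" "s \<ominus> c \<otimes> y"] s yR by auto
  hence "s \<ominus> c \<otimes> y \<in> P1" using chain by auto
  moreover have "s = (c \<otimes> y) \<oplus> (s \<ominus> c \<otimes> y)" using sR s(3) yR by algebra
  moreover have "c \<otimes> y \<in> P1" using y s P1.I_l_closed by auto
  ultimately have "s \<in> P1" by (metis P1.ideal_simps(2))
  thus False using s by auto
qed

end

section \<open>Regular systems of parameters\<close>

definition prime_chain :: "('a, 'm) ring_scheme \<Rightarrow> (nat \<Rightarrow> 'a set) \<Rightarrow> nat \<Rightarrow> bool" where
  "prime_chain R c d \<longleftrightarrow> (\<forall>i\<le>d. primeideal (c i) R) \<and> (\<forall>i<d. c i \<subset> c (Suc i))"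

lemma prime_chain_mono:
  assumes "prime_chain R c d" "i \<le> j" "j \<le> d"
  shows "c i \<subseteq> c j"
  using assms(2,3)
proof (induction j rule: dec_induct)
  case (step n)
  then have "c n \<subset> c (Suc n)" using assms(1) by (auto simp: prime_chain_def)
  then show ?case using step by auto
qed simp

context noetherian_cring
begin

text \<open>Membership of x is pushed down from the top: the prime just below the top is exchanged
  for one that contains x, and the induction hypothesis is applied to the chain without its top. The
  two ends never move.\<close>

lemma prime_chain_adjust_first:
  assumes "prime_chain R c (Suc d)" "x \<in> c (Suc d)"
  shows "\<exists>c'. prime_chain R c' (Suc d) \<and> c' 0 = c 0 \<and> c' (Suc d) = c (Suc d) \<and> x \<in> c' 1"
  using assms
proof (induction d arbitrary: c)
  case 0 then show ?case by (intro exI[of _ c]) auto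
next
  case (Suc d)
  have "primeideal (c d) R" "primeideal (c (Suc d)) R" "primeideal (c (Suc (Suc d))) R"
    "c d \<subset> c (Suc d)" "c (Suc d) \<subset> c (Suc (Suc d))"
    using Suc.prems(1) unfolding prime_chain_def by auto
  from prime_between_containing[OF this Suc.prems(2)] obtain P' where
    P': "primeideal P' R" "c d \<subset> P'" "P' \<subset> c (Suc (Suc d))" "x \<in> P'" by auto
  define e where "e = c(Suc d := P')"
  have "prime_chain R e (Suc d)"
    using Suc.prems(1) P' unfolding prime_chain_def e_def by (auto simp: less_Suc_eq)
  moreover have "x \<in> e (Suc d)" using P' by (simp add: e_def)
  ultimately obtain c'' where c'': "prime_chain R c'' (Suc d)" "c'' 0 = e 0" "c'' (Suc d) = e (Suc d)" "x \<in> c'' 1"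
    using Suc.IH[of e] by blast
  define c' where "c' = c''(Suc (Suc d) := c (Suc (Suc d)))"
  have "prime_chain R c' (Suc (Suc d))"
    using Suc.prems(1) P' c'' unfolding prime_chain_def e_def c'_def
    by (auto simp: le_Suc_eq less_Suc_eq)
  moreover have "c' 0 = c 0" "c' (Suc (Suc d)) = c (Suc (Suc d))" "x \<in> c' 1"
    using c'' by (auto simp: c'_def e_def)
  ultimately show ?case by blast
qed

text \<open>The elements are treated in order. Later adjustments affect only the part of the chain
  above the prime at index 1, which is the fixed lower end of that part, so the membership of
  \<open>x 0\<close> is kept.\<close>

lemma prime_chain_adjust:
  assumes "prime_chain R c d" "\<And>i. i < d \<Longrightarrow> x i \<in> c d"
  shows "\<exists>c'. prime_chain R c' d \<and> c' 0 = c 0 \<and> c' d = c d \<and> (\<forall>i<d. x i \<in> c' (Suc i))"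
  using assms
proof (induction d arbitrary: c x)
  case 0 then show ?case by (intro exI[of _ c]) auto
next
  case (Suc d)
  obtain c1 where c1: "prime_chain R c1 (Suc d)" "c1 0 = c 0" "c1 (Suc d) = c (Suc d)" "x 0 \<in> c1 1"
    using prime_chain_adjust_first[OF Suc.prems(1), of "x 0"] Suc.prems(2)[of 0] by auto
  have "prime_chain R (\<lambda>i. c1 (Suc i)) d" using c1(1) by (auto simp: prime_chain_def)
  moreover have "\<And>i. i < d \<Longrightarrow> x (Suc i) \<in> c1 (Suc d)" using Suc.prems(2) c1(3) by auto
  ultimately obtain c2 where c2: "prime_chain R c2 d" "c2 0 = c1 1" "c2 d = c1 (Suc d)"
      "\<And>i. i < d \<Longrightarrow> x (Suc i) \<in> c2 (Suc i)"
     using Suc.IH[of "\<lambda>i. c1 (Suc i)" "\<lambda>i. x (Suc i)"] by auto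
  define c' where "c' i = (case i of 0 \<Rightarrow> c1 0 | Suc j \<Rightarrow> c2 j)" for i
  have "prime_chain R c' (Suc d)"
    using c1(1) c2(1,2) unfolding prime_chain_def c'_def by (auto split: nat.split)
  moreover have "x i \<in> c' (Suc i)" if "i < Suc d" for i
    using that c2(4) c2(2) c1(4) by (cases i) (auto simp: c'_def)
  moreover have "c' 0 = c 0" "c' (Suc d) = c (Suc d)" using c1 c2 by (auto simp: c'_def)
  ultimately show ?case by blast
qed

text \<open>Descending induction on k, starting from the hypothesis at the top. If x_k were in c_k,
  all generators found for c_(k+1) would lie in c_k, against strictness. An element of c_k is
  locally n + e x_k with n in the smaller ideal; primality puts e into c_k, and Nakayama's lemma for
  x_k removes the second term. In particular, initial segments of the parameters generate primes
  locally.\<close>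

lemma prime_chain_eq_saturation:
  assumes c: "prime_chain R c d" and x: "\<And>i. i < d \<Longrightarrow> x i \<in> c (Suc i)"
    and gen: "c d \<subseteq> saturation R (c d) (Idl (x ` {..<d}))" and k: "k \<le> d"
  shows "saturation R (c d) (Idl (x ` {..<k})) = c k" and "k < d \<Longrightarrow> x k \<notin> c k"
proof -
  have P: "primeideal (c i) R" if "i \<le> d" for i using c that by (simp add: prime_chain_def)
  have I: "ideal (c i) R" if "i \<le> d" for i by (intro primeideal.axioms P that)
  have Pd: "primeideal (c d) R" using P by simp
  have sub: "x ` {..<i} \<subseteq> c i" if "i \<le> d" for i
  proof
    fix z assume "z \<in> x ` {..<i}"
    then obtain j where "z = x j" "j < i" by auto
    thus "z \<in> c i" using x[of j] prime_chain_mono[OF c, of "Suc j" i] that by auto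
  qed
  hence sub': "x ` {..<i} \<subseteq> carrier R" if "i \<le> d" for i
    using that ideal.Icarr[OF I] by blast
  have Idl: "ideal (Idl (x ` {..<i})) R" if "i \<le> d" for i by (intro genideal_ideal sub' that)
  have "saturation R (c d) (c i) = c i" if "i \<le> d" for i
    using prime_chain_mono[OF c, of i d] that by (intro saturation_primeideal P) auto
  hence le: "saturation R (c d) (Idl (x ` {..<i})) \<subseteq> c i" if "i \<le> d" for i
    using saturation_mono[OF genideal_minimal[OF I sub]] that by blast
  have notin: "x j \<notin> c j" if j: "j < d" and cs: "c (Suc j) \<subseteq> saturation R (c d) (Idl (x ` {..<Suc j}))" for j
  proof
    assume "x j \<in> c j"
    hence "x ` {..<Suc j} \<subseteq> c j" using sub[of j] j by (auto simp: less_Suc_eq image_subset_iff)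
    hence "c (Suc j) \<subseteq> saturation R (c d) (c j)"
      using subset_trans[OF cs saturation_mono[OF genideal_minimal[OF I]]] j by simp
    also have "\<dots> = c j" using \<open>\<And>i. i \<le> d \<Longrightarrow> saturation R (c d) (c i) = c i\<close> j by simp
    finally have "c (Suc j) \<subseteq> c j" .
    moreover have "c j \<subset> c (Suc j)" using c j by (simp add: prime_chain_def)
    ultimately show False by (simp add: less_le_not_le)
  qed
  have main: "c k \<subseteq> saturation R (c d) (Idl (x ` {..<k}))" if "k \<le> d" for k
    using that
  proof (induction k rule: inc_induct)
    case base show ?case by (rule gen)
  next
    case (step k)
    note xk = notin[OF step(2,3)]
    have xkR: "x k \<in> carrier R" using sub'[of d] step by auto
    have Pk: "primeideal (c k) R" using P step by simp
    show ?case
    proof (rule nakayama[OF Pd _ Idl I])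
      show "x k \<in> c d" using sub[of d] step by auto
      fix b assume b: "b \<in> c k"
      hence "b \<in> saturation R (c d) (Idl (x ` {..<Suc k}))" using step(3) c step(2) by (auto simp: prime_chain_def)
      also have "x ` {..<Suc k} = insert (x k) (x ` {..<k})" by (auto simp: less_Suc_eq)
      also have "Idl (insert (x k) (x ` {..<k})) = adjoin R (Idl (x ` {..<k})) (x k)"
        using sub'[of k] xkR step(2) by (intro genideal_insert) auto
      finally obtain s n e where s: "s \<in> carrier R - c d" "n \<in> Idl (x ` {..<k})" "e \<in> carrier R" "s \<otimes> b = n \<oplus> e \<otimes> x k"
        by (auto simp: saturation_def adjoin_def)
      have "n \<in> c k" using genideal_minimal[OF I sub, of k] s(2) step(2) by auto
      moreover have "n \<oplus> e \<otimes> x k \<in> c k" using ideal.I_l_closed[OF I b, of s] s step(2) by simp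
      ultimately have "e \<otimes> x k \<in> c k" using ideal.mem_add_cancel[OF I, of k n "e \<otimes> x k"] s(3) xkR step(2) by auto
      hence "e \<in> c k" using primeideal.I_prime[OF Pk s(3) xkR] xk by auto
      moreover have "s \<otimes> b = n \<oplus> x k \<otimes> e" using s xkR by (simp add: m_comm)
      ultimately show "\<exists>s\<in>carrier R - c d. \<exists>n\<in>Idl (x ` {..<k}). \<exists>e\<in>c k. s \<otimes> b = n \<oplus> x k \<otimes> e"
        using s by blast
    qed (use step in auto)
  qed
  show "saturation R (c d) (Idl (x ` {..<k})) = c k" using le main k by blast
  show "x k \<notin> c k" if "k < d" using notin[OF that main] that by simp
qed

end

text \<open>The data of a regular local ring at P, expressed in R: d elements generate P locally,
  and a chain of d strict inclusions of primes ends in P. The chain stands in for the statement that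
  the height of P is at least d.\<close>

locale regular_system = noetherian_cring +
  fixes P and d :: nat and x :: "nat \<Rightarrow> 'a"
  assumes prime: "primeideal P R"
    and x_in: "x ` {..<d} \<subseteq> P"
    and x_gen: "P \<subseteq> saturation R P (Idl (x ` {..<d}))"
    and chain: "\<exists>c. prime_chain R c d \<and> c d = P"
begin

sublocale P: primeideal P R by (rule prime)

section \<open>Parameters and their powers as regular sequences\<close>

lemma x_carrier: "i < d \<Longrightarrow> x i \<in> carrier R"
  using x_in P.Icarr by blast

lemma exists_enumeration:
  assumes "E \<subseteq> {..<d}" "i < d" "i \<notin> E"
  obtains \<pi> where "\<pi> ` {..<d} = {..<d}" "\<pi> ` {..<card E} = E" "\<pi> (card E) = i"
proof -
  have fin: "finite E" using assms finite_subset by blast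
  define xs where "xs = sorted_list_of_set E @ [i] @ sorted_list_of_set ({..<d} - insert i E)"
  have set: "set xs = {..<d}" using assms fin by (auto simp: xs_def)
  have dist: "distinct xs" using assms fin by (auto simp: xs_def)
  have len: "length xs = d" using distinct_card[OF dist] set by simp
  have lenE: "length (sorted_list_of_set E) = card E" by simp
  show ?thesis
  proof
    show "nth xs ` {..<d} = {..<d}" using set len by (auto simp: set_conv_nth)
    have "nth xs ` {..<card E} = nth (sorted_list_of_set E) ` {..<card E}"
      using lenE by (intro image_cong) (auto simp: xs_def nth_append)
    also have "\<dots> = set (sorted_list_of_set E)" using lenE by (auto simp: set_conv_nth)
    finally show "nth xs ` {..<card E} = E" using fin by simp
    show "xs ! card E = i" by (simp add: xs_def nth_append)
  qed
qed

text \<open>The parameters may be permuted, so E becomes an initial segment followed by i. For a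
  chain adjusted to this order, the saturation of the ideal generated by E is a prime of the chain,
  and \<open>x i\<close> is not in it.\<close>

lemma nonzerodivisor_subset:
  assumes E: "E \<subseteq> {..<d}" "i < d" "i \<notin> E" and z: "z \<in> carrier R"
    and xz: "x i \<otimes> z \<in> saturation R P (Idl (x ` E))"
  shows "z \<in> saturation R P (Idl (x ` E))"
proof -
  obtain \<pi> where \<pi>: "\<pi> ` {..<d} = {..<d}" "\<pi> ` {..<card E} = E" "\<pi> (card E) = i"
    using exists_enumeration[OF E] .
  obtain c where c: "prime_chain R c d" "c d = P" using chain by blast
  have "x (\<pi> j) \<in> P" if "j < d" for j using \<pi>(1) x_in that by blast
  then obtain c' where c': "prime_chain R c' d" "c' d = P" "\<And>j. j < d \<Longrightarrow> x (\<pi> j) \<in> c' (Suc j)"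
    using prime_chain_adjust[OF c(1), of "\<lambda>j. x (\<pi> j)"] c(2) by auto
  have "card (insert i E) \<le> card {..<d}" using E by (intro card_mono) auto
  hence k: "card E < d" using E finite_subset[OF E(1)] by simp
  have im: "(\<lambda>j. x (\<pi> j)) ` {..<d} = x ` {..<d}" "(\<lambda>j. x (\<pi> j)) ` {..<card E} = x ` E"
    using \<pi>(1,2) by (metis image_image)+
  have gen: "c' d \<subseteq> saturation R (c' d) (Idl ((\<lambda>j. x (\<pi> j)) ` {..<d}))"
    unfolding im c'(2) by (rule x_gen)
  note * = prime_chain_eq_saturation[OF c'(1) _ gen, of "card E", unfolded im c'(2)]
  have sat: "saturation R P (Idl (x ` E)) = c' (card E)" using *(1) k c'(3) by auto
  have ni: "x i \<notin> c' (card E)" using *(2) k c'(3) \<pi>(3) by auto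
  have "primeideal (c' (card E)) R" using c'(1) k by (auto simp: prime_chain_def)
  thus ?thesis using primeideal.I_prime[of "c' (card E)" R "x i" z] ni xz z x_carrier[OF E(2)]
    unfolding sat by auto
qed

text \<open>An exponent 0 means that the parameter is omitted; admitting x^0 = 1 as a generator
  would give the whole ring.\<close>

definition powers_ideal :: "(nat \<Rightarrow> nat) \<Rightarrow> 'a set" where
  "powers_ideal a = Idl ((\<lambda>i. x i [^] a i) ` {i. i < d \<and> a i > 0})"

lemma powers_subset: "(\<lambda>i. x i [^] (a i :: nat)) ` {i. i < d \<and> Q i} \<subseteq> carrier R"
  using x_carrier by auto

lemma powers_ideal: "ideal (powers_ideal a) R"
  unfolding powers_ideal_def by (intro genideal_ideal powers_subset)

lemma powers_ideal_split:
  assumes "j < d" "m > 0"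
  shows "powers_ideal (a(j := m)) = adjoin R (powers_ideal (a(j := 0))) (x j [^] m)"
proof -
  have eq: "(\<lambda>i. x i [^] (a(j := m)) i) ` {i. i < d \<and> (a(j := m)) i > 0}
      = insert (x j [^] m) ((\<lambda>i. x i [^] (a(j := 0)) i) ` {i. i < d \<and> (a(j := 0)) i > 0})"
    using assms by (auto simp: image_iff split: if_splits)
  show ?thesis unfolding powers_ideal_def eq
    using x_carrier[OF assms(1)] powers_subset[of "a(j := 0)"] by (intro genideal_insert) auto
qed

lemma sum_fun_upd_less:
  assumes "j < d" "m < a j"
  shows "(\<Sum>i<d. (a(j := m)) i) < (\<Sum>i<d. (a i :: nat))"
  using assms by (intro sum_strict_mono_ex1) auto

lemma cancel_power:
  assumes "i < d" "z \<in> carrier R" "x i [^] (m::nat) \<otimes> z \<in> J"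
    and "\<And>z. z \<in> carrier R \<Longrightarrow> x i \<otimes> z \<in> J \<Longrightarrow> z \<in> J"
  shows "z \<in> J"
  using assms(2,3)
proof (induction m)
  case (Suc m)
  have "x i \<otimes> (x i [^] m \<otimes> z) = x i [^] Suc m \<otimes> z"
    using x_carrier[OF assms(1)] Suc.prems(1) by (simp add: m_assoc m_lcomm m_comm)
  then show ?case using Suc assms(4)[of "x i [^] m \<otimes> z"] x_carrier[OF assms(1)] by auto
qed simp

text \<open>Induction on the sum of the exponents. If all are at most 1, the ideal is generated by a
  subset of the parameters. If some a_j is m + 1 > 1 and K is generated by the other powers, then
  locally R/(K + x_j^(m+1)) is an extension of R/(K + x_j^m) by R/(K + x_j), and x_i is a
  nonzerodivisor on both.\<close>

lemma nonzerodivisor_powers: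
  assumes "i < d" "a i = 0" "z \<in> carrier R" "x i \<otimes> z \<in> saturation R P (powers_ideal a)"
  shows "z \<in> saturation R P (powers_ideal a)"
  using assms
proof (induction "\<Sum>i<d. a i" arbitrary: a i z rule: less_induct)
  case less
  note xi = x_carrier[OF less.prems(1)]
  show ?case
  proof (cases "\<exists>j<d. a j > 1")
    case False
    hence a1: "a j = 1" if "j < d" "a j > 0" for j using that by (metis Suc_lessI One_nat_def)
    have "(\<lambda>j. x j [^] a j) ` {j. j < d \<and> a j > 0} = x ` {j. j < d \<and> a j > 0}"
    proof (rule image_cong[OF refl])
      fix j assume j: "j \<in> {j. j < d \<and> a j > 0}"
      hence "a j = 1" using a1 by blast
      thus "x j [^] a j = x j" using j x_carrier[of j] by simp
    qed
    hence "powers_ideal a = Idl (x ` {j. j < d \<and> a j > 0})" unfolding powers_ideal_def by simp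
    thus ?thesis using nonzerodivisor_subset[of "{j. j < d \<and> a j > 0}" i z] less.prems by auto
  next
    case True
    then obtain j where j: "j < d" "a j > 1" by auto
    note xj = x_carrier[OF j(1)]
    have ij: "i \<noteq> j" using j less.prems by auto
    obtain m where m: "a j = Suc m" "m > 0" using j(2) by (cases "a j") auto
    let ?y = "x j [^] m"
    have y: "?y \<in> carrier R" using xj by simp
    define K where "K = powers_ideal (a(j := 0))"
    interpret K: ideal K R unfolding K_def by (rule powers_ideal)
    have Ja: "powers_ideal a = adjoin R K (?y \<otimes> x j)"
      using powers_ideal_split[OF j(1), of "Suc m" a] m(1) by (simp add: K_def fun_upd_idem)
    have Jm: "powers_ideal (a(j := m)) = adjoin R K ?y"
      and J1: "powers_ideal (a(j := 1)) = adjoin R K (x j)"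
      using powers_ideal_split[OF j(1), of m a] powers_ideal_split[OF j(1), of 1 a] m xj by (auto simp: K_def)
    obtain s' k' c' where s': "s' \<in> carrier R - P" "k' \<in> K" "c' \<in> carrier R"
        "s' \<otimes> (x i \<otimes> z) = k' \<oplus> c' \<otimes> (?y \<otimes> x j)"
      using less.prems(4) unfolding Ja by (auto simp: saturation_def adjoin_def)
    have "s' \<otimes> (x i \<otimes> z) = k' \<oplus> (c' \<otimes> x j) \<otimes> ?y"
      unfolding s'(4) using s'(3) K.Icarr[OF s'(2)] y xj by algebra
    hence "x i \<otimes> z \<in> saturation R P (powers_ideal (a(j := m)))"
      unfolding Jm using s' xi less.prems(3) xj adjoinI[OF s'(2), of "c' \<otimes> x j" ?y]
      by (intro saturationI[OF _ s'(1)]) auto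
    hence "z \<in> saturation R P (powers_ideal (a(j := m)))"
      using less.hyps[of "a(j := m)" i z] sum_fun_upd_less[of j m a] j(1) m less.prems ij by auto
    then obtain s k c where s: "s \<in> carrier R - P" "k \<in> K" "c \<in> carrier R" "s \<otimes> z = k \<oplus> c \<otimes> ?y"
      unfolding Jm by (auto simp: saturation_def adjoin_def)
    have carr: "s \<in> carrier R" "k \<in> carrier R" "s' \<in> carrier R" "k' \<in> carrier R"
      using s s' K.Icarr by auto
    \<comment> \<open>Comparing the two expressions for a multiple of x_i z shows that x_j^m times
      \<open>?w\<close> lies in K. The induction hypothesis with exponent 0 at j cancels the power
      of x_j, so that x_i c lies locally in K + x_j R.\<close>
    let ?w = "s' \<otimes> (x i \<otimes> c) \<ominus> s \<otimes> (c' \<otimes> x j)"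
    have "?y \<otimes> ?w = (s' \<otimes> x i) \<otimes> (s \<otimes> z \<ominus> k) \<ominus> s \<otimes> (s' \<otimes> (x i \<otimes> z) \<ominus> k')"
    proof -
      have "s \<otimes> z \<ominus> k = c \<otimes> ?y" "s' \<otimes> (x i \<otimes> z) \<ominus> k' = c' \<otimes> (?y \<otimes> x j)"
        unfolding s(4) s'(4) using carr s(3) s'(3) y xj by algebra+
      thus ?thesis using carr s(3) s'(3) y xj xi by (simp only:) algebra
    qed
    also have "\<dots> = s \<otimes> k' \<ominus> (s' \<otimes> x i) \<otimes> k" using carr xi less.prems(3) by algebra
    also have "\<dots> \<in> K" using K.I_l_closed[OF s'(2) carr(1)] K.I_l_closed[OF s(2), of "s' \<otimes> x i"] carr xi by auto
    finally have "?y \<otimes> ?w \<in> saturation R P K" using saturation_superset[OF prime K.is_ideal] by auto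
    hence "?w \<in> saturation R P K"
    proof (rule cancel_power[OF j(1), rotated])
      show "?w \<in> carrier R" using carr s(3) s'(3) xi xj by simp
      fix z assume "z \<in> carrier R" "x j \<otimes> z \<in> saturation R P K"
      thus "z \<in> saturation R P K"
        using less.hyps[of "a(j := 0)" j z] sum_fun_upd_less[of j 0 a] j(1) m by (auto simp: K_def)
    qed
    hence w: "?w \<in> saturation R P (powers_ideal (a(j := 1)))"
      using saturation_mono[OF adjoin_superset(1)[OF K.is_ideal xj]] unfolding J1 by blast
    have sat1: "ideal (saturation R P (powers_ideal (a(j := 1)))) R"
      by (intro saturation_ideal prime powers_ideal)
    have "x j \<in> saturation R P (powers_ideal (a(j := 1)))"
      using saturation_superset[OF prime powers_ideal] adjoin_superset(2)[OF K.is_ideal xj] J1 by blast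
    hence "(s \<otimes> c') \<otimes> x j \<in> saturation R P (powers_ideal (a(j := 1)))"
      using ideal.I_l_closed[OF sat1] carr s'(3) by auto
    hence "?w \<oplus> (s \<otimes> c') \<otimes> x j \<in> saturation R P (powers_ideal (a(j := 1)))"
      using ideal.ideal_simps(2)[OF sat1] w by blast
    moreover have "?w \<oplus> (s \<otimes> c') \<otimes> x j = s' \<otimes> (x i \<otimes> c)" using carr s(3) s'(3) xi xj by algebra
    ultimately have "x i \<otimes> c \<in> saturation R P (powers_ideal (a(j := 1)))"
      using saturation_cancel[OF prime s'(1)] xi s(3) by auto
    hence "c \<in> saturation R P (powers_ideal (a(j := 1)))"
      using less.hyps[of "a(j := 1)" i c] sum_fun_upd_less[of j 1 a] j less.prems ij s(3) by auto
    then obtain t l e where t: "t \<in> carrier R - P" "l \<in> K" "e \<in> carrier R" "t \<otimes> c = l \<oplus> e \<otimes> x j"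
      unfolding J1 by (auto simp: saturation_def adjoin_def)
    have carr': "t \<in> carrier R" "l \<in> carrier R" using t K.Icarr by auto
    have "(t \<otimes> s) \<otimes> z = t \<otimes> (s \<otimes> z)" using carr carr' less.prems(3) by algebra
    also have "\<dots> = t \<otimes> k \<oplus> (t \<otimes> c) \<otimes> ?y" unfolding s(4) using carr carr' s(3) y by algebra
    also have "\<dots> = (t \<otimes> k \<oplus> ?y \<otimes> l) \<oplus> e \<otimes> (?y \<otimes> x j)"
      unfolding t(4) using carr carr' t(3) y xj by algebra
    finally have "(t \<otimes> s) \<otimes> z \<in> powers_ideal a"
      unfolding Ja using carr' y t s K.I_l_closed by (auto intro!: adjoinI)
    thus ?thesis using primeideal_mult_notin[OF prime t(1) s(1)] less.prems(3) unfolding saturation_def by blast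
  qed
qed

text \<open>The exponents are q below k and 0 from k on; the factor x_k is then cancelled q
  times.\<close>

corollary nonzerodivisor_power_sequence:
  assumes k: "k < d" and q: "q > 0" and z: "z \<in> carrier R"
    and xz: "x k [^] (q::nat) \<otimes> z \<in> saturation R P (Idl ((\<lambda>i. x i [^] q) ` {..<k}))"
  shows "z \<in> saturation R P (Idl ((\<lambda>i. x i [^] q) ` {..<k}))"
proof -
  define a where "a i = (if i < k then q else 0)" for i
  have "powers_ideal a = Idl ((\<lambda>i. x i [^] q) ` {..<k})"
    unfolding powers_ideal_def using k q
    by (intro arg_cong[of _ _ "genideal R"] image_cong) (auto simp: a_def)
  thus ?thesis
    using cancel_power[OF k z, of q "saturation R P (powers_ideal a)"] nonzerodivisor_powers[of k a] xz k
    by (auto simp: a_def)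
qed

end

section \<open>The equational criterion for flatness up to a multiplicative set\<close>

definition restrict_scalars :: "('a \<Rightarrow> 's) \<Rightarrow> ('s, 'c, 'n) module_scheme \<Rightarrow> ('a, 'c) module" where
  "restrict_scalars f N =
     \<lparr>carrier = carrier N, monoid.mult = monoid.mult N, monoid.one = monoid.one N,
      ring.zero = ring.zero N, ring.add = ring.add N, smult = (\<lambda>a y. f a \<odot>\<^bsub>N\<^esub> y)\<rparr>"

lemma restrict_scalars_simps [simp]:
  "carrier (restrict_scalars f N) = carrier N"
  "ring.zero (restrict_scalars f N) = ring.zero N"
  "ring.add (restrict_scalars f N) = ring.add N"
  "smult (restrict_scalars f N) = (\<lambda>a y. f a \<odot>\<^bsub>N\<^esub> y)"
  by (simp_all add: restrict_scalars_def)

lemma self_module_simps [simp]: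
  "carrier (self_module R) = carrier R"
  "ring.zero (self_module R) = ring.zero R"
  "ring.add (self_module R) = ring.add R"
  "smult (self_module R) = monoid.mult R"
  by (simp_all add: self_module_def)

text \<open>Sums depend only on carrier, zero and addition; this lets the simplifier strip
  \<open>restrict_scalars\<close> and \<open>self_module\<close> from them.\<close>

lemma finsum_cong_ring:
  assumes "carrier M = carrier N" "ring.zero M = ring.zero N" "ring.add M = ring.add N"
  shows "finsum M = finsum N"
  by (intro ext) (use assms in \<open>simp add: finsum_def finprod_def\<close>)

lemma finsum_restrict_scalars [simp]: "finsum (restrict_scalars f N) = finsum N"
  by (rule finsum_cong_ring) simp_all

lemma finsum_self_module [simp]: "finsum (self_module R) = finsum R"
  by (rule finsum_cong_ring) simp_all

lemma abelian_group_cong: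
  assumes "abelian_group M" "carrier M = carrier N" "ring.zero M = ring.zero N" "ring.add M = ring.add N"
  shows "abelian_group N"
proof -
  interpret abelian_group M by fact
  show ?thesis
  proof (rule abelian_groupI)
    fix x assume x: "x \<in> carrier N"
    show "\<exists>y\<in>carrier N. y \<oplus>\<^bsub>N\<^esub> x = \<zero>\<^bsub>N\<^esub>"
      using x l_neg[of x] a_inv_closed[of x] unfolding assms(2-4) by auto
  qed (use a_assoc a_comm in \<open>simp_all flip: assms(2-4)\<close>)
qed

lemma (in cring) module_self_module: "module R (self_module R)"
  by (rule moduleI) (auto intro: abelian_group_cong[OF is_abelian_group] is_cring
      simp: l_distr r_distr m_assoc)

lemma module_restrict_scalars:
  assumes "cring R" "f \<in> ring_hom R S" "module S N"
  shows "module R (restrict_scalars f N)"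
proof -
  interpret R: cring R by fact
  interpret N: module S N by fact
  note [simp] = ring_hom_closed[OF assms(2)] ring_hom_add[OF assms(2)] ring_hom_mult[OF assms(2)] ring_hom_one[OF assms(2)]
  show ?thesis
    by (rule moduleI) (auto intro: abelian_group_cong[OF N.abelian_group_axioms] assms(1)
        simp: N.smult_l_distr N.smult_r_distr N.smult_assoc1)
qed

lemma a_inv_cong_ring:
  assumes "carrier M = carrier N" "ring.zero M = ring.zero N" "ring.add M = ring.add N"
  shows "a_inv M = a_inv N"
  by (intro ext) (use assms in \<open>simp add: a_inv_def m_inv_def\<close>)

lemma a_inv_restrict_scalars [simp]: "a_inv (restrict_scalars f N) = a_inv N"
  by (rule a_inv_cong_ring) simp_all

lemma a_inv_self_module [simp]: "a_inv (self_module R) = a_inv R"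
  by (rule a_inv_cong_ring) simp_all

lemma (in cring) finsum_in_genideal:
  assumes "finite A" "\<And>i. r i \<in> carrier R" "\<And>i. f i \<in> carrier R"
  shows "(\<Oplus>i\<in>A. f i \<otimes> r i) \<in> Idl (r ` A)"
proof -
  have I: "ideal (Idl (r ` A)) R" using assms(2) by (intro genideal_ideal) auto
  have "(\<Oplus>i\<in>B. f i \<otimes> r i) \<in> Idl (r ` A)" if "finite B" "B \<subseteq> A" for B
    using that
  proof (induction B)
    case empty then show ?case using ideal.ideal_simps(1)[OF I] by simp
  next
    case (insert k B)
    have "r k \<in> Idl (r ` A)" using insert.prems assms(2) genideal_self[of "r ` A"] by auto
    hence "f k \<otimes> r k \<in> Idl (r ` A)" using ideal.I_l_closed[OF I] assms(3) by auto
    then show ?case using insert assms ideal.ideal_simps(2)[OF I] by (subst finsum_insert) auto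
  qed
  thus ?thesis using assms(1) by simp
qed

lemma (in abelian_monoid) finsum_swap:
  assumes "finite A" "finite B" "\<And>i j. i \<in> A \<Longrightarrow> j \<in> B \<Longrightarrow> f i j \<in> carrier G"
  shows "(\<Oplus>i\<in>A. \<Oplus>j\<in>B. f i j) = (\<Oplus>j\<in>B. \<Oplus>i\<in>A. f i j)"
  using assms(1,3)
proof (induction A)
  case empty then show ?case by simp
next
  case (insert a A)
  have "(\<Oplus>i\<in>insert a A. \<Oplus>j\<in>B. f i j) = (\<Oplus>j\<in>B. f a j) \<oplus> (\<Oplus>i\<in>A. \<Oplus>j\<in>B. f i j)"
    using insert by (intro finsum_insert) auto
  also have "\<dots> = (\<Oplus>j\<in>B. f a j \<oplus> (\<Oplus>i\<in>A. f i j))"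
    using insert by (simp add: finsum_addf Pi_def)
  also have "\<dots> = (\<Oplus>j\<in>B. \<Oplus>i\<in>insert a A. f i j)"
    using insert by (intro finsum_cong' refl) (auto intro!: finsum_closed)
  finally show ?case .
qed

context module
begin

lemma finsum_smult_rdistr:
  assumes "finite A" "y \<in> carrier M" "\<And>i. i \<in> A \<Longrightarrow> f i \<in> carrier R"
  shows "(\<Oplus>\<^bsub>R\<^esub>i\<in>A. f i) \<odot>\<^bsub>M\<^esub> y = (\<Oplus>\<^bsub>M\<^esub>i\<in>A. f i \<odot>\<^bsub>M\<^esub> y)"
  using assms(1,3)
proof (induction A)
  case empty then show ?case using assms(2) by simp
next
  case (insert a A) then show ?case using assms(2) by (simp add: Pi_def smult_l_distr)
qed

lemma finsum_matrix:
  assumes "finite A" "finite B" "\<And>i j. \<alpha> i j \<in> carrier R" "\<And>j. g j \<in> carrier R" "\<And>i. x i \<in> carrier M"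
  shows "(\<Oplus>\<^bsub>M\<^esub>i\<in>A. (\<Oplus>\<^bsub>R\<^esub>j\<in>B. \<alpha> i j \<otimes> g j) \<odot>\<^bsub>M\<^esub> x i) = (\<Oplus>\<^bsub>M\<^esub>j\<in>B. g j \<odot>\<^bsub>M\<^esub> (\<Oplus>\<^bsub>M\<^esub>i\<in>A. \<alpha> i j \<odot>\<^bsub>M\<^esub> x i))"
proof -
  have "(\<Oplus>\<^bsub>M\<^esub>i\<in>A. (\<Oplus>\<^bsub>R\<^esub>j\<in>B. \<alpha> i j \<otimes> g j) \<odot>\<^bsub>M\<^esub> x i) = (\<Oplus>\<^bsub>M\<^esub>i\<in>A. \<Oplus>\<^bsub>M\<^esub>j\<in>B. g j \<odot>\<^bsub>M\<^esub> (\<alpha> i j \<odot>\<^bsub>M\<^esub> x i))"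
    using assms by (intro M.finsum_cong') (auto simp: finsum_smult_rdistr smult_assoc1[symmetric] m_comm intro!: M.finsum_closed)
  also have "\<dots> = (\<Oplus>\<^bsub>M\<^esub>j\<in>B. \<Oplus>\<^bsub>M\<^esub>i\<in>A. g j \<odot>\<^bsub>M\<^esub> (\<alpha> i j \<odot>\<^bsub>M\<^esub> x i))"
    using assms by (intro M.finsum_swap) auto
  also have "\<dots> = (\<Oplus>\<^bsub>M\<^esub>j\<in>B. g j \<odot>\<^bsub>M\<^esub> (\<Oplus>\<^bsub>M\<^esub>i\<in>A. \<alpha> i j \<odot>\<^bsub>M\<^esub> x i))"
    using assms by (intro M.finsum_cong') (auto simp: finsum_smult_ldistr intro!: M.finsum_closed smult_closed)
  finally show ?thesis .
qed

end

section \<open>Syzygies and trivial relations\<close>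

definition syzygies ::
    "('a, 'm) ring_scheme \<Rightarrow> ('a, 'b, 'k) module_scheme \<Rightarrow> 'i set \<Rightarrow> ('i \<Rightarrow> 'b) \<Rightarrow> ('i \<Rightarrow> 'a) set" where
  "syzygies R L A x = {a. (\<forall>i. a i \<in> carrier R) \<and> (\<Oplus>\<^bsub>L\<^esub>i\<in>A. a i \<odot>\<^bsub>L\<^esub> x i) = \<zero>\<^bsub>L\<^esub>}"

text \<open>
  The family \<open>t\<close> is a \<open>T\<close>-linear combination of syzygies of \<open>x\<close>; this makes
  \<open>\<Sum>\<^sub>i x\<^sub>i \<otimes> t\<^sub>i\<close> vanish for trivial reasons.
\<close>

inductive null :: "('a, 'm) ring_scheme \<Rightarrow> ('a, 'b, 'k) module_scheme \<Rightarrow> ('a, 'c, 'l) module_scheme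
    \<Rightarrow> 'i set \<Rightarrow> ('i \<Rightarrow> 'b) \<Rightarrow> ('i \<Rightarrow> 'c) \<Rightarrow> bool" for R L T A x where
  zero: "\<lbrakk>\<forall>i. t i \<in> carrier T; \<forall>i\<in>A. t i = \<zero>\<^bsub>T\<^esub>\<rbrakk> \<Longrightarrow> null R L T A x t"
| add: "\<lbrakk>null R L T A x t; a \<in> syzygies R L A x; y \<in> carrier T; \<forall>i. t' i \<in> carrier T;
    \<forall>i\<in>A. t' i = t i \<oplus>\<^bsub>T\<^esub> a i \<odot>\<^bsub>T\<^esub> y\<rbrakk> \<Longrightarrow> null R L T A x t'"

lemma null_carrier: "null R L T A x t \<Longrightarrow> t i \<in> carrier T"
  by (cases rule: null.cases) auto

lemma null_cong:
  assumes "null R L T A x t" "\<And>i. t' i \<in> carrier T" "\<And>i. i \<in> A \<Longrightarrow> t' i = t i"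
  shows "null R L T A x t'"
  using assms(1)
proof (cases rule: null.cases)
  case zero then show ?thesis using assms(2,3) by (intro null.zero) auto
next
  case (add s a y)
  show ?thesis by (rule null.add[OF add(1-3)]) (use assms(2,3) add(5) in auto)
qed

lemma syzygies_carrier: "a \<in> syzygies R L A x \<Longrightarrow> a i \<in> carrier R"
  by (simp add: syzygies_def)

definition linear_map ::
    "('a, 'm) ring_scheme \<Rightarrow> ('a, 'b, 'k) module_scheme \<Rightarrow> ('a, 'c, 'l) module_scheme \<Rightarrow> ('b \<Rightarrow> 'c) \<Rightarrow> bool" where
  "linear_map R M N h \<longleftrightarrow> (\<forall>x\<in>carrier M. h x \<in> carrier N) \<and>
     (\<forall>x\<in>carrier M. \<forall>y\<in>carrier M. h (x \<oplus>\<^bsub>M\<^esub> y) = h x \<oplus>\<^bsub>N\<^esub> h y) \<and>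
     (\<forall>a\<in>carrier R. \<forall>x\<in>carrier M. h (a \<odot>\<^bsub>M\<^esub> x) = a \<odot>\<^bsub>N\<^esub> h x)"

lemma linear_map_zero:
  assumes "module R M" "module R N" "linear_map R M N h"
  shows "h \<zero>\<^bsub>M\<^esub> = \<zero>\<^bsub>N\<^esub>"
proof -
  interpret M: module R M by fact
  interpret N: module R N by fact
  have "h (\<zero>\<^bsub>R\<^esub> \<odot>\<^bsub>M\<^esub> \<zero>\<^bsub>M\<^esub>) = \<zero>\<^bsub>R\<^esub> \<odot>\<^bsub>N\<^esub> h \<zero>\<^bsub>M\<^esub>"
    using assms(3) M.M.zero_closed M.R.zero_closed unfolding linear_map_def by blast
  thus ?thesis using assms(3) by (simp add: linear_map_def)
qed

lemma linear_map_finsum: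
  assumes "module R M" "module R N" "linear_map R M N h" "finite A" "\<And>i. i \<in> A \<Longrightarrow> t i \<in> carrier M"
  shows "h (\<Oplus>\<^bsub>M\<^esub>i\<in>A. t i) = (\<Oplus>\<^bsub>N\<^esub>i\<in>A. h (t i))"
proof -
  interpret M: module R M by fact
  interpret N: module R N by fact
  show ?thesis using assms(4,5)
  proof (induction A)
    case empty then show ?case using linear_map_zero[OF assms(1-3)] by simp
  next
    case (insert a A)
    then have "(\<Oplus>\<^bsub>M\<^esub>i\<in>A. t i) \<in> carrier M" by (intro M.M.finsum_closed) auto
    then show ?case using insert assms(3) by (simp add: Pi_def linear_map_def)
  qed
qed

lemma null_map:
  assumes "module R T" "module R T'" "linear_map R T T' h" "null R L T A x t"
  shows "null R L T' A x (\<lambda>i. h (t i))"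
  using assms(4)
proof induction
  case (zero t)
  then show ?case using linear_map_zero[OF assms(1-3)] assms(3)
    by (intro null.zero) (auto simp: linear_map_def)
next
  case (add t a y t')
  have h: "\<And>u. u \<in> carrier T \<Longrightarrow> h u \<in> carrier T'" "\<And>u v. u \<in> carrier T \<Longrightarrow> v \<in> carrier T \<Longrightarrow> h (u \<oplus>\<^bsub>T\<^esub> v) = h u \<oplus>\<^bsub>T'\<^esub> h v"
    "\<And>b u. b \<in> carrier R \<Longrightarrow> u \<in> carrier T \<Longrightarrow> h (b \<odot>\<^bsub>T\<^esub> u) = b \<odot>\<^bsub>T'\<^esub> h u"
    using assms(3) unfolding linear_map_def by auto
  show ?case
    using h add.hyps syzygies_carrier[OF add.hyps(2)] null_carrier[OF add.hyps(1)] module.smult_closed[OF assms(1)]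
    by (intro null.add[OF add.IH add.hyps(2), of "h y"]) auto
qed

text \<open>If the r i generate the ideal I, a relation is a cycle for Tor_1(R/I, T), and it
  represents zero exactly when it is \<open>null\<close>. The condition says that every element of
  Tor_1(R/I, T) is killed by an element of U, which may depend on that element.\<close>

definition equational :: "('a, 'm) ring_scheme \<Rightarrow> ('a, 'c, 'l) module_scheme \<Rightarrow> 'a set \<Rightarrow> 'i set \<Rightarrow> ('i \<Rightarrow> 'a) \<Rightarrow> bool" where
  "equational R T U A r \<longleftrightarrow> (\<forall>t. (\<forall>i. t i \<in> carrier T) \<and> (\<Oplus>\<^bsub>T\<^esub>i\<in>A. r i \<odot>\<^bsub>T\<^esub> t i) = \<zero>\<^bsub>T\<^esub> \<longrightarrow>
     (\<exists>u\<in>U. null R (self_module R) T A r (\<lambda>i. u \<odot>\<^bsub>T\<^esub> t i)))"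

text \<open>The equational criterion for flatness of \<open>T\<close>, up to multiplication by elements of \<open>W\<close>.\<close>

definition flat_upto :: "('a, 'm) ring_scheme \<Rightarrow> 'a set \<Rightarrow> ('a, 'c, 'l) module_scheme \<Rightarrow> bool" where
  "flat_upto R W T \<longleftrightarrow> (\<forall>(n::nat) r. (\<forall>i. r i \<in> carrier R) \<longrightarrow> equational R T W {..<n} r)"

context module
begin

lemma linear_map_smult: "a \<in> carrier R \<Longrightarrow> linear_map R M M (\<lambda>y. a \<odot>\<^bsub>M\<^esub> y)"
  unfolding linear_map_def by (auto simp: smult_r_distr smult_assoc1[symmetric] m_comm)

lemma null_smult:
  assumes "null R L M A x t" "a \<in> carrier R"
  shows "null R L M A x (\<lambda>i. a \<odot>\<^bsub>M\<^esub> t i)"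
  by (rule null_map[OF module_axioms module_axioms linear_map_smult[OF assms(2)] assms(1)])

lemma null_single:
  assumes "a \<in> syzygies R L A x" "y \<in> carrier M"
  shows "null R L M A x (\<lambda>i. a i \<odot>\<^bsub>M\<^esub> y)"
proof (rule null.add[of R L M A x "\<lambda>_. \<zero>\<^bsub>M\<^esub>", OF null.zero assms])
  show "\<forall>i. a i \<odot>\<^bsub>M\<^esub> y \<in> carrier M" using syzygies_carrier[OF assms(1)] assms(2) by auto
  show "\<forall>i\<in>A. a i \<odot>\<^bsub>M\<^esub> y = \<zero>\<^bsub>M\<^esub> \<oplus>\<^bsub>M\<^esub> a i \<odot>\<^bsub>M\<^esub> y" using syzygies_carrier[OF assms(1)] assms(2) by auto
qed auto

lemma null_add:
  assumes "null R L M A x t" "null R L M A x t'"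
  shows "null R L M A x (\<lambda>i. t i \<oplus>\<^bsub>M\<^esub> t' i)"
  using assms(2)
proof induction
  case (zero t')
  then show ?case using null_carrier[OF assms(1)] by (intro null_cong[OF assms(1)]) auto
next
  case (add t1 a y t2)
  show ?case
    using null_carrier[OF assms(1)] null_carrier[OF add.hyps(1)] add.hyps(3-) syzygies_carrier[OF add.hyps(2)]
    by (intro null.add[OF add.IH add.hyps(2,3)]) (auto simp: M.a_assoc)
qed

lemma null_sum:
  assumes "finite B" "\<And>b. b \<in> B \<Longrightarrow> null R L M A x (t b)"
  shows "null R L M A x (\<lambda>i. \<Oplus>\<^bsub>M\<^esub>b\<in>B. t b i)"
  using assms
proof (induction B)
  case empty then show ?case by (intro null.zero) auto
next
  case (insert b B)
  have "\<And>c i. c \<in> insert b B \<Longrightarrow> t c i \<in> carrier M" using insert.prems null_carrier by metis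
  then have "(\<Oplus>\<^bsub>M\<^esub>c\<in>insert b B. t c i) = t b i \<oplus>\<^bsub>M\<^esub> (\<Oplus>\<^bsub>M\<^esub>c\<in>B. t c i)" for i
    using insert.hyps by (intro M.finsum_insert) auto
  then show ?case using null_add[OF insert.prems insert.IH] insert.prems by simp
qed

lemma null_cancel:
  assumes "null R L M A x (\<lambda>i. t i \<oplus>\<^bsub>M\<^esub> t' i)" "null R L M A x t'" "\<And>i. t i \<in> carrier M"
  shows "null R L M A x t"
proof (rule null_cong[OF null_add[OF assms(1) null_smult[OF assms(2), of "\<ominus> \<one>"]] assms(3)])
  fix i
  have c: "t i \<in> carrier M" "t' i \<in> carrier M" using assms(3) null_carrier[OF assms(2)] by auto
  have "\<ominus> \<one> \<odot>\<^bsub>M\<^esub> t' i = \<ominus>\<^bsub>M\<^esub> t' i" using c by (simp add: smult_l_minus)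
  thus "t i = t i \<oplus>\<^bsub>M\<^esub> t' i \<oplus>\<^bsub>M\<^esub> \<ominus> \<one> \<odot>\<^bsub>M\<^esub> t' i" using c by (simp add: M.a_assoc M.r_neg)
qed simp

text \<open>Naturality: a trivial family is a combination of syzygies of b, and the matrix
  transports each of these to a syzygy of x.\<close>

lemma null_pushforward:
  assumes null: "null R L M B b y" and fin: "finite B" and \<alpha>: "\<And>i j. \<alpha> i j \<in> carrier R"
    and syz: "\<And>g. g \<in> syzygies R L B b \<Longrightarrow> (\<lambda>i. \<Oplus>j\<in>B. \<alpha> i j \<otimes> g j) \<in> syzygies R L' A x"
  shows "null R L' M A x (\<lambda>i. \<Oplus>\<^bsub>M\<^esub>j\<in>B. \<alpha> i j \<odot>\<^bsub>M\<^esub> y j)"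
  using null
proof induction
  case (zero t)
  have "(\<Oplus>\<^bsub>M\<^esub>j\<in>B. \<alpha> i j \<odot>\<^bsub>M\<^esub> t j) = \<zero>\<^bsub>M\<^esub>" for i
    using zero \<alpha> by (intro M.add.finprod_one_eqI) auto
  then show ?case by (intro null.zero) auto
next
  case (add t a y t')
  have c: "\<And>j. a j \<in> carrier R" "\<And>j. t j \<in> carrier M" "\<And>j. t' j \<in> carrier M"
    using add.hyps syzygies_carrier[OF add.hyps(2)] null_carrier[OF add.hyps(1)] by auto
  show ?case
  proof (rule null.add[OF add.IH syz[OF add.hyps(2)] add.hyps(3)]; intro allI ballI)
    fix i
    show "(\<Oplus>\<^bsub>M\<^esub>j\<in>B. \<alpha> i j \<odot>\<^bsub>M\<^esub> t' j) \<in> carrier M" using \<alpha> c by (intro M.finsum_closed) auto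
    have "(\<Oplus>\<^bsub>M\<^esub>j\<in>B. \<alpha> i j \<odot>\<^bsub>M\<^esub> t' j) = (\<Oplus>\<^bsub>M\<^esub>j\<in>B. \<alpha> i j \<odot>\<^bsub>M\<^esub> t j \<oplus>\<^bsub>M\<^esub> (\<alpha> i j \<otimes> a j) \<odot>\<^bsub>M\<^esub> y)"
      using \<alpha> c add.hyps by (intro M.finsum_cong') (auto simp: smult_r_distr smult_assoc1)
    also have "\<dots> = (\<Oplus>\<^bsub>M\<^esub>j\<in>B. \<alpha> i j \<odot>\<^bsub>M\<^esub> t j) \<oplus>\<^bsub>M\<^esub> (\<Oplus>j\<in>B. \<alpha> i j \<otimes> a j) \<odot>\<^bsub>M\<^esub> y"
      using \<alpha> c add.hyps fin by (subst M.finsum_addf) (auto simp: finsum_smult_rdistr)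
    finally show "(\<Oplus>\<^bsub>M\<^esub>j\<in>B. \<alpha> i j \<odot>\<^bsub>M\<^esub> t' j) = (\<Oplus>\<^bsub>M\<^esub>j\<in>B. \<alpha> i j \<odot>\<^bsub>M\<^esub> t j) \<oplus>\<^bsub>M\<^esub> (\<Oplus>j\<in>B. \<alpha> i j \<otimes> a j) \<odot>\<^bsub>M\<^esub> y" .
  qed
qed

section \<open>Tor_1 in terms of relations\<close>

lemma equationalD:
  assumes "equational R M U A r" "\<And>i. t i \<in> carrier M" "(\<Oplus>\<^bsub>M\<^esub>i\<in>A. r i \<odot>\<^bsub>M\<^esub> t i) = \<zero>\<^bsub>M\<^esub>"
  obtains u where "u \<in> U" "null R (self_module R) M A r (\<lambda>i. u \<odot>\<^bsub>M\<^esub> t i)"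
  using assms unfolding equational_def by blast

text \<open>The Koszul relations show that \<open>Tor\<^sub>1(R/I, M)\<close> is killed by \<open>I\<close>.\<close>

lemma null_generator_smult:
  assumes fin: "finite A" and r: "\<And>i. r i \<in> carrier R" and t: "\<And>i. t i \<in> carrier M" and j: "j \<in> A"
    and rel: "(\<Oplus>\<^bsub>M\<^esub>i\<in>A. r i \<odot>\<^bsub>M\<^esub> t i) = \<zero>\<^bsub>M\<^esub>"
  shows "null R (self_module R) M A r (\<lambda>i. r j \<odot>\<^bsub>M\<^esub> t i)"
proof -
  \<comment> \<open>The Koszul syzygy r_j e_k - r_k e_j, written as a sum so that it vanishes for k
    = j. Weighting it with t_k and summing over k gives r_j t, since the e_j part is the vanishing
    relation.\<close>
  define a where "a k i = (if k = i then r j else \<zero>) \<oplus> (if j = i then \<ominus> r k else \<zero>)" for k i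
  have aR: "a k i \<in> carrier R" for k i using r by (auto simp: a_def)
  have syz: "a k \<in> syzygies R (self_module R) A r" if k: "k \<in> A" for k
  proof -
    have "(\<Oplus>i\<in>A. a k i \<otimes> r i) = (\<Oplus>i\<in>A. (if k = i then r j \<otimes> r i else \<zero>) \<oplus> (if j = i then \<ominus> r k \<otimes> r i else \<zero>))"
      using r by (intro R.finsum_cong') (auto simp: a_def l_distr)
    also have "\<dots> = (\<Oplus>i\<in>A. if k = i then r j \<otimes> r i else \<zero>) \<oplus> (\<Oplus>i\<in>A. if j = i then \<ominus> r k \<otimes> r i else \<zero>)"
      using r by (intro R.finsum_addf) auto
    also have "\<dots> = r j \<otimes> r k \<oplus> \<ominus> r k \<otimes> r j"
      using R.add.finprod_singleton[OF k fin, of "\<lambda>i. r j \<otimes> r i"] R.add.finprod_singleton[OF j fin, of "\<lambda>i. \<ominus> r k \<otimes> r i"] r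
      by auto
    also have "\<dots> = \<zero>" using r[of j] r[of k] by algebra
    finally show ?thesis using aR by (simp add: syzygies_def)
  qed
  have "null R (self_module R) M A r (\<lambda>i. \<Oplus>\<^bsub>M\<^esub>k\<in>A. a k i \<odot>\<^bsub>M\<^esub> t k)"
    by (intro null_sum fin null_single syz t)
  thus ?thesis
  proof (rule null_cong)
    fix i assume i: "i \<in> A"
    have "(\<Oplus>\<^bsub>M\<^esub>k\<in>A. a k i \<odot>\<^bsub>M\<^esub> t k) = (\<Oplus>\<^bsub>M\<^esub>k\<in>A. (if i = k then r j \<odot>\<^bsub>M\<^esub> t k else \<zero>\<^bsub>M\<^esub>) \<oplus>\<^bsub>M\<^esub> (if j = i then \<ominus> \<one> else \<zero>) \<odot>\<^bsub>M\<^esub> (r k \<odot>\<^bsub>M\<^esub> t k))"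
      using r t by (intro M.finsum_cong') (auto simp: a_def smult_l_distr smult_l_minus)
    also have "\<dots> = (\<Oplus>\<^bsub>M\<^esub>k\<in>A. if i = k then r j \<odot>\<^bsub>M\<^esub> t k else \<zero>\<^bsub>M\<^esub>) \<oplus>\<^bsub>M\<^esub> (\<Oplus>\<^bsub>M\<^esub>k\<in>A. (if j = i then \<ominus> \<one> else \<zero>) \<odot>\<^bsub>M\<^esub> (r k \<odot>\<^bsub>M\<^esub> t k))"
      using r t by (intro M.finsum_addf) auto
    also have "(\<Oplus>\<^bsub>M\<^esub>k\<in>A. (if j = i then \<ominus> \<one> else \<zero>) \<odot>\<^bsub>M\<^esub> (r k \<odot>\<^bsub>M\<^esub> t k)) = (if j = i then \<ominus> \<one> else \<zero>) \<odot>\<^bsub>M\<^esub> (\<Oplus>\<^bsub>M\<^esub>k\<in>A. r k \<odot>\<^bsub>M\<^esub> t k)"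
      using r t by (intro finsum_smult_ldistr[symmetric] fin) auto
    also have "\<dots> = \<zero>\<^bsub>M\<^esub>" unfolding rel by simp
    also have "(\<Oplus>\<^bsub>M\<^esub>k\<in>A. if i = k then r j \<odot>\<^bsub>M\<^esub> t k else \<zero>\<^bsub>M\<^esub>) = r j \<odot>\<^bsub>M\<^esub> t i"
      using r t by (intro M.add.finprod_singleton[OF i fin]) auto
    finally show "r j \<odot>\<^bsub>M\<^esub> t i = (\<Oplus>\<^bsub>M\<^esub>k\<in>A. a k i \<odot>\<^bsub>M\<^esub> t k)" using r t by simp
  qed (use r t in auto)
qed

lemma genideal_lincomb:
  assumes "finite A" "\<And>i. r i \<in> carrier R" "c \<in> Idl (r ` A)"
  obtains \<beta> where "\<And>i. \<beta> i \<in> carrier R" "c = (\<Oplus>i\<in>A. \<beta> i \<otimes> r i)"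
proof -
  have "\<exists>\<beta>. (\<forall>i. \<beta> i \<in> carrier R) \<and> c = (\<Oplus>i\<in>A. \<beta> i \<otimes> r i)"
    using assms(1,3)
  proof (induction A arbitrary: c)
    case empty
    have "ideal {\<zero>} R" by (rule zeroideal)
    hence "c = \<zero>" using genideal_minimal[of "{\<zero>}" "{}"] empty by auto
    then show ?case by (intro exI[of _ "\<lambda>_. \<zero>"]) auto
  next
    case (insert a A)
    have "c \<in> adjoin R (Idl (r ` A)) (r a)"
      using insert.prems genideal_insert[of "r ` A" "r a"] assms(2) by auto
    then obtain i e where e: "i \<in> Idl (r ` A)" "e \<in> carrier R" "c = i \<oplus> e \<otimes> r a" by (auto simp: adjoin_def)
    obtain \<beta> where \<beta>: "\<forall>i. \<beta> i \<in> carrier R" "i = (\<Oplus>i\<in>A. \<beta> i \<otimes> r i)" using insert.IH[OF e(1)] by auto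
    have "(\<Oplus>i\<in>insert a A. (\<beta>(a := e)) i \<otimes> r i) = e \<otimes> r a \<oplus> (\<Oplus>i\<in>A. (\<beta>(a := e)) i \<otimes> r i)"
      using insert.hyps \<beta>(1) e(2) assms(2) by (subst R.finsum_insert) auto
    also have "(\<Oplus>i\<in>A. (\<beta>(a := e)) i \<otimes> r i) = i"
      unfolding \<beta>(2) using insert.hyps \<beta>(1) assms(2) by (intro R.finsum_cong') auto
    finally have "c = (\<Oplus>i\<in>insert a A. (\<beta>(a := e)) i \<otimes> r i)"
      using e \<beta> assms(2) by (simp add: R.a_comm)
    moreover have "\<forall>i. (\<beta>(a := e)) i \<in> carrier R" using \<beta>(1) e(2) by simp
    ultimately show ?case by blast
  qed
  thus ?thesis using that by blast
qed

text \<open>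
  The exact sequence \<open>Tor\<^sub>1(R/(I:x), M) \<rightarrow> Tor\<^sub>1(R/I, M) \<rightarrow> Tor\<^sub>1(R/(I + xR), M)\<close>, where \<open>I\<close> is
  generated by the \<open>r i\<close> and \<open>I : x\<close> by the \<open>b j\<close>.
\<close>

lemma null_extension:
  assumes null: "null R (self_module R) M {..<Suc n} (r(n := x)) v"
    and r: "\<And>i. r i \<in> carrier R" and x: "x \<in> carrier R"
    and b: "\<And>j. b j \<in> carrier R" "colon R (Idl (r ` {..<n})) x \<subseteq> Idl (b ` {..<m})"
    and \<alpha>: "\<And>i j. \<alpha> i j \<in> carrier R" "\<And>j. j < m \<Longrightarrow> x \<otimes> b j = (\<Oplus>i\<in>{..<n}. \<alpha> i j \<otimes> r i)"
  shows "\<exists>y. (\<forall>j. y j \<in> carrier M) \<and> v n = (\<Oplus>\<^bsub>M\<^esub>j\<in>{..<m::nat}. b j \<odot>\<^bsub>M\<^esub> y j) \<and>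
      null R (self_module R) M {..<n} r (\<lambda>i. v i \<oplus>\<^bsub>M\<^esub> (\<Oplus>\<^bsub>M\<^esub>j\<in>{..<m}. \<alpha> i j \<odot>\<^bsub>M\<^esub> y j))"
  using null
proof induction
  case (zero t)
  show ?case
    using zero b(1) \<alpha>(1) by (intro exI[of _ "\<lambda>_. \<zero>\<^bsub>M\<^esub>"] conjI null.zero) auto
next
  case (add t a c t')
  obtain y where y: "\<And>j. y j \<in> carrier M" "t n = (\<Oplus>\<^bsub>M\<^esub>j\<in>{..<m}. b j \<odot>\<^bsub>M\<^esub> y j)"
    "null R (self_module R) M {..<n} r (\<lambda>i. t i \<oplus>\<^bsub>M\<^esub> (\<Oplus>\<^bsub>M\<^esub>j\<in>{..<m}. \<alpha> i j \<odot>\<^bsub>M\<^esub> y j))"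
    using add.IH by auto
  have aR: "\<And>i. a i \<in> carrier R" using syzygies_carrier[OF add.hyps(2)] .
  have tM: "\<And>i. t i \<in> carrier M" "\<And>i. t' i \<in> carrier M" using null_carrier[OF add.hyps(1)] add.hyps(4) by auto
  define S where "S = (\<Oplus>i\<in>{..<n}. a i \<otimes> r i)"
  have S: "S \<in> carrier R" using aR r by (auto simp: S_def)
  have "(\<Oplus>i\<in>{..<Suc n}. a i \<otimes> (r(n := x)) i) = \<zero>" using add.hyps(2) by (simp add: syzygies_def)
  moreover have "(\<Oplus>i\<in>{..<Suc n}. a i \<otimes> (r(n := x)) i) = a n \<otimes> x \<oplus> (\<Oplus>i\<in>{..<n}. a i \<otimes> (r(n := x)) i)"
    unfolding lessThan_Suc using aR r x by (subst R.finsum_insert) auto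
  moreover have "(\<Oplus>i\<in>{..<n}. a i \<otimes> (r(n := x)) i) = S"
    unfolding S_def using aR r by (intro R.finsum_cong') auto
  ultimately have rel: "a n \<otimes> x \<oplus> S = \<zero>" by simp
  have I: "ideal (Idl (r ` {..<n})) R" using r by (intro genideal_ideal) auto
  have "S \<in> Idl (r ` {..<n})" unfolding S_def using aR r by (intro finsum_in_genideal) auto
  moreover have "x \<otimes> a n = \<ominus> S" using R.minus_equality[OF rel] aR x S by (simp add: m_comm)
  \<comment> \<open>The last coefficient of a syzygy of (r, x) multiplies x into the ideal of the r
    i, and so it is a combination of the b j.\<close>
  ultimately have "a n \<in> colon R (Idl (r ` {..<n})) x"
    using aR ideal.ideal_simps(3)[OF I] by (simp add: colon_def)
  hence "a n \<in> Idl (b ` {..<m})" using b(2) by auto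
  then obtain \<beta> where \<beta>: "\<And>j. \<beta> j \<in> carrier R" "a n = (\<Oplus>j\<in>{..<m}. \<beta> j \<otimes> b j)"
    using genideal_lincomb[of "{..<m}" b "a n"] b(1) by auto
  \<comment> \<open>Replacing each product x b_j in a_n x by its expression in the r_i turns a into
    a syzygy of r alone; the coefficients beta_j c are absorbed into the new y.\<close>
  define a' where "a' i = a i \<oplus> (\<Oplus>j\<in>{..<m}. \<alpha> i j \<otimes> \<beta> j)" for i
  have a'R: "\<And>i. a' i \<in> carrier R" using aR \<alpha>(1) \<beta>(1) by (auto simp: a'_def)
  interpret self: module R "self_module R" by (rule module_self_module)
  have "(\<Oplus>i\<in>{..<n}. a' i \<otimes> r i) = (\<Oplus>i\<in>{..<n}. a i \<otimes> r i \<oplus> (\<Oplus>j\<in>{..<m}. \<alpha> i j \<otimes> \<beta> j) \<otimes> r i)"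
    using aR r \<alpha>(1) \<beta>(1) by (intro R.finsum_cong') (auto simp: a'_def l_distr)
  also have "\<dots> = S \<oplus> (\<Oplus>i\<in>{..<n}. (\<Oplus>j\<in>{..<m}. \<alpha> i j \<otimes> \<beta> j) \<otimes> r i)"
    unfolding S_def using aR r \<alpha>(1) \<beta>(1) by (intro R.finsum_addf) auto
  also have "(\<Oplus>i\<in>{..<n}. (\<Oplus>j\<in>{..<m}. \<alpha> i j \<otimes> \<beta> j) \<otimes> r i) = (\<Oplus>j\<in>{..<m}. \<beta> j \<otimes> (\<Oplus>i\<in>{..<n}. \<alpha> i j \<otimes> r i))"
    using self.finsum_matrix[of "{..<n}" "{..<m}" \<alpha> \<beta> r] r \<alpha>(1) \<beta>(1) by simp
  also have "\<dots> = (\<Oplus>j\<in>{..<m}. (\<beta> j \<otimes> b j) \<otimes> x)"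
  proof (rule R.finsum_cong'[OF refl])
    fix j assume "j \<in> {..<m}"
    hence "(\<Oplus>i\<in>{..<n}. \<alpha> i j \<otimes> r i) = x \<otimes> b j" using \<alpha>(2)[of j] by simp
    thus "\<beta> j \<otimes> (\<Oplus>i\<in>{..<n}. \<alpha> i j \<otimes> r i) = (\<beta> j \<otimes> b j) \<otimes> x" using \<beta>(1)[of j] b(1)[of j] x by (simp add: m_ac)
  qed (use \<beta> b x in auto)
  also have "\<dots> = a n \<otimes> x" unfolding \<beta>(2) using \<beta>(1) b(1) x by (intro finsum_ldistr[symmetric]) auto
  also have "S \<oplus> a n \<otimes> x = \<zero>" using rel S aR x by (simp add: R.a_comm)
  finally have syz: "a' \<in> syzygies R (self_module R) {..<n} r" using a'R by (simp add: syzygies_def)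
  define y' where "y' j = y j \<oplus>\<^bsub>M\<^esub> \<beta> j \<odot>\<^bsub>M\<^esub> c" for j
  have cM: "c \<in> carrier M" by (rule add.hyps(3))
  have y': "\<And>j. y' j \<in> carrier M" using y(1) \<beta>(1) cM by (auto simp: y'_def)
  have "t' n = (\<Oplus>\<^bsub>M\<^esub>j\<in>{..<m}. b j \<odot>\<^bsub>M\<^esub> y j) \<oplus>\<^bsub>M\<^esub> (\<Oplus>j\<in>{..<m}. \<beta> j \<otimes> b j) \<odot>\<^bsub>M\<^esub> c"
    using add.hyps(5) y(2) \<beta>(2) by simp
  also have "\<dots> = (\<Oplus>\<^bsub>M\<^esub>j\<in>{..<m}. b j \<odot>\<^bsub>M\<^esub> y j \<oplus>\<^bsub>M\<^esub> (\<beta> j \<otimes> b j) \<odot>\<^bsub>M\<^esub> c)"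
    using y(1) \<beta>(1) b(1) cM by (subst M.finsum_addf) (auto simp: finsum_smult_rdistr)
  also have "\<dots> = (\<Oplus>\<^bsub>M\<^esub>j\<in>{..<m}. b j \<odot>\<^bsub>M\<^esub> y' j)"
    using y(1) \<beta>(1) b(1) cM
    by (intro M.finsum_cong') (auto simp: y'_def smult_r_distr smult_assoc1[symmetric] m_comm)
  finally have 1: "t' n = (\<Oplus>\<^bsub>M\<^esub>j\<in>{..<m}. b j \<odot>\<^bsub>M\<^esub> y' j)" .
  have "null R (self_module R) M {..<n} r (\<lambda>i. t' i \<oplus>\<^bsub>M\<^esub> (\<Oplus>\<^bsub>M\<^esub>j\<in>{..<m}. \<alpha> i j \<odot>\<^bsub>M\<^esub> y' j))"
  proof (rule null.add[OF y(3) syz cM]; intro allI ballI)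
    fix i
    let ?Y = "\<Oplus>\<^bsub>M\<^esub>j\<in>{..<m}. \<alpha> i j \<odot>\<^bsub>M\<^esub> y j" and ?Y' = "\<Oplus>\<^bsub>M\<^esub>j\<in>{..<m}. \<alpha> i j \<odot>\<^bsub>M\<^esub> y' j"
      and ?B = "\<Oplus>j\<in>{..<m}. \<alpha> i j \<otimes> \<beta> j"
    have cl: "?Y \<in> carrier M" "?Y' \<in> carrier M" "?B \<in> carrier R" using \<alpha>(1) \<beta>(1) y(1) y' by auto
    show "t' i \<oplus>\<^bsub>M\<^esub> ?Y' \<in> carrier M" using tM cl by auto
    assume i: "i \<in> {..<n}"
    have "?Y' = (\<Oplus>\<^bsub>M\<^esub>j\<in>{..<m}. \<alpha> i j \<odot>\<^bsub>M\<^esub> y j \<oplus>\<^bsub>M\<^esub> (\<alpha> i j \<otimes> \<beta> j) \<odot>\<^bsub>M\<^esub> c)"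
      using y(1) \<beta>(1) \<alpha>(1) cM by (intro M.finsum_cong') (auto simp: y'_def smult_r_distr smult_assoc1)
    also have "\<dots> = ?Y \<oplus>\<^bsub>M\<^esub> ?B \<odot>\<^bsub>M\<^esub> c"
      using y(1) \<beta>(1) \<alpha>(1) cM by (subst M.finsum_addf) (auto simp: finsum_smult_rdistr)
    finally have "t' i \<oplus>\<^bsub>M\<^esub> ?Y' = (t i \<oplus>\<^bsub>M\<^esub> a i \<odot>\<^bsub>M\<^esub> c) \<oplus>\<^bsub>M\<^esub> (?Y \<oplus>\<^bsub>M\<^esub> ?B \<odot>\<^bsub>M\<^esub> c)"
      using add.hyps(5) i by simp
    also have "\<dots> = (t i \<oplus>\<^bsub>M\<^esub> ?Y) \<oplus>\<^bsub>M\<^esub> (a i \<odot>\<^bsub>M\<^esub> c \<oplus>\<^bsub>M\<^esub> ?B \<odot>\<^bsub>M\<^esub> c)"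
      using tM(1) aR cM cl(1,3) by (simp add: M.a_ac)
    also have "a i \<odot>\<^bsub>M\<^esub> c \<oplus>\<^bsub>M\<^esub> ?B \<odot>\<^bsub>M\<^esub> c = a' i \<odot>\<^bsub>M\<^esub> c"
      unfolding a'_def using aR cM cl(3) by (simp add: smult_l_distr)
    finally show "t' i \<oplus>\<^bsub>M\<^esub> ?Y' = (t i \<oplus>\<^bsub>M\<^esub> ?Y) \<oplus>\<^bsub>M\<^esub> a' i \<odot>\<^bsub>M\<^esub> c" .
  qed
  thus ?case using 1 y' by blast
qed

end

context module
begin

text \<open>The matrix lifts multiplication by x to generators. The case x = 1 is a change of
  generators; in general this is the map R/(I : x) -> R/I induced by x.\<close>

lemma lincomb_syzygy:
  assumes "finite A" "finite B" "\<And>i j. \<alpha> i j \<in> carrier R" "\<And>i. r i \<in> carrier R" "\<And>j. b j \<in> carrier R"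
    and "\<And>j. j \<in> B \<Longrightarrow> (\<Oplus>i\<in>A. \<alpha> i j \<otimes> r i) = x \<otimes> b j" "x \<in> carrier R"
    and g: "g \<in> syzygies R (self_module R) B b"
  shows "(\<lambda>i. \<Oplus>j\<in>B. \<alpha> i j \<otimes> g j) \<in> syzygies R (self_module R) A r"
proof -
  interpret self: module R "self_module R" by (rule module_self_module)
  have gR: "\<And>j. g j \<in> carrier R" using syzygies_carrier[OF g] .
  have "(\<Oplus>i\<in>A. (\<Oplus>j\<in>B. \<alpha> i j \<otimes> g j) \<otimes> r i) = (\<Oplus>j\<in>B. g j \<otimes> (\<Oplus>i\<in>A. \<alpha> i j \<otimes> r i))"
    using self.finsum_matrix[of A B \<alpha> g r] assms gR by simp
  also have "\<dots> = (\<Oplus>j\<in>B. (g j \<otimes> b j) \<otimes> x)"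
    using assms gR by (intro R.finsum_cong') (auto simp: m_ac)
  also have "\<dots> = (\<Oplus>j\<in>B. g j \<otimes> b j) \<otimes> x"
    using assms gR by (intro finsum_ldistr[symmetric]) auto
  also have "\<dots> = \<zero>" using g assms(7) by (simp add: syzygies_def)
  finally show ?thesis using assms gR by (auto simp: syzygies_def)
qed

text \<open>By the Koszul relations every generator kills all relations, hence so does each element
  of the ideal, in particular w.\<close>

lemma equational_meets:
  assumes "finite A" "\<And>i. r i \<in> carrier R" "w \<in> U" "w \<in> Idl (r ` A)"
  shows "equational R M U A r"
  unfolding equational_def
proof safe
  fix t assume t: "\<forall>i. t i \<in> carrier M" and rel: "(\<Oplus>\<^bsub>M\<^esub>i\<in>A. r i \<odot>\<^bsub>M\<^esub> t i) = \<zero>\<^bsub>M\<^esub>"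
  obtain \<beta> where \<beta>: "\<And>i. \<beta> i \<in> carrier R" "w = (\<Oplus>i\<in>A. \<beta> i \<otimes> r i)"
    using genideal_lincomb[OF assms(1,2,4)] by blast
  have "null R (self_module R) M A r (\<lambda>i. \<Oplus>\<^bsub>M\<^esub>j\<in>A. \<beta> j \<odot>\<^bsub>M\<^esub> (r j \<odot>\<^bsub>M\<^esub> t i))"
  proof (rule null_sum[OF assms(1)])
    fix j assume "j \<in> A"
    hence "null R (self_module R) M A r (\<lambda>i. r j \<odot>\<^bsub>M\<^esub> t i)"
      using null_generator_smult[OF assms(1,2) _ _ rel] t by blast
    thus "null R (self_module R) M A r (\<lambda>i. \<beta> j \<odot>\<^bsub>M\<^esub> (r j \<odot>\<^bsub>M\<^esub> t i))"
      by (rule null_smult[OF _ \<beta>(1)])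
  qed
  moreover have "(\<Oplus>\<^bsub>M\<^esub>j\<in>A. \<beta> j \<odot>\<^bsub>M\<^esub> (r j \<odot>\<^bsub>M\<^esub> t i)) = w \<odot>\<^bsub>M\<^esub> t i" for i
  proof -
    have "w \<odot>\<^bsub>M\<^esub> t i = (\<Oplus>\<^bsub>M\<^esub>j\<in>A. (\<beta> j \<otimes> r j) \<odot>\<^bsub>M\<^esub> t i)"
      unfolding \<beta>(2) using t \<beta>(1) assms by (intro finsum_smult_rdistr) auto
    also have "\<dots> = (\<Oplus>\<^bsub>M\<^esub>j\<in>A. \<beta> j \<odot>\<^bsub>M\<^esub> (r j \<odot>\<^bsub>M\<^esub> t i))"
      using t \<beta>(1) assms(2) by (intro M.finsum_cong') (auto simp: smult_assoc1)
    finally show ?thesis by simp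
  qed
  ultimately show "\<exists>u\<in>U. null R (self_module R) M A r (\<lambda>i. u \<odot>\<^bsub>M\<^esub> t i)" using assms(3) by auto
qed

lemma finsum_extend_zero:
  assumes "\<And>i. r i \<in> carrier R" "x \<in> carrier R" "\<And>i. t i \<in> carrier M"
  shows "(\<Oplus>\<^bsub>M\<^esub>i\<in>{..<Suc n}. (r(n := x)) i \<odot>\<^bsub>M\<^esub> (t(n := \<zero>\<^bsub>M\<^esub>)) i) = (\<Oplus>\<^bsub>M\<^esub>i\<in>{..<n}. r i \<odot>\<^bsub>M\<^esub> t i)"
proof -
  have "(\<Oplus>\<^bsub>M\<^esub>i\<in>{..<Suc n}. (r(n := x)) i \<odot>\<^bsub>M\<^esub> (t(n := \<zero>\<^bsub>M\<^esub>)) i)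
      = x \<odot>\<^bsub>M\<^esub> \<zero>\<^bsub>M\<^esub> \<oplus>\<^bsub>M\<^esub> (\<Oplus>\<^bsub>M\<^esub>i\<in>{..<n}. (r(n := x)) i \<odot>\<^bsub>M\<^esub> (t(n := \<zero>\<^bsub>M\<^esub>)) i)"
    unfolding lessThan_Suc using assms by (subst M.finsum_insert) auto
  also have "(\<Oplus>\<^bsub>M\<^esub>i\<in>{..<n}. (r(n := x)) i \<odot>\<^bsub>M\<^esub> (t(n := \<zero>\<^bsub>M\<^esub>)) i) = (\<Oplus>\<^bsub>M\<^esub>i\<in>{..<n}. r i \<odot>\<^bsub>M\<^esub> t i)"
    using assms by (intro M.finsum_cong') auto
  finally show ?thesis using assms by (auto intro!: M.l_zero M.finsum_closed)
qed

text \<open>In Tor_1(R/(I:x), M) -> Tor_1(R/I, M) -> Tor_1(R/(I + xR), M) the outer terms are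
  torsion for U, so the middle one is as well; the two multipliers are multiplied.\<close>

lemma equational_extension:
  assumes r: "\<And>i. r i \<in> carrier R" and x: "x \<in> carrier R" and b: "\<And>j. b j \<in> carrier R"
    and U: "submonoid U R"
    and col: "colon R (Idl (r ` {..<n})) x = Idl (b ` {..<m::nat})"
    and g1: "equational R M U {..<Suc n} (r(n := x))" and g2: "equational R M U {..<m} b"
  shows "equational R M U {..<n} r"
  unfolding equational_def
proof safe
  interpret U: submonoid U R by fact
  fix t assume t: "\<forall>i. t i \<in> carrier M" and rel: "(\<Oplus>\<^bsub>M\<^esub>i\<in>{..<n}. r i \<odot>\<^bsub>M\<^esub> t i) = \<zero>\<^bsub>M\<^esub>"
  \<comment> \<open>A relation of r is one of (r, x) with coefficient 0 at x. The exact sequence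
    corrects a multiple of it by a family y with vanishing sum of the b_j y_j, to which the
    hypothesis on b applies.\<close>
  define v where "v = t(n := \<zero>\<^bsub>M\<^esub>)"
  have v: "\<And>i. v i \<in> carrier M" using t by (simp add: v_def)
  have "(\<Oplus>\<^bsub>M\<^esub>i\<in>{..<Suc n}. (r(n := x)) i \<odot>\<^bsub>M\<^esub> v i) = \<zero>\<^bsub>M\<^esub>"
    unfolding v_def using finsum_extend_zero[of r x t n, OF r x] t rel by simp
  then obtain u1 where u1: "u1 \<in> U" "null R (self_module R) M {..<Suc n} (r(n := x)) (\<lambda>i. u1 \<odot>\<^bsub>M\<^esub> v i)"
    by (rule equationalD[OF g1 v])
  have "\<exists>\<beta>. (\<forall>i. \<beta> i \<in> carrier R) \<and> (j < m \<longrightarrow> x \<otimes> b j = (\<Oplus>i\<in>{..<n}. \<beta> i \<otimes> r i))" for j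
  proof (cases "j < m")
    case True
    hence "b j \<in> Idl (b ` {..<m})" using genideal_self[of "b ` {..<m}"] b by auto
    hence "x \<otimes> b j \<in> Idl (r ` {..<n})" unfolding col[symmetric] by (simp add: colon_def)
    thus ?thesis using genideal_lincomb[of "{..<n}" r "x \<otimes> b j"] r by (metis finite_lessThan)
  next
    case False then show ?thesis by (intro exI[of _ "\<lambda>_. \<zero>"]) auto
  qed
  then obtain \<beta> where \<beta>: "\<And>i j. \<beta> j i \<in> carrier R"
      "\<And>j. j < m \<Longrightarrow> x \<otimes> b j = (\<Oplus>i\<in>{..<n}. \<beta> j i \<otimes> r i)" by metis
  obtain y where y: "\<And>j. y j \<in> carrier M" "u1 \<odot>\<^bsub>M\<^esub> v n = (\<Oplus>\<^bsub>M\<^esub>j\<in>{..<m}. b j \<odot>\<^bsub>M\<^esub> y j)"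
      "null R (self_module R) M {..<n} r (\<lambda>i. u1 \<odot>\<^bsub>M\<^esub> v i \<oplus>\<^bsub>M\<^esub> (\<Oplus>\<^bsub>M\<^esub>j\<in>{..<m}. \<beta> j i \<odot>\<^bsub>M\<^esub> y j))"
    using null_extension[of n r x "\<lambda>i. u1 \<odot>\<^bsub>M\<^esub> v i" b m "\<lambda>i j. \<beta> j i", OF u1(2) r x b] col \<beta> by auto
  have "(\<Oplus>\<^bsub>M\<^esub>j\<in>{..<m}. b j \<odot>\<^bsub>M\<^esub> y j) = \<zero>\<^bsub>M\<^esub>" using y(2) u1(1) by (simp add: v_def)
  then obtain u2 where u2: "u2 \<in> U" "null R (self_module R) M {..<m} b (\<lambda>j. u2 \<odot>\<^bsub>M\<^esub> y j)"
    by (rule equationalD[OF g2 y(1)])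
  have uR: "u1 \<in> carrier R" "u2 \<in> carrier R" using u1 u2 by auto
  have n1: "null R (self_module R) M {..<n} r (\<lambda>i. \<Oplus>\<^bsub>M\<^esub>j\<in>{..<m}. \<beta> j i \<odot>\<^bsub>M\<^esub> (u2 \<odot>\<^bsub>M\<^esub> y j))"
    using \<beta> r b x by (intro null_pushforward[OF u2(2)] lincomb_syzygy[of _ _ _ r b x]) auto
  have n2: "null R (self_module R) M {..<n} r
      (\<lambda>i. u2 \<odot>\<^bsub>M\<^esub> (u1 \<odot>\<^bsub>M\<^esub> v i \<oplus>\<^bsub>M\<^esub> (\<Oplus>\<^bsub>M\<^esub>j\<in>{..<m}. \<beta> j i \<odot>\<^bsub>M\<^esub> y j)))"
    by (rule null_smult[OF y(3) uR(2)])
  have eq: "u2 \<odot>\<^bsub>M\<^esub> (u1 \<odot>\<^bsub>M\<^esub> v i \<oplus>\<^bsub>M\<^esub> (\<Oplus>\<^bsub>M\<^esub>j\<in>{..<m}. \<beta> j i \<odot>\<^bsub>M\<^esub> y j))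
      = (u2 \<otimes> u1) \<odot>\<^bsub>M\<^esub> v i \<oplus>\<^bsub>M\<^esub> (\<Oplus>\<^bsub>M\<^esub>j\<in>{..<m}. \<beta> j i \<odot>\<^bsub>M\<^esub> (u2 \<odot>\<^bsub>M\<^esub> y j))" for i
  proof -
    have "u2 \<odot>\<^bsub>M\<^esub> (\<Oplus>\<^bsub>M\<^esub>j\<in>{..<m}. \<beta> j i \<odot>\<^bsub>M\<^esub> y j) = (\<Oplus>\<^bsub>M\<^esub>j\<in>{..<m}. u2 \<odot>\<^bsub>M\<^esub> (\<beta> j i \<odot>\<^bsub>M\<^esub> y j))"
      using \<beta>(1) y(1) uR by (intro finsum_smult_ldistr) auto
    also have "\<dots> = (\<Oplus>\<^bsub>M\<^esub>j\<in>{..<m}. \<beta> j i \<odot>\<^bsub>M\<^esub> (u2 \<odot>\<^bsub>M\<^esub> y j))"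
      using \<beta>(1) y(1) uR by (intro M.finsum_cong') (auto simp: smult_assoc1[symmetric] m_comm)
    finally show ?thesis
      using \<beta>(1) y(1) uR v by (auto simp: smult_r_distr smult_assoc1 M.finsum_closed Pi_def)
  qed
  have "null R (self_module R) M {..<n} r (\<lambda>i. (u2 \<otimes> u1) \<odot>\<^bsub>M\<^esub> v i)"
    using null_cancel[OF n2[unfolded eq] n1] uR v by simp
  hence "null R (self_module R) M {..<n} r (\<lambda>i. (u2 \<otimes> u1) \<odot>\<^bsub>M\<^esub> t i)"
    using uR t by (elim null_cong) (auto simp: v_def)
  thus "\<exists>u\<in>U. null R (self_module R) M {..<n} r (\<lambda>i. u \<odot>\<^bsub>M\<^esub> t i)" using u1(1) u2(1) U.m_closed by blast
qed

text \<open>Tor_1 depends only on the ideal, here up to multipliers outside P: h writes the x_j in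
  terms of the r_k, and g writes s r_i in terms of the x_j. A relation t of r is carried by g to a
  relation of x, trivialized there, and carried back by h; the difference between s t and h g t is a
  combination of syzygies.\<close>

lemma equational_change_generators:
  assumes P: "primeideal P R" and equational: "equational R M (carrier R - P) {..<d} x"
    and r: "\<And>i. r i \<in> carrier R" and x: "\<And>j. x j \<in> carrier R"
    and h: "\<And>k j. h k j \<in> carrier R" "\<And>j. j < d \<Longrightarrow> (\<Oplus>k\<in>{..<n}. h k j \<otimes> r k) = x j"
    and s: "s \<in> carrier R - P"
    and g: "\<And>j i. g j i \<in> carrier R" "\<And>i. i < n \<Longrightarrow> s \<otimes> r i = (\<Oplus>j\<in>{..<d::nat}. g j i \<otimes> x j)"
  shows "equational R M (carrier R - P) {..<n::nat} r"
  unfolding equational_def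
proof safe
  fix t assume t': "\<forall>i. t i \<in> carrier M" and rel: "(\<Oplus>\<^bsub>M\<^esub>i\<in>{..<n}. r i \<odot>\<^bsub>M\<^esub> t i) = \<zero>\<^bsub>M\<^esub>"
  hence t: "\<And>i. t i \<in> carrier M" by simp
  interpret self: module R "self_module R" by (rule module_self_module)
  have sR: "s \<in> carrier R" using s by simp
  define y where "y j = (\<Oplus>\<^bsub>M\<^esub>i\<in>{..<n}. g j i \<odot>\<^bsub>M\<^esub> t i)" for j
  have y: "\<And>j. y j \<in> carrier M" using t g(1) by (auto simp: y_def)
  have "(\<Oplus>\<^bsub>M\<^esub>j\<in>{..<d}. x j \<odot>\<^bsub>M\<^esub> y j) = (\<Oplus>\<^bsub>M\<^esub>i\<in>{..<n}. (\<Oplus>j\<in>{..<d}. g j i \<otimes> x j) \<odot>\<^bsub>M\<^esub> t i)"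
    using finsum_matrix[of "{..<n}" "{..<d}" "\<lambda>i j. g j i" x t] g(1) x t by (simp add: y_def)
  also have "\<dots> = (\<Oplus>\<^bsub>M\<^esub>i\<in>{..<n}. s \<odot>\<^bsub>M\<^esub> (r i \<odot>\<^bsub>M\<^esub> t i))"
  proof (rule M.finsum_cong'[OF refl])
    fix i assume "i \<in> {..<n}"
    thus "(\<Oplus>j\<in>{..<d}. g j i \<otimes> x j) \<odot>\<^bsub>M\<^esub> t i = s \<odot>\<^bsub>M\<^esub> (r i \<odot>\<^bsub>M\<^esub> t i)"
      using g(2)[of i, symmetric] r t sR by (simp add: smult_assoc1)
  qed (use r t sR in auto)
  also have "\<dots> = s \<odot>\<^bsub>M\<^esub> \<zero>\<^bsub>M\<^esub>"
    unfolding rel[symmetric] using r t sR by (intro finsum_smult_ldistr[symmetric]) auto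
  also have "\<dots> = \<zero>\<^bsub>M\<^esub>" using sR by simp
  finally obtain s' where s': "s' \<in> carrier R - P" "null R (self_module R) M {..<d} x (\<lambda>j. s' \<odot>\<^bsub>M\<^esub> y j)"
    by (rule equationalD[OF equational y])
  have s'R: "s' \<in> carrier R" using s' by simp
  have n1: "null R (self_module R) M {..<n} r (\<lambda>k. \<Oplus>\<^bsub>M\<^esub>j\<in>{..<d}. h k j \<odot>\<^bsub>M\<^esub> (s' \<odot>\<^bsub>M\<^esub> y j))"
    using h r x by (intro null_pushforward[OF s'(2)] lincomb_syzygy[of _ _ _ r x \<one>]) auto
  \<comment> \<open>Entries of s times the identity minus h g. Both matrices give s r_i when paired
    with r, so the difference consists of syzygies of r.\<close>
  define a where "a i k = (if k = i then s else \<zero>) \<oplus> \<ominus> (\<Oplus>j\<in>{..<d}. h k j \<otimes> g j i)" for i k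
  have hg: "(\<Oplus>j\<in>{..<d}. h k j \<otimes> g j i) \<in> carrier R" for k i using h(1) g(1) by (intro R.finsum_closed) auto
  have aR: "a i k \<in> carrier R" for i k using sR hg by (simp add: a_def)
  have syz: "a i \<in> syzygies R (self_module R) {..<n} r" if i: "i \<in> {..<n}" for i
  proof -
    have "(\<Oplus>k\<in>{..<n}. a i k \<otimes> r k) = (\<Oplus>k\<in>{..<n}. (if i = k then s \<otimes> r k else \<zero>) \<oplus> \<ominus> \<one> \<otimes> ((\<Oplus>j\<in>{..<d}. h k j \<otimes> g j i) \<otimes> r k))"
      using r sR hg by (intro R.finsum_cong') (auto simp: a_def l_distr l_minus)
    also have "\<dots> = (\<Oplus>k\<in>{..<n}. if i = k then s \<otimes> r k else \<zero>) \<oplus> (\<Oplus>k\<in>{..<n}. \<ominus> \<one> \<otimes> ((\<Oplus>j\<in>{..<d}. h k j \<otimes> g j i) \<otimes> r k))"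
      using r sR hg by (intro R.finsum_addf) auto
    also have "(\<Oplus>k\<in>{..<n}. if i = k then s \<otimes> r k else \<zero>) = s \<otimes> r i"
      using r sR i by (intro R.add.finprod_singleton) auto
    also have "(\<Oplus>k\<in>{..<n}. \<ominus> \<one> \<otimes> ((\<Oplus>j\<in>{..<d}. h k j \<otimes> g j i) \<otimes> r k)) = \<ominus> \<one> \<otimes> (\<Oplus>k\<in>{..<n}. (\<Oplus>j\<in>{..<d}. h k j \<otimes> g j i) \<otimes> r k)"
      using r hg by (intro finsum_rdistr[symmetric]) auto
    also have "(\<Oplus>k\<in>{..<n}. (\<Oplus>j\<in>{..<d}. h k j \<otimes> g j i) \<otimes> r k) = (\<Oplus>j\<in>{..<d}. g j i \<otimes> (\<Oplus>k\<in>{..<n}. h k j \<otimes> r k))"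
      using self.finsum_matrix[of "{..<n}" "{..<d}" h "\<lambda>j. g j i" r] h(1) g(1) r by simp
    also have "\<dots> = (\<Oplus>j\<in>{..<d}. g j i \<otimes> x j)"
      using h(2) g(1) x by (intro R.finsum_cong') auto
    also have "\<dots> = s \<otimes> r i" using g(2) i by simp
    also have "s \<otimes> r i \<oplus> \<ominus> \<one> \<otimes> (s \<otimes> r i) = \<zero>" using sR r[of i] by algebra
    finally show ?thesis using aR by (simp add: syzygies_def)
  qed
  have n2: "null R (self_module R) M {..<n} r (\<lambda>k. \<Oplus>\<^bsub>M\<^esub>i\<in>{..<n}. a i k \<odot>\<^bsub>M\<^esub> t i)"
    by (intro null_sum null_single syz t) auto
  have n2_eq: "s \<odot>\<^bsub>M\<^esub> t k = (\<Oplus>\<^bsub>M\<^esub>i\<in>{..<n}. a i k \<odot>\<^bsub>M\<^esub> t i) \<oplus>\<^bsub>M\<^esub> (\<Oplus>\<^bsub>M\<^esub>j\<in>{..<d}. h k j \<odot>\<^bsub>M\<^esub> y j)"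
    if k: "k \<in> {..<n}" for k
  proof -
    have "(\<Oplus>\<^bsub>M\<^esub>j\<in>{..<d}. h k j \<odot>\<^bsub>M\<^esub> y j) = (\<Oplus>\<^bsub>M\<^esub>i\<in>{..<n}. (\<Oplus>j\<in>{..<d}. g j i \<otimes> h k j) \<odot>\<^bsub>M\<^esub> t i)"
      using finsum_matrix[of "{..<n}" "{..<d}" "\<lambda>i j. g j i" "\<lambda>j. h k j" t] g(1) h(1) t by (simp add: y_def)
    also have "\<dots> = (\<Oplus>\<^bsub>M\<^esub>i\<in>{..<n}. (\<Oplus>j\<in>{..<d}. h k j \<otimes> g j i) \<odot>\<^bsub>M\<^esub> t i)"
      using g(1) h(1) by (simp add: m_comm)
    finally have "(\<Oplus>\<^bsub>M\<^esub>i\<in>{..<n}. a i k \<odot>\<^bsub>M\<^esub> t i) \<oplus>\<^bsub>M\<^esub> (\<Oplus>\<^bsub>M\<^esub>j\<in>{..<d}. h k j \<odot>\<^bsub>M\<^esub> y j)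
      = (\<Oplus>\<^bsub>M\<^esub>i\<in>{..<n}. a i k \<odot>\<^bsub>M\<^esub> t i \<oplus>\<^bsub>M\<^esub> (\<Oplus>j\<in>{..<d}. h k j \<otimes> g j i) \<odot>\<^bsub>M\<^esub> t i)"
      using aR hg t by (subst M.finsum_addf) auto
    also have "\<dots> = (\<Oplus>\<^bsub>M\<^esub>i\<in>{..<n}. if k = i then s \<odot>\<^bsub>M\<^esub> t i else \<zero>\<^bsub>M\<^esub>)"
    proof (rule M.finsum_cong'[OF refl])
      fix i
      have "a i k \<oplus> (\<Oplus>j\<in>{..<d}. h k j \<otimes> g j i) = (if k = i then s else \<zero>)"
        using sR hg[of k i] by (auto simp: a_def R.a_assoc R.l_neg)
      thus "a i k \<odot>\<^bsub>M\<^esub> t i \<oplus>\<^bsub>M\<^esub> (\<Oplus>j\<in>{..<d}. h k j \<otimes> g j i) \<odot>\<^bsub>M\<^esub> t i = (if k = i then s \<odot>\<^bsub>M\<^esub> t i else \<zero>\<^bsub>M\<^esub>)"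
        using aR hg t smult_l_distr[of "a i k" "\<Oplus>j\<in>{..<d}. h k j \<otimes> g j i" "t i"] by auto
    qed (use sR t in auto)
    also have "\<dots> = s \<odot>\<^bsub>M\<^esub> t k" using sR t k by (intro M.add.finprod_singleton) auto
    finally show ?thesis by simp
  qed
  have "null R (self_module R) M {..<n} r (\<lambda>k. (s' \<otimes> s) \<odot>\<^bsub>M\<^esub> t k)"
  proof (rule null_cong[OF null_add[OF null_smult[OF n2 s'R] n1]])
    fix k assume k: "k \<in> {..<n}"
    let ?A = "\<Oplus>\<^bsub>M\<^esub>i\<in>{..<n}. a i k \<odot>\<^bsub>M\<^esub> t i"
    have "?A \<in> carrier M" using aR t by (intro M.finsum_closed) auto
    moreover have "(\<Oplus>\<^bsub>M\<^esub>j\<in>{..<d}. h k j \<odot>\<^bsub>M\<^esub> y j) \<in> carrier M" using h(1) y by (intro M.finsum_closed) auto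
    ultimately have "(s' \<otimes> s) \<odot>\<^bsub>M\<^esub> t k = s' \<odot>\<^bsub>M\<^esub> ?A \<oplus>\<^bsub>M\<^esub> s' \<odot>\<^bsub>M\<^esub> (\<Oplus>\<^bsub>M\<^esub>j\<in>{..<d}. h k j \<odot>\<^bsub>M\<^esub> y j)"
      using s'R sR t by (simp add: smult_assoc1 n2_eq[OF k] smult_r_distr)
    also have "s' \<odot>\<^bsub>M\<^esub> (\<Oplus>\<^bsub>M\<^esub>j\<in>{..<d}. h k j \<odot>\<^bsub>M\<^esub> y j) = (\<Oplus>\<^bsub>M\<^esub>j\<in>{..<d}. s' \<odot>\<^bsub>M\<^esub> (h k j \<odot>\<^bsub>M\<^esub> y j))"
      using h(1) y s'R by (intro finsum_smult_ldistr) auto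
    also have "\<dots> = (\<Oplus>\<^bsub>M\<^esub>j\<in>{..<d}. h k j \<odot>\<^bsub>M\<^esub> (s' \<odot>\<^bsub>M\<^esub> y j))"
      using h(1) y s'R by (intro M.finsum_cong') (auto simp: smult_assoc1[symmetric] m_comm)
    finally show "(s' \<otimes> s) \<odot>\<^bsub>M\<^esub> t k = s' \<odot>\<^bsub>M\<^esub> ?A \<oplus>\<^bsub>M\<^esub> (\<Oplus>\<^bsub>M\<^esub>j\<in>{..<d}. h k j \<odot>\<^bsub>M\<^esub> (s' \<odot>\<^bsub>M\<^esub> y j))" .
  qed (use sR s'R t in auto)
  thus "\<exists>u\<in>carrier R - P. null R (self_module R) M {..<n} r (\<lambda>i. u \<odot>\<^bsub>M\<^esub> t i)"
    using primeideal_mult_notin[OF P s'(1) s] by blast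
qed

lemma null_extend_zero:
  assumes "null R (self_module R) M {..<n::nat} r t" "\<And>i. r i \<in> carrier R"
  shows "null R (self_module R) M {..<Suc n} r (t(n := \<zero>\<^bsub>M\<^esub>))"
  using assms(1)
proof induction
  case (zero t) then show ?case by (intro null.zero) (auto simp: less_Suc_eq)
next
  case (add t a y t')
  have aR: "\<And>i. a i \<in> carrier R" using syzygies_carrier[OF add.hyps(2)] .
  interpret self: module R "self_module R" by (rule module_self_module)
  have "(\<Oplus>i\<in>{..<Suc n}. (a(n := \<zero>)) i \<otimes> r i) = \<zero> \<otimes> r n \<oplus> (\<Oplus>i\<in>{..<n}. (a(n := \<zero>)) i \<otimes> r i)"
    unfolding lessThan_Suc using aR assms(2) by (subst R.finsum_insert) auto
  also have "(\<Oplus>i\<in>{..<n}. (a(n := \<zero>)) i \<otimes> r i) = (\<Oplus>i\<in>{..<n}. a i \<otimes> r i)"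
    using aR assms(2) by (intro R.finsum_cong') auto
  finally have "a(n := \<zero>) \<in> syzygies R (self_module R) {..<Suc n} r"
    using add.hyps(2) assms(2) by (auto simp: syzygies_def)
  then show ?case
    by (rule null.add[OF add.IH _ add.hyps(3)]) (use add.hyps in \<open>auto simp: less_Suc_eq\<close>)
qed

end

text \<open>Replaces multipliers found for single vectors by a common one for a submodule Z of R^n,
  encoded by functions that vanish from n on. Induction on n: the last coordinates form a finitely
  generated ideal, whose generators come from finitely many vectors of Z, and the vectors with last
  coordinate 0 fall under the induction hypothesis.\<close>

lemma (in noetherian_cring) uniform_multiplier:
  fixes Z :: "(nat \<Rightarrow> 'a) set"
  assumes P: "primeideal P R"
    and Z: "\<And>z i. z \<in> Z \<Longrightarrow> z i \<in> carrier R" "\<And>z i. z \<in> Z \<Longrightarrow> i \<ge> n \<Longrightarrow> z i = \<zero>"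
      "\<And>z z'. z \<in> Z \<Longrightarrow> z' \<in> Z \<Longrightarrow> (\<lambda>i. z i \<oplus> z' i) \<in> Z" "\<And>z c. z \<in> Z \<Longrightarrow> c \<in> carrier R \<Longrightarrow> (\<lambda>i. c \<otimes> z i) \<in> Z"
    and N: "\<And>z z'. N z \<Longrightarrow> N z' \<Longrightarrow> N (\<lambda>i. z i \<oplus> z' i)" "\<And>z c. N z \<Longrightarrow> c \<in> carrier R \<Longrightarrow> N (\<lambda>i. c \<otimes> z i)"
    and ex: "\<And>z. z \<in> Z \<Longrightarrow> \<exists>s\<in>carrier R - P. N (\<lambda>i. s \<otimes> z i)"
  shows "\<exists>s\<in>carrier R - P. \<forall>z\<in>Z. N (\<lambda>i. s \<otimes> z i)"
  using Z ex
proof (induction n arbitrary: Z)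
  case 0
  have "Z \<subseteq> {\<lambda>_. \<zero>}" using 0(2) by auto
  then show ?case using 0(5) primeideal_one_notin[OF P] by (cases "Z = {}") auto
next
  case (Suc n)
  note ZR = Suc.prems(1) and Zadd = Suc.prems(3) and Zmult = Suc.prems(4)
  define Z' where "Z' = {z \<in> Z. z n = \<zero>}"
  have Zn: "z i = \<zero>" if "z \<in> Z'" "i \<ge> n" for z i
    using that Suc.prems(2)[of z i] by (cases "i = n") (auto simp: Z'_def)
  have "\<exists>s\<in>carrier R - P. \<forall>z\<in>Z'. N (\<lambda>i. s \<otimes> z i)"
  proof (rule Suc.IH)
    show "(\<lambda>i. z i \<oplus> z' i) \<in> Z'" if "z \<in> Z'" "z' \<in> Z'" for z z' using that Zadd by (simp add: Z'_def)
    show "(\<lambda>i. c \<otimes> z i) \<in> Z'" if "z \<in> Z'" "c \<in> carrier R" for z c using that Zmult by (simp add: Z'_def)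
    show "z i \<in> carrier R" if "z \<in> Z'" for z i using that ZR by (simp add: Z'_def)
    show "\<exists>s\<in>carrier R - P. N (\<lambda>i. s \<otimes> z i)" if "z \<in> Z'" for z using that Suc.prems(5) by (simp add: Z'_def)
  qed (rule Zn)
  then obtain s2 where s2: "s2 \<in> carrier R - P" "\<And>z. z \<in> Z' \<Longrightarrow> N (\<lambda>i. s2 \<otimes> z i)" by blast
  show ?case
  proof (cases "Z = {}")
    case True then show ?thesis using primeideal_one_notin[OF P] by blast
  next
    case False
    then obtain z0 where z0: "z0 \<in> Z" by blast
    have zeroZ: "(\<lambda>i. \<zero>) \<in> Z" using Zmult[OF z0, of \<zero>] ZR[OF z0] by simp
    have I: "ideal {z n | z. z \<in> Z} R"
    proof (rule idealI')
      show "{z n | z. z \<in> Z} \<subseteq> carrier R" using ZR by auto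
      show "\<zero> \<in> {z n | z. z \<in> Z}" using zeroZ by (intro CollectI exI[of _ "\<lambda>i. \<zero>"]) auto
      fix a assume "a \<in> {z n | z. z \<in> Z}"
      then obtain z where z: "z \<in> Z" "a = z n" by blast
      { fix b assume "b \<in> {z n | z. z \<in> Z}"
        then obtain w where w: "w \<in> Z" "b = w n" by blast
        show "a \<oplus> b \<in> {z n | z. z \<in> Z}" using Zadd[OF z(1) w(1)] z(2) w(2) by auto }
      fix c assume "c \<in> carrier R"
      thus "c \<otimes> a \<in> {z n | z. z \<in> Z}" using Zmult[OF z(1)] z(2) by auto
    qed
    obtain B where B: "B \<subseteq> carrier R" "finite B" "{z n | z. z \<in> Z} = Idl B" using finetely_gen[OF I] by blast
    have "B \<subseteq> {z n | z. z \<in> Z}" using genideal_self[OF B(1)] B(3) by simp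
    with B(2) have "\<exists>s\<in>carrier R - P. \<forall>b\<in>B. \<exists>z\<in>Z. z n = b \<and> N (\<lambda>i. s \<otimes> z i)"
    proof (induction B rule: finite_induct)
      case empty then show ?case using primeideal_one_notin[OF P] by blast
    next
      case (insert b B)
      obtain s where s: "s \<in> carrier R - P" "\<And>b. b \<in> B \<Longrightarrow> \<exists>z\<in>Z. z n = b \<and> N (\<lambda>i. s \<otimes> z i)" using insert by auto
      obtain z where z: "z \<in> Z" "z n = b" using insert.prems by auto
      obtain s' where s': "s' \<in> carrier R - P" "N (\<lambda>i. s' \<otimes> z i)" using Suc.prems(5)[OF z(1)] by blast
      have N': "N (\<lambda>i. (s \<otimes> s') \<otimes> z i)" using N(2)[OF s'(2), of s] s s' ZR[OF z(1)] by (simp add: m_assoc)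
      show ?case
      proof (rule bexI[of _ "s \<otimes> s'"], rule ballI)
        show "s \<otimes> s' \<in> carrier R - P" using primeideal_mult_notin[OF P s(1) s'(1)] .
        fix c assume "c \<in> insert b B"
        then consider "c = b" | "c \<in> B" by auto
        then show "\<exists>z\<in>Z. z n = c \<and> N (\<lambda>i. (s \<otimes> s') \<otimes> z i)"
        proof cases
          case 1 then show ?thesis using z N' by blast
        next
          case 2
          then obtain w where w: "w \<in> Z" "w n = c" "N (\<lambda>i. s \<otimes> w i)" using s(2) by blast
          have "N (\<lambda>i. (s \<otimes> s') \<otimes> w i)" using N(2)[OF w(3), of s'] s s' ZR[OF w(1)] by (simp add: m_ac)
          then show ?thesis using w by blast
        qed
      qed
    qed
    then obtain s1 where s1: "s1 \<in> carrier R - P" "\<And>b. b \<in> B \<Longrightarrow> \<exists>z\<in>Z. z n = b \<and> N (\<lambda>i. s1 \<otimes> z i)" by blast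
    have sR: "s1 \<in> carrier R" "s2 \<in> carrier R" using s1 s2 by auto
    \<comment> \<open>The last coordinates of the vectors served by s1 form an ideal. It contains
      the generators B, hence every last coordinate.\<close>
    let ?J = "{z n | z. z \<in> Z \<and> N (\<lambda>i. s1 \<otimes> z i)}"
    have N0: "N (\<lambda>i. s1 \<otimes> \<zero>)"
    proof -
      obtain s where "s \<in> carrier R - P" "N (\<lambda>i. s \<otimes> \<zero>)" using Suc.prems(5)[OF zeroZ] by blast
      thus ?thesis using sR by simp
    qed
    have "ideal ?J R"
    proof (rule idealI')
      show "?J \<subseteq> carrier R" using ZR by auto
      show "\<zero> \<in> ?J" using zeroZ N0 by (intro CollectI exI[of _ "\<lambda>i. \<zero>"]) auto
      fix a assume "a \<in> ?J"
      then obtain z where z: "z \<in> Z" "N (\<lambda>i. s1 \<otimes> z i)" "a = z n" by auto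
      { fix b assume "b \<in> ?J"
        then obtain w where w: "w \<in> Z" "N (\<lambda>i. s1 \<otimes> w i)" "b = w n" by auto
        have "N (\<lambda>i. s1 \<otimes> (z i \<oplus> w i))" using N(1)[OF z(2) w(2)] sR ZR[OF z(1)] ZR[OF w(1)] by (simp add: r_distr)
        thus "a \<oplus> b \<in> ?J" using Zadd[OF z(1) w(1)] z(3) w(3) by auto }
      fix c assume c: "c \<in> carrier R"
      have "N (\<lambda>i. s1 \<otimes> (c \<otimes> z i))" using N(2)[OF z(2) c] sR c ZR[OF z(1)] by (simp add: m_lcomm)
      thus "c \<otimes> a \<in> ?J" using Zmult[OF z(1) c] z(3) by auto
    qed
    moreover have "B \<subseteq> ?J" using s1(2) by fastforce
    ultimately have IJ: "{z n | z. z \<in> Z} \<subseteq> ?J" unfolding B(3) by (rule genideal_minimal)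
    show ?thesis
    proof (intro bexI ballI)
      show "s1 \<otimes> s2 \<in> carrier R - P" using primeideal_mult_notin[OF P s1(1) s2(1)] .
      fix z assume z: "z \<in> Z"
      then obtain w where w: "w \<in> Z" "N (\<lambda>i. s1 \<otimes> w i)" "z n = w n" using IJ by blast
      \<comment> \<open>The difference z - w has last coordinate 0 and is served by s2.\<close>
      define v where "v = (\<lambda>i. z i \<oplus> \<ominus> \<one> \<otimes> w i)"
      have "v \<in> Z" unfolding v_def using Zadd[OF z Zmult[OF w(1), of "\<ominus> \<one>"]] by simp
      moreover have "v n = \<zero>" unfolding v_def w(3) using ZR[OF w(1)] by (simp add: l_minus r_neg)
      ultimately have "N (\<lambda>i. s2 \<otimes> v i)" using s2(2) by (simp add: Z'_def)
      hence "N (\<lambda>i. s2 \<otimes> (s1 \<otimes> w i) \<oplus> s1 \<otimes> (s2 \<otimes> v i))" using N w(2) sR by blast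
      moreover have "s2 \<otimes> (s1 \<otimes> w i) \<oplus> s1 \<otimes> (s2 \<otimes> v i) = (s1 \<otimes> s2) \<otimes> z i" for i
        unfolding v_def using sR ZR[OF w(1), of i] ZR[OF z, of i] by algebra
      ultimately show "N (\<lambda>i. (s1 \<otimes> s2) \<otimes> z i)" by simp
    qed
  qed
qed

section \<open>Flatness of the Frobenius endomorphism\<close>

text \<open>The exponent is later p^e for arbitrary e; additivity of the q-th power is what the
  argument rests on, so all iterates of Frobenius are handled at once.\<close>

locale frobenius_power = noetherian_cring +
  fixes q :: nat
  assumes q_pos: "q > 0"
    and frobenius_add: "a \<in> carrier R \<Longrightarrow> b \<in> carrier R \<Longrightarrow> (a \<oplus> b) [^] q = a [^] q \<oplus> b [^] q"
begin

text \<open>The ring R on which r acts as multiplication by r^q. Ordinary multiplication is a second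
  action, linear for the first, and over it the relations with entries in F form a finitely
  generated module.\<close>

abbreviation "F \<equiv> restrict_scalars (\<lambda>a. a [^] q) (self_module R)"

lemma frobenius_hom: "(\<lambda>a. a [^] q) \<in> ring_hom R R"
  by (rule ring_hom_memI) (auto simp: nat_pow_distrib frobenius_add)

sublocale F: module R F
  by (rule module_restrict_scalars[OF is_cring frobenius_hom module_self_module])

lemma linear_map_mult: "c \<in> carrier R \<Longrightarrow> linear_map R F F (\<lambda>y. c \<otimes> y)"
  by (auto simp: linear_map_def r_distr m_lcomm)

lemma null_mult:
  assumes "null R L F A x t" "c \<in> carrier R"
  shows "null R L F A x (\<lambda>i. c \<otimes> t i)"
  by (rule null_map[OF F.module_axioms F.module_axioms linear_map_mult[OF assms(2)] assms(1)])

text \<open>Converts an ordinary multiplier c into the scalar c, which acts as c^q; as q is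
  positive, c^q is a multiple of c.\<close>

lemma null_smult_from_mult:
  assumes "null R L F A x (\<lambda>i. c \<otimes> t i)" "c \<in> carrier R" "\<And>i. t i \<in> carrier R"
  shows "null R L F A x (\<lambda>i. c [^] q \<otimes> t i)"
proof -
  have "c [^] q = c [^] (q - 1) \<otimes> c" using q_pos by (metis Suc_diff_1 nat_pow_Suc)
  hence "c [^] q \<otimes> t i = c [^] (q - 1) \<otimes> (c \<otimes> t i)" for i using assms by (simp add: m_assoc)
  thus ?thesis using null_mult[OF assms(1), of "c [^] (q - 1)"] assms(2) by simp
qed

text \<open>The powers x_i^q form a regular sequence locally at P, and relations of a regular
  sequence are Koszul: the last entry of a relation is locally a combination of the earlier powers,
  so Koszul syzygies reduce the relation to one with fewer terms.\<close>

lemma equational_regular_system: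
  assumes "regular_system R P d x" and x: "\<And>i. x i \<in> carrier R" and "k \<le> d"
  shows "equational R F (carrier R - P) {..<k} x"
  using assms(3)
proof (induction k)
  case 0
  show ?case unfolding equational_def
  proof safe
    interpret regular_system R P d x by fact
    fix t :: "nat \<Rightarrow> 'a" assume "\<forall>i. t i \<in> carrier F"
    hence "null R (self_module R) F {..<0} x (\<lambda>i. \<one> \<odot>\<^bsub>F\<^esub> t i)" by (intro null.zero) auto
    thus "\<exists>u\<in>carrier R - P. null R (self_module R) F {..<0} x (\<lambda>i. u \<odot>\<^bsub>F\<^esub> t i)"
      using primeideal_one_notin[OF prime] by blast
  qed
next
  case (Suc k)
  interpret regular_system R P d x by fact
  have k: "k < d" using Suc.prems by simp
  have IH: "equational R F (carrier R - P) {..<k} x" using Suc by simp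
  show ?case unfolding equational_def
  proof safe
    fix t assume "\<forall>i. t i \<in> carrier F" and rel: "(\<Oplus>\<^bsub>F\<^esub>i\<in>{..<Suc k}. x i \<odot>\<^bsub>F\<^esub> t i) = \<zero>\<^bsub>F\<^esub>"
    hence t: "\<And>i. t i \<in> carrier R" by simp
    let ?y = "\<lambda>i. x i [^] q"
    have y: "\<And>i. ?y i \<in> carrier R" using x by simp
    define S where "S = (\<Oplus>i\<in>{..<k}. t i \<otimes> ?y i)"
    have S: "S \<in> carrier R" using t x by (auto simp: S_def)
    have "(\<Oplus>i\<in>{..<Suc k}. ?y i \<otimes> t i) = ?y k \<otimes> t k \<oplus> (\<Oplus>i\<in>{..<k}. ?y i \<otimes> t i)"
      unfolding lessThan_Suc using t x by (subst finsum_insert) auto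
    moreover have "(\<Oplus>i\<in>{..<k}. ?y i \<otimes> t i) = S" unfolding S_def using t x by (intro finsum_cong') (auto simp: m_comm)
    ultimately have rel': "?y k \<otimes> t k \<oplus> S = \<zero>" using rel by simp
    have I: "ideal (Idl (?y ` {..<k})) R" using y by (intro genideal_ideal) auto
    have "S \<in> Idl (?y ` {..<k})" unfolding S_def using finsum_in_genideal[of "{..<k}" ?y t] y t by simp
    moreover have "?y k \<otimes> t k = \<ominus> S" using rel' y t S by (metis a_comm m_closed minus_equality)
    ultimately have "?y k \<otimes> t k \<in> Idl (?y ` {..<k})" using ideal.ideal_simps(3)[OF I] by simp
    hence "?y k \<otimes> t k \<in> saturation R P (Idl (?y ` {..<k}))"
      using saturation_superset[OF prime I] by blast
    hence "t k \<in> saturation R P (Idl (?y ` {..<k}))"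
      using nonzerodivisor_power_sequence[OF k q_pos t[of k]] by blast
    then obtain s where s: "s \<in> carrier R - P" "s \<otimes> t k \<in> Idl (?y ` {..<k})" by (auto simp: saturation_def)
    have sR: "s \<in> carrier R" using s by simp
    obtain c where c: "\<And>i. c i \<in> carrier R" "s \<otimes> t k = (\<Oplus>i\<in>{..<k}. c i \<otimes> ?y i)"
      using F.genideal_lincomb[of "{..<k}" ?y "s \<otimes> t k"] y s by blast
    \<comment> \<open>With s t_k written as the sum of the c_i x_i^q, the last term of s t is
      distributed over the others, which leaves a relation of the first k powers.\<close>
    define t' where "t' i = s \<otimes> t i \<oplus> ?y k \<otimes> c i" for i
    have t': "\<And>i. t' i \<in> carrier R" using sR t c(1) y by (simp add: t'_def)
    have "(\<Oplus>i\<in>{..<k}. ?y i \<otimes> t' i) = (\<Oplus>i\<in>{..<k}. s \<otimes> (t i \<otimes> ?y i) \<oplus> ?y k \<otimes> (c i \<otimes> ?y i))"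
    proof (rule finsum_cong'[OF refl])
      fix i show "?y i \<otimes> t' i = s \<otimes> (t i \<otimes> ?y i) \<oplus> ?y k \<otimes> (c i \<otimes> ?y i)"
        unfolding t'_def using sR t[of i] c(1)[of i] y[of i] y[of k] by algebra
    qed (use sR t c(1) y in auto)
    also have "\<dots> = (\<Oplus>i\<in>{..<k}. s \<otimes> (t i \<otimes> ?y i)) \<oplus> (\<Oplus>i\<in>{..<k}. ?y k \<otimes> (c i \<otimes> ?y i))"
      using sR t c(1) y by (intro finsum_addf) auto
    also have "(\<Oplus>i\<in>{..<k}. s \<otimes> (t i \<otimes> ?y i)) = s \<otimes> S"
      unfolding S_def using sR t y by (intro finsum_rdistr[symmetric]) auto
    also have "(\<Oplus>i\<in>{..<k}. ?y k \<otimes> (c i \<otimes> ?y i)) = ?y k \<otimes> (s \<otimes> t k)"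
      unfolding c(2) using c(1) y by (intro finsum_rdistr[symmetric]) auto
    also have "s \<otimes> S \<oplus> ?y k \<otimes> (s \<otimes> t k) = s \<otimes> (?y k \<otimes> t k \<oplus> S)"
      using sR S t[of k] y[of k] by algebra
    also have "\<dots> = \<zero>" unfolding rel' using sR by simp
    finally have "(\<Oplus>\<^bsub>F\<^esub>i\<in>{..<k}. x i \<odot>\<^bsub>F\<^esub> t' i) = \<zero>\<^bsub>F\<^esub>" by simp
    moreover have "\<And>i. t' i \<in> carrier F" using t' by simp
    ultimately obtain u where u: "u \<in> carrier R - P" "null R (self_module R) F {..<k} x (\<lambda>i. u \<odot>\<^bsub>F\<^esub> t' i)"
      using F.equationalD[OF IH, of t'] by blast
    have uR: "u \<in> carrier R" using u by simp
    let ?u = "u [^] q"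
    have n1: "null R (self_module R) F {..<Suc k} x ((\<lambda>i. ?u \<otimes> t' i)(k := \<zero>))"
      using F.null_extend_zero[OF u(2) x] by simp
    \<comment> \<open>Koszul syzygies x_b e_k - x_k e_b. Weighted with u^q c_b they restore the last
      entry of the relation and undo the shift of the others by x_k^q c_i.\<close>
    define a where "a b i = (if i = k then x b else if i = b then \<ominus> x k else \<zero>)" for b i
    have aR: "a b i \<in> carrier R" for b i using x by (simp add: a_def)
    have syz: "a b \<in> syzygies R (self_module R) {..<Suc k} x" if b: "b \<in> {..<k}" for b
    proof -
      have "(\<Oplus>i\<in>{..<Suc k}. a b i \<otimes> x i) = a b k \<otimes> x k \<oplus> (\<Oplus>i\<in>{..<k}. a b i \<otimes> x i)"
        unfolding lessThan_Suc using aR x by (subst finsum_insert) auto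
      also have "(\<Oplus>i\<in>{..<k}. a b i \<otimes> x i) = (\<Oplus>i\<in>{..<k}. if b = i then \<ominus> x k \<otimes> x i else \<zero>)"
        using x by (intro finsum_cong') (auto simp: a_def)
      also have "\<dots> = \<ominus> x k \<otimes> x b" using x b by (intro finsum_singleton) auto
      also have "a b k \<otimes> x k \<oplus> \<ominus> x k \<otimes> x b = \<zero>" using x[of k] x[of b] by (simp add: a_def) algebra
      finally show ?thesis using aR by (simp add: syzygies_def)
    qed
    have "null R (self_module R) F {..<Suc k} x (\<lambda>i. \<Oplus>\<^bsub>F\<^esub>b\<in>{..<k}. a b i \<odot>\<^bsub>F\<^esub> (?u \<otimes> c b))"
    proof (rule F.null_sum)
      fix b assume "b \<in> {..<k}"
      thus "null R (self_module R) F {..<Suc k} x (\<lambda>i. a b i \<odot>\<^bsub>F\<^esub> (?u \<otimes> c b))"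
        by (intro F.null_single syz) (use uR c(1) in auto)
    qed simp
    hence n2: "null R (self_module R) F {..<Suc k} x (\<lambda>i. \<Oplus>b\<in>{..<k}. a b i [^] q \<otimes> (?u \<otimes> c b))" by simp
    have "null R (self_module R) F {..<Suc k} x (\<lambda>i. s \<otimes> (?u \<otimes> t i))"
    proof (rule null_cong[OF F.null_add[OF n1 n2]])
      fix i show "s \<otimes> (?u \<otimes> t i) \<in> carrier F" using sR uR t by simp
      assume "i \<in> {..<Suc k}"
      then consider "i = k" | "i < k" by (auto simp: less_Suc_eq)
      thus "s \<otimes> (?u \<otimes> t i) = ((\<lambda>i. ?u \<otimes> t' i)(k := \<zero>)) i \<oplus>\<^bsub>F\<^esub> (\<Oplus>b\<in>{..<k}. a b i [^] q \<otimes> (?u \<otimes> c b))"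
      proof cases
        case 1
        have "(\<Oplus>b\<in>{..<k}. a b i [^] q \<otimes> (?u \<otimes> c b)) = (\<Oplus>b\<in>{..<k}. ?u \<otimes> (c b \<otimes> ?y b))"
          using 1 uR c(1) x by (intro finsum_cong') (auto simp: a_def m_ac)
        also have "\<dots> = ?u \<otimes> (s \<otimes> t k)" unfolding c(2) using uR c(1) y by (intro finsum_rdistr[symmetric]) auto
        finally show ?thesis using 1 uR sR t by (simp add: m_lcomm)
      next
        case 2
        have "(\<Oplus>b\<in>{..<k}. a b i [^] q \<otimes> (?u \<otimes> c b)) = (\<Oplus>b\<in>{..<k}. if i = b then (\<ominus> x k) [^] q \<otimes> (?u \<otimes> c b) else \<zero>)"
          using 2 uR c(1) x q_pos by (intro finsum_cong') (auto simp: a_def nat_pow_zero)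
        also have "\<dots> = (\<ominus> x k) [^] q \<otimes> (?u \<otimes> c i)" using 2 uR c(1) x by (intro finsum_singleton) auto
        also have "\<dots> = \<ominus> (?y k \<otimes> (?u \<otimes> c i))"
          using F.smult_l_minus[of "x k" "?u \<otimes> c i"] x uR c(1) by simp
        finally have eq: "(\<Oplus>b\<in>{..<k}. a b i [^] q \<otimes> (?u \<otimes> c b)) = \<ominus> (?y k \<otimes> (?u \<otimes> c i))" .
        have uq: "?u \<in> carrier R" using uR by simp
        have "s \<otimes> (?u \<otimes> t i) = ?u \<otimes> t' i \<oplus> \<ominus> (?y k \<otimes> (?u \<otimes> c i))"
          unfolding t'_def using sR uq t[of i] c(1)[of i] y[of k] by algebra
        thus ?thesis unfolding eq using 2 by simp
      qed
    qed
    hence "null R (self_module R) F {..<Suc k} x (\<lambda>i. s [^] q \<otimes> (?u \<otimes> t i))"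
      using null_smult_from_mult[of "self_module R" "{..<Suc k}" x s "\<lambda>i. ?u \<otimes> t i"] sR uR t by simp
    hence "null R (self_module R) F {..<Suc k} x (\<lambda>i. (s \<otimes> u) \<odot>\<^bsub>F\<^esub> t i)"
      using sR uR t by (simp add: nat_pow_distrib m_assoc)
    thus "\<exists>u\<in>carrier R - P. null R (self_module R) F {..<Suc k} x (\<lambda>i. u \<odot>\<^bsub>F\<^esub> t i)"
      using primeideal_mult_notin[OF prime s(1) u(1)] by blast
  qed
qed

text \<open>P has the generators r globally and x locally at P; a single s outside P clears the
  finitely many denominators that arise in passing from r to x.\<close>

lemma equational_prime_generators:
  assumes reg: "regular_system R P d x" and x: "\<And>i. x i \<in> carrier R"
    and r: "\<And>i. r i \<in> carrier R" and P: "P = Idl (r ` {..<n})"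
  shows "equational R F (carrier R - P) {..<n::nat} r"
proof -
  interpret regular_system R P d x by fact
  have "\<exists>h. (\<forall>k. h k \<in> carrier R) \<and> (j < d \<longrightarrow> (\<Oplus>k\<in>{..<n}. h k \<otimes> r k) = x j)" for j
  proof (cases "j < d")
    case True
    hence "x j \<in> Idl (r ` {..<n})" using x_in unfolding P by auto
    thus ?thesis using F.genideal_lincomb[of "{..<n}" r "x j"] r by (metis finite_lessThan)
  qed (intro exI[of _ "\<lambda>_. \<zero>"], auto)
  then obtain h where h: "\<And>k j. h j k \<in> carrier R" "\<And>j. j < d \<Longrightarrow> (\<Oplus>k\<in>{..<n}. h j k \<otimes> r k) = x j" by metis
  have xs: "x ` {..<d} \<subseteq> carrier R" using x by auto
  have "r ` {..<n} \<subseteq> P" unfolding P using r by (intro genideal_self) auto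
  hence "\<exists>s\<in>carrier R - P. \<forall>i<m. s \<otimes> r i \<in> Idl (x ` {..<d})" if "m \<le> n" for m
    using that
  proof (induction m)
    case 0 then show ?case using primeideal_one_notin[OF prime] by blast
  next
    case (Suc m)
    then obtain s where s: "s \<in> carrier R - P" "\<And>i. i < m \<Longrightarrow> s \<otimes> r i \<in> Idl (x ` {..<d})" by auto
    have "r m \<in> P" using Suc.prems by auto
    then obtain s' where s': "s' \<in> carrier R - P" "s' \<otimes> r m \<in> Idl (x ` {..<d})" using x_gen by (auto simp: saturation_def)
    have "(s' \<otimes> s) \<otimes> r i \<in> Idl (x ` {..<d})" if "i < Suc m" for i
    proof (cases "i = m")
      case True
      have "(s' \<otimes> s) \<otimes> r m = s \<otimes> (s' \<otimes> r m)" using s s' r[of m] by (simp add: m_ac)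
      thus ?thesis using True s s' ideal.I_l_closed[OF genideal_ideal[OF xs] s'(2)] by simp
    next
      case False
      have "(s' \<otimes> s) \<otimes> r i = s' \<otimes> (s \<otimes> r i)" using s s' r[of i] by (simp add: m_ac)
      thus ?thesis using False that s s' ideal.I_l_closed[OF genideal_ideal[OF xs] s(2)] by simp
    qed
    thus ?case using primeideal_mult_notin[OF prime s'(1) s(1)] by blast
  qed
  then obtain s where s: "s \<in> carrier R - P" "\<And>i. i < n \<Longrightarrow> s \<otimes> r i \<in> Idl (x ` {..<d})" by blast
  have "\<exists>g. (\<forall>k. g k \<in> carrier R) \<and> (i < n \<longrightarrow> s \<otimes> r i = (\<Oplus>j\<in>{..<d}. g j \<otimes> x j))" for i
  proof (cases "i < n")
    case True
    thus ?thesis using F.genideal_lincomb[of "{..<d}" x "s \<otimes> r i"] x s by (metis finite_lessThan)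
  qed (intro exI[of _ "\<lambda>_. \<zero>"], auto)
  then obtain g where g: "\<And>k i. g i k \<in> carrier R" "\<And>i. i < n \<Longrightarrow> s \<otimes> r i = (\<Oplus>j\<in>{..<d}. g i j \<otimes> x j)" by metis
  show ?thesis
    by (rule F.equational_change_generators[OF prime equational_regular_system[OF reg x order_refl] r x,
        where h = "\<lambda>k j. h j k" and g = "\<lambda>j i. g i j"]) (use h g s in auto)
qed

text \<open>Kunz's theorem: the Frobenius endomorphism of a regular ring is flat.\<close>

theorem flat_frobenius:
  assumes W: "submonoid W R"
    and reg: "\<And>P. primeideal P R \<Longrightarrow> P \<inter> W = {} \<Longrightarrow> \<exists>d x. (\<forall>i. x i \<in> carrier R) \<and> regular_system R P d x"
  shows "flat_upto R W F"
proof -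
  interpret W: submonoid W R by fact
  have main: "equational R F W {..<n} r"
    if "ideal I R" "\<And>i. r i \<in> carrier R" "I = Idl (r ` {..<n})" for I n and r :: "nat \<Rightarrow> 'a"
    using that
  proof (induction I arbitrary: n r rule: noetherian_induct)
    case (1 I)
    interpret I: ideal I R by fact
    note r = 1(3) and Ir = 1(4)
    have adj: "Idl ((r(n := x)) ` {..<Suc n}) = adjoin R I x" if "x \<in> carrier R" for x
    proof -
      have "(r(n := x)) ` {..<Suc n} = insert x (r ` {..<n})" by (auto simp: less_Suc_eq image_iff)
      thus ?thesis using genideal_insert[of "r ` {..<n}" x] r that Ir by auto
    qed
    have equational_adj: "equational R F W {..<Suc n} (r(n := x))" if x: "x \<in> carrier R" "x \<notin> I" for x
    proof (rule 1(2)[of "adjoin R I x"])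
      show "ideal (adjoin R I x) R" by (rule adjoin_ideal[OF 1(1) x(1)])
      show "I \<subset> adjoin R I x" using adjoin_superset[OF 1(1) x(1)] x(2) by auto
      show "(r(n := x)) i \<in> carrier R" for i using r x by simp
      show "adjoin R I x = Idl ((r(n := x)) ` {..<Suc n})" using adj[OF x(1)] by simp
    qed
    \<comment> \<open>An ideal that meets W is settled by the Koszul relations, and a non-prime one
      by the exact sequence for a product x y in I without its factors. The case of a prime disjoint
      from W is the one that uses regularity.\<close>
    consider (meets) "I \<inter> W \<noteq> {}" | (notprime) "I \<inter> W = {}" "\<not> primeideal I R" | (prime) "I \<inter> W = {}" "primeideal I R" by blast
    then show ?case
    proof cases
      case meets
      then obtain w where w: "w \<in> W" "w \<in> Idl (r ` {..<n})" using Ir by blast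
      show ?thesis by (rule F.equational_meets[OF finite_lessThan r w])
    next
      case notprime
      have "carrier R \<noteq> I" using notprime(1) W.one_closed by auto
      then obtain x y where xy: "x \<in> carrier R" "y \<in> carrier R" "x \<otimes> y \<in> I" "x \<notin> I" "y \<notin> I"
        using I.primeidealCD[OF is_cring notprime(2)] by auto
      have J: "ideal (colon R I x) R" by (rule colon_ideal[OF 1(1) xy(1)])
      obtain B where B: "B \<subseteq> carrier R" "finite B" "colon R I x = Idl B" using finetely_gen[OF J] by auto
      obtain xs where xs: "set xs = B" using finite_list[OF B(2)] by auto
      define b where "b j = (if j < length xs then xs ! j else \<zero>)" for j
      have bR: "b j \<in> carrier R" for j using B(1) xs by (auto simp: b_def)
      have "b ` {..<length xs} = B" using xs by (auto simp: b_def set_conv_nth)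
      hence col: "colon R (Idl (r ` {..<n})) x = Idl (b ` {..<length xs})" using B(3) Ir by simp
      have gb: "equational R F W {..<length xs} b"
      proof (rule 1(2)[OF J _ bR])
        show "I \<subset> colon R I x" using colon_superset[OF 1(1) xy(1)] xy by (auto simp: colon_def)
        show "colon R I x = Idl (b ` {..<length xs})" using col Ir by simp
      qed
      show ?thesis by (rule F.equational_extension[OF r xy(1) bR W col equational_adj[OF xy(1,4)] gb])
    next
      case prime
      interpret P: primeideal I R by (rule prime(2))
      obtain d x where dx: "\<And>i. x i \<in> carrier R" "regular_system R I d x" using reg[OF prime(2,1)] by blast
      \<comment> \<open>All relations of r with entries in F, cut off at n. This is a submodule of
        R^n for ordinary multiplication, so the multipliers outside I obtained for single relations
        combine into one.\<close>
      define Z where "Z = {t. (\<forall>i. t i \<in> carrier R) \<and> (\<forall>i\<ge>n. t i = \<zero>) \<and> (\<Oplus>i\<in>{..<n}. r i [^] q \<otimes> t i) = \<zero>}"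
      have "\<exists>s\<in>carrier R - I. \<forall>z\<in>Z. null R (self_module R) F {..<n} r (\<lambda>i. s \<otimes> z i)"
      proof (rule uniform_multiplier[OF prime(2)])
        show "z i \<in> carrier R" if "z \<in> Z" for z i using that by (simp add: Z_def)
        show "z i = \<zero>" if "z \<in> Z" "n \<le> i" for z i using that by (simp add: Z_def)
        show "(\<lambda>i. z i \<oplus> z' i) \<in> Z" if "z \<in> Z" "z' \<in> Z" for z z'
        proof -
          have "(\<Oplus>i\<in>{..<n}. r i [^] q \<otimes> (z i \<oplus> z' i)) = (\<Oplus>i\<in>{..<n}. r i [^] q \<otimes> z i \<oplus> r i [^] q \<otimes> z' i)"
            using that r by (intro finsum_cong') (auto simp: Z_def r_distr)
          also have "\<dots> = (\<Oplus>i\<in>{..<n}. r i [^] q \<otimes> z i) \<oplus> (\<Oplus>i\<in>{..<n}. r i [^] q \<otimes> z' i)"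
            using that r by (intro finsum_addf) (auto simp: Z_def)
          finally show ?thesis using that by (simp add: Z_def)
        qed
        show "(\<lambda>i. c \<otimes> z i) \<in> Z" if "z \<in> Z" "c \<in> carrier R" for z c
        proof -
          have "(\<Oplus>i\<in>{..<n}. r i [^] q \<otimes> (c \<otimes> z i)) = (\<Oplus>i\<in>{..<n}. c \<otimes> (r i [^] q \<otimes> z i))"
            using that r by (intro finsum_cong') (auto simp: Z_def m_lcomm)
          also have "\<dots> = c \<otimes> (\<Oplus>i\<in>{..<n}. r i [^] q \<otimes> z i)"
            using that r by (intro finsum_rdistr[symmetric]) (auto simp: Z_def)
          finally show ?thesis using that by (simp add: Z_def)
        qed
        show "null R (self_module R) F {..<n} r (\<lambda>i. z i \<oplus> z' i)"
          if "null R (self_module R) F {..<n} r z" "null R (self_module R) F {..<n} r z'" for z z'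
          using F.null_add[OF that] by simp
        show "null R (self_module R) F {..<n} r (\<lambda>i. c \<otimes> z i)"
          if "null R (self_module R) F {..<n} r z" "c \<in> carrier R" for z c by (rule null_mult[OF that])
        show "\<exists>s\<in>carrier R - I. null R (self_module R) F {..<n} r (\<lambda>i. s \<otimes> z i)" if z: "z \<in> Z" for z
        proof -
          have "\<And>i. z i \<in> carrier F" "(\<Oplus>\<^bsub>F\<^esub>i\<in>{..<n}. r i \<odot>\<^bsub>F\<^esub> z i) = \<zero>\<^bsub>F\<^esub>" using z by (auto simp: Z_def)
          then obtain u where "u \<in> carrier R - I" "null R (self_module R) F {..<n} r (\<lambda>i. u \<odot>\<^bsub>F\<^esub> z i)"
            by (rule F.equationalD[OF equational_prime_generators[OF dx(2,1) r Ir]])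
          thus ?thesis using primeideal_pow_notin[OF prime(2), of u q] by auto
        qed
      qed
      then obtain s where s: "s \<in> carrier R - I" "\<And>z. z \<in> Z \<Longrightarrow> null R (self_module R) F {..<n} r (\<lambda>i. s \<otimes> z i)" by blast
      have sR: "s \<in> carrier R" using s by simp
      show ?thesis unfolding equational_def
      proof safe
        fix t assume t': "\<forall>i. t i \<in> carrier F" and rel: "(\<Oplus>\<^bsub>F\<^esub>i\<in>{..<n}. r i \<odot>\<^bsub>F\<^esub> t i) = \<zero>\<^bsub>F\<^esub>"
        hence t: "\<And>i. t i \<in> carrier F" by simp
        define v where "v = t(n := \<zero>\<^bsub>F\<^esub>)"
        have v: "\<And>i. v i \<in> carrier F" using t by (simp add: v_def)
        have rel_s: "(\<Oplus>\<^bsub>F\<^esub>i\<in>{..<Suc n}. (r(n := s)) i \<odot>\<^bsub>F\<^esub> v i) = \<zero>\<^bsub>F\<^esub>"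
          unfolding v_def using F.finsum_extend_zero[of r s t n, OF r sR t] rel by metis
        have gs: "equational R F W {..<Suc n} (r(n := s))" using equational_adj[of s] s by auto
        obtain u where u: "u \<in> W" "null R (self_module R) F {..<Suc n} (r(n := s)) (\<lambda>i. u \<odot>\<^bsub>F\<^esub> v i)"
          by (rule F.equationalD[OF gs v rel_s])
        have uR: "u \<in> carrier R" using u by auto
        \<comment> \<open>As I is prime and s is outside it, I : s = I. The exact sequence is used
          with the generators r once more for the colon ideal, and the matrix that expresses s r_j
          by the r_i is s times the identity.\<close>
        have colI: "colon R (Idl (r ` {..<n})) s \<subseteq> Idl (r ` {..<n})"
          using P.I_prime[OF sR] s(1) unfolding Ir[symmetric] by (auto simp: colon_def)
        let ?\<alpha> = "\<lambda>i j. if i = j then s else \<zero>"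
        have "s \<otimes> r j = (\<Oplus>i\<in>{..<n}. ?\<alpha> i j \<otimes> r i)" if "j < n" for j
        proof -
          have "(\<Oplus>i\<in>{..<n}. ?\<alpha> i j \<otimes> r i) = (\<Oplus>i\<in>{..<n}. if j = i then s \<otimes> r i else \<zero>)"
            using r sR by (intro finsum_cong') auto
          also have "\<dots> = s \<otimes> r j" using r sR that by (intro finsum_singleton) auto
          finally show ?thesis by simp
        qed
        note \<alpha> = this
        have \<alpha>R: "?\<alpha> i j \<in> carrier R" for i j using sR by simp
        obtain y where y: "\<And>j. y j \<in> carrier F" "u \<odot>\<^bsub>F\<^esub> v n = (\<Oplus>\<^bsub>F\<^esub>j\<in>{..<n}. r j \<odot>\<^bsub>F\<^esub> y j)"
          "null R (self_module R) F {..<n} r (\<lambda>i. u \<odot>\<^bsub>F\<^esub> v i \<oplus>\<^bsub>F\<^esub> (\<Oplus>\<^bsub>F\<^esub>j\<in>{..<n}. ?\<alpha> i j \<odot>\<^bsub>F\<^esub> y j))"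
          using F.null_extension[of n r s "\<lambda>i. u \<odot>\<^bsub>F\<^esub> v i" r n ?\<alpha>, OF u(2) r sR r colI \<alpha>R \<alpha>] by blast
        have yR: "\<And>j. y j \<in> carrier R" using y(1) by simp
        \<comment> \<open>The correction y is itself a relation of r. Cut off at n it lies in Z, so
          s annihilates it up to trivial relations, and the correction term can be removed.\<close>
        define z where "z j = (if j < n then y j else \<zero>)" for j
        have "(\<Oplus>j\<in>{..<n}. r j [^] q \<otimes> y j) = \<zero>" using y(2) uR by (simp add: v_def)
        moreover have "(\<Oplus>j\<in>{..<n}. r j [^] q \<otimes> z j) = (\<Oplus>j\<in>{..<n}. r j [^] q \<otimes> y j)"
          using r yR by (intro finsum_cong') (auto simp: z_def)
        ultimately have "z \<in> Z" using yR by (auto simp: Z_def z_def)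
        hence "null R (self_module R) F {..<n} r (\<lambda>i. s [^] q \<otimes> z i)"
          by (rule null_smult_from_mult[OF s(2) sR]) (use yR in \<open>auto simp: z_def\<close>)
        hence n1: "null R (self_module R) F {..<n} r (\<lambda>i. s [^] q \<otimes> y i)"
          by (rule null_cong) (use sR yR in \<open>auto simp: z_def\<close>)
        have n2: "null R (self_module R) F {..<n} r (\<lambda>i. u [^] q \<otimes> v i \<oplus>\<^bsub>F\<^esub> s [^] q \<otimes> y i)"
        proof (rule null_cong[OF y(3)])
          fix i show "u [^] q \<otimes> v i \<oplus>\<^bsub>F\<^esub> s [^] q \<otimes> y i \<in> carrier F" using uR v sR yR by auto
          assume i: "i \<in> {..<n}"
          have "(\<Oplus>j\<in>{..<n}. ?\<alpha> i j [^] q \<otimes> y j) = (\<Oplus>j\<in>{..<n}. if i = j then s [^] q \<otimes> y j else \<zero>)"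
            using sR yR q_pos by (intro finsum_cong') (auto simp: nat_pow_zero)
          also have "\<dots> = s [^] q \<otimes> y i" using sR yR i by (intro finsum_singleton) auto
          finally show "u [^] q \<otimes> v i \<oplus>\<^bsub>F\<^esub> s [^] q \<otimes> y i = u \<odot>\<^bsub>F\<^esub> v i \<oplus>\<^bsub>F\<^esub> (\<Oplus>\<^bsub>F\<^esub>j\<in>{..<n}. ?\<alpha> i j \<odot>\<^bsub>F\<^esub> y j)"
            by simp
        qed
        have "null R (self_module R) F {..<n} r (\<lambda>i. u [^] q \<otimes> v i)"
          by (rule F.null_cancel[OF n2 n1]) (use uR v in auto)
        hence "null R (self_module R) F {..<n} r (\<lambda>i. u \<odot>\<^bsub>F\<^esub> t i)"
          by (rule null_cong) (use uR t in \<open>auto simp: v_def\<close>)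
        thus "\<exists>u\<in>W. null R (self_module R) F {..<n} r (\<lambda>i. u \<odot>\<^bsub>F\<^esub> t i)" using u(1) by blast
      qed
    qed
  qed
  show ?thesis unfolding flat_upto_def
  proof (intro allI impI)
    fix n and r :: "nat \<Rightarrow> 'a" assume r: "\<forall>i. r i \<in> carrier R"
    hence "ideal (Idl (r ` {..<n})) R" by (intro genideal_ideal) auto
    thus "equational R F W {..<n} r" using main r by blast
  qed
qed

end

section \<open>Localization\<close>

text \<open>The operations of localizations and of the perfect closure are unions over pairs of
  representatives; such a union is a single class once the summand does not depend on the
  choice.\<close>

lemma UN_pair_constant:
  assumes "U \<noteq> {}" "V \<noteq> {}" "\<And>x s y t. (x, s) \<in> U \<Longrightarrow> (y, t) \<in> V \<Longrightarrow> f x s y t = C"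
  shows "(\<Union>(x, s) \<in> U. \<Union>(y, t) \<in> V. f x s y t) = C"
  using assms by (auto simp: split_beta)

section \<open>Localization of modules\<close>

locale module_localization = module R M for R (structure) and M (structure) +
  fixes W assumes W: "submonoid W R"
begin

sublocale W: submonoid W R by (rule W)

definition frac :: "'c \<Rightarrow> 'a \<Rightarrow> ('c \<times> 'a) set" where
  "frac x s = fraction_rel R W M `` {(x, s)}"

lemma equiv_fraction_rel: "equiv (carrier M \<times> W) (fraction_rel R W M)"
proof (rule equivI)
  show "fraction_rel R W M \<subseteq> (carrier M \<times> W) \<times> (carrier M \<times> W)" by (auto simp: fraction_rel_def)
  show "refl_on (carrier M \<times> W) (fraction_rel R W M)"
    using W.one_closed by (auto simp: refl_on_def fraction_rel_def)
  show "sym (fraction_rel R W M)" by (auto simp: sym_def fraction_rel_def) metis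
  show "trans (fraction_rel R W M)"
  proof (rule transI, clarify)
    fix x s y t z r
    assume "((x, s), (y, t)) \<in> fraction_rel R W M" "((y, t), (z, r)) \<in> fraction_rel R W M"
    then obtain u v where a: "x \<in> carrier M" "y \<in> carrier M" "z \<in> carrier M" "s \<in> W" "t \<in> W" "r \<in> W"
      "u \<in> W" "v \<in> W" "u \<odot>\<^bsub>M\<^esub> (t \<odot>\<^bsub>M\<^esub> x) = u \<odot>\<^bsub>M\<^esub> (s \<odot>\<^bsub>M\<^esub> y)" "v \<odot>\<^bsub>M\<^esub> (r \<odot>\<^bsub>M\<^esub> y) = v \<odot>\<^bsub>M\<^esub> (t \<odot>\<^bsub>M\<^esub> z)"
      by (auto simp: fraction_rel_def)
    have R: "s \<in> carrier R" "t \<in> carrier R" "r \<in> carrier R" "u \<in> carrier R" "v \<in> carrier R" using a by auto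
    have "(u \<otimes> v \<otimes> t) \<odot>\<^bsub>M\<^esub> (r \<odot>\<^bsub>M\<^esub> x) = (v \<otimes> r) \<odot>\<^bsub>M\<^esub> (u \<odot>\<^bsub>M\<^esub> (t \<odot>\<^bsub>M\<^esub> x))"
      using a(1-3) R by (simp add: smult_assoc1[symmetric] m_ac)
    also have "\<dots> = (u \<otimes> s) \<odot>\<^bsub>M\<^esub> (v \<odot>\<^bsub>M\<^esub> (r \<odot>\<^bsub>M\<^esub> y))"
      unfolding a(9) using a(1-3) R by (simp add: smult_assoc1[symmetric] m_ac)
    also have "\<dots> = (u \<otimes> v \<otimes> t) \<odot>\<^bsub>M\<^esub> (s \<odot>\<^bsub>M\<^esub> z)"
      unfolding a(10) using a(1-3) R by (simp add: smult_assoc1[symmetric] m_ac)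
    finally show "((x, s), (z, r)) \<in> fraction_rel R W M"
      using a unfolding fraction_rel_def by blast
  qed
qed

lemma frac_eq_iff:
  assumes "x \<in> carrier M" "y \<in> carrier M" "s \<in> W" "t \<in> W"
  shows "frac x s = frac y t \<longleftrightarrow> (\<exists>u\<in>W. u \<odot>\<^bsub>M\<^esub> (t \<odot>\<^bsub>M\<^esub> x) = u \<odot>\<^bsub>M\<^esub> (s \<odot>\<^bsub>M\<^esub> y))"
  unfolding frac_def
  by (subst eq_equiv_class_iff[OF equiv_fraction_rel]) (use assms in \<open>auto simp: fraction_rel_def\<close>)

lemma mem_frac: "(y, t) \<in> frac x s \<longleftrightarrow> ((x, s), (y, t)) \<in> fraction_rel R W M"
  by (simp add: frac_def)

lemma mem_fracD:
  assumes "(y, t) \<in> frac x s"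
  shows "y \<in> carrier M" "t \<in> W" "frac y t = frac x s"
proof -
  have *: "((x, s), (y, t)) \<in> fraction_rel R W M" using assms by (simp add: mem_frac)
  show "frac y t = frac x s" using equiv_class_eq[OF equiv_fraction_rel *] by (simp add: frac_def)
  show "y \<in> carrier M" "t \<in> W" using * by (auto simp: fraction_rel_def)
qed

lemma frac_self: "x \<in> carrier M \<Longrightarrow> s \<in> W \<Longrightarrow> (x, s) \<in> frac x s"
  unfolding frac_def by (rule equiv_class_self[OF equiv_fraction_rel]) simp

lemma frac_nonempty: "x \<in> carrier M \<Longrightarrow> s \<in> W \<Longrightarrow> frac x s \<noteq> {}"
  using frac_self by blast

lemma frac_cancel:
  assumes "x \<in> carrier M" "s \<in> W" "u \<in> W"
  shows "frac (u \<odot>\<^bsub>M\<^esub> x) (u \<otimes> s) = frac x s"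
  using assms W.one_closed
  by (subst frac_eq_iff) (auto simp: smult_assoc1[symmetric] m_ac intro!: bexI[of _ \<one>])

abbreviation "L \<equiv> localized_module R W M"

lemma carrier_localized: "carrier L = {frac x s | x s. x \<in> carrier M \<and> s \<in> W}"
  by (auto simp: localized_module_def Let_def quotient_def frac_def)

lemma localized_closed [simp]: "x \<in> carrier M \<Longrightarrow> s \<in> W \<Longrightarrow> frac x s \<in> carrier L"
  by (auto simp: carrier_localized)

lemma zero_localized: "\<zero>\<^bsub>L\<^esub> = frac \<zero>\<^bsub>M\<^esub> \<one>"
  by (simp add: localized_module_def Let_def frac_def)

lemma add_localized:
  assumes x: "x \<in> carrier M" "s \<in> W" and y: "y \<in> carrier M" "t \<in> W"
  shows "frac x s \<oplus>\<^bsub>L\<^esub> frac y t = frac (t \<odot>\<^bsub>M\<^esub> x \<oplus>\<^bsub>M\<^esub> s \<odot>\<^bsub>M\<^esub> y) (s \<otimes> t)"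
proof -
  have "frac x s \<oplus>\<^bsub>L\<^esub> frac y t
      = (\<Union>(x', s') \<in> frac x s. \<Union>(y', t') \<in> frac y t. frac (t' \<odot>\<^bsub>M\<^esub> x' \<oplus>\<^bsub>M\<^esub> s' \<odot>\<^bsub>M\<^esub> y') (s' \<otimes> t'))"
    by (simp add: localized_module_def Let_def frac_def)
  also have "\<dots> = frac (t \<odot>\<^bsub>M\<^esub> x \<oplus>\<^bsub>M\<^esub> s \<odot>\<^bsub>M\<^esub> y) (s \<otimes> t)"
  proof (rule UN_pair_constant)
    fix x' s' y' t' assume "(x', s') \<in> frac x s" "(y', t') \<in> frac y t"
    note m = mem_fracD[OF this(1)] mem_fracD[OF this(2)]
    obtain u where u: "u \<in> W" "u \<odot>\<^bsub>M\<^esub> (s \<odot>\<^bsub>M\<^esub> x') = u \<odot>\<^bsub>M\<^esub> (s' \<odot>\<^bsub>M\<^esub> x)" using m(3) frac_eq_iff m x by auto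
    obtain v where v: "v \<in> W" "v \<odot>\<^bsub>M\<^esub> (t \<odot>\<^bsub>M\<^esub> y') = v \<odot>\<^bsub>M\<^esub> (t' \<odot>\<^bsub>M\<^esub> y)" using m(6) frac_eq_iff m y by auto
    have R: "s \<in> carrier R" "t \<in> carrier R" "s' \<in> carrier R" "t' \<in> carrier R" "u \<in> carrier R" "v \<in> carrier R"
      using x y m u v by auto
    have "(u \<otimes> v) \<odot>\<^bsub>M\<^esub> ((s \<otimes> t) \<odot>\<^bsub>M\<^esub> (t' \<odot>\<^bsub>M\<^esub> x' \<oplus>\<^bsub>M\<^esub> s' \<odot>\<^bsub>M\<^esub> y'))
        = (v \<otimes> t \<otimes> t') \<odot>\<^bsub>M\<^esub> (u \<odot>\<^bsub>M\<^esub> (s \<odot>\<^bsub>M\<^esub> x')) \<oplus>\<^bsub>M\<^esub> (u \<otimes> s \<otimes> s') \<odot>\<^bsub>M\<^esub> (v \<odot>\<^bsub>M\<^esub> (t \<odot>\<^bsub>M\<^esub> y'))"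
      using m(1,4) R by (simp add: smult_assoc1[symmetric] smult_r_distr m_ac)
    also have "\<dots> = (u \<otimes> v) \<odot>\<^bsub>M\<^esub> ((s' \<otimes> t') \<odot>\<^bsub>M\<^esub> (t \<odot>\<^bsub>M\<^esub> x \<oplus>\<^bsub>M\<^esub> s \<odot>\<^bsub>M\<^esub> y))"
      unfolding u(2) v(2) using x(1) y(1) R by (simp add: smult_assoc1[symmetric] smult_r_distr m_ac)
    finally show "frac (t' \<odot>\<^bsub>M\<^esub> x' \<oplus>\<^bsub>M\<^esub> s' \<odot>\<^bsub>M\<^esub> y') (s' \<otimes> t') = frac (t \<odot>\<^bsub>M\<^esub> x \<oplus>\<^bsub>M\<^esub> s \<odot>\<^bsub>M\<^esub> y) (s \<otimes> t)"
      using x y m u v R by (subst frac_eq_iff) auto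
  qed (use frac_nonempty x y in auto)
  finally show ?thesis .
qed

lemma smult_localized:
  assumes a: "a \<in> carrier R" and x: "x \<in> carrier M" "s \<in> W"
  shows "a \<odot>\<^bsub>L\<^esub> frac x s = frac (a \<odot>\<^bsub>M\<^esub> x) s"
proof -
  have "a \<odot>\<^bsub>L\<^esub> frac x s = (\<Union>(x', s') \<in> frac x s. frac (a \<odot>\<^bsub>M\<^esub> x') s')"
    by (simp add: localized_module_def Let_def frac_def)
  also have "\<dots> = (\<Union>p \<in> frac x s. frac (a \<odot>\<^bsub>M\<^esub> x) s)"
  proof (rule SUP_cong[OF refl], clarify)
    fix x' s' assume "(x', s') \<in> frac x s"
    note m = mem_fracD[OF this]
    obtain u where u: "u \<in> W" "u \<odot>\<^bsub>M\<^esub> (s \<odot>\<^bsub>M\<^esub> x') = u \<odot>\<^bsub>M\<^esub> (s' \<odot>\<^bsub>M\<^esub> x)" using m(3) frac_eq_iff m x by auto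
    have R: "s \<in> carrier R" "s' \<in> carrier R" "u \<in> carrier R" using x m u by auto
    have "u \<odot>\<^bsub>M\<^esub> (s \<odot>\<^bsub>M\<^esub> (a \<odot>\<^bsub>M\<^esub> x')) = a \<odot>\<^bsub>M\<^esub> (u \<odot>\<^bsub>M\<^esub> (s \<odot>\<^bsub>M\<^esub> x'))"
      using m(1) R a by (simp add: smult_assoc1[symmetric] m_ac)
    also have "\<dots> = u \<odot>\<^bsub>M\<^esub> (s' \<odot>\<^bsub>M\<^esub> (a \<odot>\<^bsub>M\<^esub> x))"
      unfolding u(2) using x(1) R a by (simp add: smult_assoc1[symmetric] m_ac)
    finally show "frac (a \<odot>\<^bsub>M\<^esub> x') s' = frac (a \<odot>\<^bsub>M\<^esub> x) s" using x m u a by (subst frac_eq_iff) auto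
  qed
  also have "\<dots> = frac (a \<odot>\<^bsub>M\<^esub> x) s" using frac_nonempty[OF x] by simp
  finally show ?thesis .
qed

lemma module_localized: "module R L"
proof (rule moduleI[OF is_cring])
  show "abelian_group L"
  proof (rule abelian_groupI)
    fix U V Y assume "U \<in> carrier L" "V \<in> carrier L" "Y \<in> carrier L"
    then obtain x s y t z r where a: "U = frac x s" "V = frac y t" "Y = frac z r"
      "x \<in> carrier M" "y \<in> carrier M" "z \<in> carrier M" "s \<in> W" "t \<in> W" "r \<in> W"
      by (auto simp: carrier_localized)
    have R: "s \<in> carrier R" "t \<in> carrier R" "r \<in> carrier R" using a by auto
    show "U \<oplus>\<^bsub>L\<^esub> V \<in> carrier L" using a R by (simp add: add_localized)
    show "U \<oplus>\<^bsub>L\<^esub> V \<oplus>\<^bsub>L\<^esub> Y = U \<oplus>\<^bsub>L\<^esub> (V \<oplus>\<^bsub>L\<^esub> Y)"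
      using a R by (simp add: add_localized smult_r_distr smult_assoc1[symmetric] m_ac M.a_ac)
    show "U \<oplus>\<^bsub>L\<^esub> V = V \<oplus>\<^bsub>L\<^esub> U"
      using a R by (simp add: add_localized m_comm M.a_comm)
  next
    fix U assume "U \<in> carrier L"
    then obtain x s where a: "U = frac x s" "x \<in> carrier M" "s \<in> W" by (auto simp: carrier_localized)
    have R: "s \<in> carrier R" using a by auto
    show "\<zero>\<^bsub>L\<^esub> \<oplus>\<^bsub>L\<^esub> U = U" using a R by (simp add: zero_localized add_localized)
    have "frac (\<ominus>\<^bsub>M\<^esub> x) s \<oplus>\<^bsub>L\<^esub> U = frac \<zero>\<^bsub>M\<^esub> (s \<otimes> s)"
      using a R by (simp add: add_localized smult_r_minus M.l_neg)
    also have "\<dots> = \<zero>\<^bsub>L\<^esub>" using a R frac_cancel[of "\<zero>\<^bsub>M\<^esub>" \<one> "s \<otimes> s"] by (simp add: zero_localized)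
    finally show "\<exists>V\<in>carrier L. V \<oplus>\<^bsub>L\<^esub> U = \<zero>\<^bsub>L\<^esub>" using a by (intro bexI[of _ "frac (\<ominus>\<^bsub>M\<^esub> x) s"]) auto
  qed (simp add: zero_localized)
next
  fix a b U V assume ab: "a \<in> carrier R" "b \<in> carrier R" and "U \<in> carrier L"
  then obtain x s where x: "U = frac x s" "x \<in> carrier M" "s \<in> W" by (auto simp: carrier_localized)
  have R: "s \<in> carrier R" using x by auto
  have "a \<odot>\<^bsub>L\<^esub> U \<oplus>\<^bsub>L\<^esub> b \<odot>\<^bsub>L\<^esub> U = frac (s \<odot>\<^bsub>M\<^esub> (a \<odot>\<^bsub>M\<^esub> x \<oplus>\<^bsub>M\<^esub> b \<odot>\<^bsub>M\<^esub> x)) (s \<otimes> s)"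
    using x R ab by (simp add: smult_localized add_localized smult_r_distr)
  also have "\<dots> = frac (a \<odot>\<^bsub>M\<^esub> x \<oplus>\<^bsub>M\<^esub> b \<odot>\<^bsub>M\<^esub> x) s" using x ab by (intro frac_cancel) auto
  finally show "(a \<oplus> b) \<odot>\<^bsub>L\<^esub> U = a \<odot>\<^bsub>L\<^esub> U \<oplus>\<^bsub>L\<^esub> b \<odot>\<^bsub>L\<^esub> U"
    using x ab by (simp add: smult_localized smult_l_distr)
  show "(a \<otimes> b) \<odot>\<^bsub>L\<^esub> U = a \<odot>\<^bsub>L\<^esub> (b \<odot>\<^bsub>L\<^esub> U)" using x ab by (simp add: smult_localized smult_assoc1)
next
  fix a U V assume a: "a \<in> carrier R" and "U \<in> carrier L" "V \<in> carrier L"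
  then obtain x s y t where x: "U = frac x s" "x \<in> carrier M" "s \<in> W" "V = frac y t" "y \<in> carrier M" "t \<in> W"
    by (auto simp: carrier_localized)
  have R: "s \<in> carrier R" "t \<in> carrier R" using x by auto
  show "a \<odot>\<^bsub>L\<^esub> (U \<oplus>\<^bsub>L\<^esub> V) = a \<odot>\<^bsub>L\<^esub> U \<oplus>\<^bsub>L\<^esub> a \<odot>\<^bsub>L\<^esub> V"
    using x R a by (simp add: smult_localized add_localized smult_r_distr smult_assoc1[symmetric] m_comm)
next
  fix a U assume "a \<in> carrier R" "U \<in> carrier L"
  thus "a \<odot>\<^bsub>L\<^esub> U \<in> carrier L" by (auto simp: carrier_localized smult_localized) blast
qed (auto simp: carrier_localized smult_localized)

end

text \<open>Characterizes localizations up to isomorphism by units, denominators and kernel. This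
  allows the local ring at a prime of the localized ring, a set of classes of pairs of classes, to
  serve as the localization of R itself.\<close>

definition is_localization :: "('a \<Rightarrow> 'b) \<Rightarrow> ('a, 'm) ring_scheme \<Rightarrow> ('b, 'n) ring_scheme \<Rightarrow> 'a set \<Rightarrow> bool" where
  "is_localization h R B U \<longleftrightarrow> h \<in> ring_hom R B \<and> (\<forall>s\<in>U. h s \<in> Units B) \<and>
     (\<forall>b\<in>carrier B. \<exists>s\<in>U. \<exists>r\<in>carrier R. h s \<otimes>\<^bsub>B\<^esub> b = h r) \<and>
     (\<forall>r\<in>carrier R. h r = \<zero>\<^bsub>B\<^esub> \<longrightarrow> (\<exists>s\<in>U. s \<otimes>\<^bsub>R\<^esub> r = \<zero>\<^bsub>R\<^esub>))"

lemma (in cring) is_localization_localized_ring: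
  assumes W: "submonoid W R"
  shows "is_localization (\<lambda>r. fraction_rel R W (self_module R) `` {(r, \<one>)}) R (localized_ring R W) W"
proof -
  interpret module R "self_module R" by (rule module_self_module)
  interpret module_localization R "self_module R" W by (intro module_localization.intro module_localization_axioms.intro W module_self_module)
  let ?B = "localized_ring R W"
  have carr: "carrier ?B = carrier L" and zero: "\<zero>\<^bsub>?B\<^esub> = \<zero>\<^bsub>L\<^esub>" and add: "ring.add ?B = ring.add L"
    and one: "\<one>\<^bsub>?B\<^esub> = frac \<one> \<one>"
    by (simp_all add: localized_ring_def Let_def frac_def)
  have mult: "frac x s \<otimes>\<^bsub>?B\<^esub> frac y t = frac (x \<otimes> y) (s \<otimes> t)"
    if x: "x \<in> carrier R" "s \<in> W" and y: "y \<in> carrier R" "t \<in> W" for x s y t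
  proof -
    have "frac x s \<otimes>\<^bsub>?B\<^esub> frac y t = (\<Union>(x', s') \<in> frac x s. \<Union>(y', t') \<in> frac y t. frac (x' \<otimes> y') (s' \<otimes> t'))"
      by (simp add: localized_ring_def Let_def frac_def)
    also have "\<dots> = frac (x \<otimes> y) (s \<otimes> t)"
    proof (rule UN_pair_constant)
      fix x' s' y' t' assume "(x', s') \<in> frac x s" "(y', t') \<in> frac y t"
      note m = mem_fracD[OF this(1)] mem_fracD[OF this(2)]
      obtain u where u: "u \<in> W" "u \<otimes> (s \<otimes> x') = u \<otimes> (s' \<otimes> x)" using m(3) frac_eq_iff m x by auto
      obtain v where v: "v \<in> W" "v \<otimes> (t \<otimes> y') = v \<otimes> (t' \<otimes> y)" using m(6) frac_eq_iff m y by auto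
      have R: "s \<in> carrier R" "t \<in> carrier R" "s' \<in> carrier R" "t' \<in> carrier R" "u \<in> carrier R" "v \<in> carrier R"
          "x' \<in> carrier R" "y' \<in> carrier R"
        using x y m u v by auto
      have "(u \<otimes> v) \<otimes> ((s \<otimes> t) \<otimes> (x' \<otimes> y')) = (u \<otimes> (s \<otimes> x')) \<otimes> (v \<otimes> (t \<otimes> y'))"
        using R by (simp add: m_ac)
      also have "\<dots> = (u \<otimes> v) \<otimes> ((s' \<otimes> t') \<otimes> (x \<otimes> y))"
        unfolding u(2) v(2) using x y R by (simp add: m_ac)
      finally show "frac (x' \<otimes> y') (s' \<otimes> t') = frac (x \<otimes> y) (s \<otimes> t)"
        using x y m u v R by (subst frac_eq_iff) auto
    qed (use frac_nonempty x y in auto)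
    finally show ?thesis .
  qed
  show ?thesis unfolding is_localization_def frac_def[symmetric]
  proof (intro conjI ballI impI)
    show "(\<lambda>r. frac r \<one>) \<in> ring_hom R ?B"
      by (rule ring_hom_memI) (auto simp: carr mult add one add_localized)
    fix s assume s: "s \<in> W"
    have "frac s s = frac \<one> \<one>" using s frac_cancel[of \<one> \<one> s] by simp
    thus "frac s \<one> \<in> Units ?B"
      using s W.one_closed unfolding Units_def carr one
      by (intro CollectI conjI bexI[of _ "frac \<one> s"]) (simp_all add: mult)
  next
    fix b assume "b \<in> carrier ?B"
    then obtain x s where x: "b = frac x s" "x \<in> carrier R" "s \<in> W" by (auto simp: carr carrier_localized)
    have "frac s \<one> \<otimes>\<^bsub>?B\<^esub> b = frac x \<one>" using x frac_cancel[of x \<one> s] by (auto simp: mult)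
    thus "\<exists>s\<in>W. \<exists>r\<in>carrier R. frac s \<one> \<otimes>\<^bsub>?B\<^esub> b = frac r \<one>" using x by blast
  next
    fix r assume r: "r \<in> carrier R" "frac r \<one> = \<zero>\<^bsub>?B\<^esub>"
    then obtain u where "u \<in> W" "u \<otimes> (\<one> \<otimes> r) = u \<otimes> (\<one> \<otimes> \<zero>)"
      unfolding zero zero_localized using frac_eq_iff[of r \<zero> \<one> \<one>] by auto
    thus "\<exists>s\<in>W. s \<otimes> r = \<zero>" using r by auto
  qed
qed

section \<open>Extension of ideals and localization in two steps\<close>

locale ring_localization = R: cring R + B: cring B for R (structure) and B (structure) +
  fixes h U
  assumes loc: "is_localization h R B U" and U: "submonoid U R"
begin

sublocale U: submonoid U R by (rule U)

lemma hom: "h \<in> ring_hom R B" using loc by (simp add: is_localization_def)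

sublocale ring_hom_cring R B h
  by unfold_locales (rule hom)

lemma unit: "s \<in> U \<Longrightarrow> h s \<in> Units B" using loc by (simp add: is_localization_def)

lemma surj: "b \<in> carrier B \<Longrightarrow> \<exists>s\<in>U. \<exists>r\<in>carrier R. h s \<otimes>\<^bsub>B\<^esub> b = h r"
  using loc by (simp add: is_localization_def)

lemma eq_imp:
  assumes "h r = h r'" "r \<in> carrier R" "r' \<in> carrier R"
  shows "\<exists>s\<in>U. s \<otimes>\<^bsub>R\<^esub> r = s \<otimes>\<^bsub>R\<^esub> r'"
proof -
  have "h (r \<ominus>\<^bsub>R\<^esub> r') = \<zero>\<^bsub>B\<^esub>" using assms by (simp add: R.minus_eq B.r_neg)
  then obtain s where s: "s \<in> U" "s \<otimes>\<^bsub>R\<^esub> (r \<ominus>\<^bsub>R\<^esub> r') = \<zero>\<^bsub>R\<^esub>"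
    using loc assms unfolding is_localization_def by (metis R.minus_closed)
  have sR: "s \<in> carrier R" using s by auto
  have "s \<otimes>\<^bsub>R\<^esub> r = s \<otimes>\<^bsub>R\<^esub> (r \<ominus>\<^bsub>R\<^esub> r') \<oplus>\<^bsub>R\<^esub> s \<otimes>\<^bsub>R\<^esub> r'" using sR assms(2,3) by algebra
  thus ?thesis using s sR assms(3) by auto
qed

text \<open>The ideal generated by the image of I, stated without fractions: a suitable denominator
  carries the element into the image of I.\<close>

definition extension :: "'a set \<Rightarrow> 'c set" where
  "extension I = {b \<in> carrier B. \<exists>s\<in>U. \<exists>r\<in>I. h s \<otimes>\<^bsub>B\<^esub> b = h r}"

lemma extension_ideal:
  assumes I: "ideal I R"
  shows "ideal (extension I) B"
proof (rule B.idealI')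
  interpret I: ideal I R by fact
  show "extension I \<subseteq> carrier B" by (auto simp: extension_def)
  show "\<zero>\<^bsub>B\<^esub> \<in> extension I"
    unfolding extension_def using U.one_closed I.ideal_simps(1)
    by (intro CollectI conjI bexI[of _ "\<one>\<^bsub>R\<^esub>"] bexI[of _ "\<zero>\<^bsub>R\<^esub>"]) auto
  fix a assume "a \<in> extension I"
  then obtain s r where s: "a \<in> carrier B" "s \<in> U" "r \<in> I" "h s \<otimes>\<^bsub>B\<^esub> a = h r" by (auto simp: extension_def)
  have R: "s \<in> carrier R" "r \<in> carrier R" using s I.Icarr by auto
  { fix b assume "b \<in> extension I"
    then obtain t r' where t: "b \<in> carrier B" "t \<in> U" "r' \<in> I" "h t \<otimes>\<^bsub>B\<^esub> b = h r'" by (auto simp: extension_def)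
    have R': "t \<in> carrier R" "r' \<in> carrier R" using t I.Icarr by auto
    have "h (s \<otimes>\<^bsub>R\<^esub> t) \<otimes>\<^bsub>B\<^esub> (a \<oplus>\<^bsub>B\<^esub> b) = h t \<otimes>\<^bsub>B\<^esub> (h s \<otimes>\<^bsub>B\<^esub> a) \<oplus>\<^bsub>B\<^esub> h s \<otimes>\<^bsub>B\<^esub> (h t \<otimes>\<^bsub>B\<^esub> b)"
      using R R' s(1) t(1) by (simp add: B.r_distr B.m_ac)
    also have "\<dots> = h (t \<otimes>\<^bsub>R\<^esub> r \<oplus>\<^bsub>R\<^esub> s \<otimes>\<^bsub>R\<^esub> r')" unfolding s(4) t(4) using R R' by simp
    finally show "a \<oplus>\<^bsub>B\<^esub> b \<in> extension I"
      using s t R R' I.I_l_closed unfolding extension_def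
      by (intro CollectI conjI bexI[of _ "s \<otimes>\<^bsub>R\<^esub> t"] bexI[of _ "t \<otimes>\<^bsub>R\<^esub> r \<oplus>\<^bsub>R\<^esub> s \<otimes>\<^bsub>R\<^esub> r'"]) auto }
  fix c assume c: "c \<in> carrier B"
  then obtain t r' where t: "t \<in> U" "r' \<in> carrier R" "h t \<otimes>\<^bsub>B\<^esub> c = h r'" using surj by blast
  have R': "t \<in> carrier R" using t by auto
  have "h (t \<otimes>\<^bsub>R\<^esub> s) \<otimes>\<^bsub>B\<^esub> (c \<otimes>\<^bsub>B\<^esub> a) = (h t \<otimes>\<^bsub>B\<^esub> c) \<otimes>\<^bsub>B\<^esub> (h s \<otimes>\<^bsub>B\<^esub> a)"
    using R R' s(1) c by (simp add: B.m_ac)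
  also have "\<dots> = h (r' \<otimes>\<^bsub>R\<^esub> r)" unfolding s(4) t(3) using R t by simp
  finally show "c \<otimes>\<^bsub>B\<^esub> a \<in> extension I"
    using s t c I.I_l_closed unfolding extension_def
    by (intro CollectI conjI bexI[of _ "t \<otimes>\<^bsub>R\<^esub> s"] bexI[of _ "r' \<otimes>\<^bsub>R\<^esub> r"]) auto
qed

lemma extension_contract:
  assumes P: "primeideal P R" "P \<inter> U = {}" and r: "r \<in> carrier R"
  shows "h r \<in> extension P \<longleftrightarrow> r \<in> P"
proof
  interpret P: primeideal P R by fact
  show "h r \<in> extension P" if "r \<in> P"
    using that r U.one_closed unfolding extension_def
    by (intro CollectI conjI bexI[of _ "\<one>\<^bsub>R\<^esub>"] bexI[of _ r]) auto
  assume "h r \<in> extension P"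
  then obtain s r' where s: "s \<in> U" "r' \<in> P" "h s \<otimes>\<^bsub>B\<^esub> h r = h r'" by (auto simp: extension_def)
  have R: "s \<in> carrier R" "r' \<in> carrier R" using s P.Icarr by auto
  have "h (s \<otimes>\<^bsub>R\<^esub> r) = h r'" using s R r by simp
  then obtain u where u: "u \<in> U" "u \<otimes>\<^bsub>R\<^esub> (s \<otimes>\<^bsub>R\<^esub> r) = u \<otimes>\<^bsub>R\<^esub> r'" using eq_imp[of "s \<otimes>\<^bsub>R\<^esub> r" r'] R r by auto
  have "u \<otimes>\<^bsub>R\<^esub> (s \<otimes>\<^bsub>R\<^esub> r) \<in> P" unfolding u(2) using s u P.I_l_closed by auto
  thus "r \<in> P" using P.I_prime[of u "s \<otimes>\<^bsub>R\<^esub> r"] P.I_prime[of s r] u s R r P(2) by auto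
qed

lemma extension_prime:
  assumes P: "primeideal P R" "P \<inter> U = {}"
  shows "primeideal (extension P) B"
proof (rule primeidealI)
  interpret P: primeideal P R by fact
  show "ideal (extension P) B" by (rule extension_ideal) (rule P.is_ideal)
  show "cring B" by (rule B.is_cring)
  have "\<one>\<^bsub>R\<^esub> \<notin> P" using P(2) U.one_closed by auto
  hence "\<one>\<^bsub>B\<^esub> \<notin> extension P" using extension_contract[OF P, of "\<one>\<^bsub>R\<^esub>"] by simp
  thus "carrier B \<noteq> extension P" by auto
  fix a b assume ab: "a \<in> carrier B" "b \<in> carrier B" "a \<otimes>\<^bsub>B\<^esub> b \<in> extension P"
  interpret E: ideal "extension P" B by (rule extension_ideal) (rule P.is_ideal)
  obtain s r where s: "s \<in> U" "r \<in> carrier R" "h s \<otimes>\<^bsub>B\<^esub> a = h r" using surj ab by blast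
  obtain t r' where t: "t \<in> U" "r' \<in> carrier R" "h t \<otimes>\<^bsub>B\<^esub> b = h r'" using surj ab by blast
  have R: "s \<in> carrier R" "t \<in> carrier R" using s t by auto
  have "h (r \<otimes>\<^bsub>R\<^esub> r') = h (s \<otimes>\<^bsub>R\<^esub> t) \<otimes>\<^bsub>B\<^esub> (a \<otimes>\<^bsub>B\<^esub> b)"
    using s t R ab(1,2) by (simp add: s(3)[symmetric] t(3)[symmetric] B.m_ac)
  also have "\<dots> \<in> extension P" using ab(3) R E.I_l_closed by simp
  finally have "r \<otimes>\<^bsub>R\<^esub> r' \<in> P" using extension_contract[OF P, of "r \<otimes>\<^bsub>R\<^esub> r'"] s t by simp
  hence "r \<in> P \<or> r' \<in> P" using P.I_prime s t by auto
  thus "a \<in> extension P \<or> b \<in> extension P" using s t ab(1,2) unfolding extension_def by blast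
qed

end

text \<open>Localizing at W and then at the extension of P is localizing at P: elements outside the
  extension have numerators outside P, and denominators from W are outside P as well.\<close>

lemma is_localization_trans:
  assumes RA: "ring_localization R A h1 W" and P: "primeideal P R" "P \<inter> W = {}"
    and AB: "ring_localization A B h2 (carrier A - ring_localization.extension A h1 W P)"
  shows "is_localization (\<lambda>r. h2 (h1 r)) R B (carrier R - P)"
proof -
  interpret RA: ring_localization R A h1 W by fact
  interpret AB: ring_localization A B h2 "carrier A - RA.extension P" by fact
  interpret P: primeideal P R by fact
  have lift: "\<exists>w\<in>W. \<exists>r\<in>carrier R - P. h1 w \<otimes>\<^bsub>A\<^esub> a = h1 r" if a: "a \<in> carrier A - RA.extension P" for a
  proof -
    obtain w r where w: "w \<in> W" "r \<in> carrier R" "h1 w \<otimes>\<^bsub>A\<^esub> a = h1 r" using RA.surj a by blast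
    hence "r \<notin> P" using a unfolding RA.extension_def by blast
    thus ?thesis using w by blast
  qed
  show ?thesis unfolding is_localization_def
  proof (intro conjI ballI impI)
    show "(\<lambda>r. h2 (h1 r)) \<in> ring_hom R B" by (rule ring_hom_memI) auto
    show "h2 (h1 s) \<in> Units B" if "s \<in> carrier R - P" for s
      using that RA.extension_contract[OF P, of s] by (intro AB.unit) auto
  next
    fix b assume b: "b \<in> carrier B"
    obtain a c where a: "a \<in> carrier A - RA.extension P" "c \<in> carrier A" "h2 a \<otimes>\<^bsub>B\<^esub> b = h2 c" using AB.surj b by blast
    obtain w r where w: "w \<in> W" "r \<in> carrier R - P" "h1 w \<otimes>\<^bsub>A\<^esub> a = h1 r" using lift a by blast
    obtain w' r' where w': "w' \<in> W" "r' \<in> carrier R" "h1 w' \<otimes>\<^bsub>A\<^esub> c = h1 r'" using RA.surj a by blast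
    have R: "w \<in> carrier R" "w' \<in> carrier R" "r \<in> carrier R" "a \<in> carrier A" using w w' a by auto
    have "h2 (h1 (w' \<otimes>\<^bsub>R\<^esub> r)) \<otimes>\<^bsub>B\<^esub> b = h2 (h1 w') \<otimes>\<^bsub>B\<^esub> h2 (h1 w) \<otimes>\<^bsub>B\<^esub> (h2 a \<otimes>\<^bsub>B\<^esub> b)"
      using R b by (simp add: w(3)[symmetric] AB.B.m_ac)
    also have "\<dots> = h2 (h1 (w \<otimes>\<^bsub>R\<^esub> r'))"
      unfolding a(3) using R w'(2) a(2) by (simp add: w'(3)[symmetric] AB.B.m_ac)
    finally have "h2 (h1 (w' \<otimes>\<^bsub>R\<^esub> r)) \<otimes>\<^bsub>B\<^esub> b = h2 (h1 (w \<otimes>\<^bsub>R\<^esub> r'))" .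
    moreover have "w' \<in> carrier R - P" using w' P(2) by auto
    hence "w' \<otimes>\<^bsub>R\<^esub> r \<in> carrier R - P" using RA.R.primeideal_mult_notin[OF P(1)] w(2) by blast
    ultimately show "\<exists>s\<in>carrier R - P. \<exists>r\<in>carrier R. h2 (h1 s) \<otimes>\<^bsub>B\<^esub> b = h2 (h1 r)"
      using R w'(2) by (meson RA.R.m_closed)
  next
    fix r assume r: "r \<in> carrier R" "h2 (h1 r) = \<zero>\<^bsub>B\<^esub>"
    hence "h2 (h1 r) = h2 \<zero>\<^bsub>A\<^esub>" by simp
    then obtain a where a: "a \<in> carrier A - RA.extension P" "a \<otimes>\<^bsub>A\<^esub> h1 r = a \<otimes>\<^bsub>A\<^esub> \<zero>\<^bsub>A\<^esub>"
      using AB.eq_imp[of "h1 r" "\<zero>\<^bsub>A\<^esub>"] r by auto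
    obtain w r' where w: "w \<in> W" "r' \<in> carrier R - P" "h1 w \<otimes>\<^bsub>A\<^esub> a = h1 r'" using lift a by blast
    have R: "w \<in> carrier R" "r' \<in> carrier R" "a \<in> carrier A" using w a by auto
    have "h1 (r' \<otimes>\<^bsub>R\<^esub> r) = h1 w \<otimes>\<^bsub>A\<^esub> (a \<otimes>\<^bsub>A\<^esub> h1 r)" using R r by (simp add: w(3)[symmetric] RA.B.m_assoc)
    also have "\<dots> = h1 \<zero>\<^bsub>R\<^esub>" using a(2) R by simp
    finally obtain u where u: "u \<in> W" "u \<otimes>\<^bsub>R\<^esub> (r' \<otimes>\<^bsub>R\<^esub> r) = u \<otimes>\<^bsub>R\<^esub> \<zero>\<^bsub>R\<^esub>"
      using RA.eq_imp[of "r' \<otimes>\<^bsub>R\<^esub> r" "\<zero>\<^bsub>R\<^esub>"] R r by auto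
    have u': "u \<in> carrier R - P" using u P(2) by auto
    have "(u \<otimes>\<^bsub>R\<^esub> r') \<otimes>\<^bsub>R\<^esub> r = \<zero>\<^bsub>R\<^esub>" using u u' R r by (simp add: RA.R.m_assoc)
    thus "\<exists>s\<in>carrier R - P. s \<otimes>\<^bsub>R\<^esub> r = \<zero>\<^bsub>R\<^esub>" using RA.R.primeideal_mult_notin[OF P(1) u' w(2)] by blast
  qed
qed

text \<open>A finite supremum of lengths is attained, for otherwise d - 1 would be an upper bound.
  The prime M provides a chain of length 0 and so settles d = 0.\<close>

lemma krull_dim_chain:
  assumes "krull_dim B = enat d" "primeideal M B"
  shows "\<exists>c. prime_chain B c d"
proof (rule ccontr)
  assume no: "\<not> ?thesis"
  define S where "S = {enat n | n. \<exists>P. (\<forall>i\<le>n. primeideal (P i) B) \<and> (\<forall>i<n. P i \<subset> P (Suc i))}"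
  have sup: "Sup S = enat d" using assms(1) by (simp add: krull_dim_def S_def)
  have "prime_chain B (\<lambda>_. M) 0" using assms(2) by (simp add: prime_chain_def)
  hence d: "d \<noteq> 0" using no by metis
  have "e \<le> enat (d - 1)" if e: "e \<in> S" for e
  proof -
    obtain n P where n: "e = enat n" "prime_chain B P n" using e by (auto simp: S_def prime_chain_def)
    have "e \<le> enat d" using sup e by (metis Sup_upper)
    moreover have "n \<noteq> d" using n no by blast
    ultimately show ?thesis using n by auto
  qed
  hence "Sup S \<le> enat (d - 1)" by (rule Sup_least)
  thus False using sup d by simp
qed

text \<open>The minimal generators of the maximal ideal of B become images of elements of P after
  multiplication by units \<open>h s\<close>. These elements generate P locally, and a longest chain
  of primes of B contracts to a chain below P.\<close>

lemma (in noetherian_cring) regular_system_exists: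
  assumes P: "primeideal P R" and loc: "is_localization h R B (carrier R - P)" and reg: "regular_local_ring B"
  shows "\<exists>d x. (\<forall>i. x i \<in> carrier R) \<and> regular_system R P d x"
proof -
  interpret P: primeideal P R by fact
  have B: "cring B" using reg by (simp add: regular_local_ring_def)
  have U: "submonoid (carrier R - P) R"
    using primeideal_one_notin[OF P] primeideal_mult_notin[OF P] by (intro submonoid.intro) auto
  interpret ring_localization R B h "carrier R - P"
    by (intro ring_localization.intro is_cring B ring_localization_axioms.intro loc U)
  have disj: "P \<inter> (carrier R - P) = {}" by blast
  obtain M Y where M: "\<And>I. maximalideal I B \<longleftrightarrow> I = M" "Y \<subseteq> carrier B" "finite Y" "M = Idl\<^bsub>B\<^esub> Y"
      "enat (card Y) = krull_dim B"
    using reg unfolding regular_local_ring_def by blast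
  have PU: "b \<in> Units B" if b: "b \<in> carrier B" "b \<notin> extension P" for b
  proof -
    obtain s r where s: "s \<in> carrier R - P" "r \<in> carrier R" "h s \<otimes>\<^bsub>B\<^esub> b = h r" using surj b by blast
    have "r \<notin> P" using b s unfolding extension_def by blast
    hence "h s \<otimes>\<^bsub>B\<^esub> b \<in> Units B" using unit s by auto
    thus ?thesis using B.unit_factor[of "h s" b] B.unit_factor[of b "h s"] b s by (simp add: B.m_comm)
  qed
  interpret E: primeideal "extension P" B by (rule extension_prime[OF P disj])
  have "maximalideal (extension P) B"
  proof (rule maximalidealI[OF E.is_ideal E.I_notcarr])
    fix J assume J: "ideal J B" "extension P \<subseteq> J" "J \<subseteq> carrier B"
    show "J = extension P \<or> J = carrier B"
    proof (cases "J = extension P")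
      case False
      then obtain b where b: "b \<in> J" "b \<notin> extension P" using J by blast
      hence "b \<in> Units B" using PU J by blast
      hence "\<one>\<^bsub>B\<^esub> \<in> J" using b J(1) by (metis B.Units_inv_closed B.Units_r_inv ideal.I_r_closed)
      thus ?thesis using ideal.one_imp_carrier[OF J(1)] by simp
    qed simp
  qed
  hence EM: "extension P = M" using M(1) by blast
  define d where "d = card Y"
  obtain c where c: "prime_chain B c d"
    using krull_dim_chain[of B d "extension P"] M(5) E.primeideal by (auto simp: d_def)
  obtain b where b: "bij_betw b {..<d} Y" using ex_bij_betw_nat_finite[OF M(3)] by (auto simp: d_def lessThan_atLeast0)
  have "\<exists>x. x \<in> carrier R \<and> (i < d \<longrightarrow> x \<in> P \<and> (\<exists>s\<in>carrier R - P. h s \<otimes>\<^bsub>B\<^esub> b i = h x))" for i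
  proof (cases "i < d")
    case True
    hence "b i \<in> Y" using b by (auto simp: bij_betw_def)
    hence "b i \<in> extension P" unfolding EM M(4) using B.genideal_self[OF M(2)] by blast
    then obtain s r where "s \<in> carrier R - P" "r \<in> P" "h s \<otimes>\<^bsub>B\<^esub> b i = h r" unfolding extension_def by blast
    thus ?thesis using P.Icarr by blast
  qed auto
  then obtain x where x: "\<And>i. x i \<in> carrier R" "\<And>i. i < d \<Longrightarrow> x i \<in> P"
      "\<And>i. i < d \<Longrightarrow> \<exists>s\<in>carrier R - P. h s \<otimes>\<^bsub>B\<^esub> b i = h (x i)" by metis
  have I: "ideal (Idl (x ` {..<d})) R" using x by (intro genideal_ideal) auto
  have "regular_system R P d x"
  proof (intro regular_system.intro noetherian_cring_axioms regular_system_axioms.intro P)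
    show "x ` {..<d} \<subseteq> P" using x by auto
    show "P \<subseteq> saturation R P (Idl (x ` {..<d}))"
    proof
      fix y assume y: "y \<in> P"
      have "Y \<subseteq> extension (Idl (x ` {..<d}))"
      proof
        fix v assume v: "v \<in> Y"
        then obtain i where i: "i < d" "v = b i" using b by (auto simp: bij_betw_def)
        have "x i \<in> Idl (x ` {..<d})" using x i genideal_self[of "x ` {..<d}"] by auto
        thus "v \<in> extension (Idl (x ` {..<d}))"
          unfolding extension_def using x(3)[OF i(1)] v M(2) i(2) by blast
      qed
      hence "M \<subseteq> extension (Idl (x ` {..<d}))" unfolding M(4) by (intro B.genideal_minimal extension_ideal I)
      moreover have "h y \<in> M" using extension_contract[OF P disj, of y] y EM P.Icarr by auto
      ultimately obtain s r where s: "s \<in> carrier R - P" "r \<in> Idl (x ` {..<d})" "h s \<otimes>\<^bsub>B\<^esub> h y = h r"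
        unfolding extension_def by blast
      have R: "s \<in> carrier R" "r \<in> carrier R" "y \<in> carrier R" using s ideal.Icarr[OF I] P.Icarr[OF y] by auto
      have "h (s \<otimes> y) = h r" using s R by simp
      then obtain u where u: "u \<in> carrier R - P" "u \<otimes> (s \<otimes> y) = u \<otimes> r" using eq_imp[of "s \<otimes> y" r] R by auto
      have "(u \<otimes> s) \<otimes> y = u \<otimes> r" using u R by (simp add: m_assoc)
      also have "\<dots> \<in> Idl (x ` {..<d})" using ideal.I_l_closed[OF I s(2)] u by simp
      finally show "y \<in> saturation R P (Idl (x ` {..<d}))"
        by (intro saturationI[OF R(3) primeideal_mult_notin[OF P u(1) s(1)]])
    qed
    have cp: "primeideal (c i) B" if "i \<le> d" for i using c that by (simp add: prime_chain_def)
    \<comment> \<open>Only the first d primes are contracted, and P is put on top because the chain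
      has to end there. The contraction of \<open>c d\<close> lies in P, so the last inclusion
      remains strict.\<close>
    define c' where "c' i = (if i < d then {r \<in> carrier R. h r \<in> c i} else P)" for i
    have sub: "{r \<in> carrier R. h r \<in> c i} \<subseteq> P" if "i \<le> d" for i
    proof
      fix r assume r: "r \<in> {r \<in> carrier R. h r \<in> c i}"
      show "r \<in> P"
      proof (rule ccontr)
        assume "r \<notin> P"
        hence "h r \<in> Units B" using unit r by simp
        hence "\<one>\<^bsub>B\<^esub> \<in> c i" using r primeideal.axioms(1)[OF cp[OF that]]
          by (metis (no_types, lifting) B.Units_inv_closed B.Units_r_inv ideal.I_r_closed mem_Collect_eq)
        thus False using ideal.one_imp_carrier[OF primeideal.axioms(1)[OF cp[OF that]]] primeideal.I_notcarr[OF cp[OF that]] by simp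
      qed
    qed
    have strict: "{r \<in> carrier R. h r \<in> c i} \<subset> {r \<in> carrier R. h r \<in> c (Suc i)}" if i: "i < d" for i
    proof -
      interpret ci: primeideal "c i" B using cp i by simp
      interpret cs: primeideal "c (Suc i)" B using cp i by simp
      have ss: "c i \<subset> c (Suc i)" using c i by (simp add: prime_chain_def)
      then obtain v where v: "v \<in> c (Suc i)" "v \<notin> c i" by blast
      have vB: "v \<in> carrier B" using v cs.Icarr by simp
      obtain s r where s: "s \<in> carrier R - P" "r \<in> carrier R" "h s \<otimes>\<^bsub>B\<^esub> v = h r" using surj vB by blast
      have hs: "h s \<notin> c i" using sub[of i] i s by auto
      have "h s \<otimes>\<^bsub>B\<^esub> v \<in> c (Suc i)" using cs.I_l_closed[OF v(1), of "h s"] s by auto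
      moreover have "h s \<otimes>\<^bsub>B\<^esub> v \<notin> c i" using ci.I_prime[of "h s" v] hs v vB s by auto
      ultimately show ?thesis using s ss by auto
    qed
    have prime': "primeideal (c' i) R" if i: "i \<le> d" for i
    proof (cases "i < d")
      case True
      interpret ci: primeideal "c i" B by (rule cp[OF i])
      have "primeideal {r \<in> carrier R. h r \<in> c i} R"
      proof (rule primeidealI)
        show "ideal {r \<in> carrier R. h r \<in> c i} R"
          by (rule idealI') (auto simp: ci.I_l_closed)
        show "carrier R \<noteq> {r \<in> carrier R. h r \<in> c i}" using sub[OF i] P.I_notcarr P.Icarr by blast
        show "a \<in> {r \<in> carrier R. h r \<in> c i} \<or> b \<in> {r \<in> carrier R. h r \<in> c i}"
          if "a \<in> carrier R" "b \<in> carrier R" "a \<otimes> b \<in> {r \<in> carrier R. h r \<in> c i}" for a b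
          using that ci.I_prime[of "h a" "h b"] by auto
      qed (rule is_cring)
      thus ?thesis using True by (simp add: c'_def)
    qed (use i P in \<open>simp add: c'_def\<close>)
    have "c' i \<subset> c' (Suc i)" if i: "i < d" for i
    proof (cases "Suc i < d")
      case True thus ?thesis using strict[OF i] i by (simp add: c'_def)
    next
      case False
      thus ?thesis using strict[OF i] sub[of "Suc i"] i by (simp add: c'_def psubset_subset_trans)
    qed
    hence "prime_chain R c' d" using prime' by (simp add: prime_chain_def)
    thus "\<exists>c. prime_chain R c d \<and> c d = P" by (intro exI[of _ c']) (simp add: c'_def)
  qed
  thus ?thesis using x(1) by blast
qed

lemma (in noetherian_cring) regular_localization_imp_regular_systems:
  assumes W: "submonoid W R" and reg: "regular_ring (localized_ring R W)"
    and P: "primeideal P R" "P \<inter> W = {}"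
  shows "\<exists>d x. (\<forall>i. x i \<in> carrier R) \<and> regular_system R P d x"
proof -
  let ?A = "localized_ring R W"
  interpret A: cring ?A using reg by (simp add: regular_ring_def)
  have RA: "ring_localization R ?A (\<lambda>r. fraction_rel R W (self_module R) `` {(r, \<one>)}) W"
    by (intro ring_localization.intro ring_localization_axioms.intro is_cring A.is_cring
        is_localization_localized_ring W)
  interpret RA: ring_localization R ?A "\<lambda>r. fraction_rel R W (self_module R) `` {(r, \<one>)}" W by (rule RA)
  let ?Q = "RA.extension P"
  have Q: "primeideal ?Q ?A" by (rule RA.extension_prime[OF P])
  let ?B = "localized_ring ?A (carrier ?A - ?Q)"
  have regB: "regular_local_ring ?B" using reg Q by (simp add: regular_ring_def)
  hence B: "cring ?B" by (simp add: regular_local_ring_def)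
  have U: "submonoid (carrier ?A - ?Q) ?A"
    using A.primeideal_one_notin[OF Q] A.primeideal_mult_notin[OF Q] by (intro submonoid.intro) auto
  have AB: "ring_localization ?A ?B (\<lambda>r. fraction_rel ?A (carrier ?A - ?Q) (self_module ?A) `` {(r, \<one>\<^bsub>?A\<^esub>)}) (carrier ?A - ?Q)"
    by (intro ring_localization.intro ring_localization_axioms.intro A.is_cring B
        A.is_localization_localized_ring U)
  show ?thesis by (rule regular_system_exists[OF P(1) is_localization_trans[OF RA P AB] regB])
qed

section \<open>The perfect closure\<close>

context cring
begin

lemma binomial:
  assumes "a \<in> carrier R" "b \<in> carrier R"
  shows "(a \<oplus> b) [^] (n::nat) = (\<Oplus>k\<in>{..n}. add_pow R (n choose k) (a [^] k \<otimes> b [^] (n - k)))"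
proof (induction n)
  case 0 then show ?case using assms by simp
next
  case (Suc n)
  let ?t = "\<lambda>c k. add_pow R (c k :: nat) (a [^] k \<otimes> b [^] (Suc n - k))"
  have t: "?t c k \<in> carrier R" for c k using assms by simp
  have "(a \<oplus> b) [^] Suc n = (\<Oplus>k\<in>{..n}. add_pow R (n choose k) (a [^] k \<otimes> b [^] (n - k))) \<otimes> a
      \<oplus> (\<Oplus>k\<in>{..n}. add_pow R (n choose k) (a [^] k \<otimes> b [^] (n - k))) \<otimes> b"
    using assms Suc by (simp add: r_distr Pi_def)
  also have "(\<Oplus>k\<in>{..n}. add_pow R (n choose k) (a [^] k \<otimes> b [^] (n - k))) \<otimes> a = (\<Oplus>k\<in>{..n}. add_pow R (n choose k) (a [^] Suc k \<otimes> b [^] (n - k)))"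
    using assms by (subst finsum_ldistr) (auto intro!: finsum_cong' simp: add_pow_ldistr add_pow_rdistr m_ac)
  also have "(\<Oplus>k\<in>{..n}. add_pow R (n choose k) (a [^] k \<otimes> b [^] (n - k))) \<otimes> b = (\<Oplus>k\<in>{..n}. ?t (\<lambda>k. n choose k) k)"
    using assms by (subst finsum_ldistr) (auto intro!: finsum_cong' simp: add_pow_ldistr add_pow_rdistr m_ac Suc_diff_le)
  also have "\<dots> = (\<Oplus>k\<in>{..Suc n}. ?t (\<lambda>k. n choose k) k)"
    using t assms by (subst finsum_Suc) (auto simp: Pi_def binomial_eq_0)
  also have "\<dots> = (\<Oplus>k\<in>{..n}. ?t (\<lambda>k. n choose k) (Suc k)) \<oplus> ?t (\<lambda>k. n choose k) 0"
    using t by (subst finsum_Suc2) (auto simp: Pi_def)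
  also have "(\<Oplus>k\<in>{..n}. add_pow R (n choose k) (a [^] Suc k \<otimes> b [^] (n - k)))
      \<oplus> ((\<Oplus>k\<in>{..n}. ?t (\<lambda>k. n choose k) (Suc k)) \<oplus> ?t (\<lambda>k. n choose k) 0)
    = (\<Oplus>k\<in>{..n}. ?t (\<lambda>k. Suc n choose k) (Suc k)) \<oplus> ?t (\<lambda>k. Suc n choose k) 0"
  proof -
    have "(\<Oplus>k\<in>{..n}. ?t (\<lambda>k. Suc n choose k) (Suc k))
      = (\<Oplus>k\<in>{..n}. add_pow R (n choose k) (a [^] Suc k \<otimes> b [^] (n - k)) \<oplus> ?t (\<lambda>k. n choose k) (Suc k))"
      using assms by (intro finsum_cong') (auto simp: add.nat_pow_mult)
    also have "\<dots> = (\<Oplus>k\<in>{..n}. add_pow R (n choose k) (a [^] Suc k \<otimes> b [^] (n - k))) \<oplus> (\<Oplus>k\<in>{..n}. ?t (\<lambda>k. n choose k) (Suc k))"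
      using assms by (intro finsum_addf) auto
    finally show ?thesis using assms by (simp add: a_assoc Pi_def)
  qed
  also have "\<dots> = (\<Oplus>k\<in>{..Suc n}. ?t (\<lambda>k. Suc n choose k) k)"
    using t by (subst finsum_Suc2) (auto simp: Pi_def)
  finally show ?case .
qed

lemma ring_char_add_pow:
  assumes "ring_char R dvd n" "a \<in> carrier R"
  shows "add_pow R n a = \<zero>"
proof -
  obtain m where m: "n = ring_char R * m" using assms(1) by auto
  have "add_pow R (ring_char R) \<one> = \<zero>"
    using group.pow_ord_eq_1[OF a_group, of \<one>] by (simp add: ring_char_def add_pow_def)
  hence "add_pow R (n) \<one> = \<zero>" unfolding m by (metis add.nat_pow_one add.nat_pow_pow one_closed)
  hence "add_pow R n \<one> \<otimes> a = \<zero>" using assms(2) by simp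
  thus ?thesis using assms(2) by (simp add: add_pow_ldistr)
qed

end

locale prime_char = cring +
  fixes p :: nat
  assumes prime: "Factorial_Ring.prime p" and char: "ring_char R = p"
begin

lemma frobenius_prime:
  assumes "a \<in> carrier R" "b \<in> carrier R"
  shows "(a \<oplus> b) [^] p = a [^] p \<oplus> b [^] p"
proof -
  obtain m where m: "p = Suc m" using prime prime_gt_0_nat[of p] by (cases p) auto
  let ?f = "\<lambda>k. add_pow R (p choose k) (a [^] k \<otimes> b [^] (p - k))"
  have f: "?f k \<in> carrier R" for k using assms by simp
  have mid: "?f k = \<zero>" if "0 < k" "k < p" for k
  proof (rule ring_char_add_pow)
    show "ring_char R dvd p choose k" using dvd_choose_prime[OF _ _ _ prime, of k] that char by simp
  qed (use assms in simp)
  have "(a \<oplus> b) [^] p = (\<Oplus>k\<in>{..p}. ?f k)" by (rule binomial[OF assms])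
  also have "\<dots> = ?f p \<oplus> (\<Oplus>k\<in>{..m}. ?f k)" unfolding m by (rule finsum_Suc) (use f in \<open>auto simp: m\<close>)
  also have "(\<Oplus>k\<in>{..m}. ?f k) = (\<Oplus>k\<in>{..m}. if 0 = k then b [^] p else \<zero>)"
    using assms mid m by (intro finsum_cong') auto
  also have "\<dots> = b [^] p" using assms finsum_singleton[of 0 "{..m}" "\<lambda>_. b [^] p"] by simp
  finally show ?thesis using assms by simp
qed

lemma frobenius_iterate:
  assumes "a \<in> carrier R" "b \<in> carrier R"
  shows "(a \<oplus> b) [^] (p ^ e) = a [^] (p ^ e) \<oplus> b [^] (p ^ e)"
proof (induction e)
  case (Suc e)
  have "(a \<oplus> b) [^] (p ^ Suc e) = ((a \<oplus> b) [^] (p ^ e)) [^] p" using assms by (simp add: nat_pow_pow mult.commute)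
  also have "\<dots> = (a [^] (p ^ e)) [^] p \<oplus> (b [^] (p ^ e)) [^] p" unfolding Suc using assms by (intro frobenius_prime) auto
  also have "\<dots> = a [^] (p ^ Suc e) \<oplus> b [^] (p ^ Suc e)" using assms by (simp add: nat_pow_pow mult.commute)
  finally show ?case .
qed (use assms in simp)

lemma p_pos: "p > 0" using prime prime_gt_0_nat by auto

lemma pow_p_pow: "a \<in> carrier R \<Longrightarrow> (a [^] (p ^ i)) [^] (p ^ j) = a [^] (p ^ (i + j))"
  by (simp add: nat_pow_pow power_add)

section \<open>Elements of the perfect closure as roots\<close>

abbreviation "S \<equiv> perfect_closure p R"

definition root :: "nat \<Rightarrow> 'a \<Rightarrow> (nat \<times> 'a) set" where
  "root m a = perfect_rel p R `` {(m, a)}"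

text \<open>An equality at one level persists at all higher levels, so several equalities can be
  compared at a common level.\<close>

lemma perfect_rel_lift:
  assumes "((m, a), (n, b)) \<in> perfect_rel p R"
  obtains k where "m \<le> k" "n \<le> k" "\<And>k'. k' \<ge> k \<Longrightarrow> a [^] (p ^ (k' - m)) = b [^] (p ^ (k' - n))"
proof -
  obtain k where k: "a \<in> carrier R" "b \<in> carrier R" "m \<le> k" "n \<le> k" "a [^] (p ^ (k - m)) = b [^] (p ^ (k - n))"
    using assms by (auto simp: perfect_rel_def)
  have "a [^] (p ^ (k' - m)) = b [^] (p ^ (k' - n))" if "k' \<ge> k" for k'
  proof -
    have "a [^] (p ^ (k' - m)) = (a [^] (p ^ (k - m))) [^] (p ^ (k' - k))" using k(1-4) that by (simp add: pow_p_pow)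
    also have "\<dots> = b [^] (p ^ (k' - n))" unfolding k(5) using k that by (simp add: pow_p_pow)
    finally show ?thesis .
  qed
  thus ?thesis using that k by blast
qed

lemma equiv_perfect_rel: "equiv (UNIV \<times> carrier R) (perfect_rel p R)"
proof (rule equivI)
  show "perfect_rel p R \<subseteq> (UNIV \<times> carrier R) \<times> (UNIV \<times> carrier R)" by (auto simp: perfect_rel_def)
  show "refl_on (UNIV \<times> carrier R) (perfect_rel p R)"
    by (auto simp: refl_on_def perfect_rel_def)
  show "sym (perfect_rel p R)" by (auto simp: sym_def perfect_rel_def)
  show "trans (perfect_rel p R)"
  proof (rule transI, clarify)
    fix m a n b l c
    assume 1: "((m, a), (n, b)) \<in> perfect_rel p R" and 2: "((n, b), (l, c)) \<in> perfect_rel p R"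
    obtain k where k: "m \<le> k" "\<And>k'. k' \<ge> k \<Longrightarrow> a [^] (p ^ (k' - m)) = b [^] (p ^ (k' - n))"
      using perfect_rel_lift[OF 1] by metis
    obtain j where j: "l \<le> j" "\<And>k'. k' \<ge> j \<Longrightarrow> b [^] (p ^ (k' - n)) = c [^] (p ^ (k' - l))"
      using perfect_rel_lift[OF 2] by metis
    have "a [^] (p ^ (max k j - m)) = c [^] (p ^ (max k j - l))" using k j by simp
    thus "((m, a), (l, c)) \<in> perfect_rel p R"
      using 1 2 k(1) j(1) unfolding perfect_rel_def by (auto intro!: exI[of _ "max k j"])
  qed
qed

lemma root_eqI:
  assumes "a \<in> carrier R" "b \<in> carrier R" "m \<le> k" "n \<le> k" "a [^] (p ^ (k - m)) = b [^] (p ^ (k - n))"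
  shows "root m a = root n b"
  unfolding root_def using assms by (intro equiv_class_eq[OF equiv_perfect_rel]) (auto simp: perfect_rel_def)

lemma root_lift: "a \<in> carrier R \<Longrightarrow> root (m + j) (a [^] (p ^ j)) = root m a"
  by (rule root_eqI[of _ _ _ "m + j"]) auto

lemma root_eqD:
  assumes "root m a = root n b" "a \<in> carrier R" "b \<in> carrier R"
  shows "((m, a), (n, b)) \<in> perfect_rel p R"
  using eq_equiv_class[OF _ equiv_perfect_rel, of "(m, a)" "(n, b)"] assms by (simp add: root_def)

text \<open>Additivity gives (a - b)^q = 0 for a suitable power q of p, and R is reduced. Thus each
  level embeds into the perfect closure.\<close>

lemma root_inject:
  assumes "reduced_ring R" "root m a = root m b" "a \<in> carrier R" "b \<in> carrier R"
  shows "a = b"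
proof -
  obtain k where k: "m \<le> k" "a [^] (p ^ (k - m)) = b [^] (p ^ (k - m))"
    using perfect_rel_lift[OF root_eqD[OF assms(2-4)]] by (metis order_refl)
  let ?q = "p ^ (k - m)"
  have c: "a [^] ?q \<in> carrier R" "b [^] ?q \<in> carrier R" "(a \<ominus> b) [^] ?q \<in> carrier R" using assms by auto
  have "a = (a \<ominus> b) \<oplus> b" using assms(3,4) by algebra
  hence "a [^] ?q = (a \<ominus> b) [^] ?q \<oplus> b [^] ?q" using frobenius_iterate[of "a \<ominus> b" b "k - m"] assms by simp
  hence "(a \<ominus> b) [^] ?q = \<zero>" using k(2) c by (metis add.l_cancel_one' a_comm)
  hence "a \<ominus> b = \<zero>" using assms unfolding reduced_ring_def by (meson minus_closed)
  thus ?thesis using assms(3,4) by simp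
qed

lemma carrier_perfect_closure: "carrier S = {root m a | m a. a \<in> carrier R}"
  by (auto simp: perfect_closure_def Let_def quotient_def root_def)

lemma root_closed [simp]: "a \<in> carrier R \<Longrightarrow> root m a \<in> carrier S"
  by (auto simp: carrier_perfect_closure)

text \<open>Addition and multiplication both commute with p^e-th powers, so that they are well
  defined is shown once for any operation g of this kind.\<close>

lemma root_operation:
  assumes cl: "\<And>x y. x \<in> carrier R \<Longrightarrow> y \<in> carrier R \<Longrightarrow> g x y \<in> carrier R"
    and hom: "\<And>x y e. x \<in> carrier R \<Longrightarrow> y \<in> carrier R \<Longrightarrow> (g x y) [^] (p ^ e) = g (x [^] (p ^ e)) (y [^] (p ^ e))"
    and a: "a \<in> carrier R" and b: "b \<in> carrier R"
  shows "(\<Union>(m', a') \<in> root m a. \<Union>(n', b') \<in> root n b. root (m' + n') (g (a' [^] (p ^ n')) (b' [^] (p ^ m'))))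
      = root (m + n) (g (a [^] (p ^ n)) (b [^] (p ^ m)))"
proof (rule UN_pair_constant)
  show "root m a \<noteq> {}" "root n b \<noteq> {}"
    using equiv_class_self[OF equiv_perfect_rel] a b by (auto simp: root_def)
  fix m' a' n' b' assume "(m', a') \<in> root m a" "(n', b') \<in> root n b"
  hence rel: "((m, a), (m', a')) \<in> perfect_rel p R" "((n, b), (n', b')) \<in> perfect_rel p R" by (auto simp: root_def)
  hence carr: "a' \<in> carrier R" "b' \<in> carrier R" by (auto simp: perfect_rel_def)
  obtain k where k: "m \<le> k" "m' \<le> k" "\<And>k'. k' \<ge> k \<Longrightarrow> a [^] (p ^ (k' - m)) = a' [^] (p ^ (k' - m'))"
    using perfect_rel_lift[OF rel(1)] by metis
  obtain j where j: "n \<le> j" "n' \<le> j" "\<And>k'. k' \<ge> j \<Longrightarrow> b [^] (p ^ (k' - n)) = b' [^] (p ^ (k' - n'))"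
    using perfect_rel_lift[OF rel(2)] by metis
  have "(g (a' [^] (p ^ n')) (b' [^] (p ^ m'))) [^] (p ^ (k + j - (m' + n'))) = g (a' [^] (p ^ (k + j - m'))) (b' [^] (p ^ (k + j - n')))"
    using carr k j by (simp add: hom pow_p_pow)
  also have "\<dots> = g (a [^] (p ^ (k + j - m))) (b [^] (p ^ (k + j - n)))" using k(3)[of "k + j"] j(3)[of "k + j"] by simp
  also have "\<dots> = (g (a [^] (p ^ n)) (b [^] (p ^ m))) [^] (p ^ (k + j - (m + n)))"
    using a b k j by (simp add: hom pow_p_pow)
  finally show "root (m' + n') (g (a' [^] (p ^ n')) (b' [^] (p ^ m'))) = root (m + n) (g (a [^] (p ^ n)) (b [^] (p ^ m)))"
    using a b carr cl k j by (intro root_eqI[of _ _ _ "k + j"]) auto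
qed

lemma mult_root:
  assumes "a \<in> carrier R" "b \<in> carrier R"
  shows "root m a \<otimes>\<^bsub>S\<^esub> root n b = root (m + n) (a [^] (p ^ n) \<otimes> b [^] (p ^ m))"
  using root_operation[where g = "(\<otimes>)" and a = a and b = b and m = m and n = n] assms
  by (simp add: perfect_closure_def Let_def root_def nat_pow_distrib)

lemma add_root:
  assumes "a \<in> carrier R" "b \<in> carrier R"
  shows "root m a \<oplus>\<^bsub>S\<^esub> root m b = root m (a \<oplus> b)"
proof -
  have "root m a \<oplus>\<^bsub>S\<^esub> root m b = root (m + m) (a [^] (p ^ m) \<oplus> b [^] (p ^ m))"
    using root_operation[of "(\<oplus>)" a b m m] assms frobenius_iterate
    by (simp add: perfect_closure_def Let_def root_def)
  also have "\<dots> = root m (a \<oplus> b)" using root_lift[of "a \<oplus> b" m m] assms by (simp add: frobenius_iterate)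
  finally show ?thesis .
qed

lemma zero_perfect_closure: "\<zero>\<^bsub>S\<^esub> = root m \<zero>"
proof -
  have "root m (\<zero> [^] (p ^ m)) = root 0 \<zero>" using root_lift[of \<zero> 0 m] by simp
  thus ?thesis using p_pos by (simp add: perfect_closure_def Let_def root_def nat_pow_zero)
qed

abbreviation "\<iota> \<equiv> perfect_emb p R"

lemma perfect_emb_eq_root: "\<iota> r = root 0 r"
  by (simp add: perfect_emb_def root_def)

lemma perfect_emb_mult_root: "r \<in> carrier R \<Longrightarrow> b \<in> carrier R \<Longrightarrow> \<iota> r \<otimes>\<^bsub>S\<^esub> root e b = root e (r [^] (p ^ e) \<otimes> b)"
  by (simp add: perfect_emb_eq_root mult_root)

lemma perfect_emb_hom: "\<iota> \<in> ring_hom R S"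
proof (rule ring_hom_memI)
  show "\<iota> \<one> = \<one>\<^bsub>S\<^esub>" by (simp add: perfect_emb_eq_root perfect_closure_def Let_def root_def)
qed (auto simp: perfect_emb_eq_root mult_root add_root)

text \<open>The perfect closure is an increasing union of copies of R: a root of lower level is
  rewritten at a higher one by raising its argument to a power of p.\<close>

lemma common_root_level:
  assumes "\<And>i. t i \<in> carrier S"
  shows "\<exists>e b. (\<forall>i. b i \<in> carrier R) \<and> (\<forall>i<n::nat. t i = root e (b i))"
proof (induction n)
  case 0 show ?case by (intro exI[of _ 0] exI[of _ "\<lambda>_. \<zero>"]) auto
next
  case (Suc n)
  then obtain e b where b: "\<And>i. b i \<in> carrier R" "\<And>i. i < n \<Longrightarrow> t i = root e (b i)" by auto
  obtain m a where a: "a \<in> carrier R" "t n = root m a" using assms[of n] by (auto simp: carrier_perfect_closure)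
  define b' where "b' i = (if i = n then a [^] (p ^ e) else b i [^] (p ^ m))" for i
  have "t i = root (e + m) (b' i)" if "i < Suc n" for i
    using that b a root_lift[of "b i" e m] root_lift[of a m e] by (auto simp: b'_def less_Suc_eq add.commute)
  moreover have "b' i \<in> carrier R" for i using a b by (simp add: b'_def)
  ultimately show ?case by blast
qed

text \<open>A relation involves finitely many elements, all in one level e. The map
  \<open>root e\<close> embeds R, with R acting through p^e-th powers, into S. So the relation
  already holds in the Frobenius module; there it becomes trivial up to W, and the trivialization is
  mapped back into S.\<close>

theorem flat_perfect_closure:
  assumes S: "cring S" and red: "reduced_ring R" and noeth: "noetherian_ring R"
    and W: "submonoid W R" and reg: "regular_ring (localized_ring R W)"
  shows "flat_upto R W (restrict_scalars \<iota> (self_module S))"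
  unfolding flat_upto_def equational_def
proof (intro allI impI, elim conjE)
  interpret N: noetherian_cring R by (intro noetherian_cring.intro is_cring noeth)
  interpret S: cring S by (rule S)
  let ?T = "restrict_scalars \<iota> (self_module S)"
  have T: "module R ?T" by (rule module_restrict_scalars[OF is_cring perfect_emb_hom S.module_self_module])
  fix n :: nat and r :: "nat \<Rightarrow> 'a" and t
  assume r: "\<forall>i. r i \<in> carrier R" and t: "\<forall>i. t i \<in> carrier ?T"
    and rel: "(\<Oplus>\<^bsub>?T\<^esub>i\<in>{..<n}. r i \<odot>\<^bsub>?T\<^esub> t i) = \<zero>\<^bsub>?T\<^esub>"
  obtain e b where b: "\<And>i. b i \<in> carrier R" "\<And>i. i < n \<Longrightarrow> t i = root e (b i)"
    using common_root_level[of t n] t by auto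
  interpret F: frobenius_power R "p ^ e"
    by unfold_locales (use p_pos frobenius_iterate in auto)
  have flat: "flat_upto R W F.F"
    by (intro F.flat_frobenius W N.regular_localization_imp_regular_systems[OF W reg])
  have lin: "linear_map R F.F ?T (root e)"
    by (auto simp: linear_map_def add_root perfect_emb_mult_root)
  have "root e (\<Oplus>\<^bsub>F.F\<^esub>i\<in>{..<n}. r i \<odot>\<^bsub>F.F\<^esub> b i) = (\<Oplus>\<^bsub>?T\<^esub>i\<in>{..<n}. root e (r i \<odot>\<^bsub>F.F\<^esub> b i))"
    using r b(1) by (intro linear_map_finsum[OF F.F.module_axioms T lin]) auto
  also have "\<dots> = (\<Oplus>\<^bsub>?T\<^esub>i\<in>{..<n}. r i \<odot>\<^bsub>?T\<^esub> t i)"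
    using r b by (simp, intro S.finsum_cong') (auto simp: perfect_emb_mult_root)
  also have "\<dots> = root e \<zero>" unfolding rel using zero_perfect_closure[of e] by simp
  finally have "(\<Oplus>\<^bsub>F.F\<^esub>i\<in>{..<n}. r i \<odot>\<^bsub>F.F\<^esub> b i) = \<zero>\<^bsub>F.F\<^esub>"
    using root_inject[OF red] r b(1) by auto
  moreover have "\<And>i. b i \<in> carrier F.F" using b(1) by simp
  moreover have "equational R F.F W {..<n} r" using flat r by (simp add: flat_upto_def)
  ultimately obtain u where u: "u \<in> W" "null R (self_module R) F.F {..<n} r (\<lambda>i. u \<odot>\<^bsub>F.F\<^esub> b i)"
    using F.F.equationalD[of W "{..<n}" r b] by blast
  interpret W: submonoid W R by (rule W)
  have "null R (self_module R) ?T {..<n} r (\<lambda>i. root e (u \<odot>\<^bsub>F.F\<^esub> b i))"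
    by (rule null_map[OF F.F.module_axioms T lin u(2)])
  hence "null R (self_module R) ?T {..<n} r (\<lambda>i. u \<odot>\<^bsub>?T\<^esub> t i)"
  proof (rule null_cong)
    show "u \<odot>\<^bsub>?T\<^esub> t i \<in> carrier ?T" for i using u(1) t by (intro module.smult_closed[OF T]) auto
    show "u \<odot>\<^bsub>?T\<^esub> t i = root e (u \<odot>\<^bsub>F.F\<^esub> b i)" if "i \<in> {..<n}" for i
      using u(1) b that by (simp add: perfect_emb_mult_root)
  qed
  thus "\<exists>u\<in>W. null R (self_module R) ?T {..<n} r (\<lambda>i. u \<odot>\<^bsub>?T\<^esub> t i)" using u(1) by blast
qed

end

section \<open>Flatness of the localized ring\<close>

lemma submonoid_image:
  assumes "cring R" "cring S" "f \<in> ring_hom R S" "submonoid W R"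
  shows "submonoid (f ` W) S"
proof -
  interpret R: cring R by fact
  interpret S: cring S by fact
  interpret W: submonoid W R by fact
  interpret f: ring_hom_cring R S f by unfold_locales fact
  show ?thesis
  proof (rule submonoid.intro)
    show "f ` W \<subseteq> carrier S" by auto
    show "\<one>\<^bsub>S\<^esub> \<in> f ` W" using W.one_closed by (metis f.hom_one image_eqI)
    fix x y assume "x \<in> f ` W" "y \<in> f ` W"
    then obtain v w where "x = f v" "y = f w" "v \<in> W" "w \<in> W" by auto
    thus "x \<otimes>\<^bsub>S\<^esub> y \<in> f ` W" using f.hom_mult[of v w] W.m_closed[of v w] by (metis W.mem_carrier image_eqI)
  qed
qed

text \<open>Multipliers from W are allowed in the conclusion, so denominators can be cleared: a
  multiple of the relation comes from S, where it is trivial up to W, and the trivialization maps to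
  the localization.\<close>

lemma flat_localized_module:
  assumes R: "cring R" and S: "cring S" and f: "f \<in> ring_hom R S" and W: "submonoid W R"
    and flat: "flat_upto R W (restrict_scalars f (self_module S))"
  shows "flat_upto R W (restrict_scalars f (localized_module S (f ` W) (self_module S)))"
  unfolding flat_upto_def equational_def
proof (intro allI impI, elim conjE)
  interpret R: cring R by (rule R)
  interpret S: cring S by (rule S)
  interpret W: submonoid W R by (rule W)
  interpret f: ring_hom_cring R S f by unfold_locales (rule f)
  have V: "submonoid (f ` W) S" by (rule submonoid_image[OF R S f W])
  interpret loc: module_localization S "self_module S" "f ` W"
    by (intro module_localization.intro module_localization_axioms.intro V S.module_self_module)
  let ?T = "restrict_scalars f (self_module S)" and ?N = "restrict_scalars f loc.L"
  have T: "module R ?T" by (rule module_restrict_scalars[OF R f S.module_self_module])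
  have N: "module R ?N" by (rule module_restrict_scalars[OF R f loc.module_localized])
  interpret T: module R ?T by (rule T)
  interpret N: module R ?N by (rule N)
  have fW: "f w \<in> f ` W" "w \<in> carrier R" if "w \<in> W" for w using that by auto
  have one: "\<one>\<^bsub>S\<^esub> \<in> f ` W" by (rule submonoid.one_closed[OF V])
  let ?j = "\<lambda>s. loc.frac s \<one>\<^bsub>S\<^esub>"
  have lin: "linear_map R ?T ?N ?j"
    using one by (auto simp: linear_map_def loc.add_localized loc.smult_localized)
  fix n :: nat and r :: "nat \<Rightarrow> 'a" and t
  assume r: "\<forall>i. r i \<in> carrier R" and t: "\<forall>i. t i \<in> carrier ?N"
    and rel: "(\<Oplus>\<^bsub>?N\<^esub>i\<in>{..<n}. r i \<odot>\<^bsub>?N\<^esub> t i) = \<zero>\<^bsub>?N\<^esub>"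
  \<comment> \<open>Denominators are images of elements of W, so finitely many entries have a common
    one.\<close>
  have "\<exists>w\<in>W. \<exists>s. (\<forall>i. s i \<in> carrier S) \<and> (\<forall>i<m. w \<odot>\<^bsub>?N\<^esub> t i = ?j (s i))" for m
  proof (induction m)
    case 0 show ?case using W.one_closed by (intro bexI[of _ "\<one>\<^bsub>R\<^esub>"] exI[of _ "\<lambda>_. \<zero>\<^bsub>S\<^esub>"]) auto
  next
    case (Suc m)
    then obtain w s where w: "w \<in> W" "\<And>i. s i \<in> carrier S" "\<And>i. i < m \<Longrightarrow> w \<odot>\<^bsub>?N\<^esub> t i = ?j (s i)" by auto
    have "t m \<in> carrier loc.L" using t by simp
    then obtain y v where y: "t m = loc.frac y (f v)" "y \<in> carrier S" "v \<in> W" by (auto simp: loc.carrier_localized)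
    define s' where "s' i = (if i = m then f w \<otimes>\<^bsub>S\<^esub> y else f v \<otimes>\<^bsub>S\<^esub> s i)" for i
    have s'S: "s' i \<in> carrier S" for i using w y by (auto simp: s'_def)
    have "(v \<otimes>\<^bsub>R\<^esub> w) \<odot>\<^bsub>?N\<^esub> t i = ?j (s' i)" if "i < Suc m" for i
    proof (cases "i = m")
      case True
      have "f v \<odot>\<^bsub>loc.L\<^esub> t m = ?j y"
        unfolding y(1) using y fW[OF y(3)] loc.frac_cancel[of y "\<one>\<^bsub>S\<^esub>" "f v"] one by (simp add: loc.smult_localized)
      hence "(w \<otimes>\<^bsub>R\<^esub> v) \<odot>\<^bsub>?N\<^esub> t m = f w \<odot>\<^bsub>loc.L\<^esub> ?j y"
        using fW[OF y(3)] fW[OF w(1)] t N.smult_assoc1[of w v "t m"] by simp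
      thus ?thesis using True y fW[OF y(3)] fW[OF w(1)] one R.m_comm[of w v] by (simp add: s'_def loc.smult_localized)
    next
      case False
      have "(v \<otimes>\<^bsub>R\<^esub> w) \<odot>\<^bsub>?N\<^esub> t i = v \<odot>\<^bsub>?N\<^esub> (w \<odot>\<^bsub>?N\<^esub> t i)"
        using fW[OF y(3)] fW[OF w(1)] t by (intro N.smult_assoc1) auto
      also have "\<dots> = f v \<odot>\<^bsub>loc.L\<^esub> ?j (s i)" using w(3)[of i] that False by simp
      also have "\<dots> = ?j (s' i)" using False w(2) y(3) one by (simp add: s'_def loc.smult_localized)
      finally show ?thesis .
    qed
    thus ?case using s'S W.m_closed[OF y(3) w(1)] by blast
  qed
  then obtain w s where w: "w \<in> W" "\<And>i. s i \<in> carrier S" "\<And>i. i < n \<Longrightarrow> w \<odot>\<^bsub>?N\<^esub> t i = ?j (s i)" by blast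
  have sT: "\<And>i. s i \<in> carrier ?T" using w(2) by simp
  have "?j (\<Oplus>\<^bsub>?T\<^esub>i\<in>{..<n}. r i \<odot>\<^bsub>?T\<^esub> s i) = (\<Oplus>\<^bsub>?N\<^esub>i\<in>{..<n}. ?j (r i \<odot>\<^bsub>?T\<^esub> s i))"
    using r sT by (intro linear_map_finsum[OF T N lin]) (auto intro!: T.smult_closed)
  also have "\<dots> = (\<Oplus>\<^bsub>?N\<^esub>i\<in>{..<n}. w \<odot>\<^bsub>?N\<^esub> (r i \<odot>\<^bsub>?N\<^esub> t i))"
  proof (rule N.M.finsum_cong'[OF refl])
    show "(\<lambda>i. w \<odot>\<^bsub>?N\<^esub> (r i \<odot>\<^bsub>?N\<^esub> t i)) \<in> {..<n} \<rightarrow> carrier ?N"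
      using fW[OF w(1)] r t by (auto simp del: restrict_scalars_simps intro!: N.smult_closed)
    fix i assume i: "i \<in> {..<n}"
    have "?j (r i \<odot>\<^bsub>?T\<^esub> s i) = r i \<odot>\<^bsub>?N\<^esub> ?j (s i)" using lin r sT by (simp add: linear_map_def)
    also have "\<dots> = r i \<odot>\<^bsub>?N\<^esub> (w \<odot>\<^bsub>?N\<^esub> t i)" using w(3)[of i] i by simp
    also have "\<dots> = w \<odot>\<^bsub>?N\<^esub> (r i \<odot>\<^bsub>?N\<^esub> t i)"
      using fW[OF w(1)] r t N.smult_assoc1[of "r i" w "t i"] N.smult_assoc1[of w "r i" "t i"] R.m_comm[of w "r i"]
      by (simp del: restrict_scalars_simps)
    finally show "?j (r i \<odot>\<^bsub>?T\<^esub> s i) = w \<odot>\<^bsub>?N\<^esub> (r i \<odot>\<^bsub>?N\<^esub> t i)" .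
  qed
  also have "\<dots> = w \<odot>\<^bsub>?N\<^esub> (\<Oplus>\<^bsub>?N\<^esub>i\<in>{..<n}. r i \<odot>\<^bsub>?N\<^esub> t i)"
    using fW[OF w(1)] r t by (intro N.finsum_smult_ldistr[symmetric]) (auto simp del: restrict_scalars_simps intro!: N.smult_closed)
  also have "\<dots> = \<zero>\<^bsub>?N\<^esub>" unfolding rel using fW[OF w(1)] by (intro N.smult_r_null) auto
  \<comment> \<open>The numerators satisfy the relation only after localization; a further factor v
    from W makes it hold in S itself.\<close>
  finally have j0: "?j (\<Oplus>\<^bsub>?T\<^esub>i\<in>{..<n}. r i \<odot>\<^bsub>?T\<^esub> s i) = ?j \<zero>\<^bsub>S\<^esub>" by (simp add: loc.zero_localized)
  have ST: "(\<Oplus>\<^bsub>?T\<^esub>i\<in>{..<n}. r i \<odot>\<^bsub>?T\<^esub> s i) \<in> carrier ?T"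
    using r sT by (intro T.M.finsum_closed) (auto simp del: restrict_scalars_simps intro!: T.smult_closed)
  then obtain v where v: "v \<in> W" "f v \<otimes>\<^bsub>S\<^esub> (\<Oplus>\<^bsub>?T\<^esub>i\<in>{..<n}. r i \<odot>\<^bsub>?T\<^esub> s i) = \<zero>\<^bsub>S\<^esub>"
    using j0 loc.frac_eq_iff[of "\<Oplus>\<^bsub>?T\<^esub>i\<in>{..<n}. r i \<odot>\<^bsub>?T\<^esub> s i" "\<zero>\<^bsub>S\<^esub>" "\<one>\<^bsub>S\<^esub>" "\<one>\<^bsub>S\<^esub>"] one by auto
  have vs: "v \<odot>\<^bsub>?T\<^esub> s i \<in> carrier ?T" for i using fW[OF v(1)] sT by (intro T.smult_closed) auto
  have "(\<Oplus>\<^bsub>?T\<^esub>i\<in>{..<n}. r i \<odot>\<^bsub>?T\<^esub> (v \<odot>\<^bsub>?T\<^esub> s i)) = (\<Oplus>\<^bsub>?T\<^esub>i\<in>{..<n}. v \<odot>\<^bsub>?T\<^esub> (r i \<odot>\<^bsub>?T\<^esub> s i))"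
    using fW[OF v(1)] r w(2) by (intro T.M.finsum_cong') (auto simp: S.m_lcomm)
  also have "\<dots> = v \<odot>\<^bsub>?T\<^esub> (\<Oplus>\<^bsub>?T\<^esub>i\<in>{..<n}. r i \<odot>\<^bsub>?T\<^esub> s i)"
    using fW[OF v(1)] r sT by (intro T.finsum_smult_ldistr[symmetric]) (auto simp del: restrict_scalars_simps intro!: T.smult_closed)
  also have "\<dots> = \<zero>\<^bsub>?T\<^esub>" using v(2) by simp
  finally have rel': "(\<Oplus>\<^bsub>?T\<^esub>i\<in>{..<n}. r i \<odot>\<^bsub>?T\<^esub> (v \<odot>\<^bsub>?T\<^esub> s i)) = \<zero>\<^bsub>?T\<^esub>" .
  have "equational R ?T W {..<n} r" using flat r by (simp add: flat_upto_def)
  then obtain u where u: "u \<in> W" "null R (self_module R) ?T {..<n} r (\<lambda>i. u \<odot>\<^bsub>?T\<^esub> (v \<odot>\<^bsub>?T\<^esub> s i))"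
    by (rule T.equationalD[OF _ vs rel'])
  have "null R (self_module R) ?N {..<n} r (\<lambda>i. ?j (u \<odot>\<^bsub>?T\<^esub> (v \<odot>\<^bsub>?T\<^esub> s i)))"
    by (rule null_map[OF T N lin u(2)])
  hence "null R (self_module R) ?N {..<n} r (\<lambda>i. (u \<otimes>\<^bsub>R\<^esub> v \<otimes>\<^bsub>R\<^esub> w) \<odot>\<^bsub>?N\<^esub> t i)"
  proof (rule null_cong)
    have c: "u \<in> carrier R" "v \<in> carrier R" "w \<in> carrier R" using u v w by auto
    show "(u \<otimes>\<^bsub>R\<^esub> v \<otimes>\<^bsub>R\<^esub> w) \<odot>\<^bsub>?N\<^esub> t i \<in> carrier ?N" for i using c t by (intro N.smult_closed) auto
    fix i assume i: "i \<in> {..<n}"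
    have "?j (u \<odot>\<^bsub>?T\<^esub> (v \<odot>\<^bsub>?T\<^esub> s i)) = u \<odot>\<^bsub>?N\<^esub> (v \<odot>\<^bsub>?N\<^esub> ?j (s i))"
      using lin c sT[of i] vs[of i] unfolding linear_map_def by metis
    also have "?j (s i) = w \<odot>\<^bsub>?N\<^esub> t i" using w(3)[of i] i by simp
    also have "u \<odot>\<^bsub>?N\<^esub> (v \<odot>\<^bsub>?N\<^esub> (w \<odot>\<^bsub>?N\<^esub> t i)) = (u \<otimes>\<^bsub>R\<^esub> v \<otimes>\<^bsub>R\<^esub> w) \<odot>\<^bsub>?N\<^esub> t i"
      using c t by (simp add: N.smult_assoc1 del: restrict_scalars_simps)
    finally show "(u \<otimes>\<^bsub>R\<^esub> v \<otimes>\<^bsub>R\<^esub> w) \<odot>\<^bsub>?N\<^esub> t i = ?j (u \<odot>\<^bsub>?T\<^esub> (v \<odot>\<^bsub>?T\<^esub> s i))" by simp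
  qed
  moreover have "u \<otimes>\<^bsub>R\<^esub> v \<otimes>\<^bsub>R\<^esub> w \<in> W" using u v w by (intro W.m_closed)
  ultimately show "\<exists>u\<in>W. null R (self_module R) ?N {..<n} r (\<lambda>i. u \<odot>\<^bsub>?N\<^esub> t i)" by blast
qed

section \<open>Vanishing in tensor products\<close>

locale tensor_product = L: module R L + N: module S N
  for R :: "('a, 'm) ring_scheme" and L :: "('a, 'b, 'k) module_scheme"
    and S :: "('s, 'q) ring_scheme" and N :: "('s, 'c, 'n) module_scheme" +
  fixes f :: "'a \<Rightarrow> 's"
  assumes hom: "f \<in> ring_hom R S"
begin

sublocale f: ring_hom_cring R S f
  by unfold_locales (rule hom)

abbreviation "T \<equiv> restrict_scalars f N"

sublocale T: module R T
  by (rule module_restrict_scalars[OF L.is_cring hom N.module_axioms])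

section \<open>Representatives of tensors\<close>

definition "F = free_Abelian_group (carrier L \<times> carrier N)"

definition "K = generate F (tensor_relations R f L N)"

definition act :: "'s \<Rightarrow> ('b \<times> 'c \<Rightarrow>\<^sub>0 int) \<Rightarrow> ('b \<times> 'c \<Rightarrow>\<^sub>0 int)" where
  "act s = frag_extend (\<lambda>(x, y). frag_of (x, s \<odot>\<^bsub>N\<^esub> y))"

lemma carrier_F: "c \<in> carrier F \<longleftrightarrow> Poly_Mapping.keys c \<subseteq> carrier L \<times> carrier N"
  by (simp add: F_def)

lemma F_diff: "a \<in> carrier F \<Longrightarrow> b \<in> carrier F \<Longrightarrow> a - b \<in> carrier F"
  using keys_diff[of a b] by (auto simp: carrier_F)

lemma F_of [simp]: "frag_of (x, y) \<in> carrier F \<longleftrightarrow> x \<in> carrier L \<and> y \<in> carrier N"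
  by (simp add: F_def)

lemma F_sum: "(\<And>i. i \<in> I \<Longrightarrow> g i \<in> carrier F) \<Longrightarrow> sum g I \<in> carrier F"
  unfolding F_def by (rule sum_closed_free_Abelian_group)

lemma relations_subset: "tensor_relations R f L N \<subseteq> carrier F"
  unfolding tensor_relations_def by (auto intro!: F_diff simp: f.hom_closed)

lemma group_F: "group F" by (simp add: F_def)

lemma K_subgroup: "subgroup K F"
  unfolding K_def by (rule group.generate_is_subgroup[OF group_F relations_subset])

lemma K_subset: "K \<subseteq> carrier F" by (rule subgroup.subset[OF K_subgroup])

lemma K_zero [simp]: "0 \<in> K"
  using subgroup.one_closed[OF K_subgroup] by (simp add: F_def)

lemma K_add: "a \<in> K \<Longrightarrow> b \<in> K \<Longrightarrow> a + b \<in> K"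
  using subgroup.m_closed[OF K_subgroup, of a b] by (simp add: F_def)

lemma K_minus: "a \<in> K \<Longrightarrow> - a \<in> K"
  using subgroup.m_inv_closed[OF K_subgroup, of a] subsetD[OF K_subset, of a] by (simp add: F_def)

lemma K_diff: "a \<in> K \<Longrightarrow> b \<in> K \<Longrightarrow> a - b \<in> K"
  using K_add[OF _ K_minus, of a b] by simp

lemma K_sum: "(\<And>i. i \<in> I \<Longrightarrow> g i \<in> K) \<Longrightarrow> sum g I \<in> K"
  by (induction I rule: infinite_finite_induct) (auto intro: K_add)

lemma K_cong: "a - b \<in> K \<Longrightarrow> a \<in> K \<longleftrightarrow> b \<in> K"
  using K_add[of "a - b" b] K_diff[of a "a - b"] by auto

lemma K_incl: "h \<in> tensor_relations R f L N \<Longrightarrow> h \<in> K"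
  unfolding K_def by (rule generate.incl)

lemma K_add_left: "x \<in> carrier L \<Longrightarrow> x' \<in> carrier L \<Longrightarrow> y \<in> carrier N \<Longrightarrow>
    frag_of (x \<oplus>\<^bsub>L\<^esub> x', y) - frag_of (x, y) - frag_of (x', y) \<in> K"
  by (rule K_incl) (auto simp: tensor_relations_def)

lemma K_add_right: "x \<in> carrier L \<Longrightarrow> y \<in> carrier N \<Longrightarrow> y' \<in> carrier N \<Longrightarrow>
    frag_of (x, y \<oplus>\<^bsub>N\<^esub> y') - frag_of (x, y) - frag_of (x, y') \<in> K"
  by (rule K_incl) (auto simp: tensor_relations_def)

lemma K_balance: "a \<in> carrier R \<Longrightarrow> x \<in> carrier L \<Longrightarrow> y \<in> carrier N \<Longrightarrow>
    frag_of (a \<odot>\<^bsub>L\<^esub> x, y) - frag_of (x, f a \<odot>\<^bsub>N\<^esub> y) \<in> K"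
  by (rule K_incl) (auto simp: tensor_relations_def)

lemma K_zero_left: "y \<in> carrier N \<Longrightarrow> frag_of (\<zero>\<^bsub>L\<^esub>, y) \<in> K"
  using K_minus[OF K_add_left[of "\<zero>\<^bsub>L\<^esub>" "\<zero>\<^bsub>L\<^esub>" y]] by simp

lemma K_zero_right: "x \<in> carrier L \<Longrightarrow> frag_of (x, \<zero>\<^bsub>N\<^esub>) \<in> K"
  using K_minus[OF K_add_right[of x "\<zero>\<^bsub>N\<^esub>" "\<zero>\<^bsub>N\<^esub>"]] by simp

lemma K_sum_left:
  assumes "finite A" "\<And>i. i \<in> A \<Longrightarrow> x i \<in> carrier L" "y \<in> carrier N"
  shows "frag_of (\<Oplus>\<^bsub>L\<^esub>i\<in>A. x i, y) - (\<Sum>i\<in>A. frag_of (x i, y)) \<in> K"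
  using assms(1,2)
proof (induction A)
  case empty then show ?case using K_zero_left assms(3) by simp
next
  case (insert a A)
  have cl: "(\<Oplus>\<^bsub>L\<^esub>i\<in>A. x i) \<in> carrier L" using insert by (intro L.M.finsum_closed) auto
  have "(\<Oplus>\<^bsub>L\<^esub>i\<in>insert a A. x i) = x a \<oplus>\<^bsub>L\<^esub> (\<Oplus>\<^bsub>L\<^esub>i\<in>A. x i)"
    using insert by (intro L.M.finsum_insert) auto
  moreover have "frag_of (x a \<oplus>\<^bsub>L\<^esub> (\<Oplus>\<^bsub>L\<^esub>i\<in>A. x i), y) - frag_of (x a, y) - frag_of (\<Oplus>\<^bsub>L\<^esub>i\<in>A. x i, y) \<in> K"
    using insert cl assms(3) by (intro K_add_left) auto
  ultimately show ?case
    using K_add[of "frag_of (\<Oplus>\<^bsub>L\<^esub>i\<in>insert a A. x i, y) - frag_of (x a, y) - frag_of (\<Oplus>\<^bsub>L\<^esub>i\<in>A. x i, y)"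
       "frag_of (\<Oplus>\<^bsub>L\<^esub>i\<in>A. x i, y) - (\<Sum>i\<in>A. frag_of (x i, y))"] insert
    by (simp add: algebra_simps)
qed

lemma act_add: "act s (a + b) = act s a + act s b" by (simp add: act_def frag_extend_add)

lemma act_diff: "act s (a - b) = act s a - act s b" by (simp add: act_def frag_extend_diff)

lemma act_minus: "act s (- a) = - act s a" by (simp add: act_def frag_extend_minus)

lemma act_zero: "act s 0 = 0" by (simp add: act_def)

lemma act_of [simp]: "act s (frag_of (x, y)) = frag_of (x, s \<odot>\<^bsub>N\<^esub> y)" by (simp add: act_def)

lemma act_sum: "act s (\<Sum>i\<in>A. g i) = (\<Sum>i\<in>A. act s (g i))"
  by (induction A rule: infinite_finite_induct) (simp_all add: act_add act_zero)

lemma F_induct [consumes 1, case_names zero of diff]: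
  assumes "c \<in> carrier F" "Q 0" "\<And>x y. x \<in> carrier L \<Longrightarrow> y \<in> carrier N \<Longrightarrow> Q (frag_of (x, y))"
    "\<And>a b. Q a \<Longrightarrow> Q b \<Longrightarrow> Q (a - b)"
  shows "Q c"
  by (rule frag_induction[of c "carrier L \<times> carrier N"]) (use assms carrier_F in auto)

lemma act_mult:
  assumes "s \<in> carrier S" "s' \<in> carrier S" "c \<in> carrier F"
  shows "act s (act s' c) = act (s \<otimes>\<^bsub>S\<^esub> s') c"
  using assms(3) by (induction rule: F_induct) (use assms in \<open>simp_all add: act_zero act_diff N.smult_assoc1\<close>)

lemma act_one: "c \<in> carrier F \<Longrightarrow> act \<one>\<^bsub>S\<^esub> c = c"
  by (induction rule: F_induct) (simp_all add: act_zero act_diff)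

lemma act_closed:
  assumes "s \<in> carrier S" "c \<in> carrier F" shows "act s c \<in> carrier F"
  using assms(2) by (induction rule: F_induct) (use assms(1) in \<open>simp_all add: act_zero act_diff F_diff, simp add: carrier_F\<close>)

lemma act_K:
  assumes s: "s \<in> carrier S" and c: "c \<in> K"
  shows "act s c \<in> K"
proof -
  have rel: "act s h \<in> K" if "h \<in> tensor_relations R f L N" for h
    using that unfolding tensor_relations_def
  proof (elim UnE CollectE exE conjE)
    fix a x y assume h: "h = frag_of (a \<odot>\<^bsub>L\<^esub> x, y) - frag_of (x, f a \<odot>\<^bsub>N\<^esub> y)"
      and a: "a \<in> carrier R" "x \<in> carrier L" "y \<in> carrier N"
    have "s \<odot>\<^bsub>N\<^esub> (f a \<odot>\<^bsub>N\<^esub> y) = f a \<odot>\<^bsub>N\<^esub> (s \<odot>\<^bsub>N\<^esub> y)"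
      using s a by (simp add: N.smult_assoc1[symmetric] N.R.m_comm)
    thus ?thesis unfolding h using K_balance[of a x "s \<odot>\<^bsub>N\<^esub> y"] s a by (simp add: act_diff)
  qed (use s in \<open>auto simp: act_diff N.smult_r_distr intro!: K_add_left K_add_right\<close>)
  show ?thesis using c unfolding K_def
  proof (induction rule: generate.induct)
    case one then show ?case using K_zero by (simp add: F_def act_zero K_def)
  next
    case (incl h) then show ?case using rel by (simp add: K_def)
  next
    case (inv h)
    then have "inv\<^bsub>F\<^esub> h = - h" using relations_subset by (auto simp: F_def)
    then show ?case using rel[OF inv] K_minus by (simp add: act_minus K_def)
  next
    case (eng h1 h2) then show ?case using K_add by (simp add: F_def act_add K_def)
  qed
qed

abbreviation "tens \<equiv> tensor_module R f L N"

lemma carrier_tensor: "carrier tens = {K #>\<^bsub>F\<^esub> c | c. c \<in> carrier F}"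
  by (auto simp: tensor_module_def Let_def F_def[symmetric] K_def[symmetric] carrier_FactGroup)

lemma zero_tensor: "\<zero>\<^bsub>tens\<^esub> = K"
  by (simp add: tensor_module_def Let_def F_def[symmetric] K_def[symmetric])

lemma coset_eq: "K #>\<^bsub>F\<^esub> c = {k + c | k. k \<in> K}"
  by (auto simp: r_coset_def F_def)

lemma coset_cong:
  assumes "c - d \<in> K" shows "K #>\<^bsub>F\<^esub> c = K #>\<^bsub>F\<^esub> d"
proof -
  have "k + c \<in> {k + d | k. k \<in> K}" if "k \<in> K" for k
    using K_add[OF that assms] by (intro CollectI exI[of _ "k + (c - d)"]) simp
  moreover have "k + d \<in> {k + c | k. k \<in> K}" if "k \<in> K" for k
    using K_diff[OF that assms] by (intro CollectI exI[of _ "k - (c - d)"]) simp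
  ultimately show ?thesis unfolding coset_eq by blast
qed

lemma coset_eq_K: "K #>\<^bsub>F\<^esub> c = K \<longleftrightarrow> c \<in> K"
proof
  assume "K #>\<^bsub>F\<^esub> c = K"
  moreover have "0 + c \<in> K #>\<^bsub>F\<^esub> c" unfolding coset_eq using K_zero by blast
  ultimately show "c \<in> K" by simp
next
  assume "c \<in> K"
  hence "K #>\<^bsub>F\<^esub> c = K #>\<^bsub>F\<^esub> 0" by (intro coset_cong) simp
  thus "K #>\<^bsub>F\<^esub> c = K" by (simp add: coset_eq)
qed

lemma smult_tensor:
  assumes "s \<in> carrier S" "c \<in> carrier F"
  shows "s \<odot>\<^bsub>tens\<^esub> (K #>\<^bsub>F\<^esub> c) = K #>\<^bsub>F\<^esub> act s c"
proof -
  have "s \<odot>\<^bsub>tens\<^esub> (K #>\<^bsub>F\<^esub> c) = (\<Union>d \<in> K #>\<^bsub>F\<^esub> c. K #>\<^bsub>F\<^esub> act s d)"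
    by (simp add: tensor_module_def Let_def F_def[symmetric] K_def[symmetric] act_def)
  also have "\<dots> = (\<Union>d \<in> K #>\<^bsub>F\<^esub> c. K #>\<^bsub>F\<^esub> act s c)"
  proof (rule SUP_cong[OF refl])
    fix d assume "d \<in> K #>\<^bsub>F\<^esub> c"
    then obtain k where "k \<in> K" "d = k + c" by (auto simp: coset_eq)
    thus "K #>\<^bsub>F\<^esub> act s d = K #>\<^bsub>F\<^esub> act s c" using act_K[OF assms(1)] by (intro coset_cong) (simp add: act_add)
  qed
  also have "\<dots> = K #>\<^bsub>F\<^esub> act s c" using K_zero by (auto simp: coset_eq)
  finally show ?thesis .
qed

text \<open>Turns annihilators in the tensor product into membership in K, so that the later
  arguments use elements of the free group instead of cosets.\<close>

lemma annihilator_tensor: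
  "c \<in> carrier F \<Longrightarrow> annihilator S tens (K #>\<^bsub>F\<^esub> c) = {s \<in> carrier S. act s c \<in> K}"
  unfolding annihilator_def
  by (intro Collect_cong conj_cong refl) (simp add: smult_tensor zero_tensor coset_eq_K)

text \<open>A representative in the free group of the sum of the tensors x_i (x) t_i.\<close>

definition formal :: "'i set \<Rightarrow> ('i \<Rightarrow> 'b) \<Rightarrow> ('i \<Rightarrow> 'c) \<Rightarrow> ('b \<times> 'c \<Rightarrow>\<^sub>0 int)" where
  "formal A x t = (\<Sum>i\<in>A. frag_of (x i, t i))"

lemma act_formal: "act s (formal A x t) = formal A x (\<lambda>i. s \<odot>\<^bsub>N\<^esub> t i)"
  by (simp add: formal_def act_sum)

lemma formal_closed: "(\<And>i. x i \<in> carrier L) \<Longrightarrow> (\<And>i. t i \<in> carrier N) \<Longrightarrow> formal A x t \<in> carrier F"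
  unfolding formal_def by (intro F_sum) simp

text \<open>Negative coefficients are absorbed modulo K because -(x (x) y) = (-x) (x) y, and
  repetitions are listed separately.\<close>

lemma formal_exists:
  assumes "c \<in> carrier F"
  shows "\<exists>(n::nat) x t. (\<forall>i. x i \<in> carrier L) \<and> (\<forall>i. t i \<in> carrier N) \<and> c - formal {..<n} x t \<in> K"
proof -
  define fl where "fl zs = sum_list (map frag_of zs)" for zs :: "('b \<times> 'c) list"
  have neg: "\<exists>ws. set ws \<subseteq> carrier L \<times> carrier N \<and> - fl zs - fl ws \<in> K" if "set zs \<subseteq> carrier L \<times> carrier N" for zs
    using that
  proof (induction zs)
    case Nil then show ?case by (intro exI[of _ "[]"]) (auto simp: fl_def)
  next
    case (Cons z zs)
    then obtain ws where ws: "set ws \<subseteq> carrier L \<times> carrier N" "- fl zs - fl ws \<in> K" by auto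
    obtain x y where z: "z = (x, y)" "x \<in> carrier L" "y \<in> carrier N" using Cons.prems by auto
    have "frag_of (\<ominus>\<^bsub>L\<^esub> x \<oplus>\<^bsub>L\<^esub> x, y) - frag_of (\<ominus>\<^bsub>L\<^esub> x, y) - frag_of (x, y) \<in> K"
      using z by (intro K_add_left) auto
    moreover have "frag_of (\<ominus>\<^bsub>L\<^esub> x \<oplus>\<^bsub>L\<^esub> x, y) \<in> K" using z K_zero_left by (simp add: L.M.l_neg)
    ultimately have "- frag_of (x, y) - frag_of (\<ominus>\<^bsub>L\<^esub> x, y) \<in> K"
      using K_diff[of "frag_of (\<ominus>\<^bsub>L\<^esub> x \<oplus>\<^bsub>L\<^esub> x, y) - frag_of (\<ominus>\<^bsub>L\<^esub> x, y) - frag_of (x, y)"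
          "frag_of (\<ominus>\<^bsub>L\<^esub> x \<oplus>\<^bsub>L\<^esub> x, y)"] by (simp add: algebra_simps)
    hence "(- fl zs - fl ws) + (- frag_of (x, y) - frag_of (\<ominus>\<^bsub>L\<^esub> x, y)) \<in> K" using ws K_add by blast
    hence "- fl (z # zs) - fl ((\<ominus>\<^bsub>L\<^esub> x, y) # ws) \<in> K" by (simp add: fl_def z algebra_simps)
    thus ?case using ws z by (intro exI[of _ "(\<ominus>\<^bsub>L\<^esub> x, y) # ws"]) auto
  qed
  have "\<exists>zs. set zs \<subseteq> carrier L \<times> carrier N \<and> c - fl zs \<in> K" using assms
  proof (induction rule: F_induct)
    case zero show ?case by (intro exI[of _ "[]"]) (simp add: fl_def)
  next
    case (of x y) then show ?case by (intro exI[of _ "[(x, y)]"]) (simp add: fl_def)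
  next
    case (diff a b)
    then obtain zs ws where zs: "set zs \<subseteq> carrier L \<times> carrier N" "a - fl zs \<in> K"
      and ws: "set ws \<subseteq> carrier L \<times> carrier N" "b - fl ws \<in> K" by blast
    obtain vs where vs: "set vs \<subseteq> carrier L \<times> carrier N" "- fl ws - fl vs \<in> K" using neg[OF ws(1)] by blast
    have "(a - fl zs) - (b - fl ws) + (- fl ws - fl vs) \<in> K" using zs ws vs K_add K_diff by blast
    hence "a - b - fl (zs @ vs) \<in> K" by (simp add: fl_def algebra_simps)
    thus ?case using zs vs by (intro exI[of _ "zs @ vs"]) auto
  qed
  then obtain zs where zs: "set zs \<subseteq> carrier L \<times> carrier N" "c - fl zs \<in> K" by blast
  define x where "x i = (if i < length zs then fst (zs ! i) else \<zero>\<^bsub>L\<^esub>)" for i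
  define t where "t i = (if i < length zs then snd (zs ! i) else \<zero>\<^bsub>N\<^esub>)" for i
  have nth: "zs ! i \<in> carrier L \<times> carrier N" if "i < length zs" for i using that zs(1) nth_mem by blast
  have "fl zs = (\<Sum>i\<in>{..<length zs}. frag_of (zs ! i))"
    unfolding fl_def by (simp add: sum_list_sum_nth atLeast0LessThan)
  also have "\<dots> = formal {..<length zs} x t" unfolding formal_def by (intro sum.cong) (auto simp: x_def t_def)
  finally have "c - formal {..<length zs} x t \<in> K" using zs by simp
  moreover have "x i \<in> carrier L" "t i \<in> carrier N" for i using nth[of i] by (auto simp: x_def t_def mem_Times_iff)
  ultimately show ?thesis by blast
qed

lemma formal_lincomb:
  assumes "finite A" "\<And>i. x i \<in> carrier L" "\<And>i. a i \<in> carrier R" "y \<in> carrier N"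
  shows "frag_of (\<Oplus>\<^bsub>L\<^esub>i\<in>A. a i \<odot>\<^bsub>L\<^esub> x i, y) - formal A x (\<lambda>i. f (a i) \<odot>\<^bsub>N\<^esub> y) \<in> K"
proof -
  let ?m = "\<Sum>i\<in>A. frag_of (a i \<odot>\<^bsub>L\<^esub> x i, y)"
  have "frag_of (\<Oplus>\<^bsub>L\<^esub>i\<in>A. a i \<odot>\<^bsub>L\<^esub> x i, y) - ?m \<in> K"
    using assms by (intro K_sum_left) auto
  moreover have "?m - formal A x (\<lambda>i. f (a i) \<odot>\<^bsub>N\<^esub> y) \<in> K"
    unfolding formal_def sum_subtractf[symmetric] using assms by (intro K_sum K_balance) auto
  ultimately have "(frag_of (\<Oplus>\<^bsub>L\<^esub>i\<in>A. a i \<odot>\<^bsub>L\<^esub> x i, y) - ?m) + (?m - formal A x (\<lambda>i. f (a i) \<odot>\<^bsub>N\<^esub> y)) \<in> K"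
    by (rule K_add)
  thus ?thesis by simp
qed

lemma syzygy_formal_K:
  assumes "finite A" "\<And>i. x i \<in> carrier L" "a \<in> syzygies R L A x" "y \<in> carrier N"
  shows "formal A x (\<lambda>i. f (a i) \<odot>\<^bsub>N\<^esub> y) \<in> K"
proof -
  have "frag_of (\<Oplus>\<^bsub>L\<^esub>i\<in>A. a i \<odot>\<^bsub>L\<^esub> x i, y) - formal A x (\<lambda>i. f (a i) \<odot>\<^bsub>N\<^esub> y) \<in> K"
    using syzygies_carrier[OF assms(3)] by (intro formal_lincomb assms(1,2,4))
  moreover have "frag_of (\<Oplus>\<^bsub>L\<^esub>i\<in>A. a i \<odot>\<^bsub>L\<^esub> x i, y) \<in> K"
    using assms(3,4) K_zero_left by (simp add: syzygies_def)
  ultimately show ?thesis using K_cong by blast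
qed

lemma formal_add:
  assumes "\<And>i. x i \<in> carrier L" "\<And>i. t i \<in> carrier N" "\<And>i. t' i \<in> carrier N"
  shows "formal A x (\<lambda>i. t i \<oplus>\<^bsub>N\<^esub> t' i) - formal A x t - formal A x t' \<in> K"
  unfolding formal_def sum_subtractf[symmetric] using assms by (intro K_sum K_add_right) auto

lemma formal_cong: "(\<And>i. i \<in> A \<Longrightarrow> t i = t' i) \<Longrightarrow> formal A x t = formal A x t'"
  by (simp add: formal_def)

lemma null_imp_K:
  assumes "finite A" "\<And>i. x i \<in> carrier L" "null R L T A x t"
  shows "formal A x t \<in> K"
  using assms(3)
proof induction
  case (zero t)
  then show ?case unfolding formal_def using assms(2) K_zero_right by (intro K_sum) auto
next
  case (add t a y t')
  have a: "\<And>i. a i \<in> carrier R" using syzygies_carrier[OF add.hyps(2)] .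
  have t: "\<And>i. t i \<in> carrier N" using null_carrier[OF add.hyps(1)] by simp
  have y: "y \<in> carrier N" using add.hyps by simp
  have "formal A x t' = formal A x (\<lambda>i. t i \<oplus>\<^bsub>N\<^esub> f (a i) \<odot>\<^bsub>N\<^esub> y)"
    using add.hyps by (intro formal_cong) auto
  moreover have "formal A x (\<lambda>i. t i \<oplus>\<^bsub>N\<^esub> f (a i) \<odot>\<^bsub>N\<^esub> y) - formal A x t - formal A x (\<lambda>i. f (a i) \<odot>\<^bsub>N\<^esub> y) \<in> K"
    using assms a t y by (intro formal_add) auto
  moreover have "formal A x (\<lambda>i. f (a i) \<odot>\<^bsub>N\<^esub> y) \<in> K"
    using syzygy_formal_K[OF assms(1,2) add.hyps(2) y] .
  ultimately show ?case using add.IH K_add K_cong by (metis diff_add_cancel)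
qed

text \<open>
  A linear relation \<open>(n, r, s)\<close> stands for \<open>\<Sum>\<^sub>i r\<^sub>i s\<^sub>i = 0\<close>. Finitely many relations suffice to
  make a given element of \<open>K\<close> vanish, and by flatness finitely many elements of \<open>N\<close> can be written in terms of functions \<open>\<delta>\<close> preserving them.
\<close>

definition relation :: "nat \<times> (nat \<Rightarrow> 'a) \<times> (nat \<Rightarrow> 'c) \<Rightarrow> bool" where
  "relation = (\<lambda>(n, r, s). (\<forall>i. r i \<in> carrier R) \<and> (\<forall>i. s i \<in> carrier N) \<and>
     (\<Oplus>\<^bsub>T\<^esub>i\<in>{..<n}. r i \<odot>\<^bsub>T\<^esub> s i) = \<zero>\<^bsub>T\<^esub>)"

definition preserves :: "('c \<Rightarrow> 'a) \<Rightarrow> nat \<times> (nat \<Rightarrow> 'a) \<times> (nat \<Rightarrow> 'c) \<Rightarrow> bool" where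
  "preserves \<delta> = (\<lambda>(n, r, s). (\<Oplus>\<^bsub>R\<^esub>i\<in>{..<n}. \<delta> (s i) \<otimes>\<^bsub>R\<^esub> r i) = \<zero>\<^bsub>R\<^esub>)"

text \<open>The map sending x (x) y to delta(y) x. For a linear functional delta on N it would
  factor through the tensor product; as delta is an arbitrary function, it lives on the free group
  only.\<close>

definition evaluation :: "('c \<Rightarrow> 'a) \<Rightarrow> (('b \<times> 'c \<Rightarrow>\<^sub>0 int) \<Rightarrow> 'b) \<Rightarrow> bool" where
  "evaluation \<delta> h \<longleftrightarrow> h \<in> hom F (add_monoid L) \<and>
     (\<forall>x\<in>carrier L. \<forall>y\<in>carrier N. h (frag_of (x, y)) = \<delta> y \<odot>\<^bsub>L\<^esub> x)"

lemma evaluation_exists: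
  assumes "\<And>y. \<delta> y \<in> carrier R"
  obtains h where "evaluation \<delta> h"
proof -
  have "(\<lambda>(x, y). \<delta> y \<odot>\<^bsub>L\<^esub> x) ` (carrier L \<times> carrier N) \<subseteq> carrier (add_monoid L)" using assms by auto
  then obtain h where "h \<in> hom (free_Abelian_group (carrier L \<times> carrier N)) (add_monoid L)"
    "\<And>p. p \<in> carrier L \<times> carrier N \<Longrightarrow> h (frag_of p) = (\<lambda>(x, y). \<delta> y \<odot>\<^bsub>L\<^esub> x) p"
    using comm_group.free_Abelian_group_universal[OF L.a_comm_group] by blast
  hence "evaluation \<delta> h" by (auto simp: evaluation_def F_def)
  thus ?thesis by (rule that)
qed

lemma evaluation_add:
  assumes "evaluation \<delta> h" "a \<in> carrier F" "b \<in> carrier F"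
  shows "h (a + b) = h a \<oplus>\<^bsub>L\<^esub> h b" "h a \<in> carrier L"
  using assms unfolding evaluation_def hom_def by (auto simp: F_def)

lemma evaluation_diff:
  assumes "evaluation \<delta> h" "a \<in> carrier F" "b \<in> carrier F"
  shows "h (a - b) = h a \<ominus>\<^bsub>L\<^esub> h b"
proof -
  have "h ((a - b) + b) = h (a - b) \<oplus>\<^bsub>L\<^esub> h b" using assms F_diff by (intro evaluation_add) auto
  thus ?thesis using evaluation_add(2)[OF assms(1), of a b] evaluation_add(2)[OF assms(1), of b b]
      evaluation_add(2)[OF assms(1) F_diff[OF assms(2,3)] assms(3)] assms
    by (simp add: L.M.minus_eq L.M.a_assoc L.M.r_neg)
qed

lemma evaluation_zero:
  assumes "evaluation \<delta> h" shows "h 0 = \<zero>\<^bsub>L\<^esub>"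
proof -
  have "0 \<in> carrier F" by (simp add: carrier_F)
  thus ?thesis using evaluation_diff[OF assms, of 0 0] evaluation_add(2)[OF assms, of 0 0] by (simp add: L.M.minus_eq L.M.r_neg)
qed

lemma evaluation_formal:
  assumes "evaluation \<delta> h" "finite A" "\<And>i. x i \<in> carrier L" "\<And>i. t i \<in> carrier N" "\<And>y. \<delta> y \<in> carrier R"
  shows "h (formal A x t) = (\<Oplus>\<^bsub>L\<^esub>i\<in>A. \<delta> (t i) \<odot>\<^bsub>L\<^esub> x i)"
  using assms(2)
proof (induction A)
  case empty then show ?case using evaluation_zero[OF assms(1)] by (simp add: formal_def)
next
  case (insert a A)
  have "formal (insert a A) x t = frag_of (x a, t a) + formal A x t" using insert by (simp add: formal_def)
  moreover have "h (frag_of (x a, t a) + formal A x t) = h (frag_of (x a, t a)) \<oplus>\<^bsub>L\<^esub> h (formal A x t)"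
    using assms by (intro evaluation_add(1)[OF assms(1)] formal_closed) auto
  ultimately show ?case using insert assms by (simp add: evaluation_def Pi_def)
qed

definition kills where
  "kills \<Gamma> c \<longleftrightarrow> (\<forall>\<delta> h. (\<forall>y. \<delta> y \<in> carrier R) \<longrightarrow> (\<forall>\<rho>\<in>\<Gamma>. preserves \<delta> \<rho>) \<longrightarrow> evaluation \<delta> h \<longrightarrow> h c = \<zero>\<^bsub>L\<^esub>)"

lemma killsD:
  "kills \<Gamma> c \<Longrightarrow> (\<And>y. \<delta> y \<in> carrier R) \<Longrightarrow> (\<And>\<rho>. \<rho> \<in> \<Gamma> \<Longrightarrow> preserves \<delta> \<rho>) \<Longrightarrow> evaluation \<delta> h \<Longrightarrow> h c = \<zero>\<^bsub>L\<^esub>"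
  unfolding kills_def by blast

text \<open>Additivity in the first factor is respected by every evaluation. Additivity in the
  second factor and balancing each amount to one linear relation in N, with three and two terms
  respectively. An element of K is built from finitely many generators, whose relations are
  collected.\<close>

lemma K_finitely_many_relations:
  assumes "c \<in> K"
  shows "\<exists>\<Gamma>. finite \<Gamma> \<and> (\<forall>\<rho>\<in>\<Gamma>. relation \<rho>) \<and> kills \<Gamma> c"
proof -
  have rel: "\<exists>\<Gamma>. finite \<Gamma> \<and> (\<forall>\<rho>\<in>\<Gamma>. relation \<rho>) \<and> kills \<Gamma> c"
    if "c \<in> tensor_relations R f L N" for c
    using that unfolding tensor_relations_def
  proof (elim UnE CollectE exE conjE)
    fix x x' y assume c: "c = frag_of (x \<oplus>\<^bsub>L\<^esub> x', y) - frag_of (x, y) - frag_of (x', y)"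
      and x: "x \<in> carrier L" "x' \<in> carrier L" "y \<in> carrier N"
    have "h c = \<zero>\<^bsub>L\<^esub>" if "\<forall>y. \<delta> y \<in> carrier R" "evaluation \<delta> h" for \<delta> h
    proof -
      have "h c = \<delta> y \<odot>\<^bsub>L\<^esub> (x \<oplus>\<^bsub>L\<^esub> x') \<ominus>\<^bsub>L\<^esub> \<delta> y \<odot>\<^bsub>L\<^esub> x \<ominus>\<^bsub>L\<^esub> \<delta> y \<odot>\<^bsub>L\<^esub> x'"
        unfolding c using that x by (simp add: evaluation_diff F_diff) (simp add: evaluation_def)
      thus ?thesis using that x by (simp add: L.smult_r_distr L.M.minus_eq L.M.minus_add L.M.a_ac L.M.r_neg L.M.r_neg1)
    qed
    thus ?thesis unfolding kills_def by (intro exI[of _ "{}"]) auto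
  next
    fix x y y' assume c: "c = frag_of (x, y \<oplus>\<^bsub>N\<^esub> y') - frag_of (x, y) - frag_of (x, y')"
      and x: "x \<in> carrier L" "y \<in> carrier N" "y' \<in> carrier N"
    define r where "r i = (if i = (0::nat) then \<one>\<^bsub>R\<^esub> else \<ominus>\<^bsub>R\<^esub> \<one>\<^bsub>R\<^esub>)" for i
    define s where "s i = (if i = (0::nat) then y \<oplus>\<^bsub>N\<^esub> y' else if i = 1 then y else y')" for i
    have three: "{..<3::nat} = {0, 1, 2}" by auto
    have "relation (3, r, s)"
    proof -
      have "(\<Oplus>\<^bsub>T\<^esub>i\<in>{..<3}. r i \<odot>\<^bsub>T\<^esub> s i) = (y \<oplus>\<^bsub>N\<^esub> y') \<oplus>\<^bsub>N\<^esub> (\<ominus>\<^bsub>N\<^esub> y \<oplus>\<^bsub>N\<^esub> \<ominus>\<^bsub>N\<^esub> y')"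
        unfolding three using x by (simp add: r_def s_def N.smult_l_minus)
      also have "\<dots> = \<zero>\<^bsub>N\<^esub>" using x by (simp add: N.M.a_ac N.M.r_neg N.M.r_neg1)
      finally show ?thesis using x by (auto simp: relation_def r_def s_def)
    qed
    moreover have "h c = \<zero>\<^bsub>L\<^esub>" if d: "\<forall>y. \<delta> y \<in> carrier R" "evaluation \<delta> h" "preserves \<delta> (3, r, s)" for \<delta> h
    proof -
      have dR: "\<delta> z \<in> carrier R" for z using d(1) by simp
      have "\<delta> (y \<oplus>\<^bsub>N\<^esub> y') \<oplus>\<^bsub>R\<^esub> (\<ominus>\<^bsub>R\<^esub> \<delta> y \<oplus>\<^bsub>R\<^esub> \<ominus>\<^bsub>R\<^esub> \<delta> y') = \<zero>\<^bsub>R\<^esub>"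
        using d(3) dR unfolding preserves_def by (simp add: three r_def s_def L.R.r_minus)
      moreover have "\<delta> (y \<oplus>\<^bsub>N\<^esub> y') = (\<delta> (y \<oplus>\<^bsub>N\<^esub> y') \<oplus>\<^bsub>R\<^esub> (\<ominus>\<^bsub>R\<^esub> \<delta> y \<oplus>\<^bsub>R\<^esub> \<ominus>\<^bsub>R\<^esub> \<delta> y')) \<oplus>\<^bsub>R\<^esub> (\<delta> y \<oplus>\<^bsub>R\<^esub> \<delta> y')"
        using dR[of "y \<oplus>\<^bsub>N\<^esub> y'"] dR[of y] dR[of y'] by algebra
      ultimately have e: "\<delta> (y \<oplus>\<^bsub>N\<^esub> y') = \<delta> y \<oplus>\<^bsub>R\<^esub> \<delta> y'" using dR by simp
      have "h c = \<delta> (y \<oplus>\<^bsub>N\<^esub> y') \<odot>\<^bsub>L\<^esub> x \<ominus>\<^bsub>L\<^esub> \<delta> y \<odot>\<^bsub>L\<^esub> x \<ominus>\<^bsub>L\<^esub> \<delta> y' \<odot>\<^bsub>L\<^esub> x"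
        unfolding c using d(2) x by (simp add: evaluation_diff F_diff) (simp add: evaluation_def)
      thus ?thesis unfolding e using dR x by (simp add: L.smult_l_distr L.M.minus_eq L.M.minus_add L.M.a_ac L.M.r_neg L.M.r_neg1)
    qed
    ultimately show ?thesis unfolding kills_def by (intro exI[of _ "{(3, r, s)}"]) auto
  next
    fix a x y assume c: "c = frag_of (a \<odot>\<^bsub>L\<^esub> x, y) - frag_of (x, f a \<odot>\<^bsub>N\<^esub> y)"
      and x: "a \<in> carrier R" "x \<in> carrier L" "y \<in> carrier N"
    define r where "r i = (if i = (0::nat) then \<one>\<^bsub>R\<^esub> else \<ominus>\<^bsub>R\<^esub> a)" for i
    define s where "s i = (if i = (0::nat) then f a \<odot>\<^bsub>N\<^esub> y else y)" for i
    have two: "{..<2::nat} = {0, 1}" by auto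
    have "relation (2, r, s)"
    proof -
      have "(\<Oplus>\<^bsub>T\<^esub>i\<in>{..<2}. r i \<odot>\<^bsub>T\<^esub> s i) = \<zero>\<^bsub>N\<^esub>"
        unfolding two using x by (simp add: r_def s_def N.smult_l_minus N.M.r_neg)
      thus ?thesis using x by (auto simp: relation_def r_def s_def)
    qed
    moreover have "h c = \<zero>\<^bsub>L\<^esub>" if d: "\<forall>y. \<delta> y \<in> carrier R" "evaluation \<delta> h" "preserves \<delta> (2, r, s)" for \<delta> h
    proof -
      have dR: "\<delta> z \<in> carrier R" for z using d(1) by simp
      have "\<delta> (f a \<odot>\<^bsub>N\<^esub> y) \<oplus>\<^bsub>R\<^esub> \<ominus>\<^bsub>R\<^esub> (\<delta> y \<otimes>\<^bsub>R\<^esub> a) = \<zero>\<^bsub>R\<^esub>"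
        using d(3) dR x unfolding preserves_def by (simp add: two r_def s_def L.R.r_minus)
      moreover have "\<delta> (f a \<odot>\<^bsub>N\<^esub> y) = (\<delta> (f a \<odot>\<^bsub>N\<^esub> y) \<oplus>\<^bsub>R\<^esub> \<ominus>\<^bsub>R\<^esub> (\<delta> y \<otimes>\<^bsub>R\<^esub> a)) \<oplus>\<^bsub>R\<^esub> \<delta> y \<otimes>\<^bsub>R\<^esub> a"
        using dR[of "f a \<odot>\<^bsub>N\<^esub> y"] dR[of y] x(1) by algebra
      ultimately have e: "\<delta> (f a \<odot>\<^bsub>N\<^esub> y) = \<delta> y \<otimes>\<^bsub>R\<^esub> a" using dR x by simp
      have "h c = \<delta> y \<odot>\<^bsub>L\<^esub> (a \<odot>\<^bsub>L\<^esub> x) \<ominus>\<^bsub>L\<^esub> \<delta> (f a \<odot>\<^bsub>N\<^esub> y) \<odot>\<^bsub>L\<^esub> x"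
        unfolding c using d(2) x by (simp add: evaluation_diff F_diff) (simp add: evaluation_def)
      thus ?thesis unfolding e using dR x by (simp add: L.smult_assoc1 L.M.minus_eq L.M.r_neg)
    qed
    ultimately show ?thesis unfolding kills_def by (intro exI[of _ "{(2, r, s)}"]) auto
  qed
  show ?thesis using assms unfolding K_def
  proof (induction rule: generate.induct)
    case one then show ?case using evaluation_zero unfolding kills_def by (intro exI[of _ "{}"]) (auto simp: F_def)
  next
    case (incl c) then show ?case by (rule rel)
  next
    case (inv c)
    have c: "c \<in> carrier F" using inv relations_subset by auto
    have inv_eq: "h (inv\<^bsub>F\<^esub> c) = \<ominus>\<^bsub>L\<^esub> h c" if "evaluation \<delta> h" for \<delta> h
      using evaluation_diff[OF that, of 0 c] evaluation_zero[OF that] evaluation_add(2)[OF that c c] c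
      by (simp add: F_def L.M.minus_eq)
    have "kills \<Gamma> (inv\<^bsub>F\<^esub> c)" if "kills \<Gamma> c" for \<Gamma>
      unfolding kills_def
    proof (intro allI impI)
      fix \<delta> h assume d: "\<forall>y. \<delta> y \<in> carrier R" "\<forall>\<rho>\<in>\<Gamma>. preserves \<delta> \<rho>" and h: "evaluation \<delta> h"
      have "h c = \<zero>\<^bsub>L\<^esub>" using killsD[OF that _ _ h] d by auto
      thus "h (inv\<^bsub>F\<^esub> c) = \<zero>\<^bsub>L\<^esub>"
        using inv_eq[OF h]
          L.M.minus_equality[of "\<zero>\<^bsub>L\<^esub>" "\<zero>\<^bsub>L\<^esub>"] by simp
    qed
    then show ?case using rel[OF inv] by blast
  next
    case (eng c d)
    have cd: "c \<in> carrier F" "d \<in> carrier F" using eng K_subset by (auto simp: K_def)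
    obtain \<Gamma> where \<Gamma>: "finite \<Gamma>" "\<forall>\<rho>\<in>\<Gamma>. relation \<rho>" "kills \<Gamma> c" using eng.IH(1) by blast
    obtain \<Gamma>' where \<Gamma>': "finite \<Gamma>'" "\<forall>\<rho>\<in>\<Gamma>'. relation \<rho>" "kills \<Gamma>' d" using eng.IH(2) by blast
    have "kills (\<Gamma> \<union> \<Gamma>') (c \<otimes>\<^bsub>F\<^esub> d)"
      unfolding kills_def
    proof (intro allI impI)
      fix \<delta> h assume d: "\<forall>y. \<delta> y \<in> carrier R" "\<forall>\<rho>\<in>\<Gamma> \<union> \<Gamma>'. preserves \<delta> \<rho>" and h: "evaluation \<delta> h"
      have "h c = \<zero>\<^bsub>L\<^esub>" "h d = \<zero>\<^bsub>L\<^esub>" using killsD[OF \<Gamma>(3) _ _ h] killsD[OF \<Gamma>'(3) _ _ h] d by auto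
      thus "h (c \<otimes>\<^bsub>F\<^esub> d) = \<zero>\<^bsub>L\<^esub>" using evaluation_add(1)[OF h cd] by (simp add: F_def)
    qed
    then show ?case using \<Gamma>(1,2) \<Gamma>'(1,2) by (intro exI[of _ "\<Gamma> \<union> \<Gamma>'"]) auto
  qed
qed

text \<open>A finite form of Lazard's description of flat modules: on Y, multiplication by u factors
  through R^m, with coordinate functions delta_j that respect the relations in Gamma and with v_j as
  images of the basis.\<close>

definition expansion where
  "expansion \<Gamma> Y u m \<delta> v \<longleftrightarrow> (\<forall>j y. \<delta> j y \<in> carrier R) \<and> (\<forall>j. v j \<in> carrier T) \<and>
    (\<forall>y\<in>Y. u \<odot>\<^bsub>T\<^esub> y = (\<Oplus>\<^bsub>T\<^esub>j\<in>{..<m::nat}. \<delta> j y \<odot>\<^bsub>T\<^esub> v j)) \<and> (\<forall>j<m. \<forall>\<rho>\<in>\<Gamma>. preserves (\<delta> j) \<rho>)"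

lemma expansionD:
  assumes "expansion \<Gamma> Y u m \<delta> v"
  shows "\<And>j y. \<delta> j y \<in> carrier R" "\<And>j. v j \<in> carrier T"
    "\<And>y. y \<in> Y \<Longrightarrow> u \<odot>\<^bsub>T\<^esub> y = (\<Oplus>\<^bsub>T\<^esub>j\<in>{..<m}. \<delta> j y \<odot>\<^bsub>T\<^esub> v j)"
    "\<And>j \<sigma>. j < m \<Longrightarrow> \<sigma> \<in> \<Gamma> \<Longrightarrow> preserves (\<delta> j) \<sigma>"
  using assms unfolding expansion_def by blast+

text \<open>The relations are imposed one at a time. Flatness is applied to the defects of the
  coordinates with respect to the new relation, and the coordinates are recombined along syzygies of
  the defects.\<close>

lemma flat_imp_expansion:
  assumes flat: "flat_upto R W T" and W: "submonoid W R"
    and "finite \<Gamma>" "\<forall>\<rho>\<in>\<Gamma>. relation \<rho>" and "finite Y" "Y \<subseteq> carrier N"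
  shows "\<exists>u\<in>W. \<exists>m \<delta> v. expansion \<Gamma> Y u m \<delta> v"
  using assms(3-)
proof (induction \<Gamma> arbitrary: Y rule: finite_induct)
  case empty
  interpret W: submonoid W R by (rule W)
  \<comment> \<open>Without relations, the v j are the elements of Y and the delta j their indicator
    functions; the list is distinct so that each y is counted once.\<close>
  obtain ys where ys: "set ys = Y" "distinct ys" using finite_distinct_list[OF empty(2)] by blast
  define v where "v j = (if j < length ys then ys ! j else \<zero>\<^bsub>N\<^esub>)" for j
  define \<delta> where "\<delta> j y = (if y = v j then \<one>\<^bsub>R\<^esub> else \<zero>\<^bsub>R\<^esub>)" for j y
  have v: "v j \<in> carrier N" for j using ys empty(3) nth_mem by (fastforce simp: v_def)
  have "\<one>\<^bsub>R\<^esub> \<odot>\<^bsub>T\<^esub> y = (\<Oplus>\<^bsub>T\<^esub>j\<in>{..<length ys}. \<delta> j y \<odot>\<^bsub>T\<^esub> v j)" if y: "y \<in> Y" for y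
  proof -
    obtain k where k: "k < length ys" "y = ys ! k" using y ys by (metis in_set_conv_nth)
    have "(\<Oplus>\<^bsub>T\<^esub>j\<in>{..<length ys}. \<delta> j y \<odot>\<^bsub>T\<^esub> v j) = (\<Oplus>\<^bsub>T\<^esub>j\<in>{..<length ys}. if k = j then y else \<zero>\<^bsub>T\<^esub>)"
    proof (rule T.M.finsum_cong'[OF refl])
      fix j assume j: "j \<in> {..<length ys}"
      have "y = v j \<longleftrightarrow> k = j" using j k ys(2) by (auto simp: v_def nth_eq_iff_index_eq)
      thus "\<delta> j y \<odot>\<^bsub>T\<^esub> v j = (if k = j then y else \<zero>\<^bsub>T\<^esub>)" using v[of j] by (auto simp: \<delta>_def)
    qed (use y empty(3) in auto)
    also have "\<dots> = y" using k y empty(3) by (intro T.M.add.finprod_singleton) auto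
    finally show ?thesis using y empty(3) by auto
  qed
  thus ?case using v W.one_closed
    unfolding expansion_def
    by (intro bexI[of _ "\<one>\<^bsub>R\<^esub>"] exI[of _ "length ys"] exI[of _ \<delta>] exI[of _ v]) (auto simp: \<delta>_def)
next
  case (insert \<rho> \<Gamma>)
  interpret W: submonoid W R by (rule W)
  interpret self: module R "self_module R" by (rule L.R.module_self_module)
  obtain n r s where \<rho>: "\<rho> = (n, r, s)" by (cases \<rho>)
  have rs: "\<And>i. r i \<in> carrier R" "\<And>i. s i \<in> carrier N" "(\<Oplus>\<^bsub>T\<^esub>i\<in>{..<n}. r i \<odot>\<^bsub>T\<^esub> s i) = \<zero>\<^bsub>T\<^esub>"
    using insert.prems(1) unfolding \<rho> relation_def by auto
  \<comment> \<open>Y is enlarged by the entries of the new relation, as their expansions are needed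
    to compute its defects.\<close>
  have "\<exists>u\<in>W. \<exists>m \<delta> v. expansion \<Gamma> (Y \<union> s ` {..<n}) u m \<delta> v"
    by (rule insert.IH) (use insert.prems rs(2) in auto)
  then obtain u m \<delta> v where uW: "u \<in> W" and exp: "expansion \<Gamma> (Y \<union> s ` {..<n}) u m \<delta> v" by blast
  note u = uW expansionD[OF exp]
  have uR: "u \<in> carrier R" using u(1) by auto
  \<comment> \<open>The defect of the new relation under delta_j. The sum of the b_j v_j vanishes,
    being the expansion of u times the relation, so flatness makes a multiple of v a combination of
    syzygies of b.\<close>
  define b where "b j = (\<Oplus>\<^bsub>R\<^esub>i\<in>{..<n}. \<delta> j (s i) \<otimes>\<^bsub>R\<^esub> r i)" for j
  have b: "\<And>j. b j \<in> carrier R" using u(2) rs(1) by (auto simp: b_def)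
  have "(\<Oplus>\<^bsub>T\<^esub>j\<in>{..<m}. b j \<odot>\<^bsub>T\<^esub> v j) = (\<Oplus>\<^bsub>T\<^esub>i\<in>{..<n}. r i \<odot>\<^bsub>T\<^esub> (\<Oplus>\<^bsub>T\<^esub>j\<in>{..<m}. \<delta> j (s i) \<odot>\<^bsub>T\<^esub> v j))"
    unfolding b_def using u(2,3) rs(1) by (intro T.finsum_matrix[of _ _ "\<lambda>j i. \<delta> j (s i)"]) auto
  also have "\<dots> = (\<Oplus>\<^bsub>T\<^esub>i\<in>{..<n}. u \<odot>\<^bsub>T\<^esub> (r i \<odot>\<^bsub>T\<^esub> s i))"
  proof (rule T.M.finsum_cong'[OF refl])
    have c: "s i \<in> carrier T" for i using rs(2) by simp
    show "(\<lambda>i. u \<odot>\<^bsub>T\<^esub> (r i \<odot>\<^bsub>T\<^esub> s i)) \<in> {..<n} \<rightarrow> carrier T"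
      using uR rs(1) c by (auto simp del: restrict_scalars_simps intro!: T.smult_closed)
    fix i assume i: "i \<in> {..<n}"
    hence "r i \<odot>\<^bsub>T\<^esub> (\<Oplus>\<^bsub>T\<^esub>j\<in>{..<m}. \<delta> j (s i) \<odot>\<^bsub>T\<^esub> v j) = r i \<odot>\<^bsub>T\<^esub> (u \<odot>\<^bsub>T\<^esub> s i)"
      using u(4)[of "s i"] by simp
    also have "\<dots> = u \<odot>\<^bsub>T\<^esub> (r i \<odot>\<^bsub>T\<^esub> s i)"
      using T.smult_assoc1[OF uR rs(1) c] T.smult_assoc1[OF rs(1) uR c] L.R.m_comm[OF uR rs(1)] by metis
    finally show "r i \<odot>\<^bsub>T\<^esub> (\<Oplus>\<^bsub>T\<^esub>j\<in>{..<m}. \<delta> j (s i) \<odot>\<^bsub>T\<^esub> v j) = u \<odot>\<^bsub>T\<^esub> (r i \<odot>\<^bsub>T\<^esub> s i)" .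
  qed
  also have "\<dots> = u \<odot>\<^bsub>T\<^esub> \<zero>\<^bsub>T\<^esub>"
    unfolding rs(3)[symmetric] using uR rs(1,2) by (intro T.finsum_smult_ldistr[symmetric]) auto
  also have "\<dots> = \<zero>\<^bsub>T\<^esub>" by (rule T.smult_r_null[OF uR])
  finally have rel: "(\<Oplus>\<^bsub>T\<^esub>j\<in>{..<m}. b j \<odot>\<^bsub>T\<^esub> v j) = \<zero>\<^bsub>T\<^esub>" .
  have "equational R T W {..<m} b" using flat b by (simp add: flat_upto_def)
  then obtain u' where u': "u' \<in> W" "null R (self_module R) T {..<m} b (\<lambda>j. u' \<odot>\<^bsub>T\<^esub> v j)"
    by (rule T.equationalD[OF _ u(3) rel])
  have u'R: "u' \<in> carrier R" using u'(1) by auto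
  have "\<exists>m' \<delta>' v'. (\<forall>j y. \<delta>' j y \<in> carrier R) \<and> (\<forall>j. v' j \<in> carrier T) \<and>
    (\<forall>y. (\<Oplus>\<^bsub>T\<^esub>j\<in>{..<m}. \<delta> j y \<odot>\<^bsub>T\<^esub> z j) = (\<Oplus>\<^bsub>T\<^esub>j\<in>{..<m'::nat}. \<delta>' j y \<odot>\<^bsub>T\<^esub> v' j)) \<and>
    (\<forall>j<m'. \<forall>\<sigma>\<in>insert \<rho> \<Gamma>. preserves (\<delta>' j) \<sigma>)"
    if "null R (self_module R) T {..<m} b z" for z
    using that
  proof induction
    case (zero z)
    have "(\<Oplus>\<^bsub>T\<^esub>j\<in>{..<m}. \<delta> j y \<odot>\<^bsub>T\<^esub> z j) = \<zero>\<^bsub>T\<^esub>" for y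
      using zero u(2) by (intro T.M.add.finprod_one_eqI) (auto simp: f.hom_closed)
    then show ?case by (intro exI[of _ 0] exI[of _ "\<lambda>_ _. \<zero>\<^bsub>R\<^esub>"] exI[of _ "\<lambda>_. \<zero>\<^bsub>T\<^esub>"]) auto
  next
    case (add z g c z')
    obtain m' \<delta>' v' where IH: "\<And>j y. \<delta>' j y \<in> carrier R" "\<And>j. v' j \<in> carrier T"
      "\<And>y. (\<Oplus>\<^bsub>T\<^esub>j\<in>{..<m}. \<delta> j y \<odot>\<^bsub>T\<^esub> z j) = (\<Oplus>\<^bsub>T\<^esub>j\<in>{..<m'::nat}. \<delta>' j y \<odot>\<^bsub>T\<^esub> v' j)"
      "\<And>j \<sigma>. j < m' \<Longrightarrow> \<sigma> \<in> insert \<rho> \<Gamma> \<Longrightarrow> preserves (\<delta>' j) \<sigma>"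
      using add.IH by metis
    have g: "\<And>j. g j \<in> carrier R" using syzygies_carrier[OF add.hyps(2)] .
    have z: "\<And>j. z j \<in> carrier T" using null_carrier[OF add.hyps(1)] .
    have c: "c \<in> carrier T" by (rule add.hyps(3))
    \<comment> \<open>The coordinates combined along a syzygy g of the defects preserve the new
      relation by the choice of g, and those in Gamma by linearity.\<close>
    define \<epsilon> where "\<epsilon> y = (\<Oplus>\<^bsub>R\<^esub>j\<in>{..<m}. \<delta> j y \<otimes>\<^bsub>R\<^esub> g j)" for y
    have \<epsilon>R: "\<epsilon> y \<in> carrier R" for y using u(2) g by (auto simp: \<epsilon>_def)
    have swap: "(\<Oplus>\<^bsub>R\<^esub>i\<in>{..<n'}. \<epsilon> (s' i) \<otimes>\<^bsub>R\<^esub> r' i) = (\<Oplus>\<^bsub>R\<^esub>j\<in>{..<m}. g j \<otimes>\<^bsub>R\<^esub> (\<Oplus>\<^bsub>R\<^esub>i\<in>{..<n'}. \<delta> j (s' i) \<otimes>\<^bsub>R\<^esub> r' i))"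
      if "\<And>i. r' i \<in> carrier R" for n' :: nat and r' s'
      unfolding \<epsilon>_def using self.finsum_matrix[of "{..<n'}" "{..<m}" "\<lambda>i j. \<delta> j (s' i)" g r'] u(2) g that by simp
    have \<epsilon>: "preserves \<epsilon> \<sigma>" if \<sigma>: "\<sigma> \<in> insert \<rho> \<Gamma>" for \<sigma>
    proof -
      obtain n' r' s' where \<sigma>': "\<sigma> = (n', r', s')" by (cases \<sigma>)
      have r': "\<And>i. r' i \<in> carrier R" using insert.prems(1) \<sigma> unfolding \<sigma>' relation_def by fastforce
      show ?thesis
      proof (cases "\<sigma> = \<rho>")
        case True
        hence "(\<Oplus>\<^bsub>R\<^esub>i\<in>{..<n}. \<epsilon> (s i) \<otimes>\<^bsub>R\<^esub> r i) = (\<Oplus>\<^bsub>R\<^esub>j\<in>{..<m}. g j \<otimes>\<^bsub>R\<^esub> b j)"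
          unfolding b_def by (intro swap rs(1))
        thus ?thesis using add.hyps(2) True by (simp add: preserves_def \<rho> syzygies_def)
      next
        case False
        hence "\<sigma> \<in> \<Gamma>" using \<sigma> by simp
        hence "(\<Oplus>\<^bsub>R\<^esub>i\<in>{..<n'}. \<delta> j (s' i) \<otimes>\<^bsub>R\<^esub> r' i) = \<zero>\<^bsub>R\<^esub>" if "j < m" for j
          using u(5)[OF that] by (auto simp: preserves_def \<sigma>')
        hence "(\<Oplus>\<^bsub>R\<^esub>j\<in>{..<m}. g j \<otimes>\<^bsub>R\<^esub> (\<Oplus>\<^bsub>R\<^esub>i\<in>{..<n'}. \<delta> j (s' i) \<otimes>\<^bsub>R\<^esub> r' i)) = \<zero>\<^bsub>R\<^esub>"
          using g by (intro L.R.add.finprod_one_eqI) auto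
        moreover have "(\<Oplus>\<^bsub>R\<^esub>i\<in>{..<n'}. \<epsilon> (s' i) \<otimes>\<^bsub>R\<^esub> r' i) = (\<Oplus>\<^bsub>R\<^esub>j\<in>{..<m}. g j \<otimes>\<^bsub>R\<^esub> (\<Oplus>\<^bsub>R\<^esub>i\<in>{..<n'}. \<delta> j (s' i) \<otimes>\<^bsub>R\<^esub> r' i))"
          by (intro swap r')
        ultimately show ?thesis by (simp add: preserves_def \<sigma>')
      qed
    qed
    have eq: "(\<Oplus>\<^bsub>T\<^esub>j\<in>{..<m}. \<delta> j y \<odot>\<^bsub>T\<^esub> z' j)
      = (\<Oplus>\<^bsub>T\<^esub>j\<in>{..<Suc m'}. (\<delta>'(m' := \<epsilon>)) j y \<odot>\<^bsub>T\<^esub> (v'(m' := c)) j)" for y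
    proof -
      have "(\<Oplus>\<^bsub>T\<^esub>j\<in>{..<m}. \<delta> j y \<odot>\<^bsub>T\<^esub> z' j) = (\<Oplus>\<^bsub>T\<^esub>j\<in>{..<m}. \<delta> j y \<odot>\<^bsub>T\<^esub> z j \<oplus>\<^bsub>T\<^esub> (\<delta> j y \<otimes>\<^bsub>R\<^esub> g j) \<odot>\<^bsub>T\<^esub> c)"
        using add.hyps(5) u(2) g z c
        by (intro T.M.finsum_cong') (auto simp: T.smult_r_distr T.smult_assoc1 simp del: restrict_scalars_simps)
      also have "\<dots> = (\<Oplus>\<^bsub>T\<^esub>j\<in>{..<m}. \<delta> j y \<odot>\<^bsub>T\<^esub> z j) \<oplus>\<^bsub>T\<^esub> (\<Oplus>\<^bsub>T\<^esub>j\<in>{..<m}. (\<delta> j y \<otimes>\<^bsub>R\<^esub> g j) \<odot>\<^bsub>T\<^esub> c)"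
        using u(2) g z c by (intro T.M.finsum_addf) (auto simp del: restrict_scalars_simps)
      also have "(\<Oplus>\<^bsub>T\<^esub>j\<in>{..<m}. (\<delta> j y \<otimes>\<^bsub>R\<^esub> g j) \<odot>\<^bsub>T\<^esub> c) = \<epsilon> y \<odot>\<^bsub>T\<^esub> c"
        unfolding \<epsilon>_def using u(2) g c by (intro T.finsum_smult_rdistr[symmetric]) auto
      also have "(\<Oplus>\<^bsub>T\<^esub>j\<in>{..<m}. \<delta> j y \<odot>\<^bsub>T\<^esub> z j) = (\<Oplus>\<^bsub>T\<^esub>j\<in>{..<m'}. (\<delta>'(m' := \<epsilon>)) j y \<odot>\<^bsub>T\<^esub> (v'(m' := c)) j)"
        unfolding IH(3) using IH(1,2)
        by (intro T.M.finsum_cong') (auto simp del: restrict_scalars_simps)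
      also have "\<dots> \<oplus>\<^bsub>T\<^esub> \<epsilon> y \<odot>\<^bsub>T\<^esub> c = (\<Oplus>\<^bsub>T\<^esub>j\<in>{..<Suc m'}. (\<delta>'(m' := \<epsilon>)) j y \<odot>\<^bsub>T\<^esub> (v'(m' := c)) j)"
      proof -
        have cl: "(\<delta>'(m' := \<epsilon>)) j y \<odot>\<^bsub>T\<^esub> (v'(m' := c)) j \<in> carrier T" for j
          using IH(1,2) \<epsilon>R c by (intro T.smult_closed) auto
        have "(\<Oplus>\<^bsub>T\<^esub>j\<in>{..<Suc m'}. (\<delta>'(m' := \<epsilon>)) j y \<odot>\<^bsub>T\<^esub> (v'(m' := c)) j)
          = (\<delta>'(m' := \<epsilon>)) m' y \<odot>\<^bsub>T\<^esub> (v'(m' := c)) m' \<oplus>\<^bsub>T\<^esub> (\<Oplus>\<^bsub>T\<^esub>j\<in>{..<m'}. (\<delta>'(m' := \<epsilon>)) j y \<odot>\<^bsub>T\<^esub> (v'(m' := c)) j)"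
          unfolding lessThan_Suc by (rule T.M.finsum_insert) (simp, simp, use cl in blast, rule cl)
        also have "\<dots> = (\<Oplus>\<^bsub>T\<^esub>j\<in>{..<m'}. (\<delta>'(m' := \<epsilon>)) j y \<odot>\<^bsub>T\<^esub> (v'(m' := c)) j) \<oplus>\<^bsub>T\<^esub> (\<delta>'(m' := \<epsilon>)) m' y \<odot>\<^bsub>T\<^esub> (v'(m' := c)) m'"
          by (rule T.M.a_comm[OF cl T.M.finsum_closed]) (use cl in blast)
        finally show ?thesis by (simp only: fun_upd_same)
      qed
      finally show ?thesis .
    qed
    show ?case
      by (intro exI[of _ "Suc m'"] exI[of _ "\<delta>'(m' := \<epsilon>)"] exI[of _ "v'(m' := c)"] conjI)
        (use eq IH \<epsilon>R \<epsilon> c in \<open>auto simp: less_Suc_eq\<close>)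
  qed
  from this[OF u'(2)] obtain m' \<delta>' v' where w: "\<And>j y. \<delta>' j y \<in> carrier R" "\<And>j. v' j \<in> carrier T"
    "\<And>y. (\<Oplus>\<^bsub>T\<^esub>j\<in>{..<m}. \<delta> j y \<odot>\<^bsub>T\<^esub> (u' \<odot>\<^bsub>T\<^esub> v j)) = (\<Oplus>\<^bsub>T\<^esub>j\<in>{..<m'::nat}. \<delta>' j y \<odot>\<^bsub>T\<^esub> v' j)"
    "\<And>j \<sigma>. j < m' \<Longrightarrow> \<sigma> \<in> insert \<rho> \<Gamma> \<Longrightarrow> preserves (\<delta>' j) \<sigma>" by metis
  have "(u' \<otimes>\<^bsub>R\<^esub> u) \<odot>\<^bsub>T\<^esub> y = (\<Oplus>\<^bsub>T\<^esub>j\<in>{..<m'}. \<delta>' j y \<odot>\<^bsub>T\<^esub> v' j)" if y: "y \<in> Y" for y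
  proof -
    have yT: "y \<in> carrier T" using y insert.prems(3) by auto
    have "(u' \<otimes>\<^bsub>R\<^esub> u) \<odot>\<^bsub>T\<^esub> y = u' \<odot>\<^bsub>T\<^esub> (u \<odot>\<^bsub>T\<^esub> y)" by (rule T.smult_assoc1[OF u'R uR yT])
    also have "u \<odot>\<^bsub>T\<^esub> y = (\<Oplus>\<^bsub>T\<^esub>j\<in>{..<m}. \<delta> j y \<odot>\<^bsub>T\<^esub> v j)" using u(4) y by blast
    also have "u' \<odot>\<^bsub>T\<^esub> (\<Oplus>\<^bsub>T\<^esub>j\<in>{..<m}. \<delta> j y \<odot>\<^bsub>T\<^esub> v j) = (\<Oplus>\<^bsub>T\<^esub>j\<in>{..<m}. u' \<odot>\<^bsub>T\<^esub> (\<delta> j y \<odot>\<^bsub>T\<^esub> v j))"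
      using u'R u(2,3) by (intro T.finsum_smult_ldistr) (auto simp del: restrict_scalars_simps)
    also have "\<dots> = (\<Oplus>\<^bsub>T\<^esub>j\<in>{..<m}. \<delta> j y \<odot>\<^bsub>T\<^esub> (u' \<odot>\<^bsub>T\<^esub> v j))"
    proof (rule T.M.finsum_cong'[OF refl])
      fix j show "u' \<odot>\<^bsub>T\<^esub> (\<delta> j y \<odot>\<^bsub>T\<^esub> v j) = \<delta> j y \<odot>\<^bsub>T\<^esub> (u' \<odot>\<^bsub>T\<^esub> v j)"
        using T.smult_assoc1[OF u'R u(2) u(3)] T.smult_assoc1[OF u(2) u'R u(3)] L.R.m_comm[OF u'R u(2)] by metis
    qed (use u'R u(2,3) in \<open>auto simp del: restrict_scalars_simps\<close>)
    finally show ?thesis using w(3) by simp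
  qed
  hence "expansion (insert \<rho> \<Gamma>) Y (u' \<otimes>\<^bsub>R\<^esub> u) m' \<delta>' v'"
    unfolding expansion_def using w(1,2,4) by blast
  thus ?case using W.m_closed[OF u'(1) u(1)] by blast
qed

text \<open>The converse of \<open>null_imp_K\<close>, up to W: a sum of tensors x_i (x) t_i
  vanishes only for the trivial reason that a multiple of t is a combination of syzygies of x. The
  syzygies are the coordinates of the t_i in an expansion respecting the finitely many relations
  that make the sum vanish.\<close>

lemma K_imp_null:
  assumes flat: "flat_upto R W T" and W: "submonoid W R"
    and A: "finite A" "\<And>i. x i \<in> carrier L" "\<And>i. t i \<in> carrier N" "formal A x t \<in> K"
  shows "\<exists>u\<in>W. null R L T A x (\<lambda>i. u \<odot>\<^bsub>T\<^esub> t i)"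
proof -
  obtain \<Gamma> where \<Gamma>: "finite \<Gamma>" "\<forall>\<rho>\<in>\<Gamma>. relation \<rho>"
    "kills \<Gamma> (formal A x t)"
    using K_finitely_many_relations[OF A(4)] by blast
  have "\<exists>u\<in>W. \<exists>m \<delta> v. expansion \<Gamma> (t ` A) u m \<delta> v"
    by (rule flat_imp_expansion[OF flat W \<Gamma>(1,2)]) (use A in auto)
  then obtain u m \<delta> v where uW: "u \<in> W" and exp: "expansion \<Gamma> (t ` A) u m \<delta> v" by blast
  note u = uW expansionD[OF exp]
  \<comment> \<open>The evaluation at delta_j kills the formal sum, and its value there is the
    combination of the x_i with coefficients \<open>\<delta> j (t i)\<close>.\<close>
  have syz: "(\<lambda>i. \<delta> j (t i)) \<in> syzygies R L A x" if j: "j < m" for j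
  proof -
    obtain h where h: "evaluation (\<delta> j) h" using evaluation_exists[of "\<delta> j"] u(2) by blast
    have "(\<Oplus>\<^bsub>L\<^esub>i\<in>A. \<delta> j (t i) \<odot>\<^bsub>L\<^esub> x i) = h (formal A x t)"
      using evaluation_formal[OF h A(1-3)] u(2) by simp
    also have "\<dots> = \<zero>\<^bsub>L\<^esub>" using killsD[OF \<Gamma>(3) u(2) u(5)[OF j] h] .
    finally show ?thesis using u(2) by (simp add: syzygies_def)
  qed
  interpret W: submonoid W R by (rule W)
  have uR: "u \<in> carrier R" using u(1) by auto
  have "null R L T A x (\<lambda>i. \<Oplus>\<^bsub>T\<^esub>j\<in>{..<m}. \<delta> j (t i) \<odot>\<^bsub>T\<^esub> v j)"
    using syz u(3) by (intro T.null_sum T.null_single) auto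
  hence "null R L T A x (\<lambda>i. u \<odot>\<^bsub>T\<^esub> t i)"
    by (rule null_cong) (use u(4) uR A(3) in auto)
  thus ?thesis using u(1) by blast
qed

end

section \<open>Strong Krull primes\<close>

text \<open>The submodule P N for the action through f, built one product at a time in parallel with
  the rule \<open>null.add\<close>.\<close>

inductive_set ideal_mult :: "('a \<Rightarrow> 's) \<Rightarrow> 'a set \<Rightarrow> ('s, 'c, 'n) module_scheme \<Rightarrow> 'c set" for f P N where
  zero: "\<zero>\<^bsub>N\<^esub> \<in> ideal_mult f P N"
| add: "\<lbrakk>z \<in> ideal_mult f P N; r \<in> P; y \<in> carrier N\<rbrakk> \<Longrightarrow> z \<oplus>\<^bsub>N\<^esub> f r \<odot>\<^bsub>N\<^esub> y \<in> ideal_mult f P N"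

text \<open>An element-wise version of \<open>Q \<in> sK\<^sub>S(N/PN)\<close>.\<close>

definition quotient_sK ::
    "('a \<Rightarrow> 's) \<Rightarrow> 'a set \<Rightarrow> ('s, 'q) ring_scheme \<Rightarrow> ('s, 'c, 'n) module_scheme \<Rightarrow> 's set \<Rightarrow> bool" where
  "quotient_sK f P S N Q \<longleftrightarrow> (\<forall>I. fg_ideal I S \<and> I \<subseteq> Q \<longrightarrow>
     (\<exists>y\<in>carrier N. (\<forall>a\<in>I. a \<odot>\<^bsub>N\<^esub> y \<in> ideal_mult f P N) \<and>
        (\<forall>s\<in>carrier S. s \<odot>\<^bsub>N\<^esub> y \<in> ideal_mult f P N \<longrightarrow> s \<in> Q)))"

lemma (in ring) fg_ideal_subset: "fg_ideal I R \<Longrightarrow> I \<subseteq> carrier R"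
  unfolding fg_ideal_def using ideal.Icarr[OF genideal_ideal] by blast

lemma (in cring) contraction_prime:
  assumes f: "f \<in> ring_hom R S" and Q: "primeideal Q S"
  shows "primeideal {r \<in> carrier R. f r \<in> Q} R"
proof -
  interpret Q: primeideal Q S by fact
  interpret S: cring S by (rule Q.is_cring)
  interpret f: ring_hom_cring R S f by unfold_locales (rule f)
  have one: "\<one>\<^bsub>S\<^esub> \<notin> Q" using Q.primeideal_one_notin[OF Q] by simp
  show ?thesis
  proof (rule primeidealI)
    show "ideal {r \<in> carrier R. f r \<in> Q} R" by (rule idealI') (auto simp: Q.I_l_closed)
    have "\<one> \<notin> {r \<in> carrier R. f r \<in> Q}" using one by simp
    thus "carrier R \<noteq> {r \<in> carrier R. f r \<in> Q}" by blast
    show "a \<in> {r \<in> carrier R. f r \<in> Q} \<or> b \<in> {r \<in> carrier R. f r \<in> Q}"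
      if "a \<in> carrier R" "b \<in> carrier R" "a \<otimes> b \<in> {r \<in> carrier R. f r \<in> Q}" for a b
      using that Q.I_prime[of "f a" "f b"] by auto
  qed (rule is_cring)
qed

section \<open>Strong Krull primes of a tensor product\<close>

context tensor_product
begin

abbreviation "PN P \<equiv> ideal_mult f P N"

lemma PN_closed:
  assumes P: "P \<subseteq> carrier R" and "z \<in> PN P" shows "z \<in> carrier N"
  using assms(2) by induction (use P in auto)

lemma PN_add:
  assumes P: "P \<subseteq> carrier R" and z: "z \<in> PN P" and "w \<in> PN P"
  shows "z \<oplus>\<^bsub>N\<^esub> w \<in> PN P"
  using assms(3)
proof induction
  case zero then show ?case using z PN_closed[OF P z] by simp
next
  case (add w r y)
  have "z \<oplus>\<^bsub>N\<^esub> (w \<oplus>\<^bsub>N\<^esub> f r \<odot>\<^bsub>N\<^esub> y) = (z \<oplus>\<^bsub>N\<^esub> w) \<oplus>\<^bsub>N\<^esub> f r \<odot>\<^bsub>N\<^esub> y"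
    using PN_closed[OF P z] PN_closed[OF P add.hyps(1)] add.hyps P by (subst N.M.a_assoc) auto
  then show ?case using ideal_mult.add[OF add.IH add.hyps(2,3)] by simp
qed

lemma PN_smult:
  assumes P: "P \<subseteq> carrier R" and s: "s \<in> carrier S" and "z \<in> PN P"
  shows "s \<odot>\<^bsub>N\<^esub> z \<in> PN P"
  using assms(3)
proof induction
  case zero then show ?case using s ideal_mult.zero by simp
next
  case (add z r y)
  have r: "f r \<in> carrier S" using add.hyps P by auto
  have "s \<odot>\<^bsub>N\<^esub> (z \<oplus>\<^bsub>N\<^esub> f r \<odot>\<^bsub>N\<^esub> y) = s \<odot>\<^bsub>N\<^esub> z \<oplus>\<^bsub>N\<^esub> f r \<odot>\<^bsub>N\<^esub> (s \<odot>\<^bsub>N\<^esub> y)"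
    using PN_closed[OF P add.hyps(1)] add.hyps(3) r s
    by (simp add: N.smult_r_distr N.smult_assoc1[symmetric] N.R.m_comm)
  then show ?case using ideal_mult.add[OF add.IH add.hyps(2), of "s \<odot>\<^bsub>N\<^esub> y"] s add.hyps(3) by simp
qed

lemma PN_annihilator_ideal:
  assumes P: "P \<subseteq> carrier R" and y: "y \<in> carrier N"
  shows "ideal {a \<in> carrier S. a \<odot>\<^bsub>N\<^esub> y \<in> PN P} S"
  by (rule N.R.idealI')
    (use PN_add[OF P] PN_smult[OF P] y ideal_mult.zero in \<open>auto simp: N.smult_l_distr N.smult_assoc1\<close>)

text \<open>Here the x_i behave like a minimal generating system: if all their syzygies have
  coefficients in P, a trivial family has its entries in P N.\<close>

lemma null_imp_PN:
  assumes P: "P \<subseteq> carrier R" and "null R L T A x t"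
    and syz: "\<And>a i. a \<in> syzygies R L A x \<Longrightarrow> i \<in> A \<Longrightarrow> a i \<in> P" and i: "i \<in> A"
  shows "t i \<in> PN P"
  using assms(2)
proof induction
  case (zero t) then show ?case using i ideal_mult.zero by simp
next
  case (add t a y t')
  then show ?case using ideal_mult.add[OF add.IH syz[OF add.hyps(2) i]] i by simp
qed

lemma frag_PN_K:
  assumes P: "P \<subseteq> carrier R" and x: "x \<in> carrier L" "\<And>r. r \<in> P \<Longrightarrow> r \<odot>\<^bsub>L\<^esub> x = \<zero>\<^bsub>L\<^esub>" and "z \<in> PN P"
  shows "frag_of (x, z) \<in> K"
  using assms(4)
proof induction
  case zero then show ?case using K_zero_right x by simp
next
  case (add z r y)
  have r: "r \<in> carrier R" using add P by auto
  have "frag_of (r \<odot>\<^bsub>L\<^esub> x, y) - frag_of (x, f r \<odot>\<^bsub>N\<^esub> y) \<in> K" by (rule K_balance[OF r x(1) add.hyps(3)])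
  hence 1: "frag_of (x, f r \<odot>\<^bsub>N\<^esub> y) \<in> K" using K_cong K_zero_left x(2) add.hyps by metis
  have "frag_of (x, z \<oplus>\<^bsub>N\<^esub> f r \<odot>\<^bsub>N\<^esub> y) - frag_of (x, z) - frag_of (x, f r \<odot>\<^bsub>N\<^esub> y) \<in> K"
    using K_add_right x(1) PN_closed[OF P add.hyps(1)] r add.hyps(3) by simp
  thus ?case using K_add[OF K_add[OF _ 1] add.IH] by fastforce
qed

definition witness :: "'s set \<Rightarrow> 's set \<Rightarrow> ('b \<times> 'c \<Rightarrow>\<^sub>0 int) \<Rightarrow> bool" where
  "witness I Q c \<longleftrightarrow> c \<in> carrier F \<and> (\<forall>a\<in>I. act a c \<in> K) \<and> (\<forall>s\<in>carrier S. act s c \<in> K \<longrightarrow> s \<in> Q)"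

lemma sK_tensor_iff:
  "Q \<in> strong_Krull_primes S tens \<longleftrightarrow> primeideal Q S \<and> (\<forall>I. fg_ideal I S \<and> I \<subseteq> Q \<longrightarrow> (\<exists>c. witness I Q c))"
proof -
  have "(\<exists>z\<in>carrier tens. I \<subseteq> annihilator S tens z \<and> annihilator S tens z \<subseteq> Q) \<longleftrightarrow> (\<exists>c. witness I Q c)"
    if I: "fg_ideal I S" for I
  proof -
    have "(I \<subseteq> annihilator S tens (K #>\<^bsub>F\<^esub> c) \<and> annihilator S tens (K #>\<^bsub>F\<^esub> c) \<subseteq> Q) \<longleftrightarrow> witness I Q c"
      if "c \<in> carrier F" for c
      unfolding annihilator_tensor[OF that] witness_def using that N.R.fg_ideal_subset[OF I] by blast
    moreover have "witness I Q c \<Longrightarrow> c \<in> carrier F" for c by (simp add: witness_def)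
    ultimately show ?thesis unfolding carrier_tensor by blast
  qed
  thus ?thesis unfolding strong_Krull_primes_def by blast
qed

lemma witness_cong:
  assumes w: "witness I Q c" and d: "d \<in> carrier F" "c - d \<in> K" and I: "I \<subseteq> carrier S"
  shows "witness I Q d"
proof -
  have "act s c \<in> K \<longleftrightarrow> act s d \<in> K" if "s \<in> carrier S" for s
    using K_cong[of "act s c" "act s d"] act_K[OF that d(2)] by (simp add: act_diff)
  thus ?thesis using w d I unfolding witness_def by blast
qed

text \<open>If s kills u z then s u kills z and lies in Q; as Q is prime and u is outside it, s is
  in Q. Witnesses may therefore be scaled by elements outside Q.\<close>

lemma witness_act:
  assumes w: "witness I Q c" and Q: "primeideal Q S" and u: "u \<in> carrier S - Q" and I: "I \<subseteq> carrier S"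
  shows "witness I Q (act u c)"
proof -
  have c: "c \<in> carrier F" and uS: "u \<in> carrier S" using w u by (auto simp: witness_def)
  have "act a (act u c) \<in> K" if a: "a \<in> I" for a
  proof -
    have "act a (act u c) = act u (act a c)"
      using a I uS c by (simp add: act_mult N.R.m_comm subset_iff)
    thus ?thesis using a w uS act_K by (simp add: witness_def)
  qed
  moreover have "s \<in> Q" if s: "s \<in> carrier S" "act s (act u c) \<in> K" for s
  proof -
    have "s \<otimes>\<^bsub>S\<^esub> u \<in> Q" using w s uS c by (simp add: act_mult witness_def)
    thus ?thesis using primeideal.I_prime[OF Q s(1) uS] u by auto
  qed
  ultimately show ?thesis using act_closed[OF uS c] by (simp add: witness_def)
qed

text \<open>If a is a syzygy of the multiples b x_i, then the combination of the x_i with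
  coefficients a_i is killed by b and by whatever kills all x_i. Regrouping the formal sum along the
  syzygies replaces the x_i by such combinations.\<close>

lemma null_shift:
  assumes "null R L T A (\<lambda>i. b \<odot>\<^bsub>L\<^esub> x i) t" "finite A" "b \<in> carrier R" "B \<subseteq> carrier R"
    and x: "\<And>i. x i \<in> carrier L" "\<And>i r. r \<in> B \<Longrightarrow> r \<odot>\<^bsub>L\<^esub> x i = \<zero>\<^bsub>L\<^esub>"
  shows "\<exists>(n::nat) x' t'. (\<forall>i. x' i \<in> carrier L) \<and> (\<forall>i. t' i \<in> carrier N) \<and>
    formal A x t - formal {..<n} x' t' \<in> K \<and> (\<forall>i. \<forall>r\<in>insert b B. r \<odot>\<^bsub>L\<^esub> x' i = \<zero>\<^bsub>L\<^esub>)"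
  using assms(1)
proof induction
  case (zero t)
  have "formal A x t \<in> K" unfolding formal_def using zero x(1) K_zero_right by (intro K_sum) auto
  then show ?case using assms(3,4)
    by (intro exI[of _ 0] exI[of _ "\<lambda>_. \<zero>\<^bsub>L\<^esub>"] exI[of _ "\<lambda>_. \<zero>\<^bsub>N\<^esub>"]) (auto simp: formal_def)
next
  case (add t a y t')
  obtain n x1 t1 where IH: "\<And>i. x1 i \<in> carrier L" "\<And>i. t1 i \<in> carrier N"
    "formal A x t - formal {..<n::nat} x1 t1 \<in> K" "\<And>i r. r \<in> insert b B \<Longrightarrow> r \<odot>\<^bsub>L\<^esub> x1 i = \<zero>\<^bsub>L\<^esub>"
    using add.IH by blast
  have a: "\<And>i. a i \<in> carrier R" using syzygies_carrier[OF add.hyps(2)] .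
  have tN: "\<And>i. t i \<in> carrier N" using null_carrier[OF add.hyps(1)] by simp
  have y: "y \<in> carrier N" using add.hyps by simp
  define z0 where "z0 = (\<Oplus>\<^bsub>L\<^esub>i\<in>A. a i \<odot>\<^bsub>L\<^esub> x i)"
  have z0: "z0 \<in> carrier L" unfolding z0_def using a x(1) by (intro L.M.finsum_closed) auto
  have rz0: "r \<odot>\<^bsub>L\<^esub> z0 = (\<Oplus>\<^bsub>L\<^esub>i\<in>A. a i \<odot>\<^bsub>L\<^esub> (r \<odot>\<^bsub>L\<^esub> x i))" if r: "r \<in> carrier R" for r
  proof -
    have "r \<odot>\<^bsub>L\<^esub> z0 = (\<Oplus>\<^bsub>L\<^esub>i\<in>A. r \<odot>\<^bsub>L\<^esub> (a i \<odot>\<^bsub>L\<^esub> x i))"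
      unfolding z0_def using a x(1) r assms(2) by (intro L.finsum_smult_ldistr) auto
    also have "\<dots> = (\<Oplus>\<^bsub>L\<^esub>i\<in>A. a i \<odot>\<^bsub>L\<^esub> (r \<odot>\<^bsub>L\<^esub> x i))"
      using a x(1) r by (intro L.M.finsum_cong') (auto simp: L.smult_assoc1[symmetric] L.R.m_comm)
    finally show ?thesis .
  qed
  have kz0: "r \<odot>\<^bsub>L\<^esub> z0 = \<zero>\<^bsub>L\<^esub>" if r: "r \<in> insert b B" for r
  proof (cases "r = b")
    case True then show ?thesis using rz0[OF assms(3)] add.hyps(2) by (simp add: syzygies_def)
  next
    case False
    hence "r \<in> B" using r by simp
    thus ?thesis using rz0[of r] assms(4) x(2) a by (auto intro!: L.M.add.finprod_one_eqI)
  qed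
  have "formal A x t' = formal A x (\<lambda>i. t i \<oplus>\<^bsub>N\<^esub> f (a i) \<odot>\<^bsub>N\<^esub> y)"
    using add.hyps by (intro formal_cong) auto
  moreover have "formal A x (\<lambda>i. t i \<oplus>\<^bsub>N\<^esub> f (a i) \<odot>\<^bsub>N\<^esub> y) - formal A x t - formal A x (\<lambda>i. f (a i) \<odot>\<^bsub>N\<^esub> y) \<in> K"
    using a tN y x(1) by (intro formal_add) auto
  ultimately have k1: "formal A x t' - formal A x t - formal A x (\<lambda>i. f (a i) \<odot>\<^bsub>N\<^esub> y) \<in> K" by simp
  have k2: "frag_of (z0, y) - formal A x (\<lambda>i. f (a i) \<odot>\<^bsub>N\<^esub> y) \<in> K"
    unfolding z0_def by (rule formal_lincomb[OF assms(2) x(1) a y])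
  have "formal {..<Suc n} (x1(n := z0)) (t1(n := y)) = formal {..<n} x1 t1 + frag_of (z0, y)"
    unfolding formal_def by simp
  moreover have "(formal A x t' - formal A x t - formal A x (\<lambda>i. f (a i) \<odot>\<^bsub>N\<^esub> y))
      - (frag_of (z0, y) - formal A x (\<lambda>i. f (a i) \<odot>\<^bsub>N\<^esub> y)) + (formal A x t - formal {..<n} x1 t1) \<in> K"
    by (rule K_add[OF K_diff[OF k1 k2] IH(3)])
  ultimately have "formal A x t' - formal {..<Suc n} (x1(n := z0)) (t1(n := y)) \<in> K"
    by (simp add: algebra_simps)
  moreover have "\<forall>i. (x1(n := z0)) i \<in> carrier L" "\<forall>i. (t1(n := y)) i \<in> carrier N"
    "\<forall>i. \<forall>r\<in>insert b B. r \<odot>\<^bsub>L\<^esub> (x1(n := z0)) i = \<zero>\<^bsub>L\<^esub>" using IH z0 y kz0 by auto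
  ultimately show ?case by blast
qed

theorem sK_tensor_iff_quotient_sK:
  assumes noeth: "noetherian_ring R" and W: "submonoid W R" and flat: "flat_upto R W T"
    and Q: "primeideal Q S" and QW: "Q \<inter> f ` W = {}"
  shows "Q \<in> strong_Krull_primes S tens \<longleftrightarrow> (\<exists>P\<in>Ass R L. quotient_sK f P S N Q)"
proof
  interpret W: submonoid W R by (rule W)
  interpret Q: primeideal Q S by (rule Q)
  have fW: "f w \<in> carrier S - Q" if "w \<in> W" for w using that QW by auto
  assume "\<exists>P\<in>Ass R L. quotient_sK f P S N Q"
  then obtain P x where P: "primeideal P R" "x \<in> carrier L" "P = annihilator R L x" and sK: "quotient_sK f P S N Q"
    unfolding Ass_def by blast
  have PR: "P \<subseteq> carrier R" unfolding P(3) annihilator_def by blast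
  have "\<exists>c. witness I Q c" if I: "fg_ideal I S" "I \<subseteq> Q" for I
  proof -
    obtain y where y: "y \<in> carrier N" "\<And>a. a \<in> I \<Longrightarrow> a \<odot>\<^bsub>N\<^esub> y \<in> PN P"
        "\<And>s. s \<in> carrier S \<Longrightarrow> s \<odot>\<^bsub>N\<^esub> y \<in> PN P \<Longrightarrow> s \<in> Q"
      using sK I unfolding quotient_sK_def by blast
    have "s \<in> Q" if s: "s \<in> carrier S" "frag_of (x, s \<odot>\<^bsub>N\<^esub> y) \<in> K" for s
    proof -
      have "formal {0::nat} (\<lambda>_. x) (\<lambda>_. s \<odot>\<^bsub>N\<^esub> y) \<in> K" using s by (simp add: formal_def)
      then obtain u where u: "u \<in> W" "null R L T {0::nat} (\<lambda>_. x) (\<lambda>i. u \<odot>\<^bsub>T\<^esub> (s \<odot>\<^bsub>N\<^esub> y))"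
        using K_imp_null[OF flat W, of "{0::nat}" "\<lambda>_. x" "\<lambda>_. s \<odot>\<^bsub>N\<^esub> y"] P(2) s y(1) by auto
      \<comment> \<open>P is the annihilator of x, so every syzygy of the single element x has its
        coefficient in P.\<close>
      have "u \<odot>\<^bsub>T\<^esub> (s \<odot>\<^bsub>N\<^esub> y) \<in> PN P"
      proof (rule null_imp_PN[OF PR u(2)])
        fix a :: "nat \<Rightarrow> 'a" and i :: nat assume "a \<in> syzygies R L {0} (\<lambda>_. x)" "i \<in> {0}"
        thus "a i \<in> P" unfolding P(3) using P(2) by (auto simp: syzygies_def annihilator_def)
      qed simp
      hence "(f u \<otimes>\<^bsub>S\<^esub> s) \<odot>\<^bsub>N\<^esub> y \<in> PN P" using u(1) s y(1) by (simp add: N.smult_assoc1)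
      hence "f u \<otimes>\<^bsub>S\<^esub> s \<in> Q" using y(3) u(1) s by simp
      thus ?thesis using Q.I_prime[of "f u" s] fW[OF u(1)] s by auto
    qed
    moreover have "frag_of (x, a \<odot>\<^bsub>N\<^esub> y) \<in> K" if "a \<in> I" for a
      using frag_PN_K[OF PR P(2) _ y(2)[OF that]] unfolding P(3) by (simp add: annihilator_def)
    ultimately have "witness I Q (frag_of (x, y))" using P(2) y(1) by (simp add: witness_def)
    thus ?thesis by blast
  qed
  thus "Q \<in> strong_Krull_primes S tens" unfolding sK_tensor_iff using Q by blast
next
  interpret W: submonoid W R by (rule W)
  interpret Q: primeideal Q S by (rule Q)
  interpret noetherian_ring R by (rule noeth)
  have fW: "f w \<in> carrier S - Q" if "w \<in> W" for w using that QW by auto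
  assume "Q \<in> strong_Krull_primes S tens"
  hence sK: "\<And>I. fg_ideal I S \<Longrightarrow> I \<subseteq> Q \<Longrightarrow> \<exists>c. witness I Q c" unfolding sK_tensor_iff by blast
  define q where "q = {r \<in> carrier R. f r \<in> Q}"
  have q: "primeideal q R" unfolding q_def by (rule L.R.contraction_prime[OF hom Q])
  interpret q: primeideal q R by (rule q)
  have qR: "q \<subseteq> carrier R" unfolding q_def by blast
  have fq: "f r \<in> carrier S - Q" if "r \<in> carrier R" "r \<notin> q" for r using that f.hom_closed[of r] unfolding q_def by blast
  obtain B where B: "B \<subseteq> carrier R" "finite B" "q = Idl\<^bsub>R\<^esub> B" using finetely_gen[OF q.is_ideal] by auto
  have Bq: "B \<subseteq> q" unfolding B(3) by (rule L.R.genideal_self[OF B(1)])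
  have main: "q \<in> Ass R L \<and> (\<exists>y\<in>carrier N. (\<forall>a\<in>I. a \<odot>\<^bsub>N\<^esub> y \<in> PN q) \<and>
      (\<forall>s\<in>carrier S. s \<odot>\<^bsub>N\<^esub> y \<in> PN q \<longrightarrow> s \<in> Q))" if I: "fg_ideal I S" "I \<subseteq> Q" for I
  proof -
    obtain C where C: "C \<subseteq> carrier S" "finite C" "I = Idl\<^bsub>S\<^esub> C" using I(1) unfolding fg_ideal_def by blast
    have CI: "C \<subseteq> I" unfolding C(3) by (rule N.R.genideal_self[OF C(1)])
    \<comment> \<open>Generators of q are added to I so that the witness is also killed by q. This
      is possible because q, the contraction of Q to the Noetherian ring R, is finitely
      generated.\<close>
    define J where "J = Idl\<^bsub>S\<^esub> (C \<union> f ` B)"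
    have CfB: "C \<union> f ` B \<subseteq> carrier S" using C(1) B(1) by auto
    have J: "fg_ideal J S" unfolding fg_ideal_def J_def using C(2) B(2) CfB by (intro exI[of _ "C \<union> f ` B"]) auto
    have JS: "J \<subseteq> carrier S" by (rule N.R.fg_ideal_subset[OF J])
    have CJ: "C \<union> f ` B \<subseteq> J" unfolding J_def by (rule N.R.genideal_self[OF CfB])
    have "f ` B \<subseteq> Q" using Bq unfolding q_def by blast
    hence "C \<union> f ` B \<subseteq> Q" using CI I(2) by blast
    hence "J \<subseteq> Q" unfolding J_def by (rule N.R.genideal_minimal[OF Q.is_ideal])
    then obtain c where c: "witness J Q c" using sK[OF J] by blast
    \<comment> \<open>Generators of q are handled one at a time: b kills the tensor, so by flatness
      the t_i are, up to W, combinations of syzygies of the b x_i, and regrouping yields vectors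
      killed by b while earlier generators still kill them.\<close>
    have kill: "\<exists>(n::nat) x t. (\<forall>i. x i \<in> carrier L) \<and> (\<forall>i. t i \<in> carrier N) \<and>
        witness J Q (formal {..<n} x t) \<and> (\<forall>i. \<forall>r\<in>B'. r \<odot>\<^bsub>L\<^esub> x i = \<zero>\<^bsub>L\<^esub>)"
      if "finite B'" "B' \<subseteq> B" for B'
      using that
    proof (induction B')
      case empty
      have "c \<in> carrier F" using c by (simp add: witness_def)
      then obtain n x t where "\<forall>i. x i \<in> carrier L" "\<forall>i. t i \<in> carrier N" "c - formal {..<n::nat} x t \<in> K"
        using formal_exists by blast
      then show ?case using witness_cong[OF c formal_closed _ JS] by blast
    next
      case (insert b B')
      obtain n x t where x: "\<And>i. x i \<in> carrier L" "\<And>i. t i \<in> carrier N"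
        "witness J Q (formal {..<n::nat} x t)" "\<And>i r. r \<in> B' \<Longrightarrow> r \<odot>\<^bsub>L\<^esub> x i = \<zero>\<^bsub>L\<^esub>"
        using insert.IH insert.prems by blast
      have b: "b \<in> carrier R" "f b \<in> J" using insert.prems B(1) CJ by auto
      have "formal {..<n} (\<lambda>i. b \<odot>\<^bsub>L\<^esub> x i) t - formal {..<n} x (\<lambda>i. f b \<odot>\<^bsub>N\<^esub> t i) \<in> K"
        unfolding formal_def sum_subtractf[symmetric] using b x by (intro K_sum K_balance) auto
      moreover have "formal {..<n} x (\<lambda>i. f b \<odot>\<^bsub>N\<^esub> t i) \<in> K"
        using x(3) b(2) unfolding witness_def act_formal by blast
      ultimately have "formal {..<n} (\<lambda>i. b \<odot>\<^bsub>L\<^esub> x i) t \<in> K" using K_cong by blast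
      then obtain u where u: "u \<in> W" "null R L T {..<n} (\<lambda>i. b \<odot>\<^bsub>L\<^esub> x i) (\<lambda>i. u \<odot>\<^bsub>T\<^esub> t i)"
        using K_imp_null[OF flat W, of "{..<n}" "\<lambda>i. b \<odot>\<^bsub>L\<^esub> x i" t] b x by auto
      have B'R: "B' \<subseteq> carrier R" using insert.prems B(1) by auto
      obtain n' x' t' where x': "\<And>i. x' i \<in> carrier L" "\<And>i. t' i \<in> carrier N"
          "formal {..<n} x (\<lambda>i. u \<odot>\<^bsub>T\<^esub> t i) - formal {..<n'::nat} x' t' \<in> K"
          "\<And>i r. r \<in> insert b B' \<Longrightarrow> r \<odot>\<^bsub>L\<^esub> x' i = \<zero>\<^bsub>L\<^esub>"
        using null_shift[OF u(2) finite_lessThan b(1) B'R x(1,4)] by blast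
      have "witness J Q (act (f u) (formal {..<n} x t))" by (rule witness_act[OF x(3) Q fW[OF u(1)] JS])
      hence "witness J Q (formal {..<n} x (\<lambda>i. u \<odot>\<^bsub>T\<^esub> t i))" by (simp add: act_formal)
      hence "witness J Q (formal {..<n'} x' t')"
        by (rule witness_cong[OF _ formal_closed[OF x'(1,2)] x'(3) JS])
      then show ?case using x' by blast
    qed
    obtain n x t0 where x: "\<And>i. x i \<in> carrier L" "\<And>i. t0 i \<in> carrier N"
        "witness J Q (formal {..<n::nat} x t0)" "\<And>i r. r \<in> B \<Longrightarrow> r \<odot>\<^bsub>L\<^esub> x i = \<zero>\<^bsub>L\<^esub>"
      using kill[OF B(2) order_refl] by blast
    have qx: "r \<odot>\<^bsub>L\<^esub> x i = \<zero>\<^bsub>L\<^esub>" if "r \<in> q" for r i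
    proof -
      have "ideal {r \<in> carrier R. r \<odot>\<^bsub>L\<^esub> x i = \<zero>\<^bsub>L\<^esub>} R"
        by (rule L.R.idealI') (use x(1) in \<open>auto simp: L.smult_l_distr L.smult_assoc1\<close>)
      hence "q \<subseteq> {r \<in> carrier R. r \<odot>\<^bsub>L\<^esub> x i = \<zero>\<^bsub>L\<^esub>}"
        unfolding B(3) using x(4) B(1) by (intro L.R.genideal_minimal) auto
      thus ?thesis using that by blast
    qed
    \<comment> \<open>The passage to as few terms as possible is an induction on the number of
      terms: as long as some syzygy has a coefficient outside q, one term can be eliminated.\<close>
    have indep: "\<exists>A t. finite A \<and> (\<forall>i. t i \<in> carrier N) \<and> witness J Q (formal A x t) \<and>
        (\<forall>a\<in>syzygies R L A x. \<forall>i\<in>A. a i \<in> q)"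
      if "finite A" "\<And>i. t i \<in> carrier N" "witness J Q (formal A x t)" for A t
      using that
    proof (induction "card A" arbitrary: A t rule: less_induct)
      case less
      show ?case
      proof (cases "\<forall>a\<in>syzygies R L A x. \<forall>i\<in>A. a i \<in> q")
        case True then show ?thesis using less.prems by blast
      next
        case False
        then obtain a k where a: "a \<in> syzygies R L A x" "k \<in> A" "a k \<notin> q" by blast
        have aR: "\<And>i. a i \<in> carrier R" using syzygies_carrier[OF a(1)] .
        have fa: "f (a k) \<in> carrier S - Q" by (rule fq[OF aR a(3)])
        \<comment> \<open>Solving the syzygy for x_k without division: a_k times the tensor has
          coefficients a_k t_i - a_i t_k, which vanish at i = k. The factor a_k maps outside Q and
          is harmless.\<close>
        define t' where "t' i = f (a k) \<odot>\<^bsub>N\<^esub> t i \<ominus>\<^bsub>N\<^esub> f (a i) \<odot>\<^bsub>N\<^esub> t k" for i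
        have t': "\<And>i. t' i \<in> carrier N" unfolding t'_def using less.prems(2) aR by simp
        have eq: "f (a k) \<odot>\<^bsub>N\<^esub> t i = t' i \<oplus>\<^bsub>N\<^esub> f (a i) \<odot>\<^bsub>N\<^esub> t k" for i
          unfolding t'_def using less.prems(2) aR by (simp add: N.M.minus_eq N.M.a_assoc N.M.l_neg)
        have k1: "formal A x (\<lambda>i. f (a k) \<odot>\<^bsub>N\<^esub> t i) - formal A x t' - formal A x (\<lambda>i. f (a i) \<odot>\<^bsub>N\<^esub> t k) \<in> K"
          unfolding eq using x(1) t' aR less.prems(2) by (intro formal_add) auto
        have k2: "formal A x (\<lambda>i. f (a i) \<odot>\<^bsub>N\<^esub> t k) \<in> K"
          by (rule syzygy_formal_K[OF less.prems(1) x(1) a(1) less.prems(2)])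
        have "t' k = \<zero>\<^bsub>N\<^esub>" unfolding t'_def using less.prems(2) aR by (simp add: N.M.minus_eq N.M.r_neg)
        hence k3: "frag_of (x k, t' k) \<in> K" using K_zero_right x(1) by simp
        have "formal A x t' = frag_of (x k, t' k) + formal (A - {k}) x t'"
          unfolding formal_def using less.prems(1) a(2) by (rule sum.remove)
        hence "formal A x (\<lambda>i. f (a k) \<odot>\<^bsub>N\<^esub> t i) - formal (A - {k}) x t' \<in> K"
          using K_add[OF K_add[OF k1 k2] k3] by (simp add: algebra_simps)
        moreover have "witness J Q (formal A x (\<lambda>i. f (a k) \<odot>\<^bsub>N\<^esub> t i))"
          using witness_act[OF less.prems(3) Q fa JS] by (simp add: act_formal)
        ultimately have "witness J Q (formal (A - {k}) x t')"
          using witness_cong[OF _ formal_closed[of x t', OF x(1) t'] _ JS] by blast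
        moreover have "card (A - {k}) < card A" using less.prems(1) a(2) by (rule card_Diff1_less)
        ultimately show ?thesis using less.hyps[of "A - {k}" t'] less.prems(1) t' by blast
      qed
    qed
    obtain A t where A: "finite A" "\<And>i. t i \<in> carrier N" "witness J Q (formal A x t)"
        "\<And>a i. a \<in> syzygies R L A x \<Longrightarrow> i \<in> A \<Longrightarrow> a i \<in> q"
      using indep[OF finite_lessThan x(2,3)] by blast
    \<comment> \<open>Otherwise each t_i has a multiplier outside Q into q N. The product of these
      multipliers is outside Q and kills the whole tensor, because q kills every x_i; this
      contradicts the witness property.\<close>
    have "\<exists>i\<in>A. \<forall>s\<in>carrier S. s \<odot>\<^bsub>N\<^esub> t i \<in> PN q \<longrightarrow> s \<in> Q"
    proof (rule ccontr)
      assume no: "\<not> ?thesis"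
      have ex: "\<exists>s\<in>carrier S - Q. \<forall>i\<in>A'. s \<odot>\<^bsub>N\<^esub> t i \<in> PN q" if "finite A'" "A' \<subseteq> A" for A'
        using that
      proof (induction A')
        case empty then show ?case using N.R.primeideal_one_notin[OF Q] by blast
      next
        case (insert i A')
        obtain s where s: "s \<in> carrier S - Q" "\<And>j. j \<in> A' \<Longrightarrow> s \<odot>\<^bsub>N\<^esub> t j \<in> PN q" using insert by auto
        obtain s' where s': "s' \<in> carrier S - Q" "s' \<odot>\<^bsub>N\<^esub> t i \<in> PN q" using no insert.prems by blast
        have "(s \<otimes>\<^bsub>S\<^esub> s') \<odot>\<^bsub>N\<^esub> t j \<in> PN q" if j: "j \<in> insert i A'" for j
        proof (cases "j = i")
          case True
          thus ?thesis using PN_smult[OF qR _ s'(2), of s] s(1) s'(1) A(2) by (simp add: N.smult_assoc1)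
        next
          case False
          hence "s' \<odot>\<^bsub>N\<^esub> (s \<odot>\<^bsub>N\<^esub> t j) \<in> PN q" using PN_smult[OF qR _ s(2), of s' j] s'(1) j by simp
          moreover have "s' \<odot>\<^bsub>N\<^esub> (s \<odot>\<^bsub>N\<^esub> t j) = (s \<otimes>\<^bsub>S\<^esub> s') \<odot>\<^bsub>N\<^esub> t j"
            using s(1) s'(1) A(2)[of j] N.R.m_comm[of s s'] by (simp add: N.smult_assoc1)
          ultimately show ?thesis by simp
        qed
        thus ?case using N.R.primeideal_mult_notin[OF Q s(1) s'(1)] by blast
      qed
      obtain s where s: "s \<in> carrier S - Q" "\<And>i. i \<in> A \<Longrightarrow> s \<odot>\<^bsub>N\<^esub> t i \<in> PN q"
        using ex[OF A(1) order_refl] by blast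
      have "formal A x (\<lambda>i. s \<odot>\<^bsub>N\<^esub> t i) \<in> K"
        unfolding formal_def by (rule K_sum) (rule frag_PN_K[OF qR x(1) qx s(2)])
      thus False using A(3) s(1) unfolding witness_def act_formal by blast
    qed
    then obtain i where i: "i \<in> A" "\<And>s. s \<in> carrier S \<Longrightarrow> s \<odot>\<^bsub>N\<^esub> t i \<in> PN q \<Longrightarrow> s \<in> Q" by blast
    have "annihilator R L (x i) = q"
    proof
      show "q \<subseteq> annihilator R L (x i)" using qx qR by (auto simp: annihilator_def)
      show "annihilator R L (x i) \<subseteq> q"
      proof
        fix r assume r: "r \<in> annihilator R L (x i)"
        \<comment> \<open>An element r that kills x_i gives the syzygy with the single entry r at i,
          so r lies in q.\<close>
        define a where "a j = (if i = j then r else \<zero>\<^bsub>R\<^esub>)" for j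
        have rR: "r \<in> carrier R" "r \<odot>\<^bsub>L\<^esub> x i = \<zero>\<^bsub>L\<^esub>" using r by (auto simp: annihilator_def)
        have "(\<Oplus>\<^bsub>L\<^esub>j\<in>A. a j \<odot>\<^bsub>L\<^esub> x j) = \<zero>\<^bsub>L\<^esub>"
          using rR x(1) by (intro L.M.add.finprod_one_eqI) (auto simp: a_def)
        hence "a \<in> syzygies R L A x" using rR by (simp add: syzygies_def a_def)
        thus "r \<in> q" using A(4)[of a i] i(1) by (simp add: a_def)
      qed
    qed
    hence Ass: "q \<in> Ass R L" unfolding Ass_def using q x(1) by blast
    \<comment> \<open>Each generator g of I kills the tensor, so by flatness g t_i lies in q N up to
      a factor from W; one factor is chosen for the finitely many generators.\<close>
    have ex_u: "\<exists>u\<in>W. \<forall>g\<in>C'. (f u \<otimes>\<^bsub>S\<^esub> g) \<odot>\<^bsub>N\<^esub> t i \<in> PN q" if "finite C'" "C' \<subseteq> C" for C'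
      using that
    proof (induction C')
      case empty then show ?case using W.one_closed by blast
    next
      case (insert g C')
      obtain u where u: "u \<in> W" "\<And>h. h \<in> C' \<Longrightarrow> (f u \<otimes>\<^bsub>S\<^esub> h) \<odot>\<^bsub>N\<^esub> t i \<in> PN q" using insert by auto
      have g: "g \<in> carrier S" "g \<in> J" using insert.prems C(1) CJ by auto
      have "formal A x (\<lambda>i. g \<odot>\<^bsub>N\<^esub> t i) \<in> K" using A(3) g(2) unfolding witness_def act_formal by blast
      then obtain v where v: "v \<in> W" "null R L T A x (\<lambda>i. v \<odot>\<^bsub>T\<^esub> (g \<odot>\<^bsub>N\<^esub> t i))"
        using K_imp_null[OF flat W A(1), of x "\<lambda>i. g \<odot>\<^bsub>N\<^esub> t i"] x(1) g(1) A(2) by auto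
      have "v \<odot>\<^bsub>T\<^esub> (g \<odot>\<^bsub>N\<^esub> t i) \<in> PN q" using null_imp_PN[OF qR v(2), of i] A(4) i(1) by blast
      hence vg: "(f v \<otimes>\<^bsub>S\<^esub> g) \<odot>\<^bsub>N\<^esub> t i \<in> PN q" using v(1) g(1) A(2) by (simp add: N.smult_assoc1)
      have uv: "f u \<in> carrier S" "f v \<in> carrier S" using u(1) v(1) by auto
      have fuv: "f (u \<otimes>\<^bsub>R\<^esub> v) = f u \<otimes>\<^bsub>S\<^esub> f v" using u(1) v(1) by simp
      have "(f (u \<otimes>\<^bsub>R\<^esub> v) \<otimes>\<^bsub>S\<^esub> h) \<odot>\<^bsub>N\<^esub> t i \<in> PN q" if h: "h \<in> insert g C'" for h
      proof (cases "h = g")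
        case True
        have "(f (u \<otimes>\<^bsub>R\<^esub> v) \<otimes>\<^bsub>S\<^esub> g) \<odot>\<^bsub>N\<^esub> t i = f u \<odot>\<^bsub>N\<^esub> ((f v \<otimes>\<^bsub>S\<^esub> g) \<odot>\<^bsub>N\<^esub> t i)"
          unfolding fuv using uv g(1) A(2)[of i] by (simp add: N.smult_assoc1[symmetric] N.R.m_assoc)
        thus ?thesis using True PN_smult[OF qR uv(1) vg] by simp
      next
        case False
        hence h': "h \<in> C'" "h \<in> carrier S" using h insert.prems C(1) by auto
        have "(f (u \<otimes>\<^bsub>R\<^esub> v) \<otimes>\<^bsub>S\<^esub> h) \<odot>\<^bsub>N\<^esub> t i = f v \<odot>\<^bsub>N\<^esub> ((f u \<otimes>\<^bsub>S\<^esub> h) \<odot>\<^bsub>N\<^esub> t i)"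
          unfolding fuv using uv h'(2) A(2)[of i] by (simp add: N.smult_assoc1[symmetric] N.R.m_ac)
        thus ?thesis using PN_smult[OF qR uv(2) u(2)[OF h'(1)]] by simp
      qed
      thus ?case using W.m_closed[OF u(1) v(1)] by blast
    qed
    obtain u where u: "u \<in> W" "\<And>g. g \<in> C \<Longrightarrow> (f u \<otimes>\<^bsub>S\<^esub> g) \<odot>\<^bsub>N\<^esub> t i \<in> PN q"
      using ex_u[OF C(2) order_refl] by blast
    have uS: "f u \<in> carrier S - Q" by (rule fW[OF u(1)])
    define y where "y = f u \<odot>\<^bsub>N\<^esub> t i"
    have y: "y \<in> carrier N" unfolding y_def using uS A(2) by simp
    have gy: "g \<odot>\<^bsub>N\<^esub> y = (f u \<otimes>\<^bsub>S\<^esub> g) \<odot>\<^bsub>N\<^esub> t i" if "g \<in> carrier S" for g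
      unfolding y_def using that uS A(2)[of i] by (simp add: N.smult_assoc1[symmetric] N.R.m_comm)
    have "C \<subseteq> {a \<in> carrier S. a \<odot>\<^bsub>N\<^esub> y \<in> PN q}" using u(2) gy C(1) by auto
    hence "I \<subseteq> {a \<in> carrier S. a \<odot>\<^bsub>N\<^esub> y \<in> PN q}"
      unfolding C(3) by (intro N.R.genideal_minimal PN_annihilator_ideal qR y)
    moreover have "s \<in> Q" if s: "s \<in> carrier S" "s \<odot>\<^bsub>N\<^esub> y \<in> PN q" for s
    proof -
      have "f u \<otimes>\<^bsub>S\<^esub> s \<in> Q" using i(2)[of "f u \<otimes>\<^bsub>S\<^esub> s"] s uS gy by simp
      thus ?thesis using Q.I_prime[of "f u" s] s(1) uS by auto
    qed
    ultimately show ?thesis using Ass y by blast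
  qed
  \<comment> \<open>The prime q does not depend on I. The ideal generated by the empty set is always
    available, so \<open>main\<close> shows that q is an associated prime.\<close>
  have "fg_ideal (Idl\<^bsub>S\<^esub> {}) S" unfolding fg_ideal_def by blast
  moreover have "Idl\<^bsub>S\<^esub> {} \<subseteq> Q" by (intro N.R.genideal_minimal Q.is_ideal) simp
  ultimately have "q \<in> Ass R L" using main by blast
  moreover have "quotient_sK f q S N Q" unfolding quotient_sK_def using main by blast
  ultimately show "\<exists>P\<in>Ass R L. quotient_sK f P S N Q" by blast
qed

end

section \<open>Strong Krull primes of quotients and localizations\<close>

lemma quotient_module_eq:
  "quotient_module R I = restrict_scalars (\<lambda>r. I +>\<^bsub>R\<^esub> r) (self_module (R Quot I))"
  by (simp add: quotient_module_def restrict_scalars_def self_module_def ring.defs module.defs)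

lemma (in cring) module_quotient_module:
  assumes "ideal I R" shows "module R (quotient_module R I)"
proof -
  interpret Q: cring "R Quot I" using ideal.quotient_is_cring[OF assms is_cring] .
  show ?thesis unfolding quotient_module_eq
    by (rule module_restrict_scalars[OF is_cring ideal.rcos_ring_hom[OF assms] Q.module_self_module])
qed

lemma (in cring) annihilator_quotient_module:
  assumes I: "ideal I R" and y: "y \<in> carrier R"
  shows "annihilator R (quotient_module R I) (I +> y) = {s \<in> carrier R. s \<otimes> y \<in> I}"
proof -
  have "(I +> s) \<otimes>\<^bsub>R Quot I\<^esub> (I +> y) = \<zero>\<^bsub>R Quot I\<^esub> \<longleftrightarrow> s \<otimes> y \<in> I" if s: "s \<in> carrier R" for s
  proof -
    have "(I +> s) \<otimes>\<^bsub>R Quot I\<^esub> (I +> y) = I +> (s \<otimes> y)"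
      using ring_hom_mult[OF ideal.rcos_ring_hom[OF I] s y] by simp
    moreover have "\<zero>\<^bsub>R Quot I\<^esub> = I" by (simp add: FactRing_def)
    ultimately show ?thesis
      using ideal.rcos_const_imp_mem[OF I, of "s \<otimes> y"] a_rcos_zero[OF I, of "s \<otimes> y"] s y by auto
  qed
  thus ?thesis by (auto simp: annihilator_def quotient_module_eq)
qed

lemma (in cring) carrier_quotient_module:
  "carrier (quotient_module R I) = {I +> y | y. y \<in> carrier R}"
  by (auto simp: quotient_module_eq FactRing_def A_RCOSETS_def')

context module_localization
begin

lemma fraction_annihilator:
  assumes x: "x \<in> carrier M" "w \<in> W"
  shows "annihilator R L (frac x w) = {s \<in> carrier R. \<exists>u\<in>W. (u \<otimes> s) \<odot>\<^bsub>M\<^esub> x = \<zero>\<^bsub>M\<^esub>}"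
proof -
  have "s \<odot>\<^bsub>L\<^esub> frac x w = \<zero>\<^bsub>L\<^esub> \<longleftrightarrow> (\<exists>u\<in>W. (u \<otimes> s) \<odot>\<^bsub>M\<^esub> x = \<zero>\<^bsub>M\<^esub>)" if s: "s \<in> carrier R" for s
  proof -
    have "s \<odot>\<^bsub>L\<^esub> frac x w = \<zero>\<^bsub>L\<^esub> \<longleftrightarrow> (\<exists>u\<in>W. u \<odot>\<^bsub>M\<^esub> (\<one> \<odot>\<^bsub>M\<^esub> (s \<odot>\<^bsub>M\<^esub> x)) = u \<odot>\<^bsub>M\<^esub> (w \<odot>\<^bsub>M\<^esub> \<zero>\<^bsub>M\<^esub>))"
      using s x W.one_closed by (simp add: smult_localized zero_localized frac_eq_iff)
    also have "\<dots> \<longleftrightarrow> (\<exists>u\<in>W. (u \<otimes> s) \<odot>\<^bsub>M\<^esub> x = \<zero>\<^bsub>M\<^esub>)"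
      using s x by (intro bex_cong refl) (auto simp: smult_assoc1)
    finally show ?thesis .
  qed
  thus ?thesis by (auto simp: annihilator_def)
qed

text \<open>This is how finite generation of the ideals in the definition of strong Krull primes
  enters under localization.\<close>

lemma common_multiplier:
  assumes "finite C" "C \<subseteq> carrier R" "ideal J R" and ex: "\<And>g. g \<in> C \<Longrightarrow> \<exists>u\<in>W. u \<otimes> g \<in> J"
  shows "\<exists>u\<in>W. \<forall>g\<in>C. u \<otimes> g \<in> J"
  using assms(1,2) ex
proof (induction C)
  case empty then show ?case using W.one_closed by blast
next
  case (insert g C)
  obtain u where u: "u \<in> W" "\<And>h. h \<in> C \<Longrightarrow> u \<otimes> h \<in> J" using insert by auto
  obtain v where v: "v \<in> W" "v \<otimes> g \<in> J" using insert.prems by blast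
  have c: "u \<in> carrier R" "v \<in> carrier R" using u v by auto
  have "(u \<otimes> v) \<otimes> h \<in> J" if h: "h \<in> insert g C" for h
  proof (cases "h = g")
    case True
    thus ?thesis using ideal.I_l_closed[OF assms(3) v(2) c(1)] c h insert.prems by (simp add: m_assoc)
  next
    case False
    hence "v \<otimes> (u \<otimes> h) \<in> J" using ideal.I_l_closed[OF assms(3) u(2) c(2)] h by simp
    moreover have "h \<in> carrier R" using h insert.prems(1) by blast
    hence "(u \<otimes> v) \<otimes> h = v \<otimes> (u \<otimes> h)" using c by (simp add: m_ac)
    ultimately show ?thesis by simp
  qed
  thus ?case using W.m_closed[OF u(1) v(1)] by blast
qed

lemma annihilator_ideal: "x \<in> carrier M \<Longrightarrow> ideal (annihilator R M x) R"
  by (rule idealI') (auto simp: annihilator_def smult_l_distr smult_assoc1)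

text \<open>The annihilator of x/w is the union of the annihilators of the u x with u in W, and a
  finitely generated ideal inside it already kills a single u x. A prime that meets W is impossible,
  since an element of W kills x/w only if the fraction is zero.\<close>

lemma sK_localized_iff:
  "Q \<in> strong_Krull_primes R L \<longleftrightarrow> Q \<in> strong_Krull_primes R M \<and> Q \<inter> W = {}"
proof
  assume sK: "Q \<in> strong_Krull_primes R L"
  hence Q: "primeideal Q R" by (simp add: strong_Krull_primes_def)
  interpret Q: primeideal Q R by (rule Q)
  have wit: "\<exists>x w. x \<in> carrier M \<and> w \<in> W \<and> I \<subseteq> annihilator R L (frac x w) \<and> annihilator R L (frac x w) \<subseteq> Q"
    if "fg_ideal I R" "I \<subseteq> Q" for I
    using sK that unfolding strong_Krull_primes_def carrier_localized by blast
  have disj: "Q \<inter> W = {}"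
  proof (rule ccontr)
    assume "Q \<inter> W \<noteq> {}"
    then obtain v where v: "v \<in> Q" "v \<in> W" by blast
    have "fg_ideal (Idl {v}) R" unfolding fg_ideal_def using v by (intro exI[of _ "{v}"]) auto
    moreover have "Idl {v} \<subseteq> Q" using v by (intro genideal_minimal Q.is_ideal) auto
    ultimately obtain x w where x: "x \<in> carrier M" "w \<in> W" "Idl {v} \<subseteq> annihilator R L (frac x w)"
      "annihilator R L (frac x w) \<subseteq> Q" using wit by blast
    have "v \<in> annihilator R L (frac x w)" using x(3) genideal_self'[of v] v by auto
    then obtain u where u: "u \<in> W" "(u \<otimes> v) \<odot>\<^bsub>M\<^esub> x = \<zero>\<^bsub>M\<^esub>" unfolding fraction_annihilator[OF x(1,2)] by blast
    hence "\<one> \<in> annihilator R L (frac x w)"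
      unfolding fraction_annihilator[OF x(1,2)] using W.m_closed[OF u(1) v(2)] v(2)
      by (intro CollectI conjI bexI[of _ "u \<otimes> v"]) auto
    thus False using x(4) primeideal_one_notin[OF Q] by blast
  qed
  have "\<exists>z\<in>carrier M. I \<subseteq> annihilator R M z \<and> annihilator R M z \<subseteq> Q" if I: "fg_ideal I R" "I \<subseteq> Q" for I
  proof -
    obtain x w where x: "x \<in> carrier M" "w \<in> W" "I \<subseteq> annihilator R L (frac x w)"
      "annihilator R L (frac x w) \<subseteq> Q" using wit[OF I] by blast
    obtain C where C: "C \<subseteq> carrier R" "finite C" "I = Idl C" using I(1) unfolding fg_ideal_def by blast
    have "\<exists>u\<in>W. u \<otimes> g \<in> annihilator R M x" if g: "g \<in> C" for g
    proof -
      have "g \<in> annihilator R L (frac x w)" using x(3) C(3) genideal_self[OF C(1)] g by blast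
      then obtain u where "g \<in> carrier R" "u \<in> W" "(u \<otimes> g) \<odot>\<^bsub>M\<^esub> x = \<zero>\<^bsub>M\<^esub>"
        unfolding fraction_annihilator[OF x(1,2)] by blast
      thus ?thesis by (intro bexI[of _ u]) (auto simp: annihilator_def)
    qed
    then obtain u where u: "u \<in> W" "\<And>g. g \<in> C \<Longrightarrow> u \<otimes> g \<in> annihilator R M x"
      using common_multiplier[OF C(2,1) annihilator_ideal[OF x(1)]] by blast
    have uR: "u \<in> carrier R" using u(1) by auto
    have ux: "u \<odot>\<^bsub>M\<^esub> x \<in> carrier M" using uR x(1) by simp
    have eq: "s \<odot>\<^bsub>M\<^esub> (u \<odot>\<^bsub>M\<^esub> x) = (u \<otimes> s) \<odot>\<^bsub>M\<^esub> x" if "s \<in> carrier R" for s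
      using that uR x(1) by (simp add: smult_assoc1[symmetric] m_comm)
    have "C \<subseteq> annihilator R M (u \<odot>\<^bsub>M\<^esub> x)"
      using u(2) C(1) eq by (auto simp: annihilator_def subset_iff)
    hence "I \<subseteq> annihilator R M (u \<odot>\<^bsub>M\<^esub> x)" unfolding C(3) by (intro genideal_minimal annihilator_ideal ux)
    moreover have "annihilator R M (u \<odot>\<^bsub>M\<^esub> x) \<subseteq> annihilator R L (frac x w)"
      unfolding fraction_annihilator[OF x(1,2)] using u(1) eq by (auto simp: annihilator_def)
    ultimately show ?thesis using ux x(4) by blast
  qed
  thus "Q \<in> strong_Krull_primes R M \<and> Q \<inter> W = {}" using Q disj by (simp add: strong_Krull_primes_def)
next
  assume a: "Q \<in> strong_Krull_primes R M \<and> Q \<inter> W = {}"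
  hence Q: "primeideal Q R" by (simp add: strong_Krull_primes_def)
  have "\<exists>z\<in>carrier L. I \<subseteq> annihilator R L z \<and> annihilator R L z \<subseteq> Q" if I: "fg_ideal I R" "I \<subseteq> Q" for I
  proof -
    obtain x where x: "x \<in> carrier M" "I \<subseteq> annihilator R M x" "annihilator R M x \<subseteq> Q"
      using a I unfolding strong_Krull_primes_def by blast
    note fa = fraction_annihilator[OF x(1) W.one_closed]
    have "I \<subseteq> annihilator R L (frac x \<one>)"
      unfolding fa using x(2) W.one_closed by (auto simp: annihilator_def intro!: bexI[of _ \<one>])
    moreover have "annihilator R L (frac x \<one>) \<subseteq> Q"
    proof
      fix s assume "s \<in> annihilator R L (frac x \<one>)"
      then obtain u where u: "s \<in> carrier R" "u \<in> W" "(u \<otimes> s) \<odot>\<^bsub>M\<^esub> x = \<zero>\<^bsub>M\<^esub>" unfolding fa by blast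
      hence "u \<otimes> s \<in> Q" using x(3) by (auto simp: annihilator_def)
      thus "s \<in> Q" using primeideal.I_prime[OF Q, of u s] u a by auto
    qed
    moreover have "frac x \<one> \<in> carrier L" using x(1) W.one_closed by simp
    ultimately show ?thesis by (intro bexI[of _ "frac x \<one>"] conjI)
  qed
  thus "Q \<in> strong_Krull_primes R L" using Q by (simp add: strong_Krull_primes_def)
qed

lemma smult_frac_cancel:
  "e \<in> W \<Longrightarrow> x \<in> carrier M \<Longrightarrow> w \<in> W \<Longrightarrow> e \<odot>\<^bsub>L\<^esub> frac x (e \<otimes> w) = frac x w"
  by (simp add: smult_localized frac_cancel)

lemma smult_localized_inj:
  assumes e: "e \<in> W"
  shows "inj_on (\<lambda>z. e \<odot>\<^bsub>L\<^esub> z) (carrier L)"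
proof (rule inj_onI)
  fix U V assume "U \<in> carrier L" "V \<in> carrier L" and eq: "e \<odot>\<^bsub>L\<^esub> U = e \<odot>\<^bsub>L\<^esub> V"
  then obtain x s y t where a: "U = frac x s" "V = frac y t" "x \<in> carrier M" "y \<in> carrier M" "s \<in> W" "t \<in> W"
    by (auto simp: carrier_localized)
  have R: "e \<in> carrier R" "s \<in> carrier R" "t \<in> carrier R" using e a by auto
  obtain u where u: "u \<in> W" "u \<odot>\<^bsub>M\<^esub> (t \<odot>\<^bsub>M\<^esub> (e \<odot>\<^bsub>M\<^esub> x)) = u \<odot>\<^bsub>M\<^esub> (s \<odot>\<^bsub>M\<^esub> (e \<odot>\<^bsub>M\<^esub> y))"
    using eq a R frac_eq_iff[of "e \<odot>\<^bsub>M\<^esub> x" "e \<odot>\<^bsub>M\<^esub> y" s t] by (auto simp: smult_localized)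
  have uR: "u \<in> carrier R" using u by auto
  have "(u \<otimes> e) \<odot>\<^bsub>M\<^esub> (t \<odot>\<^bsub>M\<^esub> x) = (u \<otimes> e) \<odot>\<^bsub>M\<^esub> (s \<odot>\<^bsub>M\<^esub> y)"
    using u(2) a(3,4) R uR by (simp add: smult_assoc1[symmetric] m_ac)
  thus "U = V" unfolding a(1,2) using frac_eq_iff[OF a(3-6)] W.m_closed[OF u(1) e] by blast
qed

lemma smult_localized_surj:
  assumes e: "e \<in> W" and U: "U \<in> carrier L"
  shows "\<exists>V\<in>carrier L. e \<odot>\<^bsub>L\<^esub> V = U"
proof -
  obtain x s where "U = frac x s" "x \<in> carrier M" "s \<in> W" using U by (auto simp: carrier_localized)
  thus ?thesis using smult_frac_cancel[OF e] e by (intro bexI[of _ "frac x (e \<otimes> s)"]) auto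
qed

text \<open>An element of W acts bijectively on the localized module; its inverse is linear and
  serves to divide null families.\<close>

lemma division_map:
  assumes e: "e \<in> W"
  shows "\<exists>h. (\<forall>z\<in>carrier L. h z \<in> carrier L \<and> h (e \<odot>\<^bsub>L\<^esub> z) = z) \<and>
    (\<forall>z\<in>carrier L. \<forall>z'\<in>carrier L. h (z \<oplus>\<^bsub>L\<^esub> z') = h z \<oplus>\<^bsub>L\<^esub> h z') \<and>
    (\<forall>a\<in>carrier R. \<forall>z\<in>carrier L. h (a \<odot>\<^bsub>L\<^esub> z) = a \<odot>\<^bsub>L\<^esub> h z)"
proof -
  interpret L: module R L by (rule module_localized)
  have eR: "e \<in> carrier R" using e by auto
  let ?m = "\<lambda>z. e \<odot>\<^bsub>L\<^esub> z"
  define h where "h = inv_into (carrier L) ?m"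
  have inj: "inj_on ?m (carrier L)" by (rule smult_localized_inj[OF e])
  have im: "?m ` carrier L = carrier L"
    using smult_localized_surj[OF e] L.smult_closed[OF eR] by (auto simp: image_iff)
  have h: "h z \<in> carrier L" "e \<odot>\<^bsub>L\<^esub> h z = z" if "z \<in> carrier L" for z
    using that inv_into_into[of z ?m "carrier L"] f_inv_into_f[of z ?m "carrier L"] im by (auto simp: h_def)
  have hm: "h (e \<odot>\<^bsub>L\<^esub> z) = z" if "z \<in> carrier L" for z using inv_into_f_f[OF inj that] by (simp add: h_def)
  have uniq: "h z = z'" if "z' \<in> carrier L" "e \<odot>\<^bsub>L\<^esub> z' = z" for z z' using hm that by auto
  have "h (z \<oplus>\<^bsub>L\<^esub> z') = h z \<oplus>\<^bsub>L\<^esub> h z'" if "z \<in> carrier L" "z' \<in> carrier L" for z z'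
    using that h eR by (intro uniq) (auto simp: L.smult_r_distr)
  moreover have "h (a \<odot>\<^bsub>L\<^esub> z) = a \<odot>\<^bsub>L\<^esub> h z" if "a \<in> carrier R" "z \<in> carrier L" for a z
  proof (rule uniq)
    show "e \<odot>\<^bsub>L\<^esub> (a \<odot>\<^bsub>L\<^esub> h z) = a \<odot>\<^bsub>L\<^esub> z"
      using that h[OF that(2)] eR L.smult_assoc1[of e a "h z"] L.smult_assoc1[of a e "h z"] by (simp add: m_comm)
  qed (use that h in auto)
  ultimately show ?thesis using h(1) hm by (intro exI[of _ h] conjI ballI) simp_all
qed

end

section \<open>Comparison of S with its localization\<close>

locale localized_base_change = R: cring R + S: cring S
  for R :: "('a, 'm) ring_scheme" and S :: "('s, 'q) ring_scheme" +
  fixes f :: "'a \<Rightarrow> 's" and W :: "'a set"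
  assumes hom: "f \<in> ring_hom R S" and W: "submonoid W R"
begin

sublocale f: ring_hom_cring R S f
  by unfold_locales (rule hom)

sublocale W: submonoid W R by (rule W)

abbreviation "V \<equiv> f ` W"

lemma V: "submonoid V S"
  by (rule submonoid_image[OF R.is_cring S.is_cring hom W])

sublocale loc: module_localization S "self_module S" V
  by (intro module_localization.intro module_localization_axioms.intro V S.module_self_module)

sublocale T: tensor_product R "self_module R" S "self_module S" f
  by (intro tensor_product.intro tensor_product_axioms.intro R.module_self_module S.module_self_module hom)

lemma ideal_mult_self_module:
  assumes P: "P \<subseteq> carrier R"
  shows "ideal_mult f P (self_module S) = Idl\<^bsub>S\<^esub> (f ` P)"
proof
  have fP: "f ` P \<subseteq> carrier S" using P by auto
  interpret J: ideal "Idl\<^bsub>S\<^esub> (f ` P)" S by (rule S.genideal_ideal[OF fP])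
  show "ideal_mult f P (self_module S) \<subseteq> Idl\<^bsub>S\<^esub> (f ` P)"
  proof
    fix z assume "z \<in> ideal_mult f P (self_module S)"
    thus "z \<in> Idl\<^bsub>S\<^esub> (f ` P)"
    proof induction
      case (add z r y)
      have "f r \<in> Idl\<^bsub>S\<^esub> (f ` P)" using S.genideal_self[OF fP] add.hyps by auto
      then show ?case using add.IH add.hyps J.I_r_closed by simp
    qed simp
  qed
  have "ideal (ideal_mult f P (self_module S)) S"
    by (rule S.idealI') (use T.PN_closed[OF P] T.PN_add[OF P] T.PN_smult[OF P] ideal_mult.zero[of "self_module S"] in auto)
  moreover have "f ` P \<subseteq> ideal_mult f P (self_module S)"
  proof clarify
    fix r assume r: "r \<in> P"
    have "\<zero>\<^bsub>self_module S\<^esub> \<oplus>\<^bsub>self_module S\<^esub> f r \<odot>\<^bsub>self_module S\<^esub> \<one>\<^bsub>S\<^esub> \<in> ideal_mult f P (self_module S)"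
      by (rule ideal_mult.add[OF ideal_mult.zero r]) simp
    thus "f r \<in> ideal_mult f P (self_module S)" using r P by auto
  qed
  ultimately show "Idl\<^bsub>S\<^esub> (f ` P) \<subseteq> ideal_mult f P (self_module S)" by (rule S.genideal_minimal)
qed

lemma quotient_sK_self_module:
  assumes P: "P \<subseteq> carrier R" and Q: "primeideal Q S"
  shows "quotient_sK f P S (self_module S) Q \<longleftrightarrow> Q \<in> strong_Krull_primes S (quotient_module S (Idl\<^bsub>S\<^esub> (f ` P)))"
proof -
  let ?J = "Idl\<^bsub>S\<^esub> (f ` P)"
  have J: "ideal ?J S" using P by (intro S.genideal_ideal) auto
  have "(\<exists>y\<in>carrier (self_module S). (\<forall>a\<in>I. a \<odot>\<^bsub>self_module S\<^esub> y \<in> ?J) \<and>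
        (\<forall>s\<in>carrier S. s \<odot>\<^bsub>self_module S\<^esub> y \<in> ?J \<longrightarrow> s \<in> Q))
    \<longleftrightarrow> (\<exists>z\<in>carrier (quotient_module S ?J). I \<subseteq> annihilator S (quotient_module S ?J) z \<and>
         annihilator S (quotient_module S ?J) z \<subseteq> Q)" if I: "fg_ideal I S" for I
  proof -
    have "((\<forall>a\<in>I. a \<otimes>\<^bsub>S\<^esub> y \<in> ?J) \<and> (\<forall>s\<in>carrier S. s \<otimes>\<^bsub>S\<^esub> y \<in> ?J \<longrightarrow> s \<in> Q))
      \<longleftrightarrow> I \<subseteq> annihilator S (quotient_module S ?J) (?J +>\<^bsub>S\<^esub> y) \<and>
         annihilator S (quotient_module S ?J) (?J +>\<^bsub>S\<^esub> y) \<subseteq> Q" if "y \<in> carrier S" for y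
      unfolding S.annihilator_quotient_module[OF J that] using S.fg_ideal_subset[OF I] by blast
    thus ?thesis unfolding S.carrier_quotient_module self_module_simps by blast
  qed
  thus ?thesis using Q unfolding quotient_sK_def strong_Krull_primes_def ideal_mult_self_module[OF P] by blast
qed

text \<open>The induction produces one representation of z whose numerator is carried into the ideal
  by V. Since equal fractions differ by factors from V, the property passes to every representation,
  as is needed when the fraction is given.\<close>

lemma ideal_mult_localizedD:
  assumes P: "P \<subseteq> carrier R" and "z \<in> ideal_mult f P loc.L"
  shows "\<forall>s w. s \<in> carrier S \<and> w \<in> V \<and> z = loc.frac s w \<longrightarrow> (\<exists>v\<in>V. v \<otimes>\<^bsub>S\<^esub> s \<in> Idl\<^bsub>S\<^esub> (f ` P))"
proof -
  let ?J = "Idl\<^bsub>S\<^esub> (f ` P)"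
  have fP: "f ` P \<subseteq> carrier S" using P by auto
  have J: "ideal ?J S" by (rule S.genideal_ideal[OF fP])
  have VS: "v \<in> carrier S" if "v \<in> V" for v using that by auto
  have rep: "\<exists>v\<in>V. v \<otimes>\<^bsub>S\<^esub> s \<in> ?J"
    if eq: "loc.frac s w = loc.frac s0 w0" "v \<in> V" "v \<otimes>\<^bsub>S\<^esub> s0 \<in> ?J" "s \<in> carrier S" "w \<in> V" "s0 \<in> carrier S" "w0 \<in> V"
    for s w s0 w0 v
  proof -
    obtain u where u: "u \<in> V" "u \<otimes>\<^bsub>S\<^esub> (w0 \<otimes>\<^bsub>S\<^esub> s) = u \<otimes>\<^bsub>S\<^esub> (w \<otimes>\<^bsub>S\<^esub> s0)"
      using iffD1[OF loc.frac_eq_iff eq(1)] eq(4-7) unfolding self_module_simps by blast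
    note c = VS[OF u(1)] VS[OF eq(2)] VS[OF eq(5)] VS[OF eq(7)]
    have "(v \<otimes>\<^bsub>S\<^esub> (u \<otimes>\<^bsub>S\<^esub> w0)) \<otimes>\<^bsub>S\<^esub> s = v \<otimes>\<^bsub>S\<^esub> (u \<otimes>\<^bsub>S\<^esub> (w0 \<otimes>\<^bsub>S\<^esub> s))"
      using c eq(4) by (simp add: S.m_assoc)
    also have "\<dots> = (u \<otimes>\<^bsub>S\<^esub> w) \<otimes>\<^bsub>S\<^esub> (v \<otimes>\<^bsub>S\<^esub> s0)" unfolding u(2) using c eq(6) by (simp add: S.m_ac)
    also have "\<dots> \<in> ?J" using ideal.I_l_closed[OF J eq(3)] c by simp
    finally show ?thesis using loc.W.m_closed[OF eq(2) loc.W.m_closed[OF u(1) eq(7)]] by blast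
  qed
  have "\<exists>s w v. s \<in> carrier S \<and> w \<in> V \<and> v \<in> V \<and> z = loc.frac s w \<and> v \<otimes>\<^bsub>S\<^esub> s \<in> ?J"
    using assms(2)
  proof induction
    case zero
    show ?case using loc.W.one_closed ideal.ideal_simps(1)[OF J]
      by (intro exI[of _ "\<zero>\<^bsub>S\<^esub>"] exI[of _ "\<one>\<^bsub>S\<^esub>"]) (auto simp: loc.zero_localized)
  next
    case (add z r y)
    obtain s w v where s: "s \<in> carrier S" "w \<in> V" "v \<in> V" "z = loc.frac s w" "v \<otimes>\<^bsub>S\<^esub> s \<in> ?J" using add.IH by blast
    obtain s' w' where s': "s' \<in> carrier S" "w' \<in> V" "y = loc.frac s' w'"
      using add.hyps(3) by (auto simp: loc.carrier_localized)
    note c = VS[OF s(2)] VS[OF s(3)] VS[OF s'(2)]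
    have r: "f r \<in> carrier S" "f r \<in> ?J" using add.hyps(2) P S.genideal_self[OF fP] by auto
    have "v \<otimes>\<^bsub>S\<^esub> (w' \<otimes>\<^bsub>S\<^esub> s \<oplus>\<^bsub>S\<^esub> w \<otimes>\<^bsub>S\<^esub> (f r \<otimes>\<^bsub>S\<^esub> s')) = w' \<otimes>\<^bsub>S\<^esub> (v \<otimes>\<^bsub>S\<^esub> s) \<oplus>\<^bsub>S\<^esub> (v \<otimes>\<^bsub>S\<^esub> w \<otimes>\<^bsub>S\<^esub> s') \<otimes>\<^bsub>S\<^esub> f r"
      using c s(1) s'(1) r by (simp add: S.r_distr S.m_ac)
    also have "\<dots> \<in> ?J"
      using ideal.I_l_closed[OF J s(5) c(3)] ideal.I_l_closed[OF J r(2), of "v \<otimes>\<^bsub>S\<^esub> w \<otimes>\<^bsub>S\<^esub> s'"] c s'(1)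
      by (intro ideal.ideal_simps(2)[OF J]) auto
    finally have "v \<otimes>\<^bsub>S\<^esub> (w' \<otimes>\<^bsub>S\<^esub> s \<oplus>\<^bsub>S\<^esub> w \<otimes>\<^bsub>S\<^esub> (f r \<otimes>\<^bsub>S\<^esub> s')) \<in> ?J" .
    moreover have "z \<oplus>\<^bsub>loc.L\<^esub> f r \<odot>\<^bsub>loc.L\<^esub> y = loc.frac (w' \<otimes>\<^bsub>S\<^esub> s \<oplus>\<^bsub>S\<^esub> w \<otimes>\<^bsub>S\<^esub> (f r \<otimes>\<^bsub>S\<^esub> s')) (w \<otimes>\<^bsub>S\<^esub> w')"
      unfolding s(4) s'(3) using s s' r by (simp add: loc.smult_localized loc.add_localized)
    moreover have "w' \<otimes>\<^bsub>S\<^esub> s \<oplus>\<^bsub>S\<^esub> w \<otimes>\<^bsub>S\<^esub> (f r \<otimes>\<^bsub>S\<^esub> s') \<in> carrier S" using c s(1) s'(1) r by simp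
    ultimately show ?case using loc.W.m_closed[OF s(2) s'(2)] s(3) by blast
  qed
  thus ?thesis using rep by blast
qed

lemma ideal_mult_localizedI:
  assumes P: "P \<subseteq> carrier R" and "s \<in> Idl\<^bsub>S\<^esub> (f ` P)"
  shows "loc.frac s \<one>\<^bsub>S\<^esub> \<in> ideal_mult f P loc.L"
proof -
  have "s \<in> ideal_mult f P (self_module S)" using assms(2) ideal_mult_self_module[OF P] by simp
  thus ?thesis
  proof induction
    case zero
    show ?case using ideal_mult.zero[of loc.L f P] by (simp add: loc.zero_localized)
  next
    case (add z r y)
    have c: "z \<in> carrier S" "f r \<in> carrier S" "y \<in> carrier S" using T.PN_closed[OF P add.hyps(1)] add.hyps(2,3) P by auto
    have "loc.frac z \<one>\<^bsub>S\<^esub> \<oplus>\<^bsub>loc.L\<^esub> f r \<odot>\<^bsub>loc.L\<^esub> loc.frac y \<one>\<^bsub>S\<^esub> \<in> ideal_mult f P loc.L"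
      using c loc.W.one_closed by (intro ideal_mult.add[OF add.IH add.hyps(2)]) simp
    thus ?case using c loc.W.one_closed by (simp add: loc.smult_localized loc.add_localized)
  qed
qed

text \<open>Elements of V are outside the prime Q and can be cancelled from products in Q, and
  finitely many generators of I need one common factor from V to descend from the localization to
  S.\<close>

lemma quotient_sK_localized:
  assumes P: "P \<subseteq> carrier R" and Q: "primeideal Q S" and QV: "Q \<inter> V = {}"
  shows "quotient_sK f P S loc.L Q \<longleftrightarrow> quotient_sK f P S (self_module S) Q"
proof -
  let ?J = "Idl\<^bsub>S\<^esub> (f ` P)"
  interpret Q: primeideal Q S by (rule Q)
  have J: "ideal ?J S" using P by (intro S.genideal_ideal) auto
  have VS: "v \<in> carrier S" "v \<notin> Q" if "v \<in> V" for v using that QV by auto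
  note one = loc.W.one_closed
  have div: "\<exists>v\<in>V. v \<otimes>\<^bsub>S\<^esub> s \<in> ?J" if "loc.frac s w \<in> ideal_mult f P loc.L" "s \<in> carrier S" "w \<in> V" for s w
    using ideal_mult_localizedD[OF P that(1)] that(2,3) by blast
  show ?thesis
  proof
    assume loc: "quotient_sK f P S loc.L Q"
    show "quotient_sK f P S (self_module S) Q"
      unfolding quotient_sK_def ideal_mult_self_module[OF P]
    proof (intro allI impI, elim conjE)
      fix I assume I: "fg_ideal I S" "I \<subseteq> Q"
      then obtain y where y: "y \<in> carrier loc.L" "\<And>a. a \<in> I \<Longrightarrow> a \<odot>\<^bsub>loc.L\<^esub> y \<in> ideal_mult f P loc.L"
        "\<And>s. s \<in> carrier S \<Longrightarrow> s \<odot>\<^bsub>loc.L\<^esub> y \<in> ideal_mult f P loc.L \<Longrightarrow> s \<in> Q"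
        using loc unfolding quotient_sK_def by blast
      obtain s0 w0 where s0: "y = loc.frac s0 w0" "s0 \<in> carrier S" "w0 \<in> V" using y(1) by (auto simp: loc.carrier_localized)
      obtain C where C: "C \<subseteq> carrier S" "finite C" "I = Idl\<^bsub>S\<^esub> C" using I(1) unfolding fg_ideal_def by blast
      have col: "ideal {a \<in> carrier S. a \<otimes>\<^bsub>S\<^esub> z \<in> ?J} S" if "z \<in> carrier S" for z
        using S.colon_ideal[OF J that] that by (simp add: colon_def S.m_comm cong: conj_cong)
      have "\<exists>v\<in>V. v \<otimes>\<^bsub>S\<^esub> g \<in> {a \<in> carrier S. a \<otimes>\<^bsub>S\<^esub> s0 \<in> ?J}" if g: "g \<in> C" for g
      proof -
        have gS: "g \<in> carrier S" "g \<in> I" using g C S.genideal_self[OF C(1)] by auto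
        have "loc.frac (g \<otimes>\<^bsub>S\<^esub> s0) w0 \<in> ideal_mult f P loc.L"
          using y(2)[OF gS(2)] gS s0 by (simp add: loc.smult_localized)
        then obtain v where "v \<in> V" "v \<otimes>\<^bsub>S\<^esub> (g \<otimes>\<^bsub>S\<^esub> s0) \<in> ?J" using div gS s0 by (metis S.m_closed)
        thus ?thesis using VS(1) gS s0(2) by (intro bexI[of _ v]) (auto simp: S.m_assoc)
      qed
      \<comment> \<open>One v works for all generators of I, and the numerator of the fraction times
        v becomes the witness in S.\<close>
      then obtain v where v: "v \<in> V" "\<And>g. g \<in> C \<Longrightarrow> v \<otimes>\<^bsub>S\<^esub> g \<in> {a \<in> carrier S. a \<otimes>\<^bsub>S\<^esub> s0 \<in> ?J}"
        using loc.common_multiplier[OF C(2,1) col[OF s0(2)]] by blast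
      have vS: "v \<in> carrier S" by (rule VS(1)[OF v(1)])
      have vs: "v \<otimes>\<^bsub>S\<^esub> s0 \<in> carrier S" using vS s0(2) by simp
      have "C \<subseteq> {a \<in> carrier S. a \<otimes>\<^bsub>S\<^esub> (v \<otimes>\<^bsub>S\<^esub> s0) \<in> ?J}"
      proof
        fix g assume g: "g \<in> C"
        have "g \<otimes>\<^bsub>S\<^esub> (v \<otimes>\<^bsub>S\<^esub> s0) = (v \<otimes>\<^bsub>S\<^esub> g) \<otimes>\<^bsub>S\<^esub> s0" using g C(1) vS s0(2) by (simp add: S.m_ac subset_iff)
        thus "g \<in> {a \<in> carrier S. a \<otimes>\<^bsub>S\<^esub> (v \<otimes>\<^bsub>S\<^esub> s0) \<in> ?J}" using v(2)[OF g] g C(1) by auto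
      qed
      hence 1: "I \<subseteq> {a \<in> carrier S. a \<otimes>\<^bsub>S\<^esub> (v \<otimes>\<^bsub>S\<^esub> s0) \<in> ?J}"
        unfolding C(3) by (intro S.genideal_minimal col vs)
      have 2: "s \<in> Q" if s: "s \<in> carrier S" "s \<otimes>\<^bsub>S\<^esub> (v \<otimes>\<^bsub>S\<^esub> s0) \<in> ?J" for s
      proof -
        have w0S: "w0 \<in> carrier S" by (rule VS(1)[OF s0(3)])
        have "(w0 \<otimes>\<^bsub>S\<^esub> (s \<otimes>\<^bsub>S\<^esub> v)) \<odot>\<^bsub>loc.L\<^esub> y = loc.frac (w0 \<otimes>\<^bsub>S\<^esub> (s \<otimes>\<^bsub>S\<^esub> (v \<otimes>\<^bsub>S\<^esub> s0))) (w0 \<otimes>\<^bsub>S\<^esub> \<one>\<^bsub>S\<^esub>)"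
          unfolding s0(1) using s(1) vS w0S s0 by (simp add: loc.smult_localized S.m_assoc)
        also have "\<dots> = loc.frac (s \<otimes>\<^bsub>S\<^esub> (v \<otimes>\<^bsub>S\<^esub> s0)) \<one>\<^bsub>S\<^esub>"
          using loc.frac_cancel[of "s \<otimes>\<^bsub>S\<^esub> (v \<otimes>\<^bsub>S\<^esub> s0)" "\<one>\<^bsub>S\<^esub>" w0] s(1) vs s0(3) one by simp
        also have "\<dots> \<in> ideal_mult f P loc.L" by (rule ideal_mult_localizedI[OF P s(2)])
        finally have "w0 \<otimes>\<^bsub>S\<^esub> (s \<otimes>\<^bsub>S\<^esub> v) \<in> Q" using y(3) s(1) vS w0S by simp
        thus ?thesis using Q.I_prime[of w0 "s \<otimes>\<^bsub>S\<^esub> v"] Q.I_prime[of s v] s(1) vS w0S VS(2)[OF s0(3)] VS(2)[OF v(1)] by auto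
      qed
      show "\<exists>y\<in>carrier (self_module S). (\<forall>a\<in>I. a \<odot>\<^bsub>self_module S\<^esub> y \<in> ?J) \<and>
          (\<forall>s\<in>carrier S. s \<odot>\<^bsub>self_module S\<^esub> y \<in> ?J \<longrightarrow> s \<in> Q)"
        using 1 2 vs by (intro bexI[of _ "v \<otimes>\<^bsub>S\<^esub> s0"]) auto
    qed
  next
    assume self: "quotient_sK f P S (self_module S) Q"
    show "quotient_sK f P S loc.L Q"
      unfolding quotient_sK_def
    proof (intro allI impI, elim conjE)
      fix I assume I: "fg_ideal I S" "I \<subseteq> Q"
      then obtain y where y: "y \<in> carrier S" "\<And>a. a \<in> I \<Longrightarrow> a \<otimes>\<^bsub>S\<^esub> y \<in> ?J"
        "\<And>s. s \<in> carrier S \<Longrightarrow> s \<otimes>\<^bsub>S\<^esub> y \<in> ?J \<Longrightarrow> s \<in> Q"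
        using mp[OF spec[OF self[unfolded quotient_sK_def ideal_mult_self_module[OF P] self_module_simps]] conjI[OF I]]
        by blast
      have sm: "s \<odot>\<^bsub>loc.L\<^esub> loc.frac y \<one>\<^bsub>S\<^esub> = loc.frac (s \<otimes>\<^bsub>S\<^esub> y) \<one>\<^bsub>S\<^esub>" if "s \<in> carrier S" for s
        using that y(1) one by (simp add: loc.smult_localized)
      have 1: "a \<odot>\<^bsub>loc.L\<^esub> loc.frac y \<one>\<^bsub>S\<^esub> \<in> ideal_mult f P loc.L" if a: "a \<in> I" for a
        using sm[of a] a S.fg_ideal_subset[OF I(1)] ideal_mult_localizedI[OF P y(2)[OF a]] by auto
      have 2: "s \<in> Q" if s: "s \<in> carrier S" "s \<odot>\<^bsub>loc.L\<^esub> loc.frac y \<one>\<^bsub>S\<^esub> \<in> ideal_mult f P loc.L" for s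
      proof -
        have "loc.frac (s \<otimes>\<^bsub>S\<^esub> y) \<one>\<^bsub>S\<^esub> \<in> ideal_mult f P loc.L" using s sm by simp
        then obtain v where v: "v \<in> V" "v \<otimes>\<^bsub>S\<^esub> (s \<otimes>\<^bsub>S\<^esub> y) \<in> ?J" using div[of "s \<otimes>\<^bsub>S\<^esub> y" "\<one>\<^bsub>S\<^esub>"] s(1) y(1) one by auto
        hence "v \<otimes>\<^bsub>S\<^esub> s \<in> Q" using y(3)[of "v \<otimes>\<^bsub>S\<^esub> s"] VS(1)[OF v(1)] s(1) y(1) by (simp add: S.m_assoc)
        thus ?thesis using Q.I_prime[of v s] VS[OF v(1)] s(1) by auto
      qed
      show "\<exists>y\<in>carrier loc.L. (\<forall>a\<in>I. a \<odot>\<^bsub>loc.L\<^esub> y \<in> ideal_mult f P loc.L) \<and>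
          (\<forall>s\<in>carrier S. s \<odot>\<^bsub>loc.L\<^esub> y \<in> ideal_mult f P loc.L \<longrightarrow> s \<in> Q)"
        using 1 2 y(1) one by (intro bexI[of _ "loc.frac y \<one>\<^bsub>S\<^esub>"]) auto
    qed
  qed
qed

text \<open>Elements of V act invertibly on the localized module, so a tensor killed by
  \<open>f w\<close> is zero, and its annihilator S is not inside Q. To divide, the vanishing is
  first expressed by a null family, on which the inverse map acts.\<close>

lemma sK_tensor_localized_disjoint:
  assumes M: "module R M" and flat: "flat_upto R W (restrict_scalars f loc.L)"
    and sK: "Q \<in> strong_Krull_primes S (tensor_module R f M loc.L)"
  shows "Q \<inter> V = {}"
proof (rule ccontr)
  interpret tensor_product R M S loc.L f
    by (intro tensor_product.intro tensor_product_axioms.intro M loc.module_localized hom)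
  have Q: "primeideal Q S" using sK by (simp add: strong_Krull_primes_def)
  interpret Q: primeideal Q S by (rule Q)
  assume "Q \<inter> V \<noteq> {}"
  then obtain w where w: "w \<in> W" "f w \<in> Q" by blast
  have fw: "f w \<in> carrier S" using w(2) Q.Icarr by blast
  have "fg_ideal (Idl\<^bsub>S\<^esub> {f w}) S" unfolding fg_ideal_def using fw by (intro exI[of _ "{f w}"]) auto
  moreover have "Idl\<^bsub>S\<^esub> {f w} \<subseteq> Q" using w by (intro S.genideal_minimal Q.is_ideal) auto
  ultimately obtain c where c: "witness (Idl\<^bsub>S\<^esub> {f w}) Q c" using sK unfolding sK_tensor_iff by blast
  have "c \<in> carrier F" using c by (simp add: witness_def)
  then obtain n x t where x: "\<And>i. x i \<in> carrier M" "\<And>i. t i \<in> carrier loc.L" "c - formal {..<n::nat} x t \<in> K"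
    using formal_exists by blast
  have IS: "Idl\<^bsub>S\<^esub> {f w} \<subseteq> carrier S" using S.fg_ideal_subset \<open>fg_ideal (Idl\<^bsub>S\<^esub> {f w}) S\<close> by blast
  have wit: "witness (Idl\<^bsub>S\<^esub> {f w}) Q (formal {..<n} x t)"
    using witness_cong[OF c formal_closed[of x t, OF x(1,2)] x(3) IS] .
  hence "formal {..<n} x (\<lambda>i. f w \<odot>\<^bsub>loc.L\<^esub> t i) \<in> K"
    using S.genideal_self'[OF fw] unfolding witness_def act_formal by blast
  moreover have "f w \<odot>\<^bsub>loc.L\<^esub> t i \<in> carrier loc.L" for i using fw x(2) by (intro N.smult_closed)
  ultimately obtain u where u: "u \<in> W" "null R M T {..<n} x (\<lambda>i. u \<odot>\<^bsub>T\<^esub> (f w \<odot>\<^bsub>loc.L\<^esub> t i))"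
    using K_imp_null[OF flat W, of "{..<n}" x "\<lambda>i. f w \<odot>\<^bsub>loc.L\<^esub> t i"] x(1) by auto
  have uw: "f u \<otimes>\<^bsub>S\<^esub> f w \<in> V" using u(1) w(1) loc.W.m_closed by blast
  have fu: "f u \<in> carrier S" using u(1) by auto
  obtain h where h: "\<forall>z\<in>carrier loc.L. h z \<in> carrier loc.L \<and> h ((f u \<otimes>\<^bsub>S\<^esub> f w) \<odot>\<^bsub>loc.L\<^esub> z) = z"
    "\<forall>z\<in>carrier loc.L. \<forall>z'\<in>carrier loc.L. h (z \<oplus>\<^bsub>loc.L\<^esub> z') = h z \<oplus>\<^bsub>loc.L\<^esub> h z'"
    "\<forall>a\<in>carrier S. \<forall>z\<in>carrier loc.L. h (a \<odot>\<^bsub>loc.L\<^esub> z) = a \<odot>\<^bsub>loc.L\<^esub> h z"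
    using loc.division_map[OF uw] by (elim exE conjE)
  have "linear_map R T T h" unfolding linear_map_def using h by auto
  hence "null R M T {..<n} x (\<lambda>i. h (u \<odot>\<^bsub>T\<^esub> (f w \<odot>\<^bsub>loc.L\<^esub> t i)))"
    by (rule null_map[OF T.module_axioms T.module_axioms _ u(2)])
  hence "null R M T {..<n} x t"
  proof (rule null_cong)
    fix i show "t i \<in> carrier T" using x(2) by simp
    show "t i = h (u \<odot>\<^bsub>T\<^esub> (f w \<odot>\<^bsub>loc.L\<^esub> t i))" using bspec[OF h(1) x(2)[of i]] N.smult_assoc1[OF fu fw x(2)[of i]] by simp
  qed
  hence k0: "formal {..<n} x t \<in> K" by (intro null_imp_K x(1)) auto
  hence "act \<one>\<^bsub>S\<^esub> (formal {..<n} x t) \<in> K" using act_one formal_closed[of x t, OF x(1,2)] by simp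
  hence "\<one>\<^bsub>S\<^esub> \<in> Q" using wit unfolding witness_def by blast
  thus False using S.primeideal_one_notin[OF Q] by blast
qed

theorem sK_tensor_perfect:
  assumes noeth: "noetherian_ring R" and M: "module R M"
    and flat: "flat_upto R W (restrict_scalars f (self_module S))" and Q: "primeideal Q S"
  shows "Q \<in> strong_Krull_primes S (tensor_module R f M loc.L) \<longleftrightarrow>
      (\<exists>P\<in>Ass R M. Q \<in> strong_Krull_primes S (localized_module S V (quotient_module S (Idl\<^bsub>S\<^esub> (f ` P)))))"
    and "Q \<inter> V = {} \<Longrightarrow> Q \<in> strong_Krull_primes S (tensor_module R f M (self_module S)) \<longleftrightarrow>
      (\<exists>P\<in>Ass R M. Q \<in> strong_Krull_primes S (quotient_module S (Idl\<^bsub>S\<^esub> (f ` P))))"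
proof -
  have AssR: "P \<subseteq> carrier R" if "P \<in> Ass R M" for P using that unfolding Ass_def annihilator_def by blast
  have flatL: "flat_upto R W (restrict_scalars f loc.L)"
    by (rule flat_localized_module[OF R.is_cring S.is_cring hom W flat])
  have quot: "Q \<in> strong_Krull_primes S (localized_module S V (quotient_module S (Idl\<^bsub>S\<^esub> (f ` P)))) \<longleftrightarrow>
      quotient_sK f P S (self_module S) Q \<and> Q \<inter> V = {}" if P: "P \<in> Ass R M" for P
  proof -
    have "ideal (Idl\<^bsub>S\<^esub> (f ` P)) S" using AssR[OF P] by (intro S.genideal_ideal) auto
    then interpret q: module_localization S "quotient_module S (Idl\<^bsub>S\<^esub> (f ` P))" V
      by (intro module_localization.intro module_localization_axioms.intro V S.module_quotient_module)
    show ?thesis using q.sK_localized_iff quotient_sK_self_module[OF AssR[OF P] Q] by simp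
  qed
  interpret TS: tensor_product R M S "self_module S" f
    by (intro tensor_product.intro tensor_product_axioms.intro M S.module_self_module hom)
  interpret TL: tensor_product R M S loc.L f
    by (intro tensor_product.intro tensor_product_axioms.intro M loc.module_localized hom)
  show "Q \<in> strong_Krull_primes S (tensor_module R f M (self_module S)) \<longleftrightarrow>
      (\<exists>P\<in>Ass R M. Q \<in> strong_Krull_primes S (quotient_module S (Idl\<^bsub>S\<^esub> (f ` P))))" if "Q \<inter> V = {}"
    using TS.sK_tensor_iff_quotient_sK[OF noeth W flat Q that] quotient_sK_self_module[OF AssR Q] by blast
  show "Q \<in> strong_Krull_primes S (tensor_module R f M loc.L) \<longleftrightarrow>
      (\<exists>P\<in>Ass R M. Q \<in> strong_Krull_primes S (localized_module S V (quotient_module S (Idl\<^bsub>S\<^esub> (f ` P)))))"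
  proof (cases "Q \<inter> V = {}")
    case True
    then show ?thesis
      using TL.sK_tensor_iff_quotient_sK[OF noeth W flatL Q True] quotient_sK_localized[OF AssR Q True] quot by blast
  next
    case False
    \<comment> \<open>A prime that meets V belongs to neither side.\<close>
    then show ?thesis using sK_tensor_localized_disjoint[OF M flatL] quot by blast
  qed
qed

end

theorem theorem4p8:
  fixes R :: "('a, 'm) ring_scheme" and L :: "('a, 'b, 'n) module_scheme"
    and W :: "'a set" and p :: nat
  defines "S \<equiv> perfect_closure p R" and "\<iota> \<equiv> perfect_emb p R"
  assumes "cring R" and "noetherian_ring R" and "reduced_ring R"
    and "Factorial_Ring.prime p" and "ring_char R = p"
    and "submonoid W R" and "regular_ring (localized_ring R W)"
    and "module R L"
  shows "strong_Krull_primes S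
           (tensor_module R \<iota> L (localized_module S (\<iota> ` W) (self_module S))) =
         (\<Union>P \<in> Ass R L. strong_Krull_primes S
           (localized_module S (\<iota> ` W) (quotient_module S (Idl\<^bsub>S\<^esub> (\<iota> ` P)))))
       \<and> (\<forall>Q. primeideal Q S \<and> Q \<inter> \<iota> ` W = {} \<longrightarrow>
            (Q \<in> strong_Krull_primes S (tensor_module R \<iota> L (self_module S)) \<longleftrightarrow>
             (\<exists>P \<in> Ass R L. Q \<in> strong_Krull_primes S (quotient_module S (Idl\<^bsub>S\<^esub> (\<iota> ` P))))))"
proof -
  interpret prime_char R p by (intro prime_char.intro prime_char_axioms.intro assms)
  have main: "Q \<in> strong_Krull_primes S (tensor_module R \<iota> L (localized_module S (\<iota> ` W) (self_module S))) \<longleftrightarrow>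
      (\<exists>P\<in>Ass R L. Q \<in> strong_Krull_primes S (localized_module S (\<iota> ` W) (quotient_module S (Idl\<^bsub>S\<^esub> (\<iota> ` P)))))"
    "Q \<inter> \<iota> ` W = {} \<Longrightarrow> Q \<in> strong_Krull_primes S (tensor_module R \<iota> L (self_module S)) \<longleftrightarrow>
      (\<exists>P\<in>Ass R L. Q \<in> strong_Krull_primes S (quotient_module S (Idl\<^bsub>S\<^esub> (\<iota> ` P))))"
    if Q: "primeideal Q S" for Q
  proof -
    \<comment> \<open>The ring axioms of S are contained in the assumption that Q is a prime ideal
      of S.\<close>
    have S: "cring S" using Q by (rule primeideal.axioms(2))
    interpret localized_base_change R S \<iota> W
      unfolding S_def \<iota>_def
      by (intro localized_base_change.intro localized_base_change_axioms.intro is_cring perfect_emb_hom assms(8) S[unfolded S_def])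
    have flat: "flat_upto R W (restrict_scalars \<iota> (self_module S))"
      using flat_perfect_closure S assms(4,5,8,9) unfolding S_def \<iota>_def by blast
    show "Q \<in> strong_Krull_primes S (tensor_module R \<iota> L (localized_module S (\<iota> ` W) (self_module S))) \<longleftrightarrow>
      (\<exists>P\<in>Ass R L. Q \<in> strong_Krull_primes S (localized_module S (\<iota> ` W) (quotient_module S (Idl\<^bsub>S\<^esub> (\<iota> ` P)))))"
      by (rule sK_tensor_perfect(1)[OF assms(4,10) flat Q])
    show "Q \<in> strong_Krull_primes S (tensor_module R \<iota> L (self_module S)) \<longleftrightarrow>
      (\<exists>P\<in>Ass R L. Q \<in> strong_Krull_primes S (quotient_module S (Idl\<^bsub>S\<^esub> (\<iota> ` P))))" if "Q \<inter> \<iota> ` W = {}"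
      by (rule sK_tensor_perfect(2)[OF assms(4,10) flat Q that])
  qed
  \<comment> \<open>Members of either side are prime by definition, so the equality of sets may be
    checked on primes.\<close>
  moreover have "primeideal Q S"
    if "Q \<in> strong_Krull_primes S (tensor_module R \<iota> L (localized_module S (\<iota> ` W) (self_module S)))
      \<or> Q \<in> strong_Krull_primes S (localized_module S (\<iota> ` W) (quotient_module S (Idl\<^bsub>S\<^esub> (\<iota> ` P))))" for Q P
    using that by (auto simp: strong_Krull_primes_def)
  ultimately show ?thesis by (intro conjI allI impI set_eqI) (blast+)
qed

end
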